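(* There is a constant $c_s>0$ with the following property: for all $\gamma,e_0,b,d>0$ and $r_0\in(0,1]$ with $b/e_0\ge 64^4 r_0$ there holds $$\frac1{c_s}\,s(\gamma,e_0,b,d,r_0)\ \le\ \inf_{(h,H,\sigma)\in\mathcal A(d,e_0,b,r_0)}\mathcal F(h,H,\sigma)\ \le\ c_s\,s(\gamma,e_0,b,d,r_0),$$ where $$s(\gamma,e_0,b,d,r_0)=\gamma(1+d)+\min\left\{\gamma^{2/3}e_0^{2/3}d^{2/3},\ \left[\gamma e_0 b d\left(1+\log\left(\frac{b}{e_0r_0}\right)\right)\right]^{1/2}\right\}.$$
   Context: Fixed data (not parameters; constants may depend on them): a kernel $J_1\in C_c^\infty(B_1(0);[0,\infty))$ on $\mathbb R^2$ with $\int_{\mathbb R^2}J_1\,d\mathcal L^2=1$, and a linear elastic energy density, i.e. a measurable $W:\mathbb R^{2\times2}\to[0,\infty)$ (typical example: $W(H)=\mu|H_{\mathrm{sym}}|^2+\frac\lambda2(\operatorname{tr}H)^2$ with $\mu>0$, $\mu+\lambda>0$) for which there is a constant $c_1>0$ with $c_1|H_{\mathrm{sym}}|^2\le W(H)\le\frac1{c_1}|H_{\mathrm{sym}}|^2$ for all $H\in\mathbb R^{2\times 2}$, where $H_{\mathrm{sym}}=\frac12(H+H^T)$. For $r_0>0$ put $J_{r_0}(x)=r_0^{-2}J_1(x/r_0)$, which is supported in $B_{r_0}(0)$. For $h:[0,1]\to[0,\infty)$ let $\Omega_h=\{(x,y)\in\mathbb R^2: 0<x<1,\ 0<y<h(x)\}$.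 The operator $\operatorname{curl}$ is the distributional one applied row-wise: for a matrix field $H$ with entries $H_{ij}$, the $i$-th component of $\operatorname{curl}H$ is $\partial_1H_{i2}-\partial_2H_{i1}$. Admissible set: for $d,e_0,b,r_0>0$, $\mathcal A(d,e_0,b,r_0)$ is the set of triples $(h,H,\sigma)$ such that - $h:[0,1]\to[0,\infty)$ is Lipschitz, $\int_0^1h\,d\mathcal L^1=d$, $h(0)=h(1)=0$; - $\sigma=(b,0)\sum_{i=1}^k\delta_{p_i}$ for some $k\in\mathbb N_0$ and points $p_i$ with $B_{r_0}(p_i)\subseteq\Omega_h$ ($\sigma=0$ if $k=0$); - $H\in L^2(\Omega_h;\mathbb R^{2\times2})$ with $\operatorname{curl}H=\sigma*J_{r_0}$ in $\Omega_h$, where $\sigma*J_{r_0}=(b,0)\sum_{i=1}^kJ_{r_0}(\cdot-p_i)$, and $H(1,0)=(e_0,0)$ on $\{y=0\}\cap\overline{\Omega_h}$ in the sense of tangential traces. (The tangential trace, i.e. the trace of $H$ applied to the vector $(1,0)$, is well defined since $\operatorname{curl}H\in L^2$; the condition means that for each row $i\in\{1,2\}$ and every $\varphi\in C_c^\infty(\mathbb R^2)$ whose support intersected with $\{y\ge0\}$ is contained in $\Omega_h\cup\{(x,0):0<x<1,\ h(x)>0\}$, one has $\int_{\Omega_h}(\operatorname{curl}H)_i\varphi\,d\mathcal L^2=\int_{\Omega_h}(H_{i1}\partial_2\varphi-H_{i2}\partial_1\varphi)\,d\mathcal L^2+g_i\int_0^1\varphi(x,0)\,dx$ with $(g_1,g_2)=(e_0,0)$.)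 Energy: for $\gamma>0$ and $(h,H,\sigma)\in\mathcal A(d,e_0,b,r_0)$, $$\mathcal F(h,H,\sigma)=\gamma\int_0^1\sqrt{1+|h'|^2}\,d\mathcal L^1+\int_{\Omega_h}W(H)\,d\mathcal L^2+k\,b^2,$$ where $k$ is the number of dislocations in $\sigma$. *)

theory Defs
  imports "HOL-Analysis.Analysis" "HOL-Library.Multiset"
begin

definition partial :: "2 \<Rightarrow> (real^2 \<Rightarrow> real) \<Rightarrow> real^2 \<Rightarrow> real" where
  "partial i f x = frechet_derivative f (at x) (axis i 1)"

primrec times_cont_differentiable :: "nat \<Rightarrow> (real^2 \<Rightarrow> real) \<Rightarrow> bool" where
  "times_cont_differentiable 0 f \<longleftrightarrow> continuous_on UNIV f"
| "times_cont_differentiable (Suc k) f \<longleftrightarrow>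
     (\<forall>x. f differentiable (at x)) \<and> (\<forall>i. times_cont_differentiable k (partial i f))"

definition smooth :: "(real^2 \<Rightarrow> real) \<Rightarrow> bool" where
  "smooth f \<longleftrightarrow> (\<forall>k. times_cont_differentiable k f)"

definition supp :: "(real^2 \<Rightarrow> real) \<Rightarrow> (real^2) set" where
  "supp f = closure {x. f x \<noteq> 0}"

text \<open>The space $C_c^\infty(U)$ for an open set $U$, its members being extended by zero
  to the whole plane.\<close>

definition test_functions :: "(real^2) set \<Rightarrow> (real^2 \<Rightarrow> real) set" where
  "test_functions U = {\<phi>. smooth \<phi> \<and> compact (supp \<phi>) \<and> supp \<phi> \<subseteq> U}"

definition admissible_kernel :: "(real^2 \<Rightarrow> real) \<Rightarrow> bool" where
  "admissible_kernel J \<longleftrightarrow>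
     J \<in> test_functions (ball 0 1) \<and> (\<forall>x. J x \<ge> 0) \<and> (LINT x|lebesgue. J x) = 1"

definition rescaled :: "(real^2 \<Rightarrow> real) \<Rightarrow> real \<Rightarrow> real^2 \<Rightarrow> real" where
  "rescaled J r x = J (x /\<^sub>R r) / r\<^sup>2"

definition sym_part :: "real^2^2 \<Rightarrow> real^2^2" where
  "sym_part A = (1/2) *\<^sub>R (A + transpose A)"

text \<open>The norm on \<^typ>\<open>real^2^2\<close> is the Euclidean norm of the vector of row norms, that is,
  the Frobenius norm.\<close>

definition linear_elastic_density :: "(real^2^2 \<Rightarrow> real) \<Rightarrow> bool" where
  "linear_elastic_density W \<longleftrightarrow>
     W \<in> borel_measurable borel \<and> (\<forall>A. W A \<ge> 0) \<and>
     (\<exists>c1>0. \<forall>A. c1 * (norm (sym_part A))\<^sup>2 \<le> W A \<and> W A \<le> 1 / c1 * (norm (sym_part A))\<^sup>2)"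

definition subgraph :: "(real \<Rightarrow> real) \<Rightarrow> (real^2) set" where
  "subgraph h = {z. 0 < z$1 \<and> z$1 < 1 \<and> 0 < z$2 \<and> z$2 < h (z$1)}"

text \<open>The row-wise distributional curl: the pairing of
  $\partial_1 H_{i2} - \partial_2 H_{i1}$ with a test function $\varphi$ is
  $\int_U (H_{i1} \partial_2 \varphi - H_{i2} \partial_1 \varphi)$.\<close>

definition has_curl :: "(real^2 \<Rightarrow> real^2^2) \<Rightarrow> (real^2 \<Rightarrow> real^2) \<Rightarrow> (real^2) set \<Rightarrow> bool" where
  "has_curl H G U \<longleftrightarrow>
     (\<forall>\<phi> \<in> test_functions U. \<forall>i.
        (LINT z:U|lebesgue. H z $ i $ 1 * partial 2 \<phi> z - H z $ i $ 2 * partial 1 \<phi> z)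
          = (LINT z:U|lebesgue. G z $ i * \<phi> z))"

text \<open>The trace of \<open>H (1,0)\<close> on the flat part of the boundary of \<^term>\<open>subgraph h\<close> is the constant
  vector \<open>g\<close>, where \<open>G\<close> is the curl of \<open>H\<close> in \<^term>\<open>subgraph h\<close>.  Unlike in \<open>has_curl\<close>, the test
  functions need not vanish on the bottom boundary.\<close>

definition has_bottom_tangential_trace ::
  "(real \<Rightarrow> real) \<Rightarrow> (real^2 \<Rightarrow> real^2^2) \<Rightarrow> (real^2 \<Rightarrow> real^2) \<Rightarrow> real^2 \<Rightarrow> bool" where
  "has_bottom_tangential_trace h H G g \<longleftrightarrow>
     (\<forall>\<phi> \<in> test_functions UNIV.
        supp \<phi> \<inter> {z. z$2 \<ge> 0} \<subseteq> subgraph h \<union> {z. 0 < z$1 \<and> z$1 < 1 \<and> z$2 = 0 \<and> h (z$1) > 0} \<longrightarrow>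
        (\<forall>i. (LINT z:subgraph h|lebesgue. G z $ i * \<phi> z)
           = (LINT z:subgraph h|lebesgue. H z $ i $ 1 * partial 2 \<phi> z - H z $ i $ 2 * partial 1 \<phi> z)
             + g $ i * (LINT x:{0..1}|lebesgue. \<phi> (vector [x, 0]))))"

text \<open>A dislocation density $\sigma = (b,0) \sum_{i=1}^k \delta_{p_i}$ is encoded by the multiset
  \<open>P\<close> of the points $p_1, \dots, p_k$; the points are not required to be distinct.  As $b > 0$,
  \<open>\<sigma>\<close> determines \<open>P\<close>, and $k$ is \<^term>\<open>size P\<close>.\<close>

definition mollified_dislocations ::
  "(real^2 \<Rightarrow> real) \<Rightarrow> real \<Rightarrow> real \<Rightarrow> (real^2) multiset \<Rightarrow> real^2 \<Rightarrow> real^2" where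
  "mollified_dislocations J r b P z = (\<Sum>p\<in>#P. rescaled J r (z - p)) *\<^sub>R vector [b, 0]"

text \<open>Only the values of \<open>h\<close> on \<open>[0,1]\<close> and of \<open>H\<close> on \<^term>\<open>subgraph h\<close> matter, here and
  in the energy.\<close>

definition admissible ::
  "(real^2 \<Rightarrow> real) \<Rightarrow> real \<Rightarrow> real \<Rightarrow> real \<Rightarrow> real
     \<Rightarrow> ((real \<Rightarrow> real) \<times> (real^2 \<Rightarrow> real^2^2) \<times> (real^2) multiset) set" where
  "admissible J d e0 b r0 = {(h, H, P).
     (\<forall>x\<in>{0..1}. h x \<ge> 0) \<and> (\<exists>L. L-lipschitz_on {0..1} h) \<and>
     (LINT x:{0..1}|lebesgue. h x) = d \<and> h 0 = 0 \<and> h 1 = 0 \<and>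
     (\<forall>p\<in>#P. ball p r0 \<subseteq> subgraph h) \<and>
     H \<in> borel_measurable (lebesgue_on (subgraph h)) \<and>
     integrable (lebesgue_on (subgraph h)) (\<lambda>z. (norm (H z))\<^sup>2) \<and>
     has_curl H (mollified_dislocations J r0 b P) (subgraph h) \<and>
     has_bottom_tangential_trace h H (mollified_dislocations J r0 b P) (vector [e0, 0])}"

definition energy ::
  "(real^2^2 \<Rightarrow> real) \<Rightarrow> real \<Rightarrow> real
     \<Rightarrow> (real \<Rightarrow> real) \<times> (real^2 \<Rightarrow> real^2^2) \<times> (real^2) multiset \<Rightarrow> ennreal" where
  "energy W \<gamma> b = (\<lambda>(h, H, P).
     ennreal \<gamma> * (\<integral>\<^sup>+x\<in>{0..1}. ennreal (sqrt (1 + (deriv h x)\<^sup>2)) \<partial>lebesgue)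
     + (\<integral>\<^sup>+z\<in>subgraph h. ennreal (W (H z)) \<partial>lebesgue)
     + ennreal (real (size P) * b\<^sup>2))"

definition scaling :: "real \<Rightarrow> real \<Rightarrow> real \<Rightarrow> real \<Rightarrow> real \<Rightarrow> real" where
  "scaling \<gamma> e0 b d r0 = \<gamma> * (1 + d)
     + min (\<gamma> powr (2/3) * e0 powr (2/3) * d powr (2/3))
           ((\<gamma> * e0 * b * d * (1 + ln (b / (e0 * r0)))) powr (1/2))"

end

theory Submission
  imports Defs
begin

text \<open>
  Write \<open>l = b / e0\<close>, \<open>L = 1 + ln (b / (e0 * r0))\<close> and \<open>E\<close> for the energy of an admissible triple.

  \<^bold>\<open>Lower bound.\<close>  Test the first row of the curl equation with \<open>\<partial>\<^sub>2 \<Phi>\<close> and the second row with \<open>\<partial>\<^sub>1 \<Phi>\<close>,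
  and subtract.  As mixed second derivatives commute, the result contains only the symmetric part of
  \<open>H\<close>, so that the linear functional
  \<open>e0 * (\<integral> \<partial>\<^sub>2 \<Phi>(x,0) dx) - (\<integral> curl H * \<partial>\<^sub>2 \<Phi>)\<close> is bounded by the product of the \<open>L\<^sup>2\<close> norms of the second
  derivatives of \<open>\<Phi>\<close> and of the strain (\<open>dual_estimate\<close>).  It remains to choose \<open>\<Phi>\<close>.  On a square of side
  \<open>X \<le> l * L\<close> that stands on the bottom and lies in the film, the claim (\<open>square_lower_bound\<close>) is that
  \<open>(e0 * X)\<^sup>2\<close> is controlled by the elastic energy in the square plus \<open>b\<^sup>2\<close> times the number of dislocations
  near the middle of its bottom side.  Without dislocations, \<open>\<Phi>\<close> is the height \<open>z \<mapsto> z$2\<close>, localised to a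
  ball (\<open>base\<close>).  In general let \<open>m = X / l\<close>, which is at most \<open>L\<close>.  If \<open>m\<close> is bounded or the number of
  dislocations is of order \<open>m\<^sup>2\<close>, the dislocations alone suffice.  Otherwise consider a maximal family of
  dislocations at mutual distance above \<open>2 * (2 ^ M * r0)\<close>, with \<open>M\<close> about \<open>L / 8\<close>.

  If the family has more than \<open>m / 8\<close> members, then around each of them \<open>\<Phi>\<close> is the height, localised to
  the balls of radii \<open>2 ^ j * r0\<close> and averaged over \<open>j < M\<close>.  This is a logarithmic cut-off: each member pairs
  with \<open>\<Phi>\<close> like \<open>b\<close>, while the annuli in which the cut-offs act are disjoint, so that the squared second
  derivatives contribute only \<open>1 / M\<close> per member.  Hence the elastic energy is at least of order
  \<open>b\<^sup>2 * m * M\<close>, and thus at least of order \<open>(b * m)\<^sup>2 = (e0 * X)\<^sup>2\<close> (\<open>separated_estimate\<close>).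

  If the family has at most \<open>m / 8\<close> members, as many balls of radius \<open>3 * (2 ^ M * r0)\<close> around them contain
  all dislocations.  Merging balls that come too close, then doubling the radii, and repeating this \<open>M\<close>
  times gives \<open>M\<close> levels of at most \<open>M\<close> balls each, with a total radius that is still a small fraction
  of \<open>X\<close> (\<open>nested_balls_exist\<close>).  Subtracting from \<open>base\<close> its localisation to the balls, averaged over the
  levels, makes \<open>\<Phi>\<close> have zero gradient on all dislocations; the averaging keeps the second derivatives
  bounded in \<open>L\<^sup>2\<close>, and the trace term remains of order \<open>e0 * X\<close> (\<open>covering_estimate\<close>).

  For a film with graph of length \<open>\<Lambda>\<close> there are about \<open>d / (\<Lambda> * X)\<close> disjoint such squares whenever
  \<open>X \<le> d / (4 * \<Lambda>)\<close> (\<open>many_squares\<close>), so that \<open>E\<close> is at least of order \<open>e0\<^sup>2 * X * d / \<Lambda>\<close>.  Taking \<open>X\<close> of the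
  order of the smaller of \<open>d / \<Lambda>\<close> and \<open>l * L\<close>, and using \<open>\<gamma> * \<Lambda> \<le> E\<close>, gives that \<open>E\<close> is at least of the
  order of one of the two terms in the minimum.

  \<^bold>\<open>Upper bound.\<close>  The film is a trapezoid of width \<open>w \<le> 1\<close> and height about \<open>d / w\<close>; its surface energy is
  at most of order \<open>\<gamma> * (1 + d / w)\<close>.  Without dislocations, the gradient of a function that decays within
  height \<open>w\<close> costs at most of order \<open>e0\<^sup>2 * w\<^sup>2\<close> (\<open>gradient_competitor\<close>).  With a row of dislocations of
  spacing \<open>l\<close> the misfit has mean zero over each period, so that the strain can decay within height
  \<open>l\<close>; the dislocations then contribute of order \<open>b\<^sup>2 * L\<close> each, \<open>e0 * b * w * L\<close> altogether
  (\<open>dislocation_competitor\<close>); in a film lower than \<open>l\<close>, a constant strain costs no more.  The best \<open>w\<close>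
  balances surface and bulk.
\<close>

section \<open>Partial derivatives and smooth functions\<close>

lemma partial_eq:
  "(f has_derivative f') (at x) \<Longrightarrow> partial i f x = f' (axis i 1)"
  unfolding partial_def by (metis frechet_derivative_at)

lemma has_derivative_partial:
  fixes f :: "real^2 \<Rightarrow> real"
  assumes "f differentiable (at x)"
  shows "(f has_derivative (\<lambda>v. partial 1 f x * v$1 + partial 2 f x * v$2)) (at x)"
proof -
  let ?f' = "frechet_derivative f (at x)"
  have d: "(f has_derivative ?f') (at x)" using assms frechet_derivative_works by blast
  interpret f': bounded_linear ?f' by (rule has_derivative_bounded_linear[OF d])
  have "?f' v = partial 1 f x * v$1 + partial 2 f x * v$2" for v :: "real^2"
  proof -
    have "v = v$1 *\<^sub>R axis 1 1 + v$2 *\<^sub>R axis 2 1"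
      by (simp add: vec_eq_iff forall_2 axis_def)
    then have "?f' v = ?f' (v$1 *\<^sub>R axis 1 1 + v$2 *\<^sub>R axis 2 1)" by simp
    then show ?thesis by (simp add: f'.add f'.scaleR partial_def mult.commute)
  qed
  then have "?f' = (\<lambda>v. partial 1 f x * v$1 + partial 2 f x * v$2)" by auto
  with d show ?thesis by simp
qed

lemma partial_add:
  assumes "f differentiable (at x)" "g differentiable (at x)"
  shows "partial i (\<lambda>z. f z + g z) x = partial i f x + partial i g x"
  using partial_eq[OF has_derivative_add[OF assms[THEN frechet_derivative_works[THEN iffD1]]], of i]
  by (simp add: partial_def)

lemma partial_mult:
  assumes "f differentiable (at x)" "g differentiable (at x)"
  shows "partial i (\<lambda>z. f z * g z) x = partial i f x * g x + f x * partial i g x"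
  using assms partial_eq[OF has_derivative_mult[OF assms[THEN frechet_derivative_works[THEN iffD1]]], of i]
  by (simp add: partial_def)

lemma partial_const [simp]: "partial i (\<lambda>z. c) = (\<lambda>z. 0)"
  by (rule ext) (simp add: partial_eq[OF has_derivative_const])

lemma partial_coord: "partial i (\<lambda>z. z $ j) = (\<lambda>z. if i = j then 1 else 0)"
proof
  fix x :: "real^2"
  have "((\<lambda>z::real^2. z $ j) has_derivative (\<lambda>z. z $ j)) (at x)"
    by (rule bounded_linear.has_derivative[OF bounded_linear_vec_nth]) (rule has_derivative_ident)
  from partial_eq[OF this] show "partial i (\<lambda>z. z $ j) x = (if i = j then 1 else 0)"
    by (auto simp: axis_def)
qed

lemma partial_chain:
  assumes "f differentiable (at x)" and "(g has_real_derivative d) (at (f x))"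
  shows "partial i (\<lambda>z. g (f z)) x = d * partial i f x"
proof -
  have "((\<lambda>z. g (f z)) has_derivative (\<lambda>v. d * frechet_derivative f (at x) v)) (at x)"
    using has_derivative_compose[OF assms(1)[THEN frechet_derivative_works[THEN iffD1]], of g "(*) d"] assms(2)
    by (simp add: has_field_derivative_def)
  from partial_eq[OF this] show ?thesis by (simp add: partial_def)
qed

lemma tcd_continuous: "times_cont_differentiable k f \<Longrightarrow> continuous_on UNIV f"
  by (cases k) (auto intro: differentiable_imp_continuous_on simp: differentiable_on_def)

lemma tcd_mono: "times_cont_differentiable (Suc k) f \<Longrightarrow> times_cont_differentiable k f"
proof (induction k arbitrary: f)
  case 0
  then show ?case using tcd_continuous by (metis times_cont_differentiable.simps(1))
next
  case (Suc k)
  then show ?case by (metis times_cont_differentiable.simps(2))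
qed

lemma tcd_add:
  "times_cont_differentiable k f \<Longrightarrow> times_cont_differentiable k g \<Longrightarrow>
   times_cont_differentiable k (\<lambda>z. f z + g z)"
proof (induction k arbitrary: f g)
  case 0 then show ?case by (simp add: continuous_on_add)
next
  case (Suc k)
  then have "partial i (\<lambda>z. f z + g z) = (\<lambda>z. partial i f z + partial i g z)" for i
    by (auto intro!: ext partial_add)
  with Suc show ?case by auto
qed

lemma tcd_mult:
  "times_cont_differentiable k f \<Longrightarrow> times_cont_differentiable k g \<Longrightarrow>
   times_cont_differentiable k (\<lambda>z. f z * g z)"
proof (induction k arbitrary: f g)
  case 0 then show ?case by (simp add: continuous_on_mult)
next
  case (Suc k)
  then have *: "partial i (\<lambda>z. f z * g z) = (\<lambda>z. partial i f z * g z + f z * partial i g z)" for i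
    by (auto intro!: ext partial_mult)
  have "times_cont_differentiable k (\<lambda>z. partial i f z * g z + f z * partial i g z)" for i
    using Suc tcd_mono[OF Suc.prems(1)] tcd_mono[OF Suc.prems(2)] by (intro tcd_add Suc.IH) auto
  with Suc * show ?case by auto
qed

lemma smooth_add: "smooth f \<Longrightarrow> smooth g \<Longrightarrow> smooth (\<lambda>z. f z + g z)"
  and smooth_mult: "smooth f \<Longrightarrow> smooth g \<Longrightarrow> smooth (\<lambda>z. f z * g z)"
  by (auto simp: smooth_def tcd_add tcd_mult)

lemma smooth_differentiable: "smooth f \<Longrightarrow> f differentiable (at x)"
  unfolding smooth_def by (metis times_cont_differentiable.simps(2))

lemma smooth_partial: "smooth f \<Longrightarrow> smooth (partial i f)"
  unfolding smooth_def by (metis times_cont_differentiable.simps(2))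

lemma smooth_continuous: "smooth f \<Longrightarrow> continuous_on A f"
  unfolding smooth_def by (metis tcd_continuous continuous_on_subset subset_UNIV)

lemma smoothI:
  assumes "\<And>x. f differentiable (at x)" and "\<And>i. smooth (partial i f)"
  shows "smooth f"
  unfolding smooth_def
proof
  fix k show "times_cont_differentiable k f"
    using assms by (cases k) (auto simp: smooth_def intro: differentiable_imp_continuous_on simp: differentiable_on_def)
qed

lemma smooth_const [simp]: "smooth (\<lambda>z. c)"
proof -
  have "times_cont_differentiable k (\<lambda>z. c)" for k c
    by (induction k arbitrary: c) auto
  then show ?thesis by (simp add: smooth_def)
qed

lemma smooth_coord [simp]: "smooth (\<lambda>z. z $ j)"
  by (rule smoothI) (auto simp: partial_coord bounded_linear_imp_differentiable bounded_linear_vec_nth)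

lemma smooth_sum:
  "finite S \<Longrightarrow> (\<And>s. s \<in> S \<Longrightarrow> smooth (f s)) \<Longrightarrow> smooth (\<lambda>z. \<Sum>s\<in>S. f s z)"
  by (induction S rule: finite_induct) (auto intro: smooth_add)

lemma smooth_diff: "smooth f \<Longrightarrow> smooth g \<Longrightarrow> smooth (\<lambda>z. f z - g z)"
  using smooth_add[of f "\<lambda>z. (-1) * g z"] smooth_mult[of "\<lambda>z. -1" g] by simp

lemma partial_diff:
  assumes "f differentiable (at x)" "g differentiable (at x)"
  shows "partial i (\<lambda>z. f z - g z) x = partial i f x - partial i g x"
proof -
  have "partial i (\<lambda>z. f z - g z) x = frechet_derivative f (at x) (axis i 1) - frechet_derivative g (at x) (axis i 1)"
    by (rule partial_eq[OF has_derivative_diff[OF assms[THEN frechet_derivative_works[THEN iffD1]]]])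
  then show ?thesis by (simp add: partial_def)
qed

lemma partial_sum:
  assumes "finite S" "\<And>s. s \<in> S \<Longrightarrow> smooth (f s)"
  shows "partial i (\<lambda>z. \<Sum>s\<in>S. f s z) x = (\<Sum>s\<in>S. partial i (f s) x)"
  using assms
proof (induction S rule: finite_induct)
  case empty then show ?case by simp
next
  case (insert s S)
  then have "partial i (\<lambda>z. f s z + (\<Sum>s\<in>S. f s z)) x = partial i (f s) x + (\<Sum>s\<in>S. partial i (f s) x)"
    by (subst partial_add) (auto intro!: smooth_differentiable smooth_sum)
  with insert show ?case by simp
qed

lemma partial_cong_open:
  assumes "open S" "x \<in> S" "\<And>z. z \<in> S \<Longrightarrow> f z = g z"
  shows "partial i f x = partial i g x"
proof -
  have "(f has_derivative f') (at x) = (g has_derivative f') (at x)" for f'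
    using has_derivative_transform_within_open[OF _ assms(1,2), of f f' UNIV g]
      has_derivative_transform_within_open[OF _ assms(1,2), of g f' UNIV f] assms(3) by auto
  then show ?thesis by (simp add: partial_def frechet_derivative_def)
qed

text \<open>The sequence \<open>D 0, D 1, \<dots>\<close> of derivatives expresses the smoothness of the outer function, as \<open>smooth\<close> is a notion
  for functions on the plane.\<close>

lemma smooth_chain:
  assumes D: "\<And>n x. (D n has_real_derivative D (Suc n) x) (at x)" and f: "smooth f"
  shows "smooth (\<lambda>z. D n (f z))"
proof -
  have "times_cont_differentiable k (\<lambda>z. D n (f z))" for k n
  proof (induction k arbitrary: n)
    case 0
    have "continuous_on UNIV (D n)" using D by (meson DERIV_isCont continuous_at_imp_continuous_on)
    then show ?case using smooth_continuous[OF f]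
      by (auto intro!: continuous_on_compose2[of UNIV "D n"])
  next
    case (Suc k)
    have "partial i (\<lambda>z. D n (f z)) = (\<lambda>z. D (Suc n) (f z) * partial i f z)" for i
      by (auto intro!: ext partial_chain smooth_differentiable f D)
    moreover have "times_cont_differentiable k (partial i f)" for i
      using smooth_partial[OF f] by (simp add: smooth_def)
    moreover have "(\<lambda>z. D n (f z)) differentiable at x" for x
      using has_derivative_compose[OF smooth_differentiable[OF f, THEN frechet_derivative_works[THEN iffD1]],
          of "D n" "(*) (D (Suc n) (f x))" x] D[of n "f x"]
      by (auto simp: has_field_derivative_def differentiable_def)
    ultimately show ?case using Suc.IH by (auto intro!: tcd_mult)
  qed
  then show ?thesis by (simp add: smooth_def)
qed

lemma smooth_inverse:
  assumes f: "smooth f" and nz: "\<And>x. f x \<noteq> 0"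
  shows "smooth (\<lambda>z. inverse (f z))"
proof -
  have d: "(\<lambda>z. inverse (f z)) differentiable at x" for x
    using smooth_differentiable[OF f] nz by (auto intro!: differentiable_inverse)
  have p: "partial i (\<lambda>z. inverse (f z)) = (\<lambda>z. (-1) * (inverse (f z) * inverse (f z)) * partial i f z)" for i
  proof
    fix x
    show "partial i (\<lambda>z. inverse (f z)) x = (-1) * (inverse (f x) * inverse (f x)) * partial i f x"
      using partial_chain[OF smooth_differentiable[OF f] DERIV_inverse[OF nz], of i x] by (simp add: power2_eq_square)
  qed
  have "times_cont_differentiable k (\<lambda>z. inverse (f z))" for k
  proof (induction k)
    case 0
    then show ?case using smooth_continuous[OF f] nz by (auto intro!: continuous_on_inverse)
  next
    case (Suc k)
    have "times_cont_differentiable k (partial i f)" for i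
      using smooth_partial[OF f] by (simp add: smooth_def)
    moreover have "times_cont_differentiable k (\<lambda>z. -1)"
      using smooth_const[of "-1"] unfolding smooth_def by blast
    ultimately show ?case using Suc d unfolding times_cont_differentiable.simps p
      by (intro conjI allI tcd_mult)
  qed
  then show ?thesis by (simp add: smooth_def)
qed

lemma partial_line_derivative:
  fixes f :: "real^2 \<Rightarrow> real"
  assumes "f differentiable (at (z + t *\<^sub>R axis i 1))"
  shows "((\<lambda>t. f (z + t *\<^sub>R axis i 1)) has_real_derivative partial i f (z + t *\<^sub>R axis i 1)) (at t)"
proof -
  let ?f' = "frechet_derivative f (at (z + t *\<^sub>R axis i 1))"
  have d: "(f has_derivative ?f') (at (z + t *\<^sub>R axis i 1))" using assms frechet_derivative_works by blast
  interpret f': bounded_linear ?f' by (rule has_derivative_bounded_linear[OF d])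
  have "((\<lambda>t. z + t *\<^sub>R axis i 1) has_derivative (\<lambda>s. s *\<^sub>R axis i (1::real))) (at t)"
    by (auto intro!: derivative_eq_intros)
  from has_derivative_compose[OF this, of f ?f'] d
  have "((\<lambda>t. f (z + t *\<^sub>R axis i 1)) has_derivative (\<lambda>s. ?f' (s *\<^sub>R axis i 1))) (at t)" by simp
  moreover have "(\<lambda>s. ?f' (s *\<^sub>R axis i 1)) = (*) (partial i f (z + t *\<^sub>R axis i 1))"
    by (auto simp: f'.scaleR partial_def)
  ultimately show ?thesis by (simp add: has_field_derivative_def)
qed

text \<open>Two applications of the mean value theorem turn the second difference into a mixed derivative.  The
  second difference is symmetric in \<open>i\<close> and \<open>j\<close>, whence \<open>partial_commute\<close> as \<open>h\<close> tends to \<open>0\<close>.\<close>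

lemma second_difference:
  fixes f :: "real^2 \<Rightarrow> real"
  assumes f: "smooth f" and h: "h > 0"
  shows "\<exists>s t. 0 < s \<and> s < h \<and> 0 < t \<and> t < h \<and>
    f (z + h *\<^sub>R axis i 1 + h *\<^sub>R axis j 1) - f (z + h *\<^sub>R axis i 1) - f (z + h *\<^sub>R axis j 1) + f z
      = h * h * partial j (partial i f) (z + s *\<^sub>R axis i 1 + t *\<^sub>R axis j 1)"
proof -
  note d = smooth_differentiable[OF f] smooth_differentiable[OF smooth_partial[OF f]]
  define u where "u s = f ((z + h *\<^sub>R axis j 1) + s *\<^sub>R axis i 1) - f (z + s *\<^sub>R axis i 1)" for s
  define u' where "u' s = partial i f ((z + h *\<^sub>R axis j 1) + s *\<^sub>R axis i 1) - partial i f (z + s *\<^sub>R axis i 1)" for s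
  have "(u has_real_derivative u' s) (at s)" for s
    unfolding u_def u'_def by (intro DERIV_diff partial_line_derivative d)
  with MVT2[OF h, of u u'] obtain s where s: "0 < s" "s < h" "u h - u 0 = h * u' s" by auto
  define v where "v t = partial i f ((z + s *\<^sub>R axis i 1) + t *\<^sub>R axis j 1)" for t
  have "(v has_real_derivative partial j (partial i f) ((z + s *\<^sub>R axis i 1) + t *\<^sub>R axis j 1)) (at t)" for t
    unfolding v_def by (intro partial_line_derivative d)
  with MVT2[OF h, of v "\<lambda>t. partial j (partial i f) ((z + s *\<^sub>R axis i 1) + t *\<^sub>R axis j 1)"]
  obtain t where t: "0 < t" "t < h"
    "v h - v 0 = h * partial j (partial i f) ((z + s *\<^sub>R axis i 1) + t *\<^sub>R axis j 1)" by auto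
  have "u' s = v h - v 0" by (simp add: u'_def v_def algebra_simps)
  then have "u h - u 0 = h * h * partial j (partial i f) (z + s *\<^sub>R axis i 1 + t *\<^sub>R axis j 1)"
    using s(3) t(3) by simp
  moreover have "u h - u 0 = f (z + h *\<^sub>R axis i 1 + h *\<^sub>R axis j 1) - f (z + h *\<^sub>R axis i 1) - f (z + h *\<^sub>R axis j 1) + f z"
    by (simp add: u_def algebra_simps)
  ultimately show ?thesis using s t by metis
qed

lemma partial_commute:
  assumes f: "smooth f"
  shows "partial i (partial j f) z = partial j (partial i f) z"
proof -
  have "\<exists>x y. dist x z \<le> 2 * h \<and> dist y z \<le> 2 * h \<and> partial i (partial j f) x = partial j (partial i f) y"
    if h: "h > 0" for h
  proof -
    obtain s t where s: "0 < s" "s < h" "0 < t" "t < h"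
      and 1: "f (z + h *\<^sub>R axis i 1 + h *\<^sub>R axis j 1) - f (z + h *\<^sub>R axis i 1) - f (z + h *\<^sub>R axis j 1) + f z
      = h * h * partial j (partial i f) (z + s *\<^sub>R axis i 1 + t *\<^sub>R axis j 1)"
      using second_difference[OF f h] by blast
    obtain s' t' where s': "0 < s'" "s' < h" "0 < t'" "t' < h"
      and 2: "f (z + h *\<^sub>R axis j 1 + h *\<^sub>R axis i 1) - f (z + h *\<^sub>R axis j 1) - f (z + h *\<^sub>R axis i 1) + f z
      = h * h * partial i (partial j f) (z + s' *\<^sub>R axis j 1 + t' *\<^sub>R axis i 1)"
      using second_difference[OF f h] by blast
    have e: "h * h * partial j (partial i f) (z + s *\<^sub>R axis i 1 + t *\<^sub>R axis j 1) = 
       h * h * partial i (partial j f) (z + s' *\<^sub>R axis j 1 + t' *\<^sub>R axis i 1)"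
      using 1 2 by (simp add: algebra_simps)
    have n: "dist (z + a *\<^sub>R axis k 1 + b *\<^sub>R axis l 1) z \<le> 2 * h" 
      if "0 < a" "a < h" "0 < b" "b < h" for a b and k l :: 2
    proof -
      have "norm (a *\<^sub>R axis k (1::real) + b *\<^sub>R axis l 1) \<le> \<bar>a\<bar> + \<bar>b\<bar>"
        by (rule norm_triangle_le) simp
      then show ?thesis using that by (simp add: dist_norm)
    qed
    show ?thesis using e h n[OF s] n[OF s'] by (metis mult_cancel_left no_zero_divisors less_irrefl)
  qed
  then have "\<forall>n. \<exists>x y. dist x z \<le> 2 * inverse (real (Suc n)) \<and> dist y z \<le> 2 * inverse (real (Suc n)) \<and>
      partial i (partial j f) x = partial j (partial i f) y"
    by (metis inverse_positive_iff_positive of_nat_0_less_iff zero_less_Suc)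
  then obtain x y where x: "\<And>n. dist (x n) z \<le> 2 * inverse (real (Suc n))"
    and y: "\<And>n. dist (y n) z \<le> 2 * inverse (real (Suc n))"
    and eq: "\<And>n. partial i (partial j f) (x n) = partial j (partial i f) (y n)"
    by metis
  have lim: "(\<lambda>n. 2 * inverse (real (Suc n))) \<longlonglongrightarrow> 0"
    using tendsto_mult_right_zero[OF LIMSEQ_inverse_real_of_nat] by simp
  have cv: "w \<longlonglongrightarrow> z" if "\<And>n. dist (w n) z \<le> 2 * inverse (real (Suc n))" for w
  proof -
    have "(\<lambda>n. dist (w n) z) \<longlonglongrightarrow> 0"
      by (rule Lim_null_comparison[OF _ lim]) (use that in auto)
    then show ?thesis using tendsto_dist_iff by blast
  qed
  have ct: "isCont (partial k (partial l f)) z" for k l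
    using smooth_continuous[OF smooth_partial[OF smooth_partial[OF f]], of UNIV k l]
    by (simp add: continuous_on_eq_continuous_at)
  have "(\<lambda>n. partial i (partial j f) (x n)) \<longlonglongrightarrow> partial i (partial j f) z"
    by (rule isCont_tendsto_compose[OF ct cv]) (rule x)
  moreover have "(\<lambda>n. partial i (partial j f) (x n)) \<longlonglongrightarrow> partial j (partial i f) z"
    unfolding eq by (rule isCont_tendsto_compose[OF ct cv]) (rule y)
  ultimately show ?thesis by (rule LIMSEQ_unique)
qed

section \<open>A smooth bump function\<close>

text \<open>For \<open>p = 1\<close> this is the classical function \<open>exp (- 1 / x)\<close>.  The polynomial makes the family closed under
  differentiation, so that smoothness follows from one derivative formula.\<close>

definition flat :: "real poly \<Rightarrow> real \<Rightarrow> real" where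
  "flat p x = (if x > 0 then poly p (1/x) * exp (- (1/x)) else 0)"

lemma poly_exp_decay: "((\<lambda>t::real. poly p t * exp (- t)) \<longlongrightarrow> 0) at_top"
proof -
  have "((\<lambda>t::real. \<Sum>i\<le>degree p. coeff p i * (t ^ i / exp t)) \<longlongrightarrow> (\<Sum>i\<le>degree p. coeff p i * 0)) at_top"
    by (intro tendsto_sum tendsto_mult tendsto_const tendsto_power_div_exp_0)
  then show ?thesis
    by (simp add: poly_altdef sum_distrib_right exp_minus divide_inverse mult.assoc)
qed

lemma flat_tendsto_0: "(flat p \<longlongrightarrow> 0) (at 0)"
proof -
  have "((\<lambda>x. poly p (inverse x) * exp (- inverse x)) \<longlongrightarrow> 0) (at_right 0)"
    by (rule filterlim_compose[OF poly_exp_decay filterlim_inverse_at_top_right])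
  moreover have "eventually (\<lambda>x. poly p (inverse x) * exp (- inverse x) = flat p x) (at_right 0)"
    by (auto simp: eventually_at_right_field flat_def inverse_eq_divide intro: exI[of _ 1])
  ultimately have "(flat p \<longlongrightarrow> 0) (at_right 0)" by (rule Lim_transform_eventually)
  moreover have "(flat p \<longlongrightarrow> 0) (at_left 0)"
    by (rule Lim_transform_eventually[OF tendsto_const])
       (auto simp: eventually_at_left_field flat_def intro: exI[of _ "-1"])
  ultimately show ?thesis by (simp add: filterlim_split_at)
qed

lemma flat_deriv:
  "(flat p has_real_derivative flat ([:0,0,1:] * (p - pderiv p)) x) (at x)"
proof (cases "x = 0")
  case True
  have "(\<lambda>h. (flat p (0 + h) - flat p 0) / h) = flat ([:0,1:] * p)"
    by (auto simp: flat_def fun_eq_iff)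
  then show ?thesis using flat_tendsto_0[of "[:0,1:] * p"] True
    by (simp add: DERIV_def flat_def)
next
  case False
  then consider "x > 0" | "x < 0" by linarith
  then show ?thesis
  proof cases
    case 1
    have "((\<lambda>x. poly p (1/x) * exp (- (1/x))) has_real_derivative flat ([:0,0,1:] * (p - pderiv p)) x) (at x)"
      using 1 by (auto intro!: derivative_eq_intros DERIV_chain2[OF poly_DERIV] simp: flat_def field_simps power2_eq_square)
    then show ?thesis
      by (rule has_field_derivative_transform_within_open[where S="{0<..}"]) (use 1 in \<open>auto simp: flat_def\<close>)
  next
    case 2
    have "((\<lambda>x. 0) has_real_derivative flat ([:0,0,1:] * (p - pderiv p)) x) (at x)"
      using 2 by (simp add: flat_def)
    then show ?thesis
      by (rule has_field_derivative_transform_within_open[where S="{..<0}"]) (use 2 in \<open>auto simp: flat_def\<close>)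
  qed
qed

primrec flat_poly :: "nat \<Rightarrow> real poly" where
  "flat_poly 0 = 1"
| "flat_poly (Suc n) = [:0,0,1:] * (flat_poly n - pderiv (flat_poly n))"

lemma smooth_flat: "smooth f \<Longrightarrow> smooth (\<lambda>z. flat 1 (f z))"
  using smooth_chain[of "\<lambda>n. flat (flat_poly n)" f 0] flat_deriv by simp

lemma flat1: "flat 1 x \<ge> 0" "flat 1 x > 0 \<longleftrightarrow> x > 0" "flat 1 x = 0 \<longleftrightarrow> x \<le> 0"
  by (auto simp: flat_def)

text \<open>Equal to \<open>1\<close> for \<open>(norm z)\<^sup>2 \<le> 2\<close> and to \<open>0\<close> for \<open>norm z \<ge> 2\<close>.  The argument is a polynomial in the
  coordinates, and the two flat functions never vanish together, so \<open>eta\<close> is smooth.\<close>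

definition eta :: "real^2 \<Rightarrow> real" where
  "eta z = (let s = (4 - (norm z)\<^sup>2) / 2 in flat 1 s * inverse (flat 1 s + flat 1 (1 - s)))"

lemma norm2: "(norm (z::real^2))\<^sup>2 = z$1 * z$1 + z$2 * z$2"
  by (simp add: norm_vec_def L2_set_def sum_2 power2_eq_square)

lemma flat1_sum_pos: "flat 1 s + flat 1 (1 - s) > 0"
  using flat1(1,2)[of s] flat1(1,2)[of "1 - s"] by (smt (verit))

lemma smooth_eta: "smooth eta"
proof -
  have s: "smooth (\<lambda>z. (1/2) * (4 - (z$1 * z$1 + z$2 * z$2)))"
    by (intro smooth_mult smooth_diff smooth_add smooth_const smooth_coord)
  have 1: "smooth (\<lambda>z. flat 1 ((1/2) * (4 - (z$1 * z$1 + z$2 * z$2))))"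
    using s by (rule smooth_flat)
  have 2: "smooth (\<lambda>z. flat 1 (1 - (1/2) * (4 - (z$1 * z$1 + z$2 * z$2))))"
    by (intro smooth_flat smooth_diff s smooth_const)
  have "smooth (\<lambda>z. flat 1 ((1/2) * (4 - (z$1 * z$1 + z$2 * z$2))) *
     inverse (flat 1 ((1/2) * (4 - (z$1 * z$1 + z$2 * z$2))) + flat 1 (1 - (1/2) * (4 - (z$1 * z$1 + z$2 * z$2)))))"
    using flat1_sum_pos by (intro smooth_mult smooth_inverse smooth_add 1 2) (simp add: less_imp_neq[symmetric])
  then show ?thesis by (simp add: eta_def[abs_def] Let_def norm2)
qed

lemma eta_range: "0 \<le> eta z" "eta z \<le> 1"
proof -
  define s where "s = (4 - (norm z)\<^sup>2) / 2"
  have e: "eta z = flat 1 s / (flat 1 s + flat 1 (1 - s))"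
    unfolding eta_def Let_def s_def[symmetric] by (rule divide_inverse[symmetric])
  show "0 \<le> eta z" "eta z \<le> 1"
    unfolding e using flat1(1)[of s] flat1(1)[of "1 - s"] flat1_sum_pos[of s]
    by (simp_all add: divide_le_eq_1_pos)
qed

lemma eta_eq_1: "(norm z)\<^sup>2 \<le> 2 \<Longrightarrow> eta z = 1"
proof -
  assume "(norm z)\<^sup>2 \<le> 2"
  then have 1: "flat 1 (1 - (4 - (norm z)\<^sup>2) / 2) = 0" "flat 1 ((4 - (norm z)\<^sup>2) / 2) > 0"
    by (auto simp: flat1)
  then show ?thesis by (simp add: eta_def Let_def)
qed

lemma eta_eq_0: "norm z \<ge> 2 \<Longrightarrow> eta z = 0"
proof -
  assume "norm z \<ge> 2"
  then have "(norm z)\<^sup>2 \<ge> 2\<^sup>2" by (intro power_mono) auto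
  then have "flat 1 ((4 - (norm z)\<^sup>2) / 2) = 0" by (simp add: flat1)
  then show ?thesis by (simp add: eta_def Let_def)
qed

lemma partial_eta_outside: "norm z > 2 \<Longrightarrow> partial i eta z = 0"
proof -
  assume z: "norm z > 2"
  have "partial i eta z = partial i (\<lambda>z. 0) z"
    by (rule partial_cong_open[of "{z. norm z > 2}"]) (use z in \<open>auto intro!: open_Collect_less continuous_intros eta_eq_0\<close>)
  then show ?thesis by simp
qed

lemma partial2_eta_outside: "norm z > 2 \<Longrightarrow> partial i (partial j eta) z = 0"
proof -
  assume z: "norm z > 2"
  have "partial i (partial j eta) z = partial i (\<lambda>z. 0) z"
    by (rule partial_cong_open[of "{z. norm z > 2}"]) (use z in \<open>auto intro!: open_Collect_less continuous_intros partial_eta_outside\<close>)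
  then show ?thesis by simp
qed

lemma eta_bound_ex: "\<exists>K\<ge>1. \<forall>i j z. \<bar>partial i eta z\<bar> \<le> K \<and> \<bar>partial i (partial j eta) z\<bar> \<le> K"
proof -
  have bd: "\<exists>B. \<forall>z. \<bar>g z\<bar> \<le> B" if g: "smooth g" "\<And>z. norm z > 2 \<Longrightarrow> g z = 0" for g :: "real^2 \<Rightarrow> real"
  proof -
    have "compact (g ` cball 0 2)" by (intro compact_continuous_image smooth_continuous g compact_cball)
    then obtain B where B: "\<And>z. z \<in> cball 0 2 \<Longrightarrow> \<bar>g z\<bar> \<le> B"
      using compact_imp_bounded bounded_real by (metis imageI)
    have "\<bar>g z\<bar> \<le> max B 0" for z
      using B[of z] g(2)[of z] by (cases "norm z \<le> 2") auto
    then show ?thesis by blast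
  qed
  have "\<forall>i. \<exists>B. \<forall>z. \<bar>partial i eta z\<bar> \<le> B"
    by (intro allI bd smooth_partial smooth_eta partial_eta_outside)
  then obtain B1 where B1: "\<And>i z. \<bar>partial i eta z\<bar> \<le> B1 i" by metis
  have "\<forall>i j. \<exists>B. \<forall>z. \<bar>partial i (partial j eta) z\<bar> \<le> B"
    by (intro allI bd smooth_partial smooth_eta partial2_eta_outside)
  then obtain B2 where B2: "\<And>i j z. \<bar>partial i (partial j eta) z\<bar> \<le> B2 i j" by metis
  let ?K = "1 + (\<Sum>i\<in>UNIV. \<bar>B1 i\<bar>) + (\<Sum>i\<in>UNIV. \<Sum>j\<in>UNIV. \<bar>B2 i j\<bar>)"
  have 1: "\<bar>B1 i\<bar> \<le> (\<Sum>i\<in>UNIV. \<bar>B1 i\<bar>)" for i by (rule member_le_sum) auto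
  have 2: "\<bar>B2 i j\<bar> \<le> (\<Sum>i\<in>UNIV. \<Sum>j\<in>UNIV. \<bar>B2 i j\<bar>)" for i j
    by (rule order_trans[OF member_le_sum member_le_sum[of i UNIV "\<lambda>i. \<Sum>j\<in>UNIV. \<bar>B2 i j\<bar>"]]) (auto intro: sum_nonneg)
  have 3: "(\<Sum>i\<in>UNIV. \<bar>B1 i\<bar>) \<ge> 0" "(\<Sum>i\<in>UNIV. \<Sum>j\<in>UNIV. \<bar>B2 i j\<bar>) \<ge> 0" by (auto intro!: sum_nonneg)
  have "\<bar>partial i eta z\<bar> \<le> ?K \<and> \<bar>partial i (partial j eta) z\<bar> \<le> ?K" for i j z
    using B1[of i z] B2[of i j z] 1[of i] 2[of i j] 3 by linarith
  then show ?thesis using 3 by (intro exI[of _ ?K]) auto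
qed

text \<open>The constant in \<open>square_lower_bound\<close> is a number times the fourth power of this one.\<close>

definition bump_const :: real where
  "bump_const = (SOME K. K \<ge> 1 \<and> (\<forall>i j z. \<bar>partial i eta z\<bar> \<le> K \<and> \<bar>partial i (partial j eta) z\<bar> \<le> K))"

lemma bump_const: "bump_const \<ge> 1" "\<bar>partial i eta z\<bar> \<le> bump_const" "\<bar>partial i (partial j eta) z\<bar> \<le> bump_const"
  using someI_ex[OF eta_bound_ex] unfolding bump_const_def by blast+

section \<open>Localising a function to a ball\<close>

lemma partial_scale:
  assumes "f differentiable (at ((z - c) /\<^sub>R r))"
  shows "partial i (\<lambda>z. f ((z - c) /\<^sub>R r)) z = partial i f ((z - c) /\<^sub>R r) / r"
proof -
  let ?f' = "frechet_derivative f (at ((z - c) /\<^sub>R r))"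
  have d: "(f has_derivative ?f') (at ((z - c) /\<^sub>R r))" using assms frechet_derivative_works by blast
  interpret f': bounded_linear ?f' by (rule has_derivative_bounded_linear[OF d])
  have "((\<lambda>z. (z - c) /\<^sub>R r) has_derivative (\<lambda>v. v /\<^sub>R r)) (at z)"
    by (auto intro!: derivative_eq_intros)
  from partial_eq[OF has_derivative_compose[OF this, of f ?f', OF d]]
  show ?thesis by (simp add: f'.scaleR partial_def divide_inverse mult.commute)
qed

lemma differentiable_scale:
  assumes "f differentiable (at ((z - c) /\<^sub>R r))"
  shows "(\<lambda>z. f ((z - c) /\<^sub>R r)) differentiable (at z)"
proof -
  have "((\<lambda>z. (z - c) /\<^sub>R r) has_derivative (\<lambda>v. v /\<^sub>R r)) (at z)"
    by (auto intro!: derivative_eq_intros)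
  from has_derivative_compose[OF this, of f] show ?thesis
    using assms unfolding differentiable_def by blast
qed

lemma smooth_scale:
  assumes "smooth f"
  shows "smooth (\<lambda>z. f ((z - c) /\<^sub>R r))"
proof -
  have "times_cont_differentiable k (\<lambda>z. f ((z - c) /\<^sub>R r))" if "smooth f" for k f
    using that
  proof (induction k arbitrary: f)
    case 0
    then show ?case using smooth_continuous[of f UNIV]
      by (auto intro!: continuous_on_compose2[of UNIV f] continuous_intros)
  next
    case (Suc k)
    have p: "partial i (\<lambda>z. f ((z - c) /\<^sub>R r)) = (\<lambda>z. partial i f ((z - c) /\<^sub>R r) * (1 / r))" for i
      using partial_scale[OF smooth_differentiable[OF Suc.prems]] by (auto simp: fun_eq_iff)
    have c: "times_cont_differentiable k (\<lambda>z. 1 / r)"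
      using smooth_const unfolding smooth_def by blast
    have "times_cont_differentiable k (partial i (\<lambda>z. f ((z - c) /\<^sub>R r)))" for i
      unfolding p by (rule tcd_mult[OF Suc.IH[OF smooth_partial[OF Suc.prems]] c])
    then show ?case using differentiable_scale[OF smooth_differentiable[OF Suc.prems]] by simp
  qed
  with assms show ?thesis unfolding smooth_def by blast
qed

definition cutoff :: "real^2 \<Rightarrow> real \<Rightarrow> real^2 \<Rightarrow> real" where
  "cutoff c r z = eta ((z - c) /\<^sub>R r)"

lemma smooth_cutoff: "smooth (cutoff c r)"
  unfolding cutoff_def[abs_def] by (rule smooth_scale[OF smooth_eta])

lemma partial_cutoff: "partial i (cutoff c r) z = partial i eta ((z - c) /\<^sub>R r) / r"
  unfolding cutoff_def[abs_def] by (rule partial_scale[OF smooth_differentiable[OF smooth_eta]])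

lemma partial2_cutoff: "partial i (partial j (cutoff c r)) z = partial i (partial j eta) ((z - c) /\<^sub>R r) / (r * r)"
proof -
  have "partial j (cutoff c r) = (\<lambda>z. partial j eta ((z - c) /\<^sub>R r) * (1 / r))"
    by (simp add: fun_eq_iff partial_cutoff)
  moreover have "partial i (\<lambda>z. partial j eta ((z - c) /\<^sub>R r) * (1 / r)) z
      = partial i (\<lambda>z. partial j eta ((z - c) /\<^sub>R r)) z * (1 / r)
        + partial j eta ((z - c) /\<^sub>R r) * partial i (\<lambda>z. 1 / r) z"
    by (rule partial_mult[OF differentiable_scale[OF smooth_differentiable[OF smooth_partial[OF smooth_eta]]]
          smooth_differentiable[OF smooth_const]])
  moreover have "partial i (\<lambda>z. partial j eta ((z - c) /\<^sub>R r)) z = partial i (partial j eta) ((z - c) /\<^sub>R r) / r"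
    by (rule partial_scale[OF smooth_differentiable[OF smooth_partial[OF smooth_eta]]])
  ultimately show ?thesis by simp
qed

text \<open>The localisation of \<open>u - u c\<close> to the ball of radius \<open>2 * r\<close>: subtracting it from \<open>u\<close> makes \<open>u\<close> constant
  near \<open>c\<close>.  Because \<open>u - u c\<close> is small near \<open>c\<close>, the derivatives of the cut-off do little harm
  (\<open>hole_bounds\<close>).\<close>

definition hole :: "(real^2 \<Rightarrow> real) \<Rightarrow> real^2 \<Rightarrow> real \<Rightarrow> real^2 \<Rightarrow> real" where
  "hole u c r z = (u z - u c) * cutoff c r z"

lemma smooth_hole: "smooth u \<Longrightarrow> smooth (hole u c r)"
  unfolding hole_def[abs_def] by (intro smooth_mult smooth_diff smooth_const smooth_cutoff)

lemma norm_scale: "r > 0 \<Longrightarrow> norm ((z - c) /\<^sub>R r) = norm (z - c) / r"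
  unfolding norm_scaleR by (simp add: inverse_eq_divide)

lemma cutoff_eq_1: "r > 0 \<Longrightarrow> (norm (z - c))\<^sup>2 \<le> 2 * r\<^sup>2 \<Longrightarrow> cutoff c r z = 1"
  unfolding cutoff_def by (rule eta_eq_1, simp only: norm_scale) (simp add: power_divide pos_divide_le_eq)

lemma cutoff_eq_0: "r > 0 \<Longrightarrow> norm (z - c) \<ge> 2 * r \<Longrightarrow> cutoff c r z = 0"
  unfolding cutoff_def by (rule eta_eq_0, simp only: norm_scale) (simp add: pos_le_divide_eq)

lemma hole_inside:
  assumes u: "smooth u" and r: "r > 0" and z: "norm (z - c) \<le> r"
  shows "partial i (hole u c r) z = partial i u z"
    and "partial i (partial j (hole u c r)) z = partial i (partial j u) z"
proof -
  let ?S = "{z. (norm (z - c))\<^sup>2 < 2 * r\<^sup>2}"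
  have o: "open ?S" by (intro open_Collect_less continuous_intros)
  have "(norm (z - c))\<^sup>2 \<le> r\<^sup>2" using z by (intro power_mono) auto
  moreover have "r\<^sup>2 > 0" using r by (intro zero_less_power)
  ultimately have "(norm (z - c))\<^sup>2 < 2 * r\<^sup>2" by linarith
  then have zS: "z \<in> ?S" by blast
  have p: "partial i (hole u c r) w = partial i u w" if "w \<in> ?S" for w i
  proof -
    have "partial i (hole u c r) w = partial i (\<lambda>z. u z - u c) w"
      by (rule partial_cong_open[OF o that]) (use cutoff_eq_1[OF r] in \<open>auto simp: hole_def\<close>)
    then show ?thesis by (simp add: partial_diff smooth_differentiable u)
  qed
  show "partial i (hole u c r) z = partial i u z" by (rule p[OF zS])
  show "partial i (partial j (hole u c r)) z = partial i (partial j u) z"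
    by (rule partial_cong_open[OF o zS]) (rule p)
qed

lemma hole_outside:
  assumes r: "r > 0" and z: "norm (z - c) > 2 * r"
  shows "hole u c r z = 0" "partial i (hole u c r) z = 0" "partial i (partial j (hole u c r)) z = 0"
proof -
  let ?S = "{z. norm (z - c) > 2 * r}"
  have o: "open ?S" by (intro open_Collect_less continuous_intros)
  have p: "partial i (hole u c r) w = 0" if "w \<in> ?S" for w i
  proof -
    have "partial i (hole u c r) w = partial i (\<lambda>z. 0) w"
      by (rule partial_cong_open[OF o that]) (use cutoff_eq_0[OF r] in \<open>auto simp: hole_def\<close>)
    then show ?thesis by simp
  qed
  show "hole u c r z = 0" using cutoff_eq_0[OF r] z by (simp add: hole_def)
  show "partial i (hole u c r) z = 0" using p z by simp
  have "partial i (partial j (hole u c r)) z = partial i (\<lambda>z. 0) z"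
    by (rule partial_cong_open[OF o]) (use z p in auto)
  then show "partial i (partial j (hole u c r)) z = 0" by simp
qed

lemma gradient_bound:
  assumes u: "smooth u" and A: "\<And>i z. \<bar>partial i u z\<bar> \<le> A"
  shows "\<bar>u z - u c\<bar> \<le> 2 * A * norm (z - c)"
proof -
  have "norm (u z - u c) \<le> 2 * A * norm (z - c)"
  proof (rule differentiable_bound[of UNIV u "\<lambda>x v. partial 1 u x * v$1 + partial 2 u x * v$2"])
    fix x :: "real^2" assume "x \<in> UNIV"
    show "(u has_derivative (\<lambda>v. partial 1 u x * v$1 + partial 2 u x * v$2)) (at x within UNIV)"
      using has_derivative_partial[OF smooth_differentiable[OF u]] by simp
    show "onorm (\<lambda>v::real^2. partial 1 u x * v$1 + partial 2 u x * v$2) \<le> 2 * A"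
    proof (rule onorm_le)
      fix v :: "real^2"
      have "\<bar>partial 1 u x * v$1 + partial 2 u x * v$2\<bar> \<le> A * \<bar>v$1\<bar> + A * \<bar>v$2\<bar>"
        using A[of 1 x] A[of 2 x]
        by (intro order_trans[OF abs_triangle_ineq] add_mono) (auto simp: abs_mult intro!: mult_right_mono)
      also have "\<dots> \<le> A * norm v + A * norm v"
        using A[of 1 x] by (intro add_mono mult_left_mono component_le_norm_cart) auto
      finally show "norm (partial 1 u x * v$1 + partial 2 u x * v$2) \<le> 2 * A * norm v" by simp
    qed
  qed auto
  then show ?thesis by simp
qed

text \<open>By \<open>gradient_bound\<close>, \<open>u - u c\<close> is of order \<open>A * r\<close> where the cut-off lives, which compensates one of
  the factors \<open>1 / r\<close> in its derivatives.\<close>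

lemma hole_bounds:
  assumes u: "smooth u" and r: "r > 0" and A: "\<And>i z. \<bar>partial i u z\<bar> \<le> A"
    and A2: "\<And>i j z. \<bar>partial i (partial j u) z\<bar> \<le> A / r"
  shows "\<bar>partial i (hole u c r) z\<bar> \<le> 5 * A * bump_const"
    and "\<bar>partial i (partial j (hole u c r)) z\<bar> \<le> 9 * A * bump_const / r"
proof -
  let ?K = bump_const
  have K: "?K \<ge> 1" by (rule bump_const)
  have A0: "A \<ge> 0" using A[of 1 z] by linarith
  have d: "f differentiable (at z)" if "smooth f" for f z using smooth_differentiable[OF that] .
  note sm = smooth_mult smooth_diff smooth_const smooth_cutoff smooth_partial u
  have p: "partial i (hole u c r) = (\<lambda>w. partial i u w * cutoff c r w + (u w - u c) * partial i (cutoff c r) w)" for i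
    unfolding hole_def[abs_def] by (rule ext) (simp add: partial_mult partial_diff d sm)
  have pp: "partial i (partial j (hole u c r)) z = partial i (partial j u) z * cutoff c r z
      + partial j u z * partial i (cutoff c r) z + partial i u z * partial j (cutoff c r) z
      + (u z - u c) * partial i (partial j (cutoff c r)) z"
    unfolding p by (simp add: partial_mult partial_add partial_diff d sm)
  have cut1: "\<bar>cutoff c r z\<bar> \<le> 1" using eta_range by (simp add: cutoff_def)
  have cut2: "\<bar>partial i (cutoff c r) z\<bar> \<le> ?K / r" for i
    using bump_const(2) r by (simp add: partial_cutoff divide_right_mono)
  have cut3: "\<bar>partial i (partial j (cutoff c r)) z\<bar> \<le> ?K / (r * r)"
    using bump_const(3) r by (simp add: partial2_cutoff divide_right_mono)
  show "\<bar>partial i (hole u c r) z\<bar> \<le> 5 * A * ?K"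
  proof (cases "norm (z - c) \<le> 2 * r")
    case True
    have uu: "\<bar>u z - u c\<bar> \<le> 4 * A * r"
      using gradient_bound[OF u A, of z c] mult_left_mono[OF True, of "2 * A"] A0 by linarith
    have "\<bar>partial i (hole u c r) z\<bar> \<le> \<bar>partial i u z\<bar> * \<bar>cutoff c r z\<bar> + \<bar>u z - u c\<bar> * \<bar>partial i (cutoff c r) z\<bar>"
      unfolding p by (rule order_trans[OF abs_triangle_ineq]) (simp add: abs_mult)
    also have "\<dots> \<le> A * 1 + (4 * A * r) * (?K / r)"
      using A0 r by (intro add_mono mult_mono A cut1 uu cut2) auto
    also have "\<dots> = A * (1 + 4 * ?K)" using r by (simp add: field_simps)
    also have "\<dots> \<le> A * (5 * ?K)" using A0 K by (intro mult_left_mono) auto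
    finally show ?thesis by simp
  next
    case False
    then show ?thesis using hole_outside(2)[OF r] A0 K by simp
  qed
  show "\<bar>partial i (partial j (hole u c r)) z\<bar> \<le> 9 * A * ?K / r"
  proof (cases "norm (z - c) \<le> 2 * r")
    case True
    have uu: "\<bar>u z - u c\<bar> \<le> 4 * A * r"
      using gradient_bound[OF u A, of z c] mult_left_mono[OF True, of "2 * A"] A0 by linarith
    have "\<bar>partial i (partial j (hole u c r)) z\<bar> \<le> \<bar>partial i (partial j u) z\<bar> * \<bar>cutoff c r z\<bar>
      + \<bar>partial j u z\<bar> * \<bar>partial i (cutoff c r) z\<bar> + \<bar>partial i u z\<bar> * \<bar>partial j (cutoff c r) z\<bar>
      + \<bar>u z - u c\<bar> * \<bar>partial i (partial j (cutoff c r)) z\<bar>"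
      unfolding pp by (simp flip: abs_mult)
    also have "\<dots> \<le> (A / r) * 1 + A * (?K / r) + A * (?K / r) + (4 * A * r) * (?K / (r * r))"
      using A0 r K by (intro add_mono mult_mono A A2 cut1 uu cut2 cut3) auto
    also have "\<dots> = A * (1 + 6 * ?K) / r" using r by (simp add: field_simps)
    also have "\<dots> \<le> A * (9 * ?K) / r" using A0 K r by (intro mult_left_mono divide_right_mono) auto
    also have "\<dots> = 9 * A * ?K / r" by (simp add: mult_ac)
    finally show ?thesis .
  next
    case False
    then show ?thesis using hole_outside(3)[OF r] A0 K r by simp
  qed
qed

section \<open>Nested families of separated balls\<close>

text \<open>The factor \<open>2\<close> says that even the concentric balls of twice the radius are disjoint.\<close>

definition separated_balls :: "((real^2) \<times> real) set \<Rightarrow> bool" where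
  "separated_balls F \<longleftrightarrow> finite F \<and> (\<forall>(c,r)\<in>F. r > 0) \<and>
     (\<forall>(c,r)\<in>F. \<forall>(c',r')\<in>F. (c,r) \<noteq> (c',r') \<longrightarrow> dist c c' > 2 * (r + r'))"

definition total_radius :: "((real^2) \<times> real) set \<Rightarrow> real" where
  "total_radius F = (\<Sum>(c,r)\<in>F. r)"

definition covers :: "((real^2) \<times> real) set \<Rightarrow> ((real^2) \<times> real) set \<Rightarrow> bool" where
  "covers F' F \<longleftrightarrow> (\<forall>c r. (c,r) \<in> F \<longrightarrow> (\<exists>c' r'. (c',r') \<in> F' \<and> cball c r \<subseteq> cball c' r'))"

lemma covers_trans: "covers F G \<Longrightarrow> covers G H \<Longrightarrow> covers F H"
  unfolding covers_def by (meson subset_trans)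

lemma separated_ballsD:
  assumes "separated_balls F" "(c,r) \<in> F" "(c',r') \<in> F" "dist c c' \<le> 2 * (r + r')"
  shows "(c,r) = (c',r')"
  using assms unfolding separated_balls_def by fastforce

text \<open>Two balls that violate the separation lie in a ball of radius \<open>3 * (r + r')\<close>.  Such a merger removes one
  ball and at most triples the total radius, so \<open>total_radius F * 3 ^ card F\<close> does not increase.\<close>

lemma merge_balls:
  assumes "finite F" "\<forall>(c,r)\<in>F. r > 0"
  shows "\<exists>F'. separated_balls F' \<and> covers F' F \<and> card F' \<le> card F \<and>
      total_radius F' * 3 ^ card F' \<le> total_radius F * 3 ^ card F"
  using assms
proof (induction "card F" arbitrary: F rule: less_induct)
  case less
  show ?case
  proof (cases "separated_balls F")
    case True
    then show ?thesis by (intro exI[of _ F]) (auto simp: covers_def)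
  next
    case False
    have "\<exists>c r c' r'. (c,r) \<in> F \<and> (c',r') \<in> F \<and> (c,r) \<noteq> (c',r') \<and> dist c c' \<le> 2 * (r + r')"
    proof (rule ccontr)
      assume "\<not> ?thesis"
      then have "\<forall>(c,r)\<in>F. \<forall>(c',r')\<in>F. (c,r) \<noteq> (c',r') \<longrightarrow> dist c c' > 2 * (r + r')"
        by (fastforce simp: not_le)
      then show False using False less.prems unfolding separated_balls_def by blast
    qed
    then obtain c r c' r' where B: "(c,r) \<in> F" "(c',r') \<in> F" "(c,r) \<noteq> (c',r')" and d: "dist c c' \<le> 2 * (r + r')"
      by blast
    have r: "r > 0" "r' > 0" using B less.prems by auto
    define G where "G = F - {(c,r)} - {(c',r')}"
    define F1 where "F1 = insert (c, 3 * (r + r')) G"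
    have finG: "finite G" using less.prems by (simp add: G_def)
    have F_eq: "F = insert (c,r) (insert (c',r') G)" and nin: "(c,r) \<notin> insert (c',r') G" "(c',r') \<notin> G"
      using B by (auto simp: G_def)
    have cardF: "card F = card G + 2"
      using finG nin by (simp add: F_eq)
    have cardF1: "card F1 \<le> card G + 1" "card F1 < card F"
      using finG card_insert_le_m1[of "card G + 1" G] by (auto simp: F1_def card_insert_if cardF)
    have sumF: "total_radius F = r + r' + total_radius G"
      using finG nin by (simp add: F_eq total_radius_def)
    have sumG: "total_radius G \<ge> 0"
      using less.prems by (auto simp: total_radius_def G_def intro!: sum_nonneg)
    have sumF1: "total_radius F1 \<le> 3 * (r + r') + total_radius G"
      using finG r by (cases "(c, 3 * (r + r')) \<in> G") (auto simp: F1_def total_radius_def insert_absorb)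
    have pos: "\<forall>(c,r)\<in>F1. r > 0" using less.prems r by (auto simp: F1_def G_def)
    have "finite F1" using finG by (simp add: F1_def)
    from less.hyps[OF cardF1(2) this pos] obtain F' where F': "separated_balls F'" "covers F' F1" "card F' \<le> card F1"
      "total_radius F' * 3 ^ card F' \<le> total_radius F1 * 3 ^ card F1" by blast
    have "covers F1 F"
    proof -
      have 1: "cball c r \<subseteq> cball c (3 * (r + r'))" using r by (intro subset_cball) auto
      have 2: "cball c' r' \<subseteq> cball c (3 * (r + r'))"
      proof
        fix x assume "x \<in> cball c' r'"
        then show "x \<in> cball c (3 * (r + r'))"
          using d r dist_triangle[of c x c'] by (simp add: algebra_simps)
      qed
      show ?thesis unfolding covers_def
      proof (intro allI impI)
        fix c1 r1 assume "(c1,r1) \<in> F"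
        then consider "c1 = c" "r1 = r" | "c1 = c'" "r1 = r'" | "(c1,r1) \<in> F1" by (auto simp: F_eq F1_def)
        then show "\<exists>c' r'. (c',r') \<in> F1 \<and> cball c1 r1 \<subseteq> cball c' r'"
        proof cases
          case 1 then show ?thesis using \<open>cball c r \<subseteq> _\<close> unfolding F1_def by blast
        next
          case 2 then show ?thesis using \<open>cball c' r' \<subseteq> _\<close> unfolding F1_def by blast
        next
          case 3 then show ?thesis by blast
        qed
      qed
    qed
    with F'(2) have "covers F' F" by (rule covers_trans)
    moreover have "total_radius F1 * 3 ^ card F1 \<le> total_radius F * 3 ^ card F"
    proof -
      have "total_radius F1 * 3 ^ card F1 \<le> (3 * (r + r') + total_radius G) * 3 ^ (card G + 1)"
        using sumF1 sumG r cardF1 by (intro mult_mono power_increasing) auto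
      also have "\<dots> \<le> (3 * total_radius F) * 3 ^ (card G + 1)"
        using sumG by (intro mult_right_mono) (auto simp: sumF)
      also have "\<dots> = total_radius F * 3 ^ card F" by (simp add: cardF)
      finally show ?thesis .
    qed
    ultimately show ?thesis using F' cardF1 by (intro exI[of _ F']) auto
  qed
qed

text \<open>A ball of one level, even doubled, lies in a ball of the next level; this is what makes the annuli of
  different levels disjoint.\<close>

definition nested_balls :: "(nat \<Rightarrow> ((real^2) \<times> real) set) \<Rightarrow> nat \<Rightarrow> bool" where
  "nested_balls F M \<longleftrightarrow> (\<forall>j<M. separated_balls (F j)) \<and>
     (\<forall>j c r. Suc j < M \<longrightarrow> (c,r) \<in> F j \<longrightarrow>
        (\<exists>c' r'. (c',r') \<in> F (Suc j) \<and> cball c (2 * r) \<subseteq> cball c' r'))"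

text \<open>The levels arise by alternately merging balls and doubling all radii.  Only the doubling increases
  \<open>total_radius F * 3 ^ card F\<close>, by a factor \<open>2\<close> per level.\<close>

lemma nested_balls_exist:
  assumes G: "finite G" "\<forall>(c,r)\<in>G. r > 0"
  shows "\<exists>F. nested_balls F M \<and> covers (F 0) G \<and>
    (\<forall>j. card (F j) \<le> card G \<and> total_radius (F j) \<le> 2 ^ j * (total_radius G * 3 ^ card G))"
proof -
  define dil where "dil F = (\<lambda>(c,r). (c, 2 * r)) ` F" for F :: "((real^2) \<times> real) set"
  have inj: "inj_on (\<lambda>(c,r). (c, 2 * r)) F" for F :: "((real^2) \<times> real) set" by (auto simp: inj_on_def)
  have dil_card: "card (dil F) = card F" for F using inj by (simp add: dil_def card_image)
  have dil_sum: "total_radius (dil F) = 2 * total_radius F" for F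
    unfolding dil_def total_radius_def by (subst sum.reindex[OF inj]) (simp add: case_prod_unfold sum_distrib_left)
  let ?P = "\<lambda>F F'. separated_balls F' \<and> covers F' F \<and> card F' \<le> card F \<and>
      total_radius F' * 3 ^ card F' \<le> total_radius F * 3 ^ card F"
  have ex: "\<forall>F. \<exists>F'. finite F \<and> (\<forall>(c,r)\<in>F. r > 0) \<longrightarrow> ?P F F'"
    using merge_balls by blast
  then obtain mrg where mrg: "\<And>F. finite F \<Longrightarrow> \<forall>(c,r)\<in>F. r > 0 \<Longrightarrow> ?P F (mrg F)" by metis
  define F where "F = rec_nat (mrg G) (\<lambda>_ F. mrg (dil F))"
  have F0: "F 0 = mrg G" and FS: "F (Suc j) = mrg (dil (F j))" for j by (simp_all add: F_def)
  have P0: "?P G (F 0)" unfolding F0 by (rule mrg[OF G])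
  have PS: "?P (dil (F j)) (F (Suc j))" if "separated_balls (F j)" for j
    unfolding FS using that by (intro mrg) (auto simp: separated_balls_def dil_def)
  have sep: "separated_balls (F j)" for j
    by (induction j) (use P0 PS in auto)
  have card: "card (F j) \<le> card G" for j
  proof (induction j)
    case (Suc j) then show ?case using PS[OF sep[of j]] dil_card[of "F j"] by linarith
  qed (use P0 in auto)
  have psi: "total_radius (F j) * 3 ^ card (F j) \<le> 2 ^ j * (total_radius G * 3 ^ card G)" for j
  proof (induction j)
    case (Suc j)
    have "total_radius (F (Suc j)) * 3 ^ card (F (Suc j)) \<le> 2 * (total_radius (F j) * 3 ^ card (F j))"
      using PS[OF sep[of j]] by (simp add: dil_card dil_sum)
    with Suc show ?case by simp
  qed (use P0 in auto)
  have nn: "total_radius (F j) \<ge> 0" for j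
    using sep[of j] by (auto simp: total_radius_def separated_balls_def intro!: sum_nonneg)
  have "total_radius (F j) \<le> 2 ^ j * (total_radius G * 3 ^ card G)" for j
    using psi[of j] mult_left_mono[OF one_le_power[of "3::real" "card (F j)"] nn[of j]] by simp
  moreover have "nested_balls F M"
    unfolding nested_balls_def
  proof (intro conjI allI impI sep)
    fix j c r assume "(c,r) \<in> F j"
    then have "(c, 2 * r) \<in> dil (F j)" by (force simp: dil_def)
    moreover have "covers (F (Suc j)) (dil (F j))" using PS[OF sep] by blast
    ultimately show "\<exists>c' r'. (c',r') \<in> F (Suc j) \<and> cball c (2 * r) \<subseteq> cball c' r'"
      unfolding covers_def by blast
  qed
  ultimately show ?thesis using P0 card by blast
qed

lemma nested_ballsD:
  assumes "nested_balls F M" "Suc j < M" "(c,r) \<in> F j"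
  shows "\<exists>c' r'. (c',r') \<in> F (Suc j) \<and> cball c (2 * r) \<subseteq> cball c' r'"
  using assms unfolding nested_balls_def by blast

lemma nested_balls_pos: "nested_balls F M \<Longrightarrow> j < M \<Longrightarrow> (c,r) \<in> F j \<Longrightarrow> r > 0"
  unfolding nested_balls_def separated_balls_def by blast

lemma nested_balls_le:
  assumes n: "nested_balls F M" and j: "j < j'" "j' < M" and B: "(c,r) \<in> F j"
  shows "\<exists>c' r'. (c',r') \<in> F j' \<and> cball c (2 * r) \<subseteq> cball c' r'"
  using j
proof (induction j')
  case (Suc j')
  show ?case
  proof (cases "j = j'")
    case True
    then show ?thesis using nested_ballsD[OF n _ B] Suc.prems by simp
  next
    case False
    then obtain c1 r1 where 1: "(c1,r1) \<in> F j'" "cball c (2 * r) \<subseteq> cball c1 r1"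
      using Suc.IH Suc.prems by (auto simp: less_Suc_eq)
    then obtain c2 r2 where 2: "(c2,r2) \<in> F (Suc j')" "cball c1 (2 * r1) \<subseteq> cball c2 r2"
      using nested_ballsD[OF n _ 1(1)] Suc.prems by blast
    have "r1 > 0" using nested_balls_pos[OF n _ 1(1)] Suc.prems by simp
    then have "cball c1 r1 \<subseteq> cball c1 (2 * r1)" by (intro subset_cball) auto
    then have "cball c (2 * r) \<subseteq> cball c2 r2" using 1(2) 2(2) by (meson subset_trans)
    then show ?thesis using 2(1) by blast
  qed
qed simp

definition annulus :: "(real^2) \<times> real \<Rightarrow> (real^2) set" where
  "annulus = (\<lambda>(c,r). cball c (2 * r) - cball c r)"

text \<open>Within one level this is the separation.  For \<open>j < j'\<close> the doubled ball of level \<open>j\<close> is contained in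
  one ball of level \<open>j'\<close>, hence outside the annuli of that level.\<close>

lemma nested_annuli_disjoint:
  assumes n: "nested_balls F M" and j: "j < M" "j' < M" and B: "B \<in> F j" "B' \<in> F j'"
    and z: "z \<in> annulus B" "z \<in> annulus B'"
  shows "j = j' \<and> B = B'"
proof -
  have *: "j = j' \<and> (c,r) = (c',r')" if "j \<le> j'" "j < M" "j' < M" "(c,r) \<in> F j" "(c',r') \<in> F j'"
    "z \<in> annulus (c,r)" "z \<in> annulus (c',r')" for j j' c r c' r'
  proof -
    note pr = that
    have sep: "separated_balls (F j')" using n that by (simp add: nested_balls_def)
    then have r': "r' > 0" using that using nested_balls_pos[OF n] by blast
    have same: "(c1,r1) = (c',r')" if "(c1,r1) \<in> F j'" "dist c1 z \<le> 2 * r1" for c1 r1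
      using separated_ballsD[OF sep that(1) \<open>(c',r') \<in> F j'\<close>] \<open>z \<in> annulus (c',r')\<close> that(2)
        dist_triangle[of c1 c' z] by (simp add: annulus_def dist_commute)
    show ?thesis
    proof (cases "j = j'")
      case True
      then show ?thesis using same[of c r] that by (simp add: annulus_def)
    next
      case False
      then obtain c1 r1 where 1: "(c1,r1) \<in> F j'" "cball c (2 * r) \<subseteq> cball c1 r1"
        using nested_balls_le[OF n _ pr(3,4)] pr(1) by auto
      have z1: "dist c1 z \<le> r1" using 1(2) pr(6) by (auto simp: annulus_def)
      have "r1 > 0" using nested_balls_pos[OF n pr(3) 1(1)] .
      then have "(c1,r1) = (c',r')" using same[OF 1(1)] z1 by simp
      then show ?thesis using z1 that(7) by (simp add: annulus_def)
    qed
  qed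
  obtain c r c' r' where "B = (c,r)" "B' = (c',r')" by fastforce
  then show ?thesis using *[of j j' c r c' r'] *[of j' j c' r' c r] assms by (cases "j \<le> j'") auto
qed

section \<open>Averaging over the levels of a nested family\<close>

text \<open>The mean over the levels of the localisations of \<open>u\<close>.  A single level has second derivatives of
  order \<open>1 / r\<close> in its annuli; averaging over \<open>M\<close> levels with disjoint annuli gains a factor \<open>1 / M\<close> there.\<close>

definition average :: "(real^2 \<Rightarrow> real) \<Rightarrow> (nat \<Rightarrow> ((real^2) \<times> real) set) \<Rightarrow> nat \<Rightarrow> real^2 \<Rightarrow> real" where
  "average u F M z = (\<Sum>j<M. (\<Sum>(c,r)\<in>F j. hole u c r z) * (1 / M))"

lemma partial_cmult: "smooth f \<Longrightarrow> partial i (\<lambda>z. f z * a) z = partial i f z * a"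
  by (simp add: partial_mult smooth_differentiable)

text \<open>The bound \<open>A2\<close> says that \<open>u\<close> varies on a scale not below the radii of the balls, as \<open>hole_bounds\<close>
  requires.\<close>

locale hole_average =
  fixes u :: "real^2 \<Rightarrow> real" and F :: "nat \<Rightarrow> ((real^2) \<times> real) set" and M :: nat and A :: real
  assumes u: "smooth u" and M: "M > 0" and nested: "nested_balls F M"
    and A1: "\<And>i z. \<bar>partial i u z\<bar> \<le> A"
    and A2: "\<And>i k z j c r. j < M \<Longrightarrow> (c,r) \<in> F j \<Longrightarrow> \<bar>partial i (partial k u) z\<bar> \<le> A / r"
begin

lemma fin: "j < M \<Longrightarrow> finite (F j)"
  using nested by (simp add: nested_balls_def separated_balls_def)

lemma rpos: "j < M \<Longrightarrow> (c,r) \<in> F j \<Longrightarrow> r > 0"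
  using nested_balls_pos[OF nested] .

lemma A_nonneg: "A \<ge> 0" using A1[of 1 0] by linarith

lemma smooth_level: "j < M \<Longrightarrow> smooth (\<lambda>z. \<Sum>(c,r)\<in>F j. hole u c r z)"
  and smooth_level_partial: "j < M \<Longrightarrow> smooth (\<lambda>z. \<Sum>(c,r)\<in>F j. partial k (hole u c r) z)"
  unfolding case_prod_unfold by (intro smooth_sum smooth_partial smooth_hole fin u; simp)+

lemma smooth_average: "smooth (average u F M)"
  unfolding average_def[abs_def]
  by (rule smooth_sum[OF finite_lessThan], rule smooth_mult[OF smooth_level smooth_const]) simp

lemma partial_average:
  "partial i (average u F M) z = (\<Sum>j<M. (\<Sum>(c,r)\<in>F j. partial i (hole u c r) z) * (1 / M))"
proof -
  note s = smooth_level
  have "partial i (average u F M) z = (\<Sum>j<M. partial i (\<lambda>z. (\<Sum>(c,r)\<in>F j. hole u c r z) * (1 / M)) z)"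
    unfolding average_def[abs_def] by (rule partial_sum[OF finite_lessThan], rule smooth_mult[OF s smooth_const]) simp
  also have "\<dots> = (\<Sum>j<M. (\<Sum>(c,r)\<in>F j. partial i (hole u c r) z) * (1 / M))"
  proof (rule sum.cong[OF refl])
    fix j assume j: "j \<in> {..<M}"
    have "partial i (\<lambda>z. \<Sum>B\<in>F j. hole u (fst B) (snd B) z) z = (\<Sum>B\<in>F j. partial i (hole u (fst B) (snd B)) z)"
      by (rule partial_sum) (use j in \<open>auto simp: fin u smooth_hole\<close>)
    then show "partial i (\<lambda>z. (\<Sum>(c,r)\<in>F j. hole u c r z) * (1 / M)) z = (\<Sum>(c,r)\<in>F j. partial i (hole u c r) z) * (1 / M)"
      using s[of j] j by (subst partial_cmult) (auto simp: case_prod_unfold)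
  qed
  finally show ?thesis .
qed

lemma partial2_average:
  "partial i (partial k (average u F M)) z = (\<Sum>j<M. (\<Sum>(c,r)\<in>F j. partial i (partial k (hole u c r)) z) * (1 / M))"
proof -
  note s = smooth_level_partial
  have "partial i (partial k (average u F M)) z = (\<Sum>j<M. partial i (\<lambda>z. (\<Sum>(c,r)\<in>F j. partial k (hole u c r) z) * (1 / M)) z)"
    unfolding partial_average[abs_def] by (rule partial_sum[OF finite_lessThan], rule smooth_mult[OF s smooth_const]) simp
  also have "\<dots> = (\<Sum>j<M. (\<Sum>(c,r)\<in>F j. partial i (partial k (hole u c r)) z) * (1 / M))"
  proof (rule sum.cong[OF refl])
    fix j assume j: "j \<in> {..<M}"
    have "partial i (\<lambda>z. \<Sum>B\<in>F j. partial k (hole u (fst B) (snd B)) z) z = (\<Sum>B\<in>F j. partial i (partial k (hole u (fst B) (snd B))) z)"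
      by (rule partial_sum) (use j in \<open>auto simp: fin u smooth_hole smooth_partial\<close>)
    then show "partial i (\<lambda>z. (\<Sum>(c,r)\<in>F j. partial k (hole u c r) z) * (1 / M)) z = (\<Sum>(c,r)\<in>F j. partial i (partial k (hole u c r)) z) * (1 / M)"
      using s[of j] j by (subst partial_cmult) (auto simp: case_prod_unfold)
  qed
  finally show ?thesis .
qed

text \<open>At a given point, at most one ball of each level matters.\<close>

lemma level_sum:
  assumes j: "j < M" and B: "(c,r) \<in> F j" and z: "z \<in> cball c (2 * r)"
    and f: "\<And>c r. r > 0 \<Longrightarrow> norm (z - c) > 2 * r \<Longrightarrow> f c r = (0::real)"
  shows "(\<Sum>(c,r)\<in>F j. f c r) = f c r"
proof -
  have sep: "separated_balls (F j)" using nested j by (simp add: nested_balls_def)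
  have 0: "f c' r' = 0" if "(c',r') \<in> F j" "(c',r') \<noteq> (c,r)" for c' r'
  proof (rule f)
    show "r' > 0" using rpos j that by blast
    show "norm (z - c') > 2 * r'"
    proof (rule ccontr)
      assume "\<not> norm (z - c') > 2 * r'"
      then have "dist c' c \<le> 2 * (r' + r)"
        using z dist_triangle[of c' c z] by (simp add: dist_norm norm_minus_commute)
      then show False using separated_ballsD[OF sep that(1) B] that(2) by auto
    qed
  qed
  have "(\<Sum>(c,r)\<in>F j. f c r) = (\<Sum>(c',r')\<in>{(c,r)}. f c' r')"
    by (rule sum.mono_neutral_right) (use B 0 fin[OF j] in auto)
  then show ?thesis by simp
qed

lemma level_sum_0:
  assumes j: "j < M" and z: "\<And>c r. (c,r) \<in> F j \<Longrightarrow> z \<notin> cball c (2 * r)"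
    and f: "\<And>c r. r > 0 \<Longrightarrow> norm (z - c) > 2 * r \<Longrightarrow> f c r = (0::real)"
  shows "(\<Sum>(c,r)\<in>F j. f c r) = 0"
proof (rule sum.neutral, clarify)
  fix c r assume "(c,r) \<in> F j"
  then show "f c r = 0" using z[of c r] rpos[OF j] by (intro f) (auto simp: dist_norm norm_minus_commute)
qed

text \<open>The number \<open>\<theta>\<close> is the fraction of levels with a ball around \<open>z\<close>.  On these levels the localisation has the
  derivatives of \<open>u\<close>; on the others it contributes only in an annulus, and \<open>z\<close> lies in at most one annulus.\<close>

lemma average_dichotomy:
  assumes D: "\<And>c r. r > 0 \<Longrightarrow> norm (z - c) > 2 * r \<Longrightarrow> D c r = (0::real)"
    and Du: "\<And>c r. r > 0 \<Longrightarrow> norm (z - c) \<le> r \<Longrightarrow> D c r = d"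
  shows "\<exists>\<theta>. 0 \<le> \<theta> \<and> \<theta> \<le> 1 \<and>
     ((\<Sum>j<M. (\<Sum>(c,r)\<in>F j. D c r) * (1 / M)) = \<theta> * d \<or>
      (\<exists>j<M. \<exists>(c,r)\<in>F j. z \<in> annulus (c,r) \<and> (\<Sum>j<M. (\<Sum>(c,r)\<in>F j. D c r) * (1 / M)) = \<theta> * d + D c r / M))"
proof -
  define I where "I = {j \<in> {..<M}. \<exists>(c,r)\<in>F j. z \<in> cball c r}"
  have finI: "finite I" "I \<subseteq> {..<M}" by (auto simp: I_def)
  define T where "T j = (\<Sum>(c,r)\<in>F j. D c r)" for j
  have TI: "T j = d" if jI: "j \<in> I" for j
  proof -
    obtain c r where c: "j < M" "(c,r) \<in> F j" "z \<in> cball c r" using jI by (auto simp: I_def)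
    have r: "r > 0" using rpos c by blast
    have "T j = D c r"
      unfolding T_def by (rule level_sum[OF c(1,2) _ D]) (use c(3) r in auto)
    also have "\<dots> = d" using c(3) by (intro Du r) (simp add: dist_norm norm_minus_commute)
    finally show ?thesis .
  qed
  have cI: "card I \<le> M" using card_mono[OF _ finI(2)] by simp
  let ?\<theta> = "card I / M"
  have \<theta>: "0 \<le> ?\<theta>" "?\<theta> \<le> 1" using cI M by auto
  have split: "(\<Sum>j<M. T j * (1 / M)) = ?\<theta> * d + (\<Sum>j\<in>{..<M} - I. T j) * (1 / M)"
  proof -
    have "(\<Sum>j<M. T j) = (\<Sum>j\<in>{..<M} - I. T j) + (\<Sum>j\<in>I. T j)"
      using finI by (intro sum.subset_diff) auto
    also have "(\<Sum>j\<in>I. T j) = card I * d" using TI by simp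
    finally show ?thesis by (simp add: sum_divide_distrib[symmetric] add_divide_distrib)
  qed
  show ?thesis
  proof (cases "\<exists>j<M. \<exists>B\<in>F j. z \<in> annulus B")
    case True
    then obtain j c r where j: "j < M" "(c,r) \<in> F j" "z \<in> annulus (c,r)" by auto
    have r: "r > 0" using rpos j by blast
    have jI: "j \<notin> I"
    proof
      assume "j \<in> I"
      then obtain c' r' where c': "(c',r') \<in> F j" "z \<in> cball c' r'" by (auto simp: I_def)
      have "r' > 0" using rpos j c' by blast
      then have "dist c' c \<le> 2 * (r' + r)"
        using c' j(3) dist_triangle[of c' c z] by (simp add: annulus_def dist_commute)
      then have "(c',r') = (c,r)" using nested j c' separated_ballsD by (metis nested_balls_def)
      then show False using c' j by (simp add: annulus_def)
    qed
    have other: "T j' = 0" if j': "j' < M" "j' \<notin> I" "j' \<noteq> j" for j'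
      unfolding T_def
    proof (rule level_sum_0[OF j'(1) _ D])
      fix c' r' assume "(c',r') \<in> F j'"
      moreover have "z \<notin> annulus (c',r')"
        using nested_annuli_disjoint[OF nested j'(1) j(1) \<open>(c',r') \<in> F j'\<close> j(2) _ j(3)] j'(3) by blast
      moreover have "z \<notin> cball c' r'" using j' \<open>(c',r') \<in> F j'\<close> by (auto simp: I_def)
      ultimately show "z \<notin> cball c' (2 * r')" by (simp add: annulus_def)
    qed auto
    have Tj: "T j = D c r" unfolding T_def by (rule level_sum[OF j(1,2) _ D]) (use j in \<open>auto simp: annulus_def\<close>)
    have "(\<Sum>j'\<in>{..<M} - I. T j') = (\<Sum>j'\<in>{j}. T j')"
      by (rule sum.mono_neutral_right) (use j jI other in auto)
    then have "(\<Sum>j<M. T j * (1 / M)) = ?\<theta> * d + D c r / M" using split Tj by simp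
    then show ?thesis using j \<theta> unfolding T_def by blast
  next
    case False
    have "T j = 0" if j: "j < M" "j \<notin> I" for j
      unfolding T_def
    proof (rule level_sum_0[OF j(1) _ D])
      fix c r assume B: "(c,r) \<in> F j"
      then have "z \<notin> annulus (c,r)" "z \<notin> cball c r" using False j by (auto simp: I_def)
      then show "z \<notin> cball c (2 * r)" by (simp add: annulus_def)
    qed auto
    then have "(\<Sum>j\<in>{..<M} - I. T j) = 0" by (intro sum.neutral) auto
    then have "(\<Sum>j<M. T j * (1 / M)) = ?\<theta> * d" using split by simp
    then show ?thesis using \<theta> unfolding T_def by blast
  qed
qed

lemma partial_average_cases:
  "\<exists>\<theta> e. 0 \<le> \<theta> \<and> \<theta> \<le> 1 \<and> \<bar>e\<bar> \<le> 5 * A * bump_const / M \<and>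
     partial i (average u F M) z = \<theta> * partial i u z + e"
proof -
  have 0: "5 * A * bump_const / M \<ge> 0" using A_nonneg bump_const(1) by simp
  obtain \<theta> where \<theta>: "0 \<le> \<theta>" "\<theta> \<le> 1"
     "partial i (average u F M) z = \<theta> * partial i u z \<or>
      (\<exists>j<M. \<exists>(c,r)\<in>F j. z \<in> annulus (c,r) \<and> partial i (average u F M) z = \<theta> * partial i u z + partial i (hole u c r) z / M)"
    using average_dichotomy[of z "\<lambda>c r. partial i (hole u c r) z" "partial i u z"]
      hole_outside(2) hole_inside(1)[OF u] unfolding partial_average by blast
  from \<theta>(3) show ?thesis
  proof
    assume "partial i (average u F M) z = \<theta> * partial i u z"
    then show ?thesis using \<theta> 0 by (intro exI[of _ \<theta>] exI[of _ 0]) auto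
  next
    assume "\<exists>j<M. \<exists>(c,r)\<in>F j. z \<in> annulus (c,r) \<and> partial i (average u F M) z = \<theta> * partial i u z + partial i (hole u c r) z / M"
    then obtain j c r where j: "j < M" "(c,r) \<in> F j"
      "partial i (average u F M) z = \<theta> * partial i u z + partial i (hole u c r) z / M" by auto
    have "\<bar>partial i (hole u c r) z / M\<bar> \<le> 5 * A * bump_const / M"
      using hole_bounds(1)[OF u rpos[OF j(1,2)] A1 A2[OF j(1,2)], where c=c and z=z and i=i] by (simp add: divide_right_mono)
    then show ?thesis using \<theta> j by (intro exI[of _ \<theta>] exI[of _ "partial i (hole u c r) z / M"]) auto
  qed
qed

text \<open>The squared second derivatives due to the cut-offs.  At each point at most one summand is nonzero, as
  the annuli are disjoint.\<close>

definition hess_bound :: "real^2 \<Rightarrow> real" where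
  "hess_bound z = (\<Sum>j<M. \<Sum>B\<in>F j. (9 * A * bump_const / snd B)\<^sup>2 * indicator (annulus B) z) / (real M)\<^sup>2"

lemma hess_bound_nonneg: "hess_bound z \<ge> 0"
  unfolding hess_bound_def by (intro divide_nonneg_nonneg sum_nonneg) auto

lemma partial2_average_cases:
  "\<exists>\<theta> e. 0 \<le> \<theta> \<and> \<theta> \<le> 1 \<and> e\<^sup>2 \<le> hess_bound z \<and>
     partial i (partial k (average u F M)) z = \<theta> * partial i (partial k u) z + e"
proof -
  obtain \<theta> where \<theta>: "0 \<le> \<theta>" "\<theta> \<le> 1"
     "partial i (partial k (average u F M)) z = \<theta> * partial i (partial k u) z \<or>
      (\<exists>j<M. \<exists>(c,r)\<in>F j. z \<in> annulus (c,r) \<and> partial i (partial k (average u F M)) z =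
          \<theta> * partial i (partial k u) z + partial i (partial k (hole u c r)) z / M)"
    using average_dichotomy[of z "\<lambda>c r. partial i (partial k (hole u c r)) z" "partial i (partial k u) z"]
      hole_outside(3) hole_inside(2)[OF u] unfolding partial2_average by blast
  from \<theta>(3) show ?thesis
  proof
    assume "partial i (partial k (average u F M)) z = \<theta> * partial i (partial k u) z"
    then show ?thesis using \<theta> hess_bound_nonneg by (intro exI[of _ \<theta>] exI[of _ 0]) auto
  next
    assume "\<exists>j<M. \<exists>(c,r)\<in>F j. z \<in> annulus (c,r) \<and> partial i (partial k (average u F M)) z =
          \<theta> * partial i (partial k u) z + partial i (partial k (hole u c r)) z / M"
    then obtain j c r where j: "j < M" "(c,r) \<in> F j" "z \<in> annulus (c,r)"
      "partial i (partial k (average u F M)) z = \<theta> * partial i (partial k u) z + partial i (partial k (hole u c r)) z / M" by auto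
    have "(partial i (partial k (hole u c r)) z / M)\<^sup>2 \<le> (9 * A * bump_const / r / M)\<^sup>2"
    proof -
      have "\<bar>partial i (partial k (hole u c r)) z\<bar> \<le> 9 * A * bump_const / r"
        by (rule hole_bounds(2)[OF u rpos[OF j(1,2)] A1 A2[OF j(1,2)]])
      then have "\<bar>partial i (partial k (hole u c r)) z / M\<bar> \<le> 9 * A * bump_const / r / M"
        unfolding abs_divide by (simp only: abs_of_nat) (rule divide_right_mono, auto)
      from power_mono[OF this, of 2] show ?thesis by (simp only: power2_abs abs_ge_zero)
    qed
    also have "\<dots> = (9 * A * bump_const / snd (c,r))\<^sup>2 * indicator (annulus (c,r)) z / (real M)\<^sup>2"
      using j by (simp add: power_divide power_mult_distrib)
    also have "\<dots> \<le> (\<Sum>B\<in>F j. (9 * A * bump_const / snd B)\<^sup>2 * indicator (annulus B) z) / (real M)\<^sup>2"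
      using j fin by (intro divide_right_mono member_le_sum) auto
    also have "\<dots> \<le> hess_bound z"
      unfolding hess_bound_def using j by (intro divide_right_mono
        member_le_sum[of j "{..<M}" "\<lambda>j. \<Sum>B\<in>F j. (9 * A * bump_const / snd B)\<^sup>2 * indicator (annulus B) z"])
        (auto intro!: sum_nonneg)
    finally show ?thesis using \<theta> j by (intro exI[of _ \<theta>] exI[of _ "partial i (partial k (hole u c r)) z / M"]) auto
  qed
qed

text \<open>There each of the \<open>M\<close> localisations has the derivatives of \<open>u\<close>.\<close>

lemma partial_average_covered:
  assumes "\<And>j. j < M \<Longrightarrow> \<exists>(c,r)\<in>F j. z \<in> cball c r"
  shows "partial i (average u F M) z = partial i u z"
proof -
  have "(\<Sum>(c,r)\<in>F j. partial i (hole u c r) z) = partial i u z" if j: "j < M" for j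
  proof -
    obtain c r where c: "(c,r) \<in> F j" "z \<in> cball c r" using assms[OF j] by auto
    have r: "r > 0" using rpos j c by blast
    have "(\<Sum>(c,r)\<in>F j. partial i (hole u c r) z) = partial i (hole u c r) z"
    proof (rule level_sum[OF j c(1)])
      have "dist c z \<le> r" using c by simp
      then show "z \<in> cball c (2 * r)" using r by simp
    qed (rule hole_outside(2))
    also have "\<dots> = partial i u z"
      using c by (intro hole_inside(1) u r) (simp add: dist_norm norm_minus_commute)
    finally show ?thesis .
  qed
  then show ?thesis using M by (simp add: partial_average)
qed

text \<open>Every ball of the family, doubled, lies in a doubled ball of the last level.\<close>

lemma average_outside:
  assumes "\<And>c r. (c,r) \<in> F (M - 1) \<Longrightarrow> z \<notin> cball c (2 * r)"
  shows "average u F M z = 0" "partial i (average u F M) z = 0"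
proof -
  have out: "z \<notin> cball c (2 * r)" if j: "j < M" "(c,r) \<in> F j" for j c r
  proof (cases "j = M - 1")
    case True then show ?thesis using assms j by blast
  next
    case False
    then obtain c' r' where c': "(c',r') \<in> F (M - 1)" "cball c (2 * r) \<subseteq> cball c' r'"
      using nested_balls_le[OF nested _ _ j(2), of "M - 1"] j by (metis M Suc_diff_1 diff_less less_antisym zero_less_one)
    have "r' > 0" using rpos[OF _ c'(1)] M by simp
    then have "cball c' r' \<subseteq> cball c' (2 * r')" by (intro subset_cball) auto
    then show ?thesis using c' assms by blast
  qed
  have "(\<Sum>(c,r)\<in>F j. hole u c r z) = 0" if "j < M" for j
    by (rule level_sum_0[OF that]) (use out that hole_outside(1) in auto)
  then show "average u F M z = 0" by (simp add: average_def)
  have "(\<Sum>(c,r)\<in>F j. partial i (hole u c r) z) = 0" if "j < M" for j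
    by (rule level_sum_0[OF that]) (use out that hole_outside(2) in auto)
  then show "partial i (average u F M) z = 0" by (simp add: partial_average)
qed

lemma partial_average_bound: "\<bar>partial i (average u F M) z\<bar> \<le> 6 * A * bump_const"
proof -
  obtain \<theta> e where \<theta>: "0 \<le> \<theta>" "\<theta> \<le> 1" "\<bar>e\<bar> \<le> 5 * A * bump_const / M"
     "partial i (average u F M) z = \<theta> * partial i u z + e" using partial_average_cases by blast
  have "\<bar>\<theta> * partial i u z\<bar> \<le> 1 * A" using \<theta> A1 by (simp only: abs_mult) (intro mult_mono, auto)
  moreover have "5 * A * bump_const / M \<le> 5 * A * bump_const"
    using M A_nonneg bump_const(1) mult_left_mono[of 1 "real M" "5 * A * bump_const"]
    by (simp add: pos_divide_le_eq)
  moreover have "A \<le> A * bump_const" using A_nonneg bump_const(1) by (simp add: mult_le_cancel_left1)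
  ultimately show ?thesis using \<theta>(3,4) by linarith
qed

end

section \<open>Testing the compatibility condition with second derivatives\<close>

lemma not_supp: "z \<notin> supp f \<Longrightarrow> f z = 0"
  using closure_subset[of "{x. f x \<noteq> 0}"] by (auto simp: supp_def)

lemma supp_partial: "supp (partial i f) \<subseteq> supp f"
  unfolding supp_def[of "partial i f"]
proof (rule closure_minimal)
  show "closed (supp f)" by (simp add: supp_def)
  show "{x. partial i f x \<noteq> 0} \<subseteq> supp f"
  proof (rule ccontr)
    assume "\<not> ?thesis"
    then obtain x where x: "partial i f x \<noteq> 0" "x \<in> - supp f" by auto
    have "partial i f x = partial i (\<lambda>z. 0) x"
    proof (rule partial_cong_open[OF _ x(2)])
      show "open (- supp f)" by (simp add: supp_def open_Compl)
    qed (simp add: not_supp)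
    then show False using x by simp
  qed
qed

lemma supp_subset_closed: "closed S \<Longrightarrow> (\<And>z. z \<notin> S \<Longrightarrow> f z = 0) \<Longrightarrow> supp f \<subseteq> S"
  unfolding supp_def by (rule closure_minimal) auto

lemma compact_supp_partial: "compact (supp f) \<Longrightarrow> compact (supp (partial i f))"
  using supp_partial[of i f] closed_Int_compact[of "supp (partial i f)" "supp f"]
  by (simp add: supp_def Int_absorb2)

lemma compact_supp_subset: "compact S \<Longrightarrow> supp f \<subseteq> S \<Longrightarrow> compact (supp f)"
  using closed_Int_compact[of "supp f" S] by (simp add: supp_def Int_absorb2)

lemma continuous_compact_integrable:
  fixes f :: "real^2 \<Rightarrow> real"
  assumes "continuous_on UNIV f" "compact (supp f)"
  shows "integrable lborel f" "integrable lebesgue f"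
proof -
  have "integrable lborel (\<lambda>x. indicator (supp f) x *\<^sub>R f x)"
    using assms by (intro borel_integrable_compact) (auto intro: continuous_on_subset)
  moreover have "(\<lambda>x. indicator (supp f) x *\<^sub>R f x) = f"
    by (auto simp: fun_eq_iff indicator_def not_supp)
  ultimately show "integrable lborel f" by simp
  then show "integrable lebesgue f" by (simp add: integrable_completion)
qed

lemma open_subgraph:
  assumes "continuous_on {0..1} h"
  shows "open (subgraph h)"
proof -
  let ?U = "{z::real^2. 0 < z$1 \<and> z$1 < 1 \<and> 0 < z$2}"
  have U: "open ?U" by (intro open_Collect_conj open_Collect_less continuous_intros)
  have "continuous_on ?U (\<lambda>z. h (z$1))"
    by (rule continuous_on_compose2[OF assms]) (auto intro!: continuous_intros)
  then have "continuous_on ?U (\<lambda>z. h (z$1) - z$2)" by (intro continuous_intros)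
  then have "open (?U \<inter> (\<lambda>z. h (z$1) - z$2) -` {0<..})"
    using U by (rule continuous_open_preimage) simp
  moreover have "?U \<inter> (\<lambda>z. h (z$1) - z$2) -` {0<..} = subgraph h" by (auto simp: subgraph_def)
  ultimately show ?thesis by simp
qed

lemma vector2_eq: "vector [x, y] = x *\<^sub>R axis 1 1 + y *\<^sub>R (axis 2 1 :: real^2)"
  by (simp add: vec_eq_iff forall_2 axis_def)

lemma continuous_on_slice: "continuous_on UNIV f \<Longrightarrow> continuous_on S (\<lambda>x. f (vector [x, 0] :: real^2))"
  unfolding vector2_eq by (rule continuous_on_compose2[of UNIV f]) (auto intro!: continuous_intros)

text \<open>Optimising \<open>t\<close> recovers the Cauchy-Schwarz form from Young's inequality with all parameters.\<close>

lemma quadratic_from_all_scales: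
  fixes D E R :: real
  assumes "\<And>t. t > 0 \<Longrightarrow> D \<le> t / 2 * E + 2 * R / t" and "R > 0" "D \<ge> 0"
  shows "D\<^sup>2 \<le> 4 * R * E"
proof (cases "D = 0")
  case True
  have "E \<ge> 0"
  proof (rule ccontr)
    assume "\<not> E \<ge> 0"
    then have E: "- E > 0" by simp
    define t where "t = sqrt (8 * R / - E)"
    have p: "8 * R / - E > 0" using E assms(2) by (intro divide_pos_pos) auto
    then have t: "t > 0" by (simp add: t_def)
    have "t * t = 8 * R / - E" unfolding t_def real_sqrt_mult_self by (rule abs_of_pos[OF p])
    then have tt: "t * t * E = - 8 * R" using E by (simp add: field_simps)
    have "0 \<le> (t / 2 * E + 2 * R / t) * t" using assms(1)[OF t] t True by simp
    also have "(t / 2 * E + 2 * R / t) * t = t * t * E / 2 + 2 * R" using t by (simp add: field_simps)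
    finally show False using tt assms(2) by simp
  qed
  then show ?thesis using assms True by simp
next
  case False
  then have "D > 0" using assms by simp
  then have "D \<le> (4 * R / D) / 2 * E + 2 * R / (4 * R / D)" using assms by (intro assms(1)) auto
  then have "D * D \<le> (2 * R / D * E + D / 2) * D" using \<open>D > 0\<close> assms by (intro mult_right_mono) (auto simp: field_simps)
  also have "\<dots> = 2 * R * E + D * D / 2" using \<open>D > 0\<close> by (simp add: field_simps)
  finally show ?thesis by (simp add: power2_eq_square)
qed

lemma sym_part_norm:
  "(norm (sym_part A))\<^sup>2 = (A$1$1)\<^sup>2 + (A$2$2)\<^sup>2 + (A$1$2 + A$2$1)\<^sup>2 / 2"
proof -
  have "(norm (sym_part A))\<^sup>2 = (\<Sum>i\<in>UNIV. (norm (sym_part A $ i))\<^sup>2)"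
    by (simp add: norm_vec_def[where 'a="real^2"] L2_set_def sum_nonneg)
  also have "\<dots> = (A$1$1)\<^sup>2 + (A$2$2)\<^sup>2 + (A$1$2 + A$2$1)\<^sup>2 / 2"
    unfolding sum_2 norm2 by (simp add: sym_part_def transpose_def power2_eq_square field_simps)
  finally show ?thesis .
qed

lemma sym_part_le_norm: "(norm (sym_part A))\<^sup>2 \<le> (norm A)\<^sup>2"
proof -
  have "(norm A)\<^sup>2 = (\<Sum>i\<in>UNIV. (norm (A $ i))\<^sup>2)"
    by (simp add: norm_vec_def[where 'a="real^2"] L2_set_def sum_nonneg)
  also have "\<dots> = (A$1$1)\<^sup>2 + (A$1$2)\<^sup>2 + (A$2$1)\<^sup>2 + (A$2$2)\<^sup>2"
    unfolding sum_2 norm2 by (simp add: power2_eq_square)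
  finally show ?thesis unfolding sym_part_norm
    using sum_squares_ge_zero[of "A$1$2 - A$2$1" 0] by (simp add: power2_eq_square algebra_simps)
qed

text \<open>The off-diagonal entries enter only through their sum, so the symmetric part controls the product.\<close>

lemma young_sym:
  fixes t :: real
  assumes t: "t > 0" and B: "a\<^sup>2 \<le> B" "c\<^sup>2 \<le> B" "d\<^sup>2 \<le> B"
  shows "\<bar>A$1$1 * a - (A$1$2 + A$2$1) * c + A$2$2 * d\<bar> \<le> t / 2 * (norm (sym_part A))\<^sup>2 + 2 * B / t"
proof -
  have y: "\<bar>x * y\<bar> \<le> t / 2 * x\<^sup>2 + y\<^sup>2 / (2 * t)" for x y :: real
  proof -
    have "0 \<le> (t * \<bar>x\<bar> - \<bar>y\<bar>)\<^sup>2" by simp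
    also have "\<dots> = t * t * x\<^sup>2 + y\<^sup>2 - 2 * t * \<bar>x * y\<bar>"
      by (simp add: power2_diff power_mult_distrib abs_mult) (simp add: power2_eq_square)
    finally have "2 * t * \<bar>x * y\<bar> \<le> t * t * x\<^sup>2 + y\<^sup>2" by simp
    then have "2 * t * \<bar>x * y\<bar> / (2 * t) \<le> (t * t * x\<^sup>2 + y\<^sup>2) / (2 * t)" using t by (intro divide_right_mono) auto
    then show ?thesis using t by (simp add: add_divide_distrib)
  qed
  have "\<bar>(A$1$2 + A$2$1) * c\<bar> = 2 * \<bar>((A$1$2 + A$2$1) / 2) * c\<bar>" by (simp add: abs_mult)
  also have "\<dots> \<le> 2 * (t / 2 * ((A$1$2 + A$2$1) / 2)\<^sup>2 + c\<^sup>2 / (2 * t))" by (intro mult_left_mono y) auto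
  also have "\<dots> = t / 2 * ((A$1$2 + A$2$1)\<^sup>2 / 2) + 2 * (c\<^sup>2 / (2 * t))" by (simp add: power_divide)
  finally have 1: "\<bar>(A$1$2 + A$2$1) * c\<bar> \<le> t / 2 * ((A$1$2 + A$2$1)\<^sup>2 / 2) + 2 * (c\<^sup>2 / (2 * t))" .
  have m: "x / (2 * t) \<le> B / (2 * t)" if "x \<le> B" for x using t that by (intro divide_right_mono) auto
  have "\<bar>A$1$1 * a - (A$1$2 + A$2$1) * c + A$2$2 * d\<bar> \<le> \<bar>A$1$1 * a\<bar> + \<bar>(A$1$2 + A$2$1) * c\<bar> + \<bar>A$2$2 * d\<bar>"
    by linarith
  also have "\<dots> \<le> t / 2 * (norm (sym_part A))\<^sup>2 + 4 * (B / (2 * t))"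
    using 1 y[of "A$1$1" a] y[of "A$2$2" d] m[OF B(1)] m[OF B(2)] m[OF B(3)]
    unfolding sym_part_norm by (simp only: distrib_left)
  also have "4 * (B / (2 * t)) = 2 * B / t" by simp
  finally show ?thesis .
qed

text \<open>A film and a field in it with curl \<open>G\<close>.  The second row of the curl vanishes because all Burgers vectors are
  multiples of \<open>(1,0)\<close>.\<close>

locale strain_field =
  fixes h :: "real \<Rightarrow> real" and H :: "real^2 \<Rightarrow> real^2^2" and G :: "real^2 \<Rightarrow> real^2" and e0 :: real
  assumes op: "open (subgraph h)"
    and meas: "H \<in> borel_measurable (lebesgue_on (subgraph h))"
    and sq: "integrable (lebesgue_on (subgraph h)) (\<lambda>z. (norm (H z))\<^sup>2)"
    and trace: "has_bottom_tangential_trace h H G (vector [e0, 0])"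
    and G2: "\<And>z. G z $ 2 = 0"
begin

abbreviation "\<Omega> \<equiv> subgraph h"

lemma \<Omega>_sets: "\<Omega> \<in> sets lebesgue"
  using op by (simp add: lmeasurable_open sets_completionI_sets borel_open)

lemma comp_meas: "(\<lambda>z. H z $ i $ j) \<in> borel_measurable (lebesgue_on \<Omega>)"
proof -
  have "(\<lambda>A::real^2^2. A $ i $ j) \<in> borel_measurable borel"
    by (intro borel_measurable_continuous_onI continuous_intros)
  from measurable_compose[OF meas this] show ?thesis .
qed

lemma comp_le: "\<bar>A $ i $ j\<bar> \<le> norm (A :: real^2^2)"
  using component_le_norm_cart[of "A $ i" j] Finite_Cartesian_Product.norm_nth_le[of A i] by linarith

lemma comp_integrable:
  assumes f: "continuous_on UNIV f" "compact (supp f)"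
  shows "set_integrable lebesgue \<Omega> (\<lambda>z. H z $ i $ j * f z)"
proof -
  have S: "\<Omega> \<inter> space lebesgue \<in> sets lebesgue" using \<Omega>_sets by simp
  have "supp (\<lambda>z. (f z)\<^sup>2) = supp f" by (simp add: supp_def)
  then have "integrable lebesgue (\<lambda>z. (f z)\<^sup>2)"
    using f by (intro continuous_compact_integrable continuous_intros) auto
  then have f2: "integrable (lebesgue_on \<Omega>) (\<lambda>z. (f z)\<^sup>2)"
    unfolding integrable_restrict_space[OF S] by (intro integrable_mult_indicator \<Omega>_sets)
  have fm: "f \<in> borel_measurable (lebesgue_on \<Omega>)"
    using f(1) by (intro measurable_restrict_space1 measurable_completion) (simp add: borel_measurable_continuous_onI)
  have "integrable (lebesgue_on \<Omega>) (\<lambda>z. H z $ i $ j * f z)"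
  proof (rule Bochner_Integration.integrable_bound[OF Bochner_Integration.integrable_add[OF sq f2]])
    show "(\<lambda>z. H z $ i $ j * f z) \<in> borel_measurable (lebesgue_on \<Omega>)"
      by (intro borel_measurable_times comp_meas fm)
    show "AE z in lebesgue_on \<Omega>. norm (H z $ i $ j * f z) \<le> norm ((norm (H z))\<^sup>2 + (f z)\<^sup>2)"
    proof (rule AE_I2)
      fix z
      have "\<bar>H z $ i $ j * f z\<bar> \<le> norm (H z) * \<bar>f z\<bar>"
        unfolding abs_mult by (intro mult_right_mono comp_le) auto
      also have "\<dots> \<le> (norm (H z))\<^sup>2 + (f z)\<^sup>2"
      proof -
        have "0 \<le> norm (H z) * \<bar>f z\<bar>" by simp
        moreover have "2 * norm (H z) * \<bar>f z\<bar> \<le> (norm (H z))\<^sup>2 + (f z)\<^sup>2"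
          using sum_squares_bound[of "norm (H z)" "\<bar>f z\<bar>"] by simp
        ultimately show ?thesis by linarith
      qed
      finally show "norm (H z $ i $ j * f z) \<le> norm ((norm (H z))\<^sup>2 + (f z)\<^sup>2)" by simp
    qed
  qed
  then show ?thesis by (simp add: set_integrable_def integrable_restrict_space[OF S])
qed

definition bottom :: "(real^2) set" where
  "bottom = {z. 0 < z$1 \<and> z$1 < 1 \<and> z$2 = 0 \<and> h (z$1) > 0}"

text \<open>The difference of the trace condition of row \<open>1\<close> with test function \<open>partial 2 \<Phi>\<close> and of row \<open>2\<close> with
  \<open>partial 1 \<Phi>\<close>.  Only \<open>H z $ 1 $ 2 + H z $ 2 $ 1\<close> survives of the off-diagonal entries because the mixed
  second derivatives of \<open>\<Phi>\<close> agree.\<close>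

lemma tested_identity:
  assumes \<Phi>: "smooth \<Phi>" "compact (supp \<Phi>)" "supp \<Phi> \<inter> {z. z$2 \<ge> 0} \<subseteq> \<Omega> \<union> bottom"
  shows "(LINT z:\<Omega>|lebesgue. G z $ 1 * partial 2 \<Phi> z) =
    (LINT z:\<Omega>|lebesgue. H z $ 1 $ 1 * partial 2 (partial 2 \<Phi>) z
       - (H z $ 1 $ 2 + H z $ 2 $ 1) * partial 1 (partial 2 \<Phi>) z + H z $ 2 $ 2 * partial 1 (partial 1 \<Phi>) z)
     + e0 * (LINT x:{0..1}|lebesgue. partial 2 \<Phi> (vector [x, 0]))"
proof -
  have tf: "partial j \<Phi> \<in> test_functions UNIV" for j
    using \<Phi> by (auto simp: test_functions_def smooth_partial compact_supp_partial)
  have sp: "supp (partial j \<Phi>) \<inter> {z. z$2 \<ge> 0} \<subseteq> \<Omega> \<union> {z. 0 < z$1 \<and> z$1 < 1 \<and> z$2 = 0 \<and> h (z$1) > 0}" for j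
    using \<Phi>(3) supp_partial[of j \<Phi>] unfolding bottom_def by blast
  have int: "set_integrable lebesgue \<Omega> (\<lambda>z. H z $ i $ j * partial k (partial l \<Phi>) z)" for i j k l
    using \<Phi> by (intro comp_integrable smooth_continuous smooth_partial compact_supp_partial)
  have "(LINT z:\<Omega>|lebesgue. G z $ 1 * partial 2 \<Phi> z) =
      (LINT z:\<Omega>|lebesgue. H z $ 1 $ 1 * partial 2 (partial 2 \<Phi>) z - H z $ 1 $ 2 * partial 1 (partial 2 \<Phi>) z)
      + vector [e0, 0] $ (1::2) * (LINT x:{0..1}|lebesgue. partial 2 \<Phi> (vector [x, 0]))"
    using trace tf[of 2] sp[of 2] unfolding has_bottom_tangential_trace_def by blast
  then have 1: "(LINT z:\<Omega>|lebesgue. G z $ 1 * partial 2 \<Phi> z) =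
      (LINT z:\<Omega>|lebesgue. H z $ 1 $ 1 * partial 2 (partial 2 \<Phi>) z - H z $ 1 $ 2 * partial 1 (partial 2 \<Phi>) z)
      + e0 * (LINT x:{0..1}|lebesgue. partial 2 \<Phi> (vector [x, 0]))"
    by (simp only: vector_2)
  have "(LINT z:\<Omega>|lebesgue. G z $ 2 * partial 1 \<Phi> z) =
      (LINT z:\<Omega>|lebesgue. H z $ 2 $ 1 * partial 2 (partial 1 \<Phi>) z - H z $ 2 $ 2 * partial 1 (partial 1 \<Phi>) z)
      + vector [e0, 0] $ (2::2) * (LINT x:{0..1}|lebesgue. partial 1 \<Phi> (vector [x, 0]))"
    using trace tf[of 1] sp[of 1] unfolding has_bottom_tangential_trace_def by blast
  then have 2: "(LINT z:\<Omega>|lebesgue. H z $ 2 $ 1 * partial 1 (partial 2 \<Phi>) z - H z $ 2 $ 2 * partial 1 (partial 1 \<Phi>) z) = 0"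
    using G2 by (simp add: partial_commute[OF \<Phi>(1), of 2 1])
  have "(LINT z:\<Omega>|lebesgue. (H z $ 1 $ 1 * partial 2 (partial 2 \<Phi>) z - H z $ 1 $ 2 * partial 1 (partial 2 \<Phi>) z)
       - (H z $ 2 $ 1 * partial 1 (partial 2 \<Phi>) z - H z $ 2 $ 2 * partial 1 (partial 1 \<Phi>) z)) =
      (LINT z:\<Omega>|lebesgue. H z $ 1 $ 1 * partial 2 (partial 2 \<Phi>) z - H z $ 1 $ 2 * partial 1 (partial 2 \<Phi>) z) - 0"
    unfolding 2[symmetric] by (rule set_integral_diff(2)) (intro set_integral_diff(1) int)+
  then show ?thesis unfolding 1 by (simp add: algebra_simps)
qed

text \<open>\<open>tested_identity\<close> and \<open>young_sym\<close> for all parameters.  The set \<open>Q\<close> localises the strain, so that the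
  estimates on disjoint squares can be added.\<close>

lemma dual_estimate:
  assumes \<Phi>: "smooth \<Phi>" "compact (supp \<Phi>)" "supp \<Phi> \<inter> {z. z$2 \<ge> 0} \<subseteq> \<Omega> \<union> bottom"
    and Q: "Q \<in> sets lebesgue" "\<And>z. z \<in> \<Omega> \<Longrightarrow> z \<notin> Q \<Longrightarrow> z \<notin> supp \<Phi>"
    and B: "integrable lebesgue B" "\<And>i k z. (partial i (partial k \<Phi>) z)\<^sup>2 \<le> B z"
    and R: "(LINT z|lebesgue. B z) \<le> R" "R > 0"
  shows "(e0 * (LINT x:{0..1}|lebesgue. partial 2 \<Phi> (vector [x, 0])) - (LINT z:\<Omega>|lebesgue. G z $ 1 * partial 2 \<Phi> z))\<^sup>2
     \<le> 4 * R * (LINT z:\<Omega> \<inter> Q|lebesgue. (norm (sym_part (H z)))\<^sup>2)"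
proof -
  let ?D = "e0 * (LINT x:{0..1}|lebesgue. partial 2 \<Phi> (vector [x, 0])) - (LINT z:\<Omega>|lebesgue. G z $ 1 * partial 2 \<Phi> z)"
  let ?q = "\<lambda>z. (norm (sym_part (H z)))\<^sup>2"
  let ?E = "LINT z:\<Omega> \<inter> Q|lebesgue. ?q z"
  let ?f = "\<lambda>z. H z $ 1 $ 1 * partial 2 (partial 2 \<Phi>) z
       - (H z $ 1 $ 2 + H z $ 2 $ 1) * partial 1 (partial 2 \<Phi>) z + H z $ 2 $ 2 * partial 1 (partial 1 \<Phi>) z"
  have S: "\<Omega> \<inter> space lebesgue \<in> sets lebesgue" using \<Omega>_sets by simp
  have D: "?D = - (LINT z:\<Omega>|lebesgue. ?f z)" using tested_identity[OF \<Phi>] by simp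
  have B0: "B z \<ge> 0" for z using B(2)[of 1 1 z] by (meson zero_le_power2 order_trans)
  have qm: "?q \<in> borel_measurable (lebesgue_on \<Omega>)"
    unfolding sym_part_norm by (intro borel_measurable_add borel_measurable_power borel_measurable_divide
      borel_measurable_const comp_meas)
  have "integrable (lebesgue_on \<Omega>) ?q"
    by (rule Bochner_Integration.integrable_bound[OF sq qm]) (auto simp: sym_part_le_norm)
  then have "set_integrable lebesgue \<Omega> ?q" by (simp add: set_integrable_def integrable_restrict_space[OF S])
  then have q: "set_integrable lebesgue (\<Omega> \<inter> Q) ?q"
    by (rule set_integrable_subset) (use \<Omega>_sets Q in auto)
  have int: "set_integrable lebesgue \<Omega> (\<lambda>z. H z $ i $ j * partial k (partial l \<Phi>) z)" for i j k l
    using \<Phi> by (intro comp_integrable smooth_continuous smooth_partial compact_supp_partial)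
  have fint: "set_integrable lebesgue \<Omega> ?f"
    unfolding distrib_right by (intro set_integral_add(1) set_integral_diff(1) int)
  have main: "\<bar>?D\<bar> \<le> t / 2 * ?E + 2 * R / t" if t: "t > 0" for t
  proof -
    have "\<bar>LINT z:\<Omega>|lebesgue. ?f z\<bar> \<le> (LINT z|lebesgue. \<bar>indicator \<Omega> z *\<^sub>R ?f z\<bar>)"
      unfolding set_lebesgue_integral_def by (rule integral_abs_bound)
    also have "\<dots> \<le> (LINT z|lebesgue. t / 2 * (indicator (\<Omega> \<inter> Q) z *\<^sub>R ?q z) + 2 / t * B z)"
    proof (rule integral_mono)
      show "integrable lebesgue (\<lambda>z. \<bar>indicator \<Omega> z *\<^sub>R ?f z\<bar>)"
        using fint unfolding set_integrable_def by (rule integrable_abs)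
      show "integrable lebesgue (\<lambda>z. t / 2 * (indicator (\<Omega> \<inter> Q) z *\<^sub>R ?q z) + 2 / t * B z)"
        using q B unfolding set_integrable_def by (intro Bochner_Integration.integrable_add integrable_mult_right) auto
      fix z
      show "\<bar>indicator \<Omega> z *\<^sub>R ?f z\<bar> \<le> t / 2 * (indicator (\<Omega> \<inter> Q) z *\<^sub>R ?q z) + 2 / t * B z"
      proof (cases "z \<in> \<Omega> \<inter> Q")
        case True
        then show ?thesis using young_sym[OF t B(2) B(2) B(2), of "H z"] by simp
      next
        case False
        have "\<bar>indicator \<Omega> z *\<^sub>R ?f z\<bar> = 0"
        proof (cases "z \<in> \<Omega>")
          case True
          then have "z \<notin> supp \<Phi>" using Q False by auto
          then have "z \<notin> supp (partial k (partial l \<Phi>))" for k l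
            using supp_partial by blast
          then show ?thesis by (simp add: not_supp)
        qed simp
        moreover have "0 \<le> t / 2 * (indicator (\<Omega> \<inter> Q) z *\<^sub>R ?q z) + 2 / t * B z"
          using t B0[of z] by simp
        ultimately show ?thesis by linarith
      qed
    qed
    also have "\<dots> = t / 2 * ?E + 2 / t * (LINT z|lebesgue. B z)"
      using q B unfolding set_integrable_def set_lebesgue_integral_def by (subst Bochner_Integration.integral_add) auto
    also have "\<dots> \<le> t / 2 * ?E + 2 * R / t"
      using t R(1) mult_left_mono[OF R(1), of "2 / t"] by simp
    finally show ?thesis by (simp add: D)
  qed
  have "\<bar>?D\<bar>\<^sup>2 \<le> 4 * R * ?E" by (rule quadratic_from_all_scales[OF main R(2)]) auto
  then show ?thesis by simp
qed

end

section \<open>Areas, line integrals and kernels\<close>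

lemma area_cball:
  fixes c :: "real^2"
  assumes "r \<ge> 0"
  shows "measure lebesgue (cball c r) \<le> 4 * r\<^sup>2" "integrable lebesgue (indicator (cball c r) :: _ \<Rightarrow> real)"
proof -
  have "measure lborel (cball c r) = pi * r\<^sup>2"
    using content_cball[OF assms, of c] by (simp add: eval_unit_ball_vol)
  then show "measure lebesgue (cball c r) \<le> 4 * r\<^sup>2"
    using pi_less_4 by (simp add: measure_completion mult_right_mono)
  show "integrable lebesgue (indicator (cball c r) :: _ \<Rightarrow> real)"
    using lmeasurable_cball[of c r] by (simp add: fmeasurable_def)
qed

lemma integral_indicator_cball:
  fixes c :: "real^2"
  assumes "r \<ge> 0"
  shows "(LINT z|lebesgue. indicator (cball c r) z) \<le> 4 * r\<^sup>2"
  using area_cball[OF assms, of c] by simp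

context hole_average
begin

text \<open>An annulus of radius \<open>r\<close> has area of order \<open>r\<^sup>2\<close>, and the squared second derivatives there are of order
  \<open>1 / r\<^sup>2\<close>: each ball contributes the same, whatever its scale.\<close>

lemma hess_bound_integral:
  "integrable lebesgue hess_bound"
  "(LINT z|lebesgue. hess_bound z) \<le> 1296 * (A * bump_const)\<^sup>2 * (\<Sum>j<M. real (card (F j))) / (real M)\<^sup>2"
proof -
  have int: "integrable lebesgue (indicator (annulus (c,r)) :: _ \<Rightarrow> real)"
    and le: "(LINT z|lebesgue. indicator (annulus (c,r)) z) \<le> 16 * r\<^sup>2" if r: "r > 0" for c r
  proof -
    have m: "annulus (c,r) \<in> sets lebesgue" by (simp add: annulus_def)
    show 1: "integrable lebesgue (indicator (annulus (c,r)) :: _ \<Rightarrow> real)"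
    proof (rule Bochner_Integration.integrable_bound[OF area_cball(2)[of "2 * r" c]])
      show "indicator (annulus (c,r)) \<in> borel_measurable lebesgue" by (rule borel_measurable_indicator[OF m])
    qed (use r in \<open>auto simp: annulus_def indicator_def\<close>)
    have "(LINT z|lebesgue. indicator (annulus (c,r)) z) \<le> (LINT z|lebesgue. indicator (cball c (2 * r)) z :: real)"
      using r by (intro integral_mono 1 area_cball(2)) (auto simp: annulus_def indicator_def)
    also have "\<dots> \<le> 16 * r\<^sup>2" using integral_indicator_cball[of "2 * r" c] r by (simp add: power_mult_distrib)
    finally show "(LINT z|lebesgue. indicator (annulus (c,r)) z) \<le> 16 * r\<^sup>2" .
  qed
  have intB: "integrable lebesgue (\<lambda>z. (9 * A * bump_const / snd B)\<^sup>2 * indicator (annulus B) z)"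
    if "j < M" "B \<in> F j" for j B
  proof (cases B)
    case (Pair c r)
    then have "integrable lebesgue (indicator (annulus B) :: _ \<Rightarrow> real)"
      using int[OF rpos] that by blast
    then show ?thesis by (rule integrable_mult_right)
  qed
  have intj: "integrable lebesgue (\<lambda>z. \<Sum>B\<in>F j. (9 * A * bump_const / snd B)\<^sup>2 * indicator (annulus B) z)" if "j < M" for j
    using that by (intro Bochner_Integration.integrable_sum intB)
  have ints: "integrable lebesgue (\<lambda>z. \<Sum>j<M. \<Sum>B\<in>F j. (9 * A * bump_const / snd B)\<^sup>2 * indicator (annulus B) z)"
    by (rule Bochner_Integration.integrable_sum[OF intj]) simp
  then show "integrable lebesgue hess_bound"
    unfolding hess_bound_def[abs_def] by (intro integrable_divide)
  have "(LINT z|lebesgue. hess_bound z) = (\<Sum>j<M. \<Sum>B\<in>F j. (9 * A * bump_const / snd B)\<^sup>2 * (LINT z|lebesgue. indicator (annulus B) z)) / (real M)\<^sup>2"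
  proof -
    have "(LINT z|lebesgue. hess_bound z) = (LINT z|lebesgue. (\<Sum>j<M. \<Sum>B\<in>F j. (9 * A * bump_const / snd B)\<^sup>2 * indicator (annulus B) z)) / (real M)\<^sup>2"
      unfolding hess_bound_def by (rule integral_divide_zero)
    also have "(LINT z|lebesgue. (\<Sum>j<M. \<Sum>B\<in>F j. (9 * A * bump_const / snd B)\<^sup>2 * indicator (annulus B) z)) =
      (\<Sum>j<M. (LINT z|lebesgue. (\<Sum>B\<in>F j. (9 * A * bump_const / snd B)\<^sup>2 * indicator (annulus B) z)))"
      by (rule Bochner_Integration.integral_sum[OF intj]) simp
    also have "\<dots> = (\<Sum>j<M. \<Sum>B\<in>F j. (LINT z|lebesgue. (9 * A * bump_const / snd B)\<^sup>2 * indicator (annulus B) z))"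
    proof (rule sum.cong[OF refl])
      fix j assume "j \<in> {..<M}"
      then have "j < M" by simp
      then show "(LINT z|lebesgue. (\<Sum>B\<in>F j. (9 * A * bump_const / snd B)\<^sup>2 * indicator (annulus B) z)) =
          (\<Sum>B\<in>F j. (LINT z|lebesgue. (9 * A * bump_const / snd B)\<^sup>2 * indicator (annulus B) z))"
        by (rule Bochner_Integration.integral_sum[OF intB])
    qed
    finally show ?thesis by simp
  qed
  also have "\<dots> \<le> (\<Sum>j<M. \<Sum>B\<in>F j. 1296 * (A * bump_const)\<^sup>2) / (real M)\<^sup>2"
  proof (intro divide_right_mono sum_mono)
    fix j B assume j: "j \<in> {..<M}" "B \<in> F j"
    then have r: "snd B > 0" using rpos[of j "fst B" "snd B"] by simp
    have "(9 * A * bump_const / snd B)\<^sup>2 * (LINT z|lebesgue. indicator (annulus B) z) \<le> (9 * A * bump_const / snd B)\<^sup>2 * (16 * (snd B)\<^sup>2)"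
      using le[OF r, of "fst B"] by (intro mult_left_mono) auto
    also have "\<dots> = 1296 * (A * bump_const)\<^sup>2" using r by (simp add: power_divide power_mult_distrib)
    finally show "(9 * A * bump_const / snd B)\<^sup>2 * (LINT z|lebesgue. indicator (annulus B) z) \<le> 1296 * (A * bump_const)\<^sup>2" .
  qed auto
  also have "\<dots> = 1296 * (A * bump_const)\<^sup>2 * (\<Sum>j<M. real (card (F j))) / (real M)\<^sup>2"
    by (simp add: sum_distrib_left sum_distrib_right mult.commute)
  finally show "(LINT z|lebesgue. hess_bound z) \<le> 1296 * (A * bump_const)\<^sup>2 * (\<Sum>j<M. real (card (F j))) / (real M)\<^sup>2" .
qed

end

lemma line_integrable:
  assumes "continuous_on UNIV f"
  shows "integrable lebesgue (\<lambda>x. indicator {0..1} x * f (vector [x, 0] :: real^2) :: real)"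
proof -
  have "integrable lborel (\<lambda>x. indicator {0..1} x *\<^sub>R f (vector [x, 0] :: real^2))"
    by (rule borel_integrable_compact) (use assms in \<open>auto intro: continuous_on_slice\<close>)
  then show ?thesis by (simp add: integrable_completion)
qed

lemma disc_slice: "vector [x, 0] \<in> cball c R \<Longrightarrow> x \<in> {c$1 - R .. c$1 + R}" for c :: "real^2"
  using component_le_norm_cart[of "vector [x, 0] - c" 1] by (auto simp: dist_norm norm_minus_commute)

lemma interval_integral: "p \<le> q \<Longrightarrow> (LINT x|lebesgue. indicator {p..q::real} x) = q - p"
  "integrable lebesgue (indicator {p..q::real} :: _ \<Rightarrow> real)"
  using lmeasurable_interval(1)[of p q] by (simp_all add: measure_completion fmeasurable_def)

text \<open>A ball of radius \<open>2 * r\<close> meets the line in a segment of length at most \<open>4 * r\<close>.\<close>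

lemma line_integral_le:
  assumes f: "continuous_on UNIV f" and S: "finite Bs" "\<And>c r. (c,r) \<in> Bs \<Longrightarrow> r \<ge> 0" and C: "C \<ge> 0"
    and le: "\<And>z. f z \<le> C" and out: "\<And>z. (\<And>c r. (c,r) \<in> Bs \<Longrightarrow> z \<notin> cball c (2 * r)) \<Longrightarrow> f z \<le> 0"
  shows "(LINT x:{0..1}|lebesgue. f (vector [x, 0] :: real^2)) \<le> 4 * C * (\<Sum>(c,r)\<in>Bs. r)"
proof -
  define I :: "(real^2) \<times> real \<Rightarrow> real \<Rightarrow> real"
    where "I = (\<lambda>B. indicator {fst B $ 1 - 2 * snd B .. fst B $ 1 + 2 * snd B})"
  have I_int: "integrable lebesgue (I B)" for B unfolding I_def by (rule interval_integral(2))
  have I_nonneg: "I B x \<ge> 0" for B x by (simp add: I_def)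
  have int: "integrable lebesgue (\<lambda>x. \<Sum>B\<in>Bs. C * I B x)"
    by (intro Bochner_Integration.integrable_sum integrable_mult_right I_int)
  have "(LINT x:{0..1}|lebesgue. f (vector [x, 0])) \<le> (LINT x|lebesgue. (\<Sum>B\<in>Bs. C * I B x))"
    unfolding set_lebesgue_integral_def real_scaleR_def
  proof (rule integral_mono[OF line_integrable[OF f] int])
    fix x :: real
    have nn: "0 \<le> (\<Sum>B\<in>Bs. C * I B x)" using C I_nonneg by (intro sum_nonneg mult_nonneg_nonneg) auto
    show "indicator {0..1} x * f (vector [x, 0]) \<le> (\<Sum>B\<in>Bs. C * I B x)"
    proof (cases "f (vector [x, 0]) \<le> 0")
      case True
      then show ?thesis using nn by (simp add: indicator_def)
    next
      case False
      then obtain c r where c: "(c,r) \<in> Bs" "vector [x, 0] \<in> cball c (2 * r)" using out[of "vector [x,0]"] by auto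
      have "C * I (c,r) x \<le> (\<Sum>B\<in>Bs. C * I B x)"
        by (rule member_le_sum) (use c C S I_nonneg in auto)
      then have "C \<le> (\<Sum>B\<in>Bs. C * I B x)" using disc_slice[OF c(2)] by (simp add: I_def)
      then show ?thesis using le[of "vector [x,0]"] nn by (simp add: indicator_def)
    qed
  qed
  also have "\<dots> = (\<Sum>B\<in>Bs. C * (LINT x|lebesgue. I B x))"
    by (subst Bochner_Integration.integral_sum) (auto intro!: integrable_mult_right I_int)
  also have "\<dots> = (\<Sum>B\<in>Bs. C * (4 * snd B))"
  proof (intro sum.cong refl)
    fix B assume "B \<in> Bs"
    then have "snd B \<ge> 0" using S(2)[of "fst B" "snd B"] by simp
    then have "(LINT x|lebesgue. I B x) = 4 * snd B" unfolding I_def by (subst interval_integral) auto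
    then show "C * (LINT x|lebesgue. I B x) = C * (4 * snd B)" by simp
  qed
  also have "\<dots> = 4 * C * (\<Sum>(c,r)\<in>Bs. r)" unfolding case_prod_unfold sum_distrib_left by (simp add: mult_ac)
  finally show ?thesis .
qed

lemma kernel_props:
  assumes J: "admissible_kernel J" and r: "r > 0"
  shows "rescaled J r (z - p) \<ge> 0" "dist z p \<ge> r \<Longrightarrow> rescaled J r (z - p) = 0"
    "continuous_on UNIV (\<lambda>z. rescaled J r (z - p))" "compact (supp (\<lambda>z. rescaled J r (z - p)))"
    "integrable lebesgue (\<lambda>z. rescaled J r (z - p))" "(LINT z|lebesgue. rescaled J r (z - p)) = 1"
proof -
  have Jc: "continuous_on UNIV J" and Js: "supp J \<subseteq> ball 0 1" and Jp: "\<And>x. J x \<ge> 0"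
    and Ji: "(LINT x|lebesgue. J x) = 1"
    using J by (auto simp: admissible_kernel_def test_functions_def intro: smooth_continuous)
  show "rescaled J r (z - p) \<ge> 0" using Jp by (simp add: rescaled_def)
  show 0: "rescaled J r (z - p) = 0" if "dist z p \<ge> r" for z
  proof -
    have "norm ((z - p) /\<^sub>R r) = norm (z - p) / r" by (rule norm_scale[OF r])
    then have "norm ((z - p) /\<^sub>R r) \<ge> 1" using that r by (simp add: dist_norm pos_le_divide_eq)
    then have "(z - p) /\<^sub>R r \<notin> supp J" using Js by (auto simp: dist_norm)
    then show ?thesis by (simp add: rescaled_def not_supp)
  qed
  show c: "continuous_on UNIV (\<lambda>z. rescaled J r (z - p))"
    unfolding rescaled_def using r by (intro continuous_intros continuous_on_compose2[OF Jc]) auto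
  have "supp (\<lambda>z. rescaled J r (z - p)) \<subseteq> cball p r"
    by (rule supp_subset_closed) (use 0 in \<open>auto simp: dist_commute\<close>)
  then show s: "compact (supp (\<lambda>z. rescaled J r (z - p)))" by (rule compact_supp_subset[OF compact_cball])
  show i: "integrable lebesgue (\<lambda>z. rescaled J r (z - p))" by (rule continuous_compact_integrable[OF c s])
  have Jm: "J \<in> borel_measurable borel" using Jc by (rule borel_measurable_continuous_onI)
  have "(LINT z|lebesgue. rescaled J r (z - p)) = (LINT z|lborel. rescaled J r (z - p))"
    using c by (intro integral_completion) (simp add: borel_measurable_continuous_onI)
  also have "\<dots> = (LINT z|density (distr lborel borel (\<lambda>x. p + r *\<^sub>R x)) (\<lambda>_. \<bar>r\<bar>^DIM(real^2)). rescaled J r (z - p))"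
    using lborel_affine[of r p] r by simp
  also have "\<dots> = (LINT z|distr lborel borel (\<lambda>x. p + r *\<^sub>R x). r\<^sup>2 *\<^sub>R rescaled J r (z - p))"
    using r c by (subst integral_density) (auto intro!: borel_measurable_continuous_onI)
  also have "\<dots> = (LINT x|lborel. r\<^sup>2 *\<^sub>R rescaled J r (p + r *\<^sub>R x - p))"
    by (subst integral_distr) (auto intro!: borel_measurable_continuous_onI c continuous_intros borel_measurable_scaleR)
  also have "\<dots> = (LINT x|lborel. J x)" using r by (simp add: rescaled_def)
  also have "\<dots> = 1" using Ji Jm by (simp add: integral_completion)
  finally show "(LINT z|lebesgue. rescaled J r (z - p)) = 1" .
qed

definition height :: "real^2 \<Rightarrow> real" where "height z = z $ 2"

lemma smooth_height: "smooth height"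
  by (simp add: height_def[abs_def])

lemma partial_height: "partial i height = (\<lambda>z. if i = 2 then 1 else 0)"
  by (simp add: height_def[abs_def] partial_coord)

lemma partial2_height: "partial i (partial j height) = (\<lambda>z. 0)"
  by (simp add: partial_height)

section \<open>The lower bound on one square\<close>

text \<open>A square of side \<open>X\<close> that stands on the bottom at \<open>a\<close> and lies in the film.  The cores of the
  dislocations, if there are any, are small compared with the square.\<close>

locale dislocated_square =
  fixes J :: "real^2 \<Rightarrow> real" and h :: "real \<Rightarrow> real" and H :: "real^2 \<Rightarrow> real^2^2"
    and P :: "(real^2) multiset" and b e0 r0 a X :: real
  assumes J: "admissible_kernel J" and b: "b > 0" and e0: "e0 > 0" and r0: "r0 > 0" and X: "X > 0"
    and film: "strain_field h H (mollified_dislocations J r0 b P) e0"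
    and a: "0 \<le> a" "a + X \<le> 1" and hX: "\<And>x. x \<in> {a..a+X} \<Longrightarrow> h x \<ge> X"
    and balls: "\<And>p. p \<in># P \<Longrightarrow> ball p r0 \<subseteq> subgraph h"
    and r0X: "P = {#} \<or> r0 \<le> X / 64"
begin

sublocale strain_field h H "mollified_dislocations J r0 b P" e0 by (rule film)

definition sq :: "(real^2) set" where "sq = {z. a < z$1 \<and> z$1 < a + X \<and> 0 < z$2 \<and> z$2 < X}"

text \<open>All test functions are supported in a ball around the middle of the bottom side.\<close>

definition mid :: "real^2" where "mid = vector [a + X / 2, 0]"

definition near :: nat where "near = size (filter_mset (\<lambda>p. dist p mid \<le> 3 * X / 8) P)"

definition en :: real where "en = (LINT z:\<Omega> \<inter> sq|lebesgue. (norm (sym_part (H z)))\<^sup>2)"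

lemma sq_sets: "sq \<in> sets lebesgue"
proof -
  have "open sq" unfolding sq_def by (intro open_Collect_conj open_Collect_less continuous_intros)
  then show ?thesis by (simp add: borel_open)
qed

lemma near_mid:
  assumes "z \<in> cball mid (3 * X / 8)" "z$2 \<ge> 0"
  shows "a < z$1" "z$1 < a + X" "z$2 < X" "z$2 > 0 \<Longrightarrow> z \<in> \<Omega> \<inter> sq" "z$2 = 0 \<Longrightarrow> z \<in> bottom"
proof -
  have "norm (z - mid) \<le> 3 * X / 8" using assms by (simp add: dist_norm norm_minus_commute)
  then have "\<bar>(z - mid)$1\<bar> \<le> 3 * X / 8" "\<bar>(z - mid)$2\<bar> \<le> 3 * X / 8"
    by (meson component_le_norm_cart order_trans)+
  then have "\<bar>z$1 - (a + X / 2)\<bar> \<le> 3 * X / 8" "\<bar>z$2\<bar> \<le> 3 * X / 8" by (simp_all add: mid_def)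
  then show 1: "a < z$1" "z$1 < a + X" "z$2 < X" using X by linarith+
  have "h (z$1) \<ge> X" using 1 by (intro hX) auto
  then show "z$2 > 0 \<Longrightarrow> z \<in> \<Omega> \<inter> sq" "z$2 = 0 \<Longrightarrow> z \<in> bottom"
    using 1 a X by (auto simp: subgraph_def bottom_def sq_def)
qed

text \<open>\<open>dual_estimate\<close> for test functions that vanish outside the half ball contained in the square.\<close>

lemma square_estimate:
  assumes \<Phi>: "smooth \<Phi>" and out: "\<And>z. z \<notin> cball mid (3 * X / 8) \<Longrightarrow> \<Phi> z = 0"
    and B: "integrable lebesgue B" "\<And>i k z. (partial i (partial k \<Phi>) z)\<^sup>2 \<le> B z"
    and R: "(LINT z|lebesgue. B z) \<le> R" "R > 0"
  shows "(e0 * (LINT x:{0..1}|lebesgue. partial 2 \<Phi> (vector [x, 0]))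
     - (LINT z:\<Omega>|lebesgue. mollified_dislocations J r0 b P z $ 1 * partial 2 \<Phi> z))\<^sup>2 \<le> 4 * R * en"
  unfolding en_def
proof (rule dual_estimate[OF \<Phi> _ _ sq_sets _ B R])
  have s: "supp \<Phi> \<subseteq> cball mid (3 * X / 8)" by (rule supp_subset_closed) (use out in auto)
  show "compact (supp \<Phi>)" by (rule compact_supp_subset[OF compact_cball s])
  show "supp \<Phi> \<inter> {z. 0 \<le> z $ 2} \<subseteq> \<Omega> \<union> bottom"
  proof
    fix z assume "z \<in> supp \<Phi> \<inter> {z. 0 \<le> z $ 2}"
    then have "z \<in> cball mid (3 * X / 8)" "z$2 \<ge> 0" using s by auto
    then show "z \<in> \<Omega> \<union> bottom" using near_mid(4,5)[of z] by (cases "z$2 = 0") auto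
  qed
  show "z \<notin> supp \<Phi>" if "z \<in> \<Omega>" "z \<notin> sq" for z
    using that near_mid(4)[of z] s by (auto simp: subgraph_def)
qed

lemma moll_1: "mollified_dislocations J r0 b P z $ 1 = (\<Sum>p\<in>#P. rescaled J r0 (z - p)) * b"
  by (simp add: mollified_dislocations_def)

text \<open>The height, localised around \<open>mid\<close>: the test function for a square without dislocations.\<close>

abbreviation "base \<equiv> hole height mid (X / 16)"

lemma base_bounds:
  "smooth base" "\<bar>partial i base z\<bar> \<le> 9 * bump_const" "\<bar>partial i (partial k base) z\<bar> \<le> 144 * bump_const / X"
  "z \<notin> cball mid (X / 8) \<Longrightarrow> base z = 0" "z \<notin> cball mid (X / 8) \<Longrightarrow> partial i (partial k base) z = 0"
proof -
  show "smooth base" by (intro smooth_hole smooth_height)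
  have r: "X / 16 > 0" using X by simp
  have 1: "\<bar>partial i height z\<bar> \<le> 1" for i z by (simp add: partial_height)
  have 2: "\<bar>partial i (partial k height) z\<bar> \<le> 1 / (X / 16)" for i k z using X by (simp add: partial2_height)
  show "\<bar>partial i base z\<bar> \<le> 9 * bump_const"
    using hole_bounds(1)[OF smooth_height r 1 2, where i=i and c=mid and z=z] bump_const(1) by simp
  show "\<bar>partial i (partial k base) z\<bar> \<le> 144 * bump_const / X"
    using hole_bounds(2)[OF smooth_height r 1 2, where i=i and j=k and c=mid and z=z] by simp
  assume "z \<notin> cball mid (X / 8)"
  then have n: "norm (z - mid) > 2 * (X / 16)" by (simp add: dist_norm norm_minus_commute)
  show "base z = 0" "partial i (partial k base) z = 0" by (rule hole_outside[OF r n])+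
qed

lemma partial_base_bottom: "partial 2 base (vector [x, 0]) = cutoff mid (X / 16) (vector [x, 0])"
proof -
  have "partial 2 base z = partial 2 height z * cutoff mid (X / 16) z + (height z - height mid) * partial 2 (cutoff mid (X / 16)) z" for z
    unfolding hole_def[abs_def] by (simp add: partial_mult partial_diff smooth_differentiable smooth_height smooth_cutoff smooth_diff)
  then show ?thesis by (simp add: partial_height height_def mid_def)
qed

end

lemma covers_all_levels:
  assumes n: "nested_balls F M" and c: "covers (F 0) G" and j: "j < M" and B: "(c,r) \<in> G"
  shows "\<exists>c' r'. (c',r') \<in> F j \<and> cball c r \<subseteq> cball c' r'"
proof -
  obtain c1 r1 where 1: "(c1,r1) \<in> F 0" "cball c r \<subseteq> cball c1 r1" using c B unfolding covers_def by blast
  show ?thesis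
  proof (cases "j = 0")
    case True then show ?thesis using 1 by blast
  next
    case False
    then obtain c2 r2 where 2: "(c2,r2) \<in> F j" "cball c1 (2 * r1) \<subseteq> cball c2 r2"
      using nested_balls_le[OF n _ j 1(1)] by blast
    have "r1 > 0" using nested_balls_pos[OF n _ 1(1)] j by simp
    then have "cball c1 r1 \<subseteq> cball c1 (2 * r1)" by (intro subset_cball) auto
    then have "cball c r \<subseteq> cball c2 r2" using 1(2) 2(2) by (meson subset_trans)
    then show ?thesis using 2(1) by blast
  qed
qed

context dislocated_square
begin

text \<open>The test function is \<open>base\<close> minus its average over \<open>M\<close> levels of balls grown out of \<open>GG\<close>.  A point in a
  dislocation core lies in a ball of every level, where the average has the gradient of \<open>base\<close>; so the
  gradient of the difference vanishes there and the dislocations are invisible.  There are at most \<open>M\<close> balls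
  per level and \<open>M\<close> levels, so the squared second derivatives of the average integrate to a constant,
  and the balls of the last level are so small in total that the average changes the trace term by at
  most half.\<close>

lemma covering_estimate:
  assumes GG: "finite GG" "\<forall>(c,r)\<in>GG. r > 0" and M: "M > 0" and card: "card GG \<le> M"
    and cov: "\<And>p. p \<in># P \<Longrightarrow> dist p mid \<le> X / 4 \<Longrightarrow> \<exists>c r. (c,r) \<in> GG \<and> cball p r0 \<subseteq> cball c r"
    and small: "2 ^ M * (total_radius GG * 3 ^ card GG) \<le> X / (4000 * bump_const\<^sup>2)"
  shows "(e0 * X)\<^sup>2 \<le> 2 * 10 ^ 9 * bump_const ^ 4 * en"
proof -
  let ?K = bump_const
  have K: "?K \<ge> 1" by (rule bump_const)
  obtain F where F: "nested_balls F M" "covers (F 0) GG" "\<And>j. card (F j) \<le> card GG"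
    "\<And>j. total_radius (F j) \<le> 2 ^ j * (total_radius GG * 3 ^ card GG)"
    using nested_balls_exist[OF GG, of M] by blast
  have GG0: "total_radius GG \<ge> 0" using GG by (auto simp: total_radius_def intro!: sum_nonneg)
  define \<rho> where "\<rho> = X / (4000 * ?K\<^sup>2)"
  have K2: "1 \<le> ?K\<^sup>2" using K by simp
  have \<rho>: "\<rho> > 0" "\<rho> \<le> X / 4000"
    unfolding \<rho>_def using X K2 by (intro divide_pos_pos frac_le; linarith)+
  have tr: "total_radius (F j) \<le> \<rho>" if "j < M" for j
  proof -
    have "total_radius (F j) \<le> 2 ^ j * (total_radius GG * 3 ^ card GG)" by (rule F(4))
    also have "\<dots> \<le> 2 ^ M * (total_radius GG * 3 ^ card GG)"
      using that GG0 by (intro mult_right_mono power_increasing) auto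
    finally show ?thesis using small by (simp add: \<rho>_def)
  qed
  have r_le: "r \<le> \<rho>" if "j < M" "(c,r) \<in> F j" for j c r
  proof -
    have fin: "finite (F j)" using F(1) that by (auto simp: nested_balls_def separated_balls_def)
    have "snd (c,r) \<le> (\<Sum>B\<in>F j. snd B)"
      by (rule member_le_sum) (use that fin nested_balls_pos[OF F(1) that(1)] in \<open>auto intro: less_imp_le\<close>)
    then show ?thesis using tr[OF that(1)] by (simp add: total_radius_def case_prod_unfold)
  qed
  interpret A: hole_average base F M "9 * ?K"
  proof
    show "smooth base" by (rule base_bounds)
    show "M > 0" by (rule M)
    show "nested_balls F M" by (rule F)
    show "\<bar>partial i base z\<bar> \<le> 9 * ?K" for i z by (rule base_bounds)
    show "\<bar>partial i (partial k base) z\<bar> \<le> 9 * ?K / r" if j: "j < M" "(c,r) \<in> F j" for i k z j c r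
    proof -
      have r: "r > 0" "r \<le> X / 16" using nested_balls_pos[OF F(1) j] r_le[OF j] \<rho> by auto
      have "\<bar>partial i (partial k base) z\<bar> \<le> 9 * ?K / (X / 16)" using base_bounds(3)[of i k z] by simp
      also have "\<dots> \<le> 9 * ?K / r" using r K X by (intro divide_left_mono) auto
      finally show ?thesis .
    qed
  qed
  let ?\<Phi> = "\<lambda>z. base z - average base F M z"
  have sm: "smooth ?\<Phi>" by (intro smooth_diff base_bounds(1) A.smooth_average)
  have d1: "partial i ?\<Phi> z = partial i base z - partial i (average base F M) z" for i z
    by (intro partial_diff smooth_differentiable base_bounds(1) A.smooth_average)
  have d2: "partial i (partial k ?\<Phi>) z = partial i (partial k base) z - partial i (partial k (average base F M)) z" for i k z
  proof -
    have "partial k ?\<Phi> = (\<lambda>z. partial k base z - partial k (average base F M) z)" using d1 by auto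
    then show ?thesis
      by (simp add: partial_diff smooth_differentiable smooth_partial base_bounds(1) A.smooth_average)
  qed
  have out: "?\<Phi> z = 0" if z: "z \<notin> cball mid (X / 8 + X / 64)" for z
  proof -
    have "z \<notin> cball mid (X / 8)" using z X by auto
    then have "base z = 0" by (rule base_bounds(4))
    moreover have "hole base c r z = 0" if j: "j < M" "(c,r) \<in> F j" for j c r
    proof (rule ccontr)
      assume nz: "hole base c r z \<noteq> 0"
      have "\<not> norm (z - c) > 2 * r" using hole_outside(1)[OF nested_balls_pos[OF F(1) j]] nz by blast
      then have 1: "dist z c \<le> 2 * \<rho>" using r_le[OF j] by (simp add: dist_norm)
      have "base c \<noteq> 0" using nz \<open>base z = 0\<close> by (auto simp: hole_def)
      then have "dist mid c \<le> X / 8" using base_bounds(4)[of c] by auto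
      then have "dist mid z \<le> X / 8 + 2 * \<rho>" using 1 dist_triangle[of mid z c] by (simp add: dist_commute)
      then show False using z \<rho> X by simp
    qed
    then have "average base F M z = 0" unfolding average_def by (intro sum.neutral) (auto intro!: sum.neutral)
    ultimately show ?thesis by simp
  qed
  have supp: "supp ?\<Phi> \<subseteq> cball mid (X / 8 + X / 64)" by (rule supp_subset_closed) (use out in auto)
  have disl: "mollified_dislocations J r0 b P z $ 1 * partial 2 ?\<Phi> z = 0" for z
  proof (cases "partial 2 ?\<Phi> z = 0")
    case False
    then have "z \<in> supp ?\<Phi>" using supp_partial not_supp by blast
    then have zm: "dist z mid \<le> X / 8 + X / 64" using supp by (auto simp: dist_commute)
    have "rescaled J r0 (z - p) = 0" if p: "p \<in># P" for p
    proof (rule ccontr)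
      assume nz: "rescaled J r0 (z - p) \<noteq> 0"
      then have zp: "dist z p < r0" using kernel_props(2)[OF J r0] not_less by blast
      have "r0 \<le> X / 64" using r0X p by auto
      then have "dist p mid \<le> X / 4" using zp zm dist_triangle[of p mid z] X by (simp add: dist_commute)
      then obtain c r where cr: "(c,r) \<in> GG" "cball p r0 \<subseteq> cball c r" using cov[OF p] by blast
      have "z \<in> cball p r0" using zp by (simp add: dist_commute)
      then have zc: "z \<in> cball c r" using cr(2) by blast
      have "partial 2 (average base F M) z = partial 2 base z"
      proof (rule A.partial_average_covered)
        fix j assume "j < M"
        then obtain c' r' where "(c',r') \<in> F j" "cball c r \<subseteq> cball c' r'"
          using covers_all_levels[OF F(1,2) _ cr(1)] by blast
        then show "\<exists>(c,r)\<in>F j. z \<in> cball c r" using zc by blast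
      qed
      then show False using False d1 by simp
    qed
    then have "(\<Sum>p\<in>#P. rescaled J r0 (z - p)) = 0"
      using image_mset_cong[of P "\<lambda>p. rescaled J r0 (z - p)" "\<lambda>p. 0"] by simp
    then show ?thesis by (simp add: moll_1)
  qed simp
  have line: "(LINT x:{0..1}|lebesgue. partial 2 ?\<Phi> (vector [x, 0])) \<ge> X / 16"
  proof -
    have c1: "continuous_on UNIV (partial 2 base)" "continuous_on UNIV (partial 2 (average base F M))"
      by (intro smooth_continuous smooth_partial base_bounds(1) A.smooth_average)+
    have "(LINT x:{0..1}|lebesgue. partial 2 ?\<Phi> (vector [x, 0])) =
        (LINT x:{0..1}|lebesgue. partial 2 base (vector [x, 0])) - (LINT x:{0..1}|lebesgue. partial 2 (average base F M) (vector [x, 0]))"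
      unfolding d1 by (rule set_integral_diff(2)) (use line_integrable[OF c1(1)] line_integrable[OF c1(2)] in \<open>simp_all add: set_integrable_def\<close>)
    moreover have "(LINT x:{0..1}|lebesgue. partial 2 base (vector [x, 0])) \<ge> X / 8"
    proof -
      let ?I = "indicator {a + X / 2 - X / 16 .. a + X / 2 + X / 16} :: real \<Rightarrow> real"
      have "X / 8 = (LINT x|lebesgue. ?I x)" using X by (subst interval_integral) auto
      also have "\<dots> \<le> (LINT x|lebesgue. indicator {0..1} x * partial 2 base (vector [x, 0]))"
      proof (rule integral_mono[OF interval_integral(2) line_integrable[OF c1(1)]])
        fix x :: real
        show "?I x \<le> indicator {0..1} x * partial 2 base (vector [x, 0])"
        proof (cases "x \<in> {a + X / 2 - X / 16 .. a + X / 2 + X / 16}")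
          case True
          then have x: "\<bar>x - (a + X / 2)\<bar> \<le> X / 16" "0 \<le> x" "x \<le> 1" using a X unfolding atLeastAtMost_iff by linarith+
          have "(norm (vector [x, 0] - mid))\<^sup>2 = (x - (a + X / 2))\<^sup>2"
            unfolding norm2 by (simp add: mid_def power2_eq_square)
          also have "\<dots> \<le> (X / 16)\<^sup>2" using power_mono[OF x(1), of 2] by simp
          also have "\<dots> \<le> 2 * (X / 16)\<^sup>2" by simp
          finally have "cutoff mid (X / 16) (vector [x, 0]) = 1" using X by (intro cutoff_eq_1) auto
          then show ?thesis using x by (simp add: partial_base_bottom)
        next
          case False
          then show ?thesis using eta_range(1) by (simp add: partial_base_bottom cutoff_def)
        qed
      qed
      finally show ?thesis by (simp add: set_lebesgue_integral_def)
    qed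
    moreover have "(LINT x:{0..1}|lebesgue. partial 2 (average base F M) (vector [x, 0])) \<le> 4 * (6 * (9 * ?K) * ?K) * (\<Sum>(c,r)\<in>F (M - 1). r)"
    proof (rule line_integral_le[OF c1(2)])
      show "finite (F (M - 1))" using M by (intro A.fin) simp
      show "r \<ge> 0" if "(c,r) \<in> F (M - 1)" for c r using A.rpos[OF _ that] M by simp
      show "partial 2 (average base F M) z \<le> 6 * (9 * ?K) * ?K" for z using A.partial_average_bound[of 2 z] by linarith
      show "partial 2 (average base F M) z \<le> 0" if "\<And>c r. (c,r) \<in> F (M - 1) \<Longrightarrow> z \<notin> cball c (2 * r)" for z
        using A.average_outside(2)[OF that] by simp
    qed (use K in auto)
    moreover have "4 * (6 * (9 * ?K) * ?K) * (\<Sum>(c,r)\<in>F (M - 1). r) \<le> X / 16"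
    proof -
      have "4 * (6 * (9 * ?K) * ?K) * (\<Sum>(c,r)\<in>F (M - 1). r) \<le> (216 * ?K\<^sup>2) * \<rho>"
        using tr[of "M - 1"] M mult_left_mono[of "total_radius (F (M - 1))" \<rho> "216 * ?K\<^sup>2"]
        by (simp add: total_radius_def power2_eq_square)
      also have "\<dots> = 216 / 4000 * X" using K by (simp add: \<rho>_def)
      finally show ?thesis using X by simp
    qed
    ultimately show ?thesis by linarith
  qed
  define B where "B z = 2 * (144 * ?K / X)\<^sup>2 * indicator (cball mid (X / 8)) z + 2 * A.hess_bound z" for z
  have X8: "X / 8 \<ge> 0" using X by simp
  have intB: "integrable lebesgue B"
    unfolding B_def[abs_def]
    by (intro Bochner_Integration.integrable_add integrable_mult_right area_cball(2)[OF X8] A.hess_bound_integral(1))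
  have leB: "(partial i (partial k ?\<Phi>) z)\<^sup>2 \<le> B z" for i k z
  proof -
    obtain \<theta> e where \<theta>: "0 \<le> \<theta>" "\<theta> \<le> 1" "e\<^sup>2 \<le> A.hess_bound z"
      "partial i (partial k (average base F M)) z = \<theta> * partial i (partial k base) z + e"
      using A.partial2_average_cases by blast
    let ?p = "partial i (partial k base) z"
    have "(partial i (partial k ?\<Phi>) z)\<^sup>2 = ((1 - \<theta>) * ?p - e)\<^sup>2" by (simp add: d2 \<theta>(4) algebra_simps)
    also have "\<dots> \<le> 2 * ((1 - \<theta>) * ?p)\<^sup>2 + 2 * e\<^sup>2"
      using sum_squares_ge_zero[of "(1 - \<theta>) * ?p + e" 0] by (simp add: power2_eq_square algebra_simps)
    also have "((1 - \<theta>) * ?p)\<^sup>2 \<le> ?p\<^sup>2"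
      using \<theta> by (simp add: power_mult_distrib mult_left_le_one_le power_le_one)
    also have "?p\<^sup>2 \<le> (144 * ?K / X)\<^sup>2 * indicator (cball mid (X / 8)) z"
    proof (cases "z \<in> cball mid (X / 8)")
      case True
      have "\<bar>?p\<bar>\<^sup>2 \<le> (144 * ?K / X)\<^sup>2" by (intro power_mono base_bounds) auto
      then show ?thesis using True by simp
    next
      case False
      then show ?thesis using base_bounds(5) by simp
    qed
    finally show ?thesis using \<theta>(3) by (simp add: B_def)
  qed
  have R: "(LINT z|lebesgue. B z) \<le> 10 ^ 6 * ?K ^ 4"
  proof -
    have "(LINT z|lebesgue. B z) = 2 * (144 * ?K / X)\<^sup>2 * (LINT z|lebesgue. indicator (cball mid (X / 8)) z) + 2 * (LINT z|lebesgue. A.hess_bound z)"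
      unfolding B_def
      by (subst Bochner_Integration.integral_add)
         (intro integrable_mult_right area_cball(2)[OF X8] A.hess_bound_integral(1) | simp only: integral_mult_right_zero)+
    also have "\<dots> \<le> 2 * (144 * ?K / X)\<^sup>2 * (4 * (X / 8)\<^sup>2) + 2 * (1296 * (9 * ?K * ?K)\<^sup>2 * (\<Sum>j<M. real (card (F j))) / (real M)\<^sup>2)"
      using integral_indicator_cball[OF X8, of mid] A.hess_bound_integral(2)
      by (intro add_mono mult_left_mono) auto
    also have "2 * (144 * ?K / X)\<^sup>2 * (4 * (X / 8)\<^sup>2) = 2592 * ?K\<^sup>2" using X by (simp add: power_divide power_mult_distrib)
    also have "1296 * (9 * ?K * ?K)\<^sup>2 * (\<Sum>j<M. real (card (F j))) / (real M)\<^sup>2 \<le> 1296 * (9 * ?K * ?K)\<^sup>2"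
    proof -
      have "(\<Sum>j<M. real (card (F j))) \<le> (\<Sum>j<M. real M)"
        using F(3) card by (intro sum_mono) (meson of_nat_le_iff order_trans)
      then have "(\<Sum>j<M. real (card (F j))) / (real M)\<^sup>2 \<le> 1" using M by (simp add: power2_eq_square)
      from mult_left_mono[OF this, of "1296 * (9 * ?K * ?K)\<^sup>2"] show ?thesis by simp
    qed
    also have "2592 * ?K\<^sup>2 + 2 * (1296 * (9 * ?K * ?K)\<^sup>2) = 2592 * ?K\<^sup>2 + 209952 * ?K ^ 4"
      by (simp add: power_mult_distrib)
    also have "\<dots> \<le> 2592 * ?K ^ 4 + 209952 * ?K ^ 4" using K by (intro add_mono mult_left_mono power_increasing) auto
    also have "\<dots> \<le> 10 ^ 6 * ?K ^ 4" using K by simp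
    finally show ?thesis by simp
  qed
  have "(e0 * (LINT x:{0..1}|lebesgue. partial 2 ?\<Phi> (vector [x, 0]))
     - (LINT z:\<Omega>|lebesgue. mollified_dislocations J r0 b P z $ 1 * partial 2 ?\<Phi> z))\<^sup>2 \<le> 4 * (10 ^ 6 * ?K ^ 4) * en"
    by (rule square_estimate[OF sm _ intB leB R]) (use out X K in auto)
  then have main: "(e0 * (LINT x:{0..1}|lebesgue. partial 2 ?\<Phi> (vector [x, 0])))\<^sup>2 \<le> 4 * (10 ^ 6 * ?K ^ 4) * en"
    unfolding disl by (simp add: set_lebesgue_integral_def)
  have "(e0 * (X / 16))\<^sup>2 \<le> (e0 * (LINT x:{0..1}|lebesgue. partial 2 ?\<Phi> (vector [x, 0])))\<^sup>2"
    using line e0 X by (intro power_mono mult_left_mono) auto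
  with main have "(e0 * X)\<^sup>2 \<le> 1024 * 10 ^ 6 * ?K ^ 4 * en" by (simp add: power_mult_distrib power_divide)
  moreover have "en \<ge> 0" unfolding en_def set_lebesgue_integral_def by (intro integral_nonneg_AE) auto
  moreover have "1024 * 10 ^ 6 * ?K ^ 4 * en \<le> 2 * 10 ^ 9 * ?K ^ 4 * en"
    using K \<open>en \<ge> 0\<close> by (intro mult_right_mono) auto
  ultimately show ?thesis by linarith
qed

end

context dislocated_square
begin

lemma en_nonneg: "en \<ge> 0"
  unfolding en_def set_lebesgue_integral_def by (intro integral_nonneg_AE) auto

text \<open>A dislocation in \<open>S\<close> contributes \<open>b\<close>, one elsewhere near \<open>mid\<close> at least \<open>- b * \<delta>\<close>, and the rest
  nothing.\<close>

lemma dislocation_integral: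
  assumes f: "continuous_on UNIV f" and fl: "\<And>z. f z \<ge> - \<delta>" "\<delta> \<ge> 0"
    and S: "finite S" "S \<subseteq> set_mset P" and one: "\<And>p z. p \<in> S \<Longrightarrow> z \<in> ball p r0 \<Longrightarrow> f z = 1"
    and out: "\<And>z. dist z mid > 3 * X / 8 - r0 \<Longrightarrow> f z = 0"
  shows "(LINT z:\<Omega>|lebesgue. mollified_dislocations J r0 b P z $ 1 * f z) \<ge> b * (real (card S) - \<delta> * near)"
proof -
  define lb where "lb p = (if p \<in> S then 1 else 0) - (if dist p mid \<le> 3 * X / 8 then \<delta> else 0)" for p
  let ?k = "\<lambda>p z. indicator \<Omega> z * (rescaled J r0 (z - p) * f z)"
  note kp = kernel_props[OF J r0]
  have int: "integrable lebesgue (?k p)" for p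
  proof -
    have "supp (\<lambda>z. rescaled J r0 (z - p) * f z) \<subseteq> supp (\<lambda>z. rescaled J r0 (z - p))"
      unfolding supp_def by (intro closure_mono) auto
    from compact_supp_subset[OF kp(4) this] have "integrable lebesgue (\<lambda>z. rescaled J r0 (z - p) * f z)"
      by (intro continuous_compact_integrable continuous_on_mult kp(3) f)
    from integrable_mult_indicator[OF \<Omega>_sets this] show ?thesis by simp
  qed
  have lower: "(LINT z|lebesgue. ?k p z) \<ge> lb p" if p: "p \<in># P" for p
  proof -
    have "lb p = (LINT z|lebesgue. lb p * rescaled J r0 (z - p))" using kp(6)[of p] by simp
    also have "\<dots> \<le> (LINT z|lebesgue. ?k p z)"
    proof (rule integral_mono[OF integrable_mult_right[OF kp(5)] int])
      fix z
      show "lb p * rescaled J r0 (z - p) \<le> ?k p z"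
      proof (cases "dist z p < r0")
        case False
        then show ?thesis using kp(2)[of z p] by simp
      next
        case True
        then have zb: "z \<in> ball p r0" by (simp add: dist_commute)
        then have z\<Omega>: "z \<in> \<Omega>" using balls[OF p] by auto
        have "lb p \<le> f z"
        proof (cases "p \<in> S")
          case True
          then show ?thesis using one[OF True zb] fl(2) by (simp add: lb_def)
        next
          case nS: False
          show ?thesis
          proof (cases "dist p mid \<le> 3 * X / 8")
            case True then show ?thesis using nS fl(1)[of z] by (simp add: lb_def)
          next
            case False
            then have "dist z mid > 3 * X / 8 - r0" using True dist_triangle[of p mid z] by (simp add: dist_commute)
            then show ?thesis using out nS False by (simp add: lb_def)
          qed
        qed
        from mult_right_mono[OF this kp(1)[of z p]] show ?thesis using z\<Omega> by (simp add: mult.commute)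
      qed
    qed
    finally show ?thesis .
  qed
  have eq: "(LINT z|lebesgue. (\<Sum>p\<in>#M. ?k p z)) = (\<Sum>p\<in>#M. LINT z|lebesgue. ?k p z) \<and> integrable lebesgue (\<lambda>z. \<Sum>p\<in>#M. ?k p z)"
    for M :: "(real^2) multiset"
  proof (induction M)
    case (add p M)
    then show ?case using int[of p] by (simp add: Bochner_Integration.integral_add)
  qed simp
  have sum_lb: "(\<Sum>p\<in>#M. lb p) = real (size (filter_mset (\<lambda>p. p \<in> S) M)) - \<delta> * size (filter_mset (\<lambda>p. dist p mid \<le> 3 * X / 8) M)"
    for M by (induction M) (auto simp: lb_def algebra_simps)
  have card: "card S \<le> size (filter_mset (\<lambda>p. p \<in> S) P)"
  proof -
    have "mset_set S \<subseteq># filter_mset (\<lambda>p. p \<in> S) P"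
      using S by (auto simp: subseteq_mset_def count_mset_set')
    then show ?thesis using size_mset_mono by fastforce
  qed
  have "(LINT z:\<Omega>|lebesgue. mollified_dislocations J r0 b P z $ 1 * f z) = (LINT z|lebesgue. b * (\<Sum>p\<in>#P. ?k p z))"
    unfolding set_lebesgue_integral_def moll_1
    by (rule Bochner_Integration.integral_cong[OF refl]) (simp add: sum_mset_distrib_left sum_mset_distrib_right mult_ac)
  also have "\<dots> = b * (\<Sum>p\<in>#P. LINT z|lebesgue. ?k p z)" using eq[of P] by simp
  also have "\<dots> \<ge> b * (\<Sum>p\<in>#P. lb p)"
    using b lower by (intro mult_left_mono sum_mset_mono) auto
  finally have "b * (\<Sum>p\<in>#P. lb p) \<le> (LINT z:\<Omega>|lebesgue. mollified_dislocations J r0 b P z $ 1 * f z)" .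
  moreover have "b * (real (card S) - \<delta> * near) \<le> b * (\<Sum>p\<in>#P. lb p)"
    using b card by (intro mult_left_mono) (simp_all add: sum_lb near_def)
  ultimately show ?thesis by (rule order_trans[rotated])
qed

text \<open>The test function is the average of the height over the \<open>M\<close> levels of balls of radii \<open>2 ^ j * r0\<close> around the
  points of \<open>S\<close>.  Its derivative \<open>partial 2\<close> is \<open>1\<close> on the cores of \<open>S\<close> and nowhere below
  \<open>- 5 * bump_const / M\<close>, so the other dislocations do little harm (\<open>few\<close>); by \<open>s2\<close> the balls are so small
  that the trace term is dominated by the dislocations.  The squared second derivatives integrate to order
  \<open>card S / M\<close>.\<close>

lemma separated_estimate:
  assumes S: "finite S" "S \<noteq> {}" "S \<subseteq> set_mset P" "\<And>p. p \<in> S \<Longrightarrow> dist p mid \<le> X / 4"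
    and sep: "\<And>p q. p \<in> S \<Longrightarrow> q \<in> S \<Longrightarrow> p \<noteq> q \<Longrightarrow> dist p q > 2 * (2 ^ M * r0)"
    and M: "M > 0" and s1: "2 ^ M * r0 \<le> X / 64" and s2: "2 ^ M * r0 \<le> b / (96 * bump_const * e0)"
    and few: "40 * bump_const * near \<le> real (card S) * M"
  shows "b\<^sup>2 * card S * M \<le> 40000 * bump_const\<^sup>2 * en"
proof -
  let ?K = bump_const
  have K: "?K \<ge> 1" by (rule bump_const)
  define F :: "nat \<Rightarrow> ((real^2) \<times> real) set" where "F j = (\<lambda>p. (p, 2 ^ j * r0)) ` S" for j
  have cS: "card S > 0" using S by (simp add: card_gt_0_iff)
  have cF: "card (F j) = card S" for j unfolding F_def by (rule card_image) (auto simp: inj_on_def)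
  have nest: "nested_balls F M"
    unfolding nested_balls_def
  proof (intro conjI allI impI)
    fix j assume j: "j < M"
    have "(2::real) ^ Suc j \<le> 2 ^ M" using j by (intro power_increasing) auto
    then have "2 * (2 ^ j * r0 + 2 ^ j * r0) \<le> 2 * (2 ^ M * r0)" using r0 by simp
    then have "dist p q > 2 * (2 ^ j * r0 + 2 ^ j * r0)" if "p \<in> S" "q \<in> S" "p \<noteq> q" for p q
      using sep[OF that] by linarith
    then show "separated_balls (F j)" unfolding separated_balls_def F_def using S r0 by auto
  next
    fix j c r assume "(c,r) \<in> F j"
    then show "\<exists>c' r'. (c',r') \<in> F (Suc j) \<and> cball c (2 * r) \<subseteq> cball c' r'"
      by (intro exI[of _ c] exI[of _ "2 * r"]) (auto simp: F_def)
  qed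
  have h1: "\<bar>partial i height z\<bar> \<le> 1" for i z by (simp add: partial_height)
  interpret A: hole_average height F M 1
  proof
    show "\<bar>partial i (partial k height) z\<bar> \<le> 1 / r" if "j < M" "(c,r) \<in> F j" for i k z j c r
      using nested_balls_pos[OF nest that] by (simp add: partial2_height)
  qed (use smooth_height M nest h1 in auto)
  let ?\<Phi> = "average height F M"
  have ge: "partial 2 ?\<Phi> z \<ge> - (5 * ?K / M)" for z
  proof -
    obtain \<theta> e where "0 \<le> \<theta>" "\<theta> \<le> 1" "\<bar>e\<bar> \<le> 5 * 1 * ?K / M" "partial 2 ?\<Phi> z = \<theta> * partial 2 height z + e"
      using A.partial_average_cases by blast
    then show ?thesis by (simp add: partial_height)
  qed
  have rM: "2 * (2 ^ (M - 1) * r0) = 2 ^ M * r0" using M power_Suc[of "2::real" "M - 1"] by simp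
  have outp: "\<And>c r. (c,r) \<in> F (M - 1) \<Longrightarrow> z \<notin> cball c (2 * r)" if "dist z mid > 3 * X / 8 - X / 64" for z
  proof
    fix c r assume "(c,r) \<in> F (M - 1)" "z \<in> cball c (2 * r)"
    then have c: "c \<in> S" "dist c z \<le> 2 * (2 ^ (M - 1) * r0)" by (auto simp: F_def)
    then have "dist c z \<le> X / 64" using s1 unfolding rM by linarith
    with c(1) show False using S(4)[of c] that dist_triangle[of z mid c] X by (simp add: dist_commute)
  qed
  have r0X': "r0 \<le> X / 64" using r0X S by auto
  have Pint: "(LINT z:\<Omega>|lebesgue. mollified_dislocations J r0 b P z $ 1 * partial 2 ?\<Phi> z) \<ge> b * (real (card S) - 5 * ?K / M * near)"
  proof (rule dislocation_integral[OF smooth_continuous[OF smooth_partial[OF A.smooth_average]] ge _ S(1,3)])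
    show "0 \<le> 5 * ?K / M" using K by simp
    show "partial 2 ?\<Phi> z = 1" if p: "p \<in> S" "z \<in> ball p r0" for p z
    proof -
      have "partial 2 ?\<Phi> z = partial 2 height z"
      proof (rule A.partial_average_covered)
        fix j
        have "(1::real) \<le> 2 ^ j" by simp
        then have "r0 \<le> 2 ^ j * r0" using r0 by simp
        then show "\<exists>(c,r)\<in>F j. z \<in> cball c r" using p by (auto simp: F_def intro!: bexI[of _ p])
      qed
      then show ?thesis by (simp add: partial_height)
    qed
    show "partial 2 ?\<Phi> z = 0" if "3 * X / 8 - r0 < dist z mid" for z
      by (rule A.average_outside(2)[OF outp]) (use that r0X' in auto)
  qed
  have "5 * ?K / M * near \<le> card S / 8"
    using few M by (simp add: field_simps)
  then have "b * (7 / 8 * card S) \<le> b * (real (card S) - 5 * ?K / M * near)"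
    using b by (intro mult_left_mono) linarith+
  with Pint have dis: "b * (7 / 8 * card S) \<le> (LINT z:\<Omega>|lebesgue. mollified_dislocations J r0 b P z $ 1 * partial 2 ?\<Phi> z)"
    by linarith
  have "(LINT x:{0..1}|lebesgue. partial 2 ?\<Phi> (vector [x, 0])) \<le> 4 * (6 * 1 * ?K) * (\<Sum>(c,r)\<in>F (M - 1). r)"
  proof (rule line_integral_le[OF smooth_continuous[OF smooth_partial[OF A.smooth_average]]])
    show "finite (F (M - 1))" using M by (intro A.fin) simp
    show "r \<ge> 0" if "(c,r) \<in> F (M - 1)" for c r using A.rpos[OF _ that] M by simp
    show "partial 2 ?\<Phi> z \<le> 6 * 1 * ?K" for z using A.partial_average_bound[of 2 z] by linarith
    show "partial 2 ?\<Phi> z \<le> 0" if "\<And>c r. (c,r) \<in> F (M - 1) \<Longrightarrow> z \<notin> cball c (2 * r)" for z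
      using A.average_outside(2)[OF that] by simp
  qed (use K in auto)
  also have "(\<Sum>(c,r)\<in>F (M - 1). r) = card S * (2 ^ (M - 1) * r0)"
    unfolding F_def by (subst sum.reindex) (auto simp: inj_on_def)
  also have "4 * (6 * 1 * ?K) * (card S * (2 ^ (M - 1) * r0)) = 12 * ?K * card S * (2 ^ M * r0)" using rM by simp
  also have "\<dots> \<le> 12 * ?K * card S * (b / (96 * ?K * e0))" using K by (intro mult_left_mono s2) auto
  also have "\<dots> = card S * b / (8 * e0)" using K by simp
  finally have "e0 * (LINT x:{0..1}|lebesgue. partial 2 ?\<Phi> (vector [x, 0])) \<le> e0 * (card S * b / (8 * e0))"
    using e0 by (intro mult_left_mono) auto
  also have "\<dots> = b * card S / 8" using e0 by simp
  finally have line: "e0 * (LINT x:{0..1}|lebesgue. partial 2 ?\<Phi> (vector [x, 0])) \<le> b * card S / 8" .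
  let ?R = "1296 * ?K\<^sup>2 * card S / M"
  have "(e0 * (LINT x:{0..1}|lebesgue. partial 2 ?\<Phi> (vector [x, 0]))
     - (LINT z:\<Omega>|lebesgue. mollified_dislocations J r0 b P z $ 1 * partial 2 ?\<Phi> z))\<^sup>2 \<le> 4 * ?R * en"
  proof (rule square_estimate[OF A.smooth_average _ A.hess_bound_integral(1)])
    show "?\<Phi> z = 0" if "z \<notin> cball mid (3 * X / 8)" for z
      by (rule A.average_outside(1)[OF outp]) (use that X in \<open>auto simp: dist_commute\<close>)
    show "(partial i (partial k ?\<Phi>) z)\<^sup>2 \<le> A.hess_bound z" for i k z
      using A.partial2_average_cases[of z i k] by (auto simp: partial2_height)
    have "1296 * (1 * ?K)\<^sup>2 * (\<Sum>j<M. real (card (F j))) / (real M)\<^sup>2 = ?R"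
      using M by (simp add: cF power2_eq_square)
    then show "(LINT z|lebesgue. A.hess_bound z) \<le> ?R" using A.hess_bound_integral(2) by simp
    show "?R > 0" using K M cS by simp
  qed
  moreover have "(b * card S / 2)\<^sup>2 \<le> ((LINT z:\<Omega>|lebesgue. mollified_dislocations J r0 b P z $ 1 * partial 2 ?\<Phi> z)
     - e0 * (LINT x:{0..1}|lebesgue. partial 2 ?\<Phi> (vector [x, 0])))\<^sup>2"
  proof (rule power_mono)
    have "b * (7 / 8 * card S) = 7 / 8 * (b * card S)" "0 \<le> b * card S" using b by simp_all
    then show "b * card S / 2 \<le> (LINT z:\<Omega>|lebesgue. mollified_dislocations J r0 b P z $ 1 * partial 2 ?\<Phi> z)
     - e0 * (LINT x:{0..1}|lebesgue. partial 2 ?\<Phi> (vector [x, 0]))" using dis line by linarith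
  qed (use b in auto)
  ultimately have "(b * card S / 2)\<^sup>2 \<le> 4 * ?R * en" by (simp add: power2_commute)
  then have "b\<^sup>2 * card S * card S \<le> 20736 * ?K\<^sup>2 * card S / M * en"
    by (simp add: power_mult_distrib power_divide) (simp add: power2_eq_square mult_ac)
  then have "card S * (b\<^sup>2 * card S * M) \<le> card S * (20736 * ?K\<^sup>2 * en)" using M by (simp add: field_simps)
  then have "b\<^sup>2 * card S * M \<le> 20736 * ?K\<^sup>2 * en" using cS by simp
  also have "\<dots> \<le> 40000 * ?K\<^sup>2 * en" using en_nonneg by (intro mult_right_mono) auto
  finally show ?thesis .
qed

end

lemma exp4_ge_24: "(24::real) \<le> exp 4"
proof -
  have "(5/2::real) \<le> exp 1" using exp_lower_Taylor_quadratic[of 1] by (simp add: power2_eq_square)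
  then have "(5/2::real) ^ 4 \<le> exp 1 ^ 4" by (intro power_mono) auto
  also have "exp 1 ^ 4 = exp (4::real)" by (simp flip: exp_of_nat_mult)
  finally show ?thesis by (simp add: power4_eq_xxxx)
qed

lemma maximal_separated_subset:
  fixes T :: "'a::metric_space set"
  assumes T: "finite T"
  shows "\<exists>S\<subseteq>T. (\<forall>p\<in>S. \<forall>q\<in>S. p \<noteq> q \<longrightarrow> dist p q > \<delta>) \<and> (\<forall>q\<in>T - S. \<exists>p\<in>S. dist p q \<le> \<delta>)"
proof -
  let ?sep = "\<lambda>S. \<forall>p\<in>S. \<forall>q\<in>S. p \<noteq> q \<longrightarrow> dist p q > \<delta>"
  define A where "A = {S. S \<subseteq> T \<and> ?sep S}"
  have "finite A" using T by (intro finite_subset[of A "Pow T"]) (auto simp: A_def)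
  moreover have "{} \<in> A" by (simp add: A_def)
  ultimately obtain S where S: "S \<in> A" "\<And>S'. S' \<in> A \<Longrightarrow> S \<subseteq> S' \<Longrightarrow> S = S'"
    using finite_has_maximal[of A] by blast
  have "\<forall>q\<in>T - S. \<exists>p\<in>S. dist p q \<le> \<delta>"
  proof (rule ballI, rule ccontr)
    fix q assume q: "q \<in> T - S"
    assume "\<not> (\<exists>p\<in>S. dist p q \<le> \<delta>)"
    then have "dist p q > \<delta>" "dist q p > \<delta>" if "p \<in> S" for p
      using that by (auto simp: not_le dist_commute[of q])
    then have "insert q S \<in> A" using S(1) q unfolding A_def by blast
    then have "S = insert q S" by (rule S(2)) auto
    then show False using q by blast
  qed
  moreover have "S \<subseteq> T" "?sep S" using S(1) by (simp_all add: A_def)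
  ultimately show ?thesis by (intro exI[of _ S] conjI)
qed

context dislocated_square
begin

text \<open>The three easy cases are those without dislocations near \<open>mid\<close>, with a square of side comparable to
  \<open>b / e0\<close>, and with so many dislocations that their number alone suffices.  Otherwise the square is large,
  and the separated dislocations are either numerous (\<open>separated_estimate\<close>) or few
  (\<open>covering_estimate\<close>).\<close>

lemma square_lower_bound:
  assumes XL: "X \<le> b / e0 * (1 + ln (b / (e0 * r0)))" and core: "b / e0 \<ge> 64 ^ 4 * r0"
  shows "(e0 * X)\<^sup>2 \<le> 10 ^ 10 * bump_const ^ 4 * (en + b\<^sup>2 * near)"
proof -
  let ?K = bump_const
  have K: "?K \<ge> 1" by (rule bump_const)
  have K24: "?K\<^sup>2 \<le> ?K ^ 4" "1 \<le> ?K\<^sup>2" "?K \<le> ?K ^ 4" "?K \<le> ?K\<^sup>2"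
    using K power_increasing[of 2 4 ?K] power_increasing[of 1 4 ?K] power_increasing[of 1 2 ?K] by auto
  have ten: "(10::real) ^ 10 = 10000000000" by simp
  define l L where "l = b / e0" and "L = 1 + ln (b / (e0 * r0))"
  define m where "m = X / l"
  have l: "l > 0" using b e0 by (simp add: l_def)
  have m: "m > 0" "m \<le> L" "X = m * l" using X l XL
    by (simp_all add: m_def pos_divide_le_eq mult.commute flip: l_def L_def)
  have e0X: "e0 * X = b * m" using m(3) e0 by (simp add: l_def)
  have nn: "0 \<le> b\<^sup>2 * near" by simp
  have finish: ?thesis if "(e0 * X)\<^sup>2 \<le> C * en" "C \<le> 10 ^ 10 * ?K ^ 4" for C
  proof -
    have "C * en \<le> 10 ^ 10 * ?K ^ 4 * (en + b\<^sup>2 * near)"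
      using that(2) en_nonneg nn K by (intro mult_mono) auto
    with that(1) show ?thesis by linarith
  qed
  have finish2: ?thesis if "(e0 * X)\<^sup>2 \<le> C * (b\<^sup>2 * near)" "C \<le> 10 ^ 10 * ?K ^ 4" for C
  proof -
    have "C * (b\<^sup>2 * near) \<le> 10 ^ 10 * ?K ^ 4 * (en + b\<^sup>2 * near)"
      using that(2) en_nonneg nn K by (intro mult_mono) auto
    with that(1) show ?thesis by linarith
  qed
  \<comment> \<open>\<open>72000 * ?K\<^sup>2\<close> makes \<open>exp (L / 2)\<close> exceed the constants in \<open>key\<close>, \<open>5120 * ?K\<close> is what \<open>few\<close> below consumes\<close>
  consider (free) "near = 0" | (small) "near \<ge> 1" "m \<le> 72000 * ?K\<^sup>2"
    | (many) "(e0 * X)\<^sup>2 \<le> 5120 * ?K * (b\<^sup>2 * near)"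
    | (large) "m > 72000 * ?K\<^sup>2" "5120 * ?K * (b\<^sup>2 * near) < (e0 * X)\<^sup>2"
    by linarith
  then show ?thesis
  proof cases
    case free
    have "(e0 * X)\<^sup>2 \<le> 2 * 10 ^ 9 * ?K ^ 4 * en"
    proof (rule covering_estimate[of "{}" 1])
      fix p assume p: "p \<in># P" "dist p mid \<le> X / 4"
      then have "p \<in># filter_mset (\<lambda>p. dist p mid \<le> 3 * X / 8) P" using X by simp
      then show "\<exists>c r. (c,r) \<in> {} \<and> cball p r0 \<subseteq> cball c r" using free unfolding near_def by (metis empty_not_add_mset multi_member_split size_eq_0_iff_empty)
    qed (use X K in \<open>auto simp: total_radius_def\<close>)
    then show ?thesis by (rule finish) (use K in auto)
  next
    case small
    have "(e0 * X)\<^sup>2 = m\<^sup>2 * b\<^sup>2" unfolding e0X by (simp add: power_mult_distrib)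
    also have "\<dots> \<le> (72000 * ?K\<^sup>2)\<^sup>2 * (b\<^sup>2 * near)"
      using small m by (intro mult_mono power_mono) (auto simp: mult_le_cancel_left1)
    finally show ?thesis by (rule finish2) (simp add: power_mult_distrib flip: power_mult)
  next
    case many
    then show ?thesis by (rule finish2, unfold ten) (use K24 K in linarith)
  next
    case large
    have L: "L > 72000 * ?K\<^sup>2" "L \<ge> 16" using large m K24(2) by linarith+
    \<comment> \<open>the number of scales: as \<open>24 ^ M \<le> exp (L / 2)\<close>, growing and merging \<open>M\<close> balls over \<open>M\<close> scales costs a factor well below \<open>l / r0\<close>\<close>
    define M where "M = nat \<lfloor>L / 8\<rfloor>"
    have M: "real M \<le> L / 8" "real M \<ge> L / 16" using L(2) by (auto simp: M_def) linarith+
    have M0: "M > 0" using M(2) L(2) by (cases M) auto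
    define q where "q = 2 ^ M * r0"
    have l_eq: "l = exp (L - 1) * r0" using b e0 r0 by (simp add: L_def l_def)
    have e24: "(24::real) ^ M \<le> exp (L / 2)"
    proof -
      have "(24::real) ^ M \<le> exp 4 ^ M" by (intro power_mono exp4_ge_24) auto
      also have "\<dots> = exp (M * 4)" by (simp add: exp_of_nat_mult)
      also have "\<dots> \<le> exp (L / 2)" using M(1) by simp
      finally show ?thesis .
    qed
    have key: "3 * exp (L / 2) * r0 \<le> l / (4000 * ?K\<^sup>2)"
    proof -
      have "36000 * ?K\<^sup>2 \<le> exp (L / 2)" using exp_ge_add_one_self[of "L / 2"] L(1) by linarith
      then have 1: "exp (L / 2) * (36000 * ?K\<^sup>2) \<le> exp (L / 2) * exp (L / 2)" by (intro mult_left_mono) auto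
      have "exp (L / 2) * exp (L / 2) = exp (L - 1) * exp 1" by (simp flip: exp_add)
      also have "\<dots> \<le> exp (L - 1) * 3" by (intro mult_left_mono exp_le) auto
      finally have "exp (L / 2) * (12000 * ?K\<^sup>2) \<le> exp (L - 1)" using 1 by linarith
      then have "exp (L / 2) * (12000 * ?K\<^sup>2) * r0 \<le> l" using r0 unfolding l_eq by (intro mult_right_mono) auto
      moreover have "0 < 4000 * ?K\<^sup>2" using K24(2) by linarith
      ultimately show ?thesis by (subst pos_le_divide_eq) (simp_all add: mult_ac)
    qed
    have q_le: "q \<le> l / (12000 * ?K\<^sup>2)"
    proof -
      have "(2::real) ^ M \<le> 24 ^ M" by (intro power_mono) auto
      then have "q \<le> exp (L / 2) * r0" using e24 r0 unfolding q_def by (intro mult_right_mono) auto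
      then show ?thesis using key by simp
    qed
    have lX: "l \<le> X"
    proof -
      have "1 * l \<le> m * l" using large K24(2) l by (intro mult_right_mono) auto
      then show ?thesis using m(3) by simp
    qed
    have q0: "q > 0" using r0 by (simp add: q_def)
    obtain S where S: "S \<subseteq> {p \<in> set_mset P. dist p mid \<le> X / 4}"
      "\<forall>p\<in>S. \<forall>p'\<in>S. p \<noteq> p' \<longrightarrow> dist p p' > 2 * q"
      "\<forall>p'\<in>{p \<in> set_mset P. dist p mid \<le> X / 4} - S. \<exists>p\<in>S. dist p p' \<le> 2 * q"
      using maximal_separated_subset[of "{p \<in> set_mset P. dist p mid \<le> X / 4}" "2 * q"] by auto
    have finS: "finite S" using S(1) finite_subset by fastforce
    show ?thesis
    proof (cases "real (card S) > m / 8")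
      case True
      have few: "40 * ?K * near \<le> real (card S) * M"
      proof -
        have "b\<^sup>2 * (5120 * ?K * near) \<le> b\<^sup>2 * m\<^sup>2" using large(2) unfolding e0X by (simp add: power_mult_distrib mult_ac)
        then have "5120 * ?K * near \<le> m\<^sup>2" using b by simp
        moreover have "m\<^sup>2 \<le> 128 * (m / 8 * (L / 16))" using m by (simp add: power2_eq_square)
        moreover have "m / 8 * (L / 16) \<le> real (card S) * M" using True M L m by (intro mult_mono) auto
        ultimately show ?thesis by linarith
      qed
      have "b\<^sup>2 * card S * M \<le> 40000 * ?K\<^sup>2 * en"
      proof (rule separated_estimate[OF finS _ _ _ _ M0 _ _ few])
        show "S \<noteq> {}" using True m by auto
        show "2 ^ M * r0 \<le> X / 64"
        proof -
          have "l / (12000 * ?K\<^sup>2) \<le> l / 64" using K24(2) l by (intro divide_left_mono) auto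
          then show ?thesis using q_le lX unfolding q_def by linarith
        qed
        show "2 ^ M * r0 \<le> b / (96 * ?K * e0)"
        proof -
          have "l / (12000 * ?K\<^sup>2) \<le> l / (96 * ?K)" using K24 K l by (intro divide_left_mono) auto
          then show ?thesis using q_le by (simp add: q_def l_def mult_ac)
        qed
      qed (use S in \<open>auto simp: q_def\<close>)
      moreover have "b\<^sup>2 * (m / 8) * (m / 16) \<le> b\<^sup>2 * card S * M"
        using True M m by (intro mult_mono mult_left_mono) auto
      ultimately have "b\<^sup>2 * m\<^sup>2 \<le> 5120000 * ?K\<^sup>2 * en" by (simp add: power2_eq_square)
      then have "(e0 * X)\<^sup>2 \<le> 5120000 * ?K\<^sup>2 * en" unfolding e0X by (simp add: power_mult_distrib)
      then show ?thesis by (rule finish, unfold ten) (use K24 in linarith)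
    next
      case False
      then have "real (card S) \<le> L / 8" using m by linarith
      then have cM: "card S \<le> M" unfolding M_def by (simp add: le_nat_floor)
      define GG where "GG = (\<lambda>p. (p, 3 * q)) ` S"
      have cG: "card GG = card S" unfolding GG_def by (rule card_image) (auto simp: inj_on_def)
      have tG: "total_radius GG = card S * (3 * q)"
        unfolding GG_def total_radius_def by (subst sum.reindex) (auto simp: inj_on_def)
      have "(e0 * X)\<^sup>2 \<le> 2 * 10 ^ 9 * ?K ^ 4 * en"
      proof (rule covering_estimate[of GG M])
        show "finite GG" "\<forall>(c,r)\<in>GG. r > 0" using finS q0 by (auto simp: GG_def)
        show "M > 0" "card GG \<le> M" using M0 cM cG by auto
        fix p assume p: "p \<in># P" "dist p mid \<le> X / 4"
        have "\<exists>p'\<in>S. dist p' p \<le> 2 * q"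
          using p S(3) q0 by (cases "p \<in> S") (auto intro!: bexI[of _ p])
        then obtain p' where p': "p' \<in> S" "dist p' p \<le> 2 * q" by blast
        have "(1::real) \<le> 2 ^ M" by simp
        then have "r0 \<le> q" using r0 by (simp add: q_def)
        have "cball p r0 \<subseteq> cball p' (3 * q)"
        proof
          fix z assume "z \<in> cball p r0"
          then show "z \<in> cball p' (3 * q)" using p'(2) \<open>r0 \<le> q\<close> dist_triangle[of p' z p] by simp
        qed
        then show "\<exists>c r. (c,r) \<in> GG \<and> cball p r0 \<subseteq> cball c r" using p'(1) by (auto simp: GG_def)
      next
        have "2 ^ M * (total_radius GG * 3 ^ card GG) \<le> 2 ^ M * ((M * (3 * q)) * 3 ^ M)"
          unfolding tG cG using cM q0 by (intro mult_left_mono mult_mono mult_right_mono power_increasing) auto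
        also have "\<dots> \<le> 2 ^ M * ((2 ^ M * (3 * q)) * 3 ^ M)"
          using q0 of_nat_less_two_power[of M, where 'a=real] by (intro mult_left_mono mult_right_mono) auto
        also have "\<dots> = 3 * ((2 * 2 * 2 * 3) ^ M) * r0"
          unfolding q_def power_mult_distrib by (simp add: mult_ac)
        also have "\<dots> \<le> 3 * exp (L / 2) * r0" using e24 r0 by simp
        also have "\<dots> \<le> l / (4000 * ?K\<^sup>2)" by (rule key)
        also have "\<dots> \<le> X / (4000 * ?K\<^sup>2)" using lX by (intro divide_right_mono) auto
        finally show "2 ^ M * (total_radius GG * 3 ^ card GG) \<le> X / (4000 * ?K\<^sup>2)" .
      qed
      then show ?thesis by (rule finish) (use K in auto)
    qed
  qed
qed

end

section \<open>Lipschitz functions of one variable are integrals of their derivatives\<close>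

lemma bilipschitz_homeomorphism:
  fixes g :: "real \<Rightarrow> real"
  assumes up: "\<And>x y. x \<le> y \<Longrightarrow> y - x \<le> g y - g x" and cont: "continuous_on UNIV g"
  obtains k where "\<And>x. k (g x) = x" "\<And>y. g (k y) = y" "mono k"
proof -
  have inj: "x = y" if "g x = g y" for x y
    using up[of x y] up[of y x] that by linarith
  have "\<exists>x. g x = y" for y
  proof -
    define t where "t = \<bar>y - g 0\<bar>"
    have "g (- t) \<le> y" "y \<le> g t" using up[of "-t" 0] up[of 0 t] unfolding t_def by linarith+
    moreover have "- t \<le> t" by (simp add: t_def)
    moreover have "continuous_on {- t..t} g" using cont by (rule continuous_on_subset) simp
    ultimately show ?thesis using IVT'[of g "-t" y t] by blast
  qed
  then obtain k where k: "\<And>y. g (k y) = y" by metis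
  then have k2: "k (g x) = x" for x using inj by blast
  have "mono k"
  proof (rule monoI)
    fix x y :: real assume "x \<le> y"
    then show "k x \<le> k y" using up[of "k y" "k x"] k[of x] k[of y] by linarith
  qed
  then show ?thesis by (rule that[OF k2 k])
qed

text \<open>The derivative of \<open>g\<close> as a Radon-Nikodym density: the image of Lebesgue measure under the inverse of \<open>g\<close>
  gives \<open>{x..y}\<close> the mass \<open>g y - g x\<close>, and it is absolutely continuous because the Lipschitz function \<open>g\<close>
  maps null sets to null sets.\<close>

lemma bilipschitz_density:
  fixes g :: "real \<Rightarrow> real"
  assumes up: "\<And>x y. x \<le> y \<Longrightarrow> y - x \<le> g y - g x" and lip: "C-lipschitz_on UNIV g"
  shows "\<exists>\<phi>\<in>borel_measurable borel. \<forall>x y. x \<le> y \<longrightarrow>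
     set_integrable lborel {x..y} \<phi> \<and> (LINT u:{x..y}|lborel. \<phi> u) = g y - g x"
proof -
  obtain k where k: "\<And>x. k (g x) = x" "\<And>y. g (k y) = y" "mono k"
    using bilipschitz_homeomorphism[OF up lipschitz_on_continuous_on[OF lip]] by blast
  have km: "k \<in> borel_measurable borel" by (rule borel_measurable_mono[OF k(3)])
  define N where "N = distr lborel borel k"
  have vim: "k -` A = g ` A" for A :: "real set"
  proof (intro set_eqI iffI)
    fix y assume "y \<in> k -` A"
    then show "y \<in> g ` A" using k(2)[of y] by (intro image_eqI[of _ _ "k y"]) auto
  qed (use k(1) in auto)
  have ac: "absolutely_continuous lborel N"
    unfolding absolutely_continuous_def
  proof
    fix A :: "real set" assume A: "A \<in> null_sets lborel"
    then have "negligible A" by (simp add: negligible_iff_null_sets null_sets_completionI)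
    then have "negligible (g ` A)"
      using lip by (intro negligible_locally_Lipschitz_image[of A g]) (auto simp: lipschitz_on_def dist_norm)
    then have "k -` A \<in> null_sets lebesgue" by (simp add: vim negligible_iff_null_sets)
    moreover have As: "A \<in> sets borel" using A by (auto simp: null_sets_def)
    then have "k -` A \<in> sets lborel" using measurable_sets_borel[OF km] by simp
    ultimately have "k -` A \<in> null_sets lborel" by (simp add: null_sets_completion_iff)
    then have "emeasure lborel (k -` A) = 0" by (simp add: null_sets_def)
    then show "A \<in> null_sets N" using As km by (simp add: null_sets_def N_def emeasure_distr)
  qed
  then obtain f where f: "f \<in> borel_measurable lborel" "density lborel f = N"
    using sigma_finite_measure.Radon_Nikodym[OF sigma_finite_lborel ac] by (auto simp: N_def)
  define \<phi> where "\<phi> x = enn2real (f x)" for x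
  have \<phi>m: "\<phi> \<in> borel_measurable borel" using f(1) by (simp add: \<phi>_def[abs_def])
  have "set_integrable lborel {x..y} \<phi> \<and> (LINT u:{x..y}|lborel. \<phi> u) = g y - g x" if xy: "x \<le> y" for x y
  proof -
    have gxy: "g x \<le> g y" using up[OF xy] xy by linarith
    have img: "g ` {x..y} = {g x..g y}"
    proof
      show "g ` {x..y} \<subseteq> {g x..g y}"
      proof
        fix v assume "v \<in> g ` {x..y}"
        then obtain u where "v = g u" "x \<le> u" "u \<le> y" by auto
        then show "v \<in> {g x..g y}" using up[of x u] up[of u y] by auto
      qed
      show "{g x..g y} \<subseteq> g ` {x..y}"
      proof
        fix v assume "v \<in> {g x..g y}"
        then have "k (g x) \<le> k v" "k v \<le> k (g y)" using k(3) by (auto simp: mono_def)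
        then show "v \<in> g ` {x..y}" using k by (intro image_eqI[of _ _ "k v"]) auto
      qed
    qed
    have "(\<integral>\<^sup>+u. f u * indicator {x..y} u \<partial>lborel) = emeasure N {x..y}"
      using f by (simp add: emeasure_density flip: f(2))
    also have "\<dots> = emeasure lborel (k -` {x..y})" using km by (simp add: N_def emeasure_distr)
    also have "\<dots> = ennreal (g y - g x)" using gxy by (simp add: vim img)
    finally have nn: "(\<integral>\<^sup>+u. f u * indicator {x..y} u \<partial>lborel) = ennreal (g y - g x)" .
    then have "AE u in lborel. f u * indicator {x..y} u \<noteq> \<infinity>"
      using f(1) by (intro nn_integral_noteq_infinite) auto
    then have "AE u in lborel. f u * indicator {x..y} u = ennreal (indicator {x..y} u *\<^sub>R \<phi> u)"
      by eventually_elim (auto simp: \<phi>_def indicator_def ennreal_enn2real_if)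
    then have "(\<integral>\<^sup>+u. ennreal (indicator {x..y} u *\<^sub>R \<phi> u) \<partial>lborel) = ennreal (g y - g x)"
      using nn nn_integral_cong_AE by force
    then have "integrable lborel (\<lambda>u. indicator {x..y} u *\<^sub>R \<phi> u) \<and> (LINT u|lborel. indicator {x..y} u *\<^sub>R \<phi> u) = g y - g x"
    proof (subst (asm) nn_integral_eq_integrable)
      show "(\<lambda>u. indicator {x..y} u *\<^sub>R \<phi> u) \<in> borel_measurable lborel" using \<phi>m by simp
    qed (use gxy in \<open>auto simp: \<phi>_def\<close>)
    then show ?thesis by (simp add: set_integrable_def set_lebesgue_integral_def)
  qed
  then show ?thesis using \<phi>m by blast
qed

lemma right_derivative_ae:
  fixes g \<phi> :: "real \<Rightarrow> real"
  assumes \<phi>: "\<And>x y. x \<le> y \<Longrightarrow> (\<phi> has_integral (g y - g x)) {x..y}"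
  shows "\<exists>N. negligible N \<and> (\<forall>x. x \<notin> N \<longrightarrow> (g has_real_derivative \<phi> x) (at_right x))"
proof -
  have int: "\<phi> integrable_on cbox a b" for a b
    using \<phi>[of a b] by (cases "a \<le> b") auto
  obtain N where N: "negligible N"
       "\<And>x e. \<lbrakk>x \<notin> N; 0 < e\<rbrakk> \<Longrightarrow> \<exists>d>0. \<forall>h. 0 < h \<and> h < d \<longrightarrow>
                         norm (integral (cbox x (x + h *\<^sub>R One)) \<phi> /\<^sub>R h ^ DIM(real) - \<phi> x) < e"
    by (rule integrable_ccontinuous_explicit[OF int]) (rule that)
  have "(g has_real_derivative \<phi> x) (at_right x)" if x: "x \<notin> N" for x
    unfolding has_field_derivative_iff
  proof (rule tendstoI)
    fix e :: real assume "e > 0"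
    then obtain d where d: "d > 0" "\<And>h. 0 < h \<Longrightarrow> h < d \<Longrightarrow> norm (integral (cbox x (x + h *\<^sub>R One)) \<phi> /\<^sub>R h ^ DIM(real) - \<phi> x) < e"
      using N(2)[OF x] by blast
    have "dist ((g y - g x) / (y - x)) (\<phi> x) < e" if y: "x < y" "y < x + d" for y
    proof -
      have "integral {x..y} \<phi> = g y - g x" using \<phi>[of x y] y by (intro integral_unique) auto
      then have "norm ((g y - g x) /\<^sub>R (y - x) - \<phi> x) < e" using d(2)[of "y - x"] y by simp
      moreover have "(g y - g x) /\<^sub>R (y - x) = (g y - g x) / (y - x)" by (simp only: real_scaleR_def divide_inverse_commute)
      ultimately show ?thesis by (simp only: dist_norm)
    qed
    then show "\<forall>\<^sub>F y in at_right x. dist ((g y - g x) / (y - x)) (\<phi> x) < e"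
      unfolding eventually_at_right_field using d(1) by (intro exI[of _ "x + d"]) auto
  qed
  then show ?thesis using N(1) by blast
qed

lemma derivative_ae:
  fixes g \<phi> :: "real \<Rightarrow> real"
  assumes \<phi>: "\<And>x y. x \<le> y \<Longrightarrow> (\<phi> has_integral (g y - g x)) {x..y}"
  shows "\<exists>N. negligible N \<and> (\<forall>x. x \<notin> N \<longrightarrow> (g has_real_derivative \<phi> x) (at x))"
proof -
  obtain N1 where N1: "negligible N1" "\<And>x. x \<notin> N1 \<Longrightarrow> (g has_real_derivative \<phi> x) (at_right x)"
    using right_derivative_ae[OF \<phi>] by blast
  have "((\<lambda>u. \<phi> (- u)) has_integral (- g (- y) - - g (- x))) {x..y}" if "x \<le> y" for x y
  proof -
    have "(\<phi> has_integral (g (- x) - g (- y))) {- y..- x}" using \<phi>[of "- y" "- x"] that by simp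
    then have "((\<lambda>u. \<phi> (- u)) has_integral (g (- x) - g (- y))) {- (- x)..- (- y)}"
      by (subst has_integral_reflect_real)
    then show ?thesis by (simp add: algebra_simps)
  qed
  from right_derivative_ae[OF this] obtain N2 where N2: "negligible N2"
    "\<And>x. x \<notin> N2 \<Longrightarrow> ((\<lambda>u. - g (- u)) has_real_derivative \<phi> (- x)) (at_right x)" by blast
  have left: "(g has_real_derivative \<phi> x) (at_left x)" if "- x \<notin> N2" for x
  proof -
    have "((\<lambda>y. (- g (- y) - - g (- (- x))) / (y - - x)) \<longlongrightarrow> \<phi> x) (at_right (- x))"
      using N2(2)[OF that] by (simp add: has_field_derivative_iff)
    moreover have "(- g (- y) - - g (- (- x))) / (y - - x) = (g (- y) - g x) / (- y - x)" for y
      using minus_divide_divide[of "g (- y) - g x" "- y - x"] by (simp add: algebra_simps)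
    ultimately have "((\<lambda>y. (g y - g x) / (y - x)) \<longlongrightarrow> \<phi> x) (at_left x)"
      unfolding filterlim_at_left_to_right by simp
    then show ?thesis by (simp add: has_field_derivative_iff)
  qed
  have neg: "negligible (uminus ` N2)"
    by (rule negligible_locally_Lipschitz_image[OF _ N2(1)])
       (auto intro!: exI[of _ UNIV] exI[of _ "1::real"] simp: abs_minus_commute)
  show ?thesis
  proof (intro exI[of _ "N1 \<union> uminus ` N2"] conjI allI impI)
    show "negligible (N1 \<union> uminus ` N2)" using N1(1) neg by (rule negligible_Un)
    fix x assume x: "x \<notin> N1 \<union> uminus ` N2"
    then have "- x \<notin> N2" by (metis UnI2 add.inverse_inverse image_eqI)
    then show "(g has_real_derivative \<phi> x) (at x)"
      using left N1(2) x by (simp add: has_field_derivative_iff filterlim_split_at)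
  qed
qed

text \<open>Adding \<open>(C + 1) * x\<close> to a Lipschitz function makes it strictly increasing with slope at least \<open>1\<close>, which
  reduces the claim to \<open>bilipschitz_density\<close> and to Lebesgue's differentiation theorem.\<close>

lemma lipschitz_derivative:
  fixes h :: "real \<Rightarrow> real"
  assumes lip: "C-lipschitz_on {0..1} h"
  shows "\<exists>\<phi>\<in>borel_measurable borel. (\<forall>x y. 0 \<le> x \<longrightarrow> x \<le> y \<longrightarrow> y \<le> 1 \<longrightarrow>
      set_integrable lborel {x..y} \<phi> \<and> (LINT u:{x..y}|lborel. \<phi> u) = h y - h x) \<and>
    (\<exists>N. negligible N \<and> (\<forall>x\<in>{0..1} - N. deriv h x = \<phi> x))"
proof -
  \<comment> \<open>the extension of \<open>h\<close> by constants\<close>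
  define h1 where "h1 x = h (max 0 (min 1 x))" for x
  have C: "C \<ge> 0" using lip by (simp add: lipschitz_on_def)
  have h1: "\<bar>h1 x - h1 y\<bar> \<le> C * \<bar>x - y\<bar>" for x y
  proof -
    have "\<bar>h1 x - h1 y\<bar> \<le> C * \<bar>max 0 (min 1 x) - max 0 (min 1 y)\<bar>"
      using lipschitz_onD[OF lip, of "max 0 (min 1 x)" "max 0 (min 1 y)"] by (simp add: h1_def dist_real_def)
    also have "\<dots> \<le> C * \<bar>x - y\<bar>" using C by (intro mult_left_mono) auto
    finally show ?thesis .
  qed
  define g where "g x = h1 x + (C + 1) * x" for x
  have up: "y - x \<le> g y - g x" if "x \<le> y" for x y
    using h1[of y x] that by (simp add: g_def algebra_simps)
  have "(2 * C + 1)-lipschitz_on UNIV g"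
  proof (rule lipschitz_onI)
    fix x y
    have "\<bar>g x - g y\<bar> \<le> \<bar>h1 x - h1 y\<bar> + \<bar>(C + 1) * (x - y)\<bar>" by (simp add: g_def algebra_simps)
    also have "\<dots> \<le> C * \<bar>x - y\<bar> + (C + 1) * \<bar>x - y\<bar>" using h1[of x y] C by (simp add: abs_mult)
    finally show "dist (g x) (g y) \<le> (2 * C + 1) * dist x y" by (simp add: dist_real_def algebra_simps)
  qed (use C in auto)
  from bilipschitz_density[OF up this] obtain \<psi> where \<psi>: "\<psi> \<in> borel_measurable borel"
    "\<And>x y. x \<le> y \<Longrightarrow> set_integrable lborel {x..y} \<psi>" "\<And>x y. x \<le> y \<Longrightarrow> (LINT u:{x..y}|lborel. \<psi> u) = g y - g x" by blast
  have hi: "(\<psi> has_integral (g y - g x)) {x..y}" if "x \<le> y" for x y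
    using set_borel_integral_eq_integral[OF \<psi>(2)[OF that]] \<psi>(3)[OF that] by (simp add: has_integral_iff)
  from derivative_ae[OF hi] obtain N where N: "negligible N" "\<And>x. x \<notin> N \<Longrightarrow> (g has_real_derivative \<psi> x) (at x)"
    by blast
  define \<phi> where "\<phi> x = \<psi> x - (C + 1)" for x
  have c: "set_integrable lborel {x..y} (\<lambda>u. C + 1)" "(LINT u:{x..y}|lborel. C + 1) = (C + 1) * (y - x)" if "x \<le> y" for x y :: real
    using that by (simp_all add: set_integrable_def set_lebesgue_integral_def integrable_indicator_iff)
  have h1_eq: "h1 x = h x" if "0 \<le> x" "x \<le> 1" for x using that by (simp add: h1_def)
  have int: "set_integrable lborel {x..y} \<phi>" "(LINT u:{x..y}|lborel. \<phi> u) = h y - h x" if "0 \<le> x" "x \<le> y" "y \<le> 1" for x y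
    unfolding \<phi>_def using that by (auto intro!: set_integral_diff \<psi> c simp: set_integral_diff(2)[OF \<psi>(2) c(1)] \<psi> c g_def h1_eq algebra_simps)
  have der: "deriv h x = \<phi> x" if x: "x \<in> {0..1} - (N \<union> {0, 1})" for x
  proof -
    have "((\<lambda>x. g x - (C + 1) * x) has_real_derivative \<phi> x) (at x)"
      unfolding \<phi>_def using N(2) x by (auto intro!: derivative_eq_intros)
    then have "(h has_real_derivative \<phi> x) (at x)"
      by (rule has_field_derivative_transform_within_open[where S="{0<..<1}"]) (use x in \<open>auto simp: g_def h1_def max_def min_def\<close>)
    then show ?thesis by (rule DERIV_imp_deriv)
  qed
  have neg: "negligible (N \<union> {0, 1})" using N(1) by simp
  have m: "\<phi> \<in> borel_measurable borel" unfolding \<phi>_def[abs_def] using \<psi>(1) by simp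
  have A: "\<forall>x y. 0 \<le> x \<longrightarrow> x \<le> y \<longrightarrow> y \<le> 1 \<longrightarrow>
      set_integrable lborel {x..y} \<phi> \<and> (LINT u:{x..y}|lborel. \<phi> u) = h y - h x"
    using int by simp
  have B: "\<exists>N. negligible N \<and> (\<forall>x\<in>{0..1} - N. deriv h x = \<phi> x)"
    by (intro exI[of _ "N \<union> {0, 1}"] conjI neg ballI der)
  show ?thesis using A B m by (intro bexI[of _ \<phi>] conjI)
qed

section \<open>The graph: length, height and inscribed squares\<close>

lemma integral_split_equal:
  fixes f :: "real \<Rightarrow> real"
  assumes f: "f integrable_on {0..1}" and n: "n > 0"
  shows "integral {0..1} f = (\<Sum>i<n. integral {real i / n..real (Suc i) / n} f)"
proof -
  have "integral {0..real k / n} f = (\<Sum>i<k. integral {real i / n..real (Suc i) / n} f)" if "k \<le> n" for k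
    using that
  proof (induction k)
    case (Suc k)
    have le: "real k / n \<le> real (Suc k) / n" "real (Suc k) / n \<le> 1" using Suc.prems n by (auto simp: divide_right_mono)
    have "f integrable_on {0..real (Suc k) / n}" using le by (intro integrable_on_subinterval[OF f]) auto
    then have "integral {0..real (Suc k) / n} f = integral {0..real k / n} f + integral {real k / n..real (Suc k) / n} f"
      using le by (intro Henstock_Kurzweil_Integration.integral_combine[symmetric]) auto
    then show ?case using Suc by simp
  qed simp
  from this[of n] show ?thesis using n by simp
qed

lemma film_length:
  fixes h :: "real \<Rightarrow> real"
  assumes lip: "C-lipschitz_on {0..1} h"
  obtains \<Lambda> \<phi> where "(\<integral>\<^sup>+x\<in>{0..1}. ennreal (sqrt (1 + (deriv h x)\<^sup>2)) \<partial>lebesgue) = ennreal \<Lambda>" "\<Lambda> \<ge> 1"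
    "(\<lambda>u. \<bar>\<phi> u\<bar>) integrable_on {0..1}" "integral {0..1} (\<lambda>u. \<bar>\<phi> u\<bar>) \<le> \<Lambda>"
    "\<And>x y. 0 \<le> x \<Longrightarrow> x \<le> y \<Longrightarrow> y \<le> 1 \<Longrightarrow> \<bar>h y - h x\<bar> \<le> integral {x..y} (\<lambda>u. \<bar>\<phi> u\<bar>)"
proof -
  obtain \<phi> N where \<phi>: "\<phi> \<in> borel_measurable borel" and N: "negligible N" "\<And>x. x \<in> {0..1} - N \<Longrightarrow> deriv h x = \<phi> x"
    and int: "\<And>x y. 0 \<le> x \<Longrightarrow> x \<le> y \<Longrightarrow> y \<le> 1 \<Longrightarrow> set_integrable lborel {x..y} \<phi>"
      "\<And>x y. 0 \<le> x \<Longrightarrow> x \<le> y \<Longrightarrow> y \<le> 1 \<Longrightarrow> (LINT u:{x..y}|lborel. \<phi> u) = h y - h x"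
    using lipschitz_derivative[OF lip] by metis
  let ?s = "\<lambda>u. sqrt (1 + (\<phi> u)\<^sup>2)"
  have s1: "1 \<le> ?s u" "\<bar>\<phi> u\<bar> \<le> ?s u" "?s u \<le> 1 + \<bar>\<phi> u\<bar>" for u
  proof -
    show "1 \<le> ?s u" "\<bar>\<phi> u\<bar> \<le> ?s u" by (auto intro!: real_le_rsqrt)
    show "?s u \<le> 1 + \<bar>\<phi> u\<bar>" by (intro real_le_lsqrt) (auto simp: power2_sum)
  qed
  have aint: "set_integrable lborel {x..y} (\<lambda>u. \<bar>\<phi> u\<bar>)" if "0 \<le> x" "x \<le> y" "y \<le> 1" for x y
    using int(1)[OF that] by (rule set_integrable_abs)
  have one: "set_integrable lborel {0..1::real} (\<lambda>u. 1::real)"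
    by (simp add: set_integrable_def integrable_indicator_iff)
  have sint: "set_integrable lborel {0..1} ?s"
    unfolding set_integrable_def
  proof (rule Bochner_Integration.integrable_bound)
    show "integrable lborel (\<lambda>u. indicator {0..1} u *\<^sub>R (1 + \<bar>\<phi> u\<bar>))"
      using set_integral_add(1)[OF one aint[of 0 1]] by (simp add: set_integrable_def)
    show "(\<lambda>u. indicator {0..1} u *\<^sub>R ?s u) \<in> borel_measurable lborel" using \<phi> by simp
    have "norm (indicator {0..1} u *\<^sub>R ?s u) \<le> norm (indicator {0..1} u *\<^sub>R (1 + \<bar>\<phi> u\<bar>))" for u
      using s1(3)[of u] s1(1)[of u] by (auto simp: indicator_def)
    then show "AE u in lborel. norm (indicator {0..1} u *\<^sub>R ?s u) \<le> norm (indicator {0..1} u *\<^sub>R (1 + \<bar>\<phi> u\<bar>))" by simp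
  qed
  define \<Lambda> where "\<Lambda> = (LINT u:{0..1}|lborel. ?s u)"
  have "(\<integral>\<^sup>+x\<in>{0..1}. ennreal (sqrt (1 + (deriv h x)\<^sup>2)) \<partial>lebesgue) = (\<integral>\<^sup>+x. ennreal (indicator {0..1} x *\<^sub>R ?s x) \<partial>lebesgue)"
  proof (rule nn_integral_cong_AE)
    have "AE x in lebesgue. x \<notin> N" using N(1) by (simp add: negligible_iff_null_sets AE_not_in)
    then show "AE x in lebesgue. ennreal (sqrt (1 + (deriv h x)\<^sup>2)) * indicator {0..1} x = ennreal (indicator {0..1} x *\<^sub>R ?s x)"
      by eventually_elim (use N(2) in \<open>auto simp: indicator_def\<close>)
  qed
  also have "\<dots> = (\<integral>\<^sup>+x. ennreal (indicator {0..1} x *\<^sub>R ?s x) \<partial>lborel)"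
    by (rule nn_integral_completion)
  also have "\<dots> = ennreal \<Lambda>"
    unfolding \<Lambda>_def set_lebesgue_integral_def
    by (rule nn_integral_eq_integral) (use sint in \<open>auto simp: set_integrable_def\<close>)
  finally have L1: "(\<integral>\<^sup>+x\<in>{0..1}. ennreal (sqrt (1 + (deriv h x)\<^sup>2)) \<partial>lebesgue) = ennreal \<Lambda>" .
  have "(LINT u:{0..1::real}|lborel. 1::real) \<le> \<Lambda>"
    unfolding \<Lambda>_def by (rule set_integral_mono[OF one sint]) (use s1 in auto)
  then have L2: "\<Lambda> \<ge> 1" by (simp add: set_lebesgue_integral_def)
  have HK: "(\<lambda>u. \<bar>\<phi> u\<bar>) integrable_on {x..y}" "(LINT u:{x..y}|lborel. \<bar>\<phi> u\<bar>) = integral {x..y} (\<lambda>u. \<bar>\<phi> u\<bar>)"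
    if "0 \<le> x" "x \<le> y" "y \<le> 1" for x y
    using set_borel_integral_eq_integral[OF aint[OF that]] by auto
  have "(LINT u:{0..1}|lborel. \<bar>\<phi> u\<bar>) \<le> \<Lambda>"
    unfolding \<Lambda>_def by (rule set_integral_mono[OF aint sint]) (use s1 in auto)
  then have L4: "integral {0..1} (\<lambda>u. \<bar>\<phi> u\<bar>) \<le> \<Lambda>" using HK(2)[of 0 1] by simp
  have "\<bar>h y - h x\<bar> \<le> integral {x..y} (\<lambda>u. \<bar>\<phi> u\<bar>)" if "0 \<le> x" "x \<le> y" "y \<le> 1" for x y
  proof -
    have "\<bar>LINT u:{x..y}|lborel. \<phi> u\<bar> \<le> (LINT u:{x..y}|lborel. \<bar>\<phi> u\<bar>)"
      unfolding set_lebesgue_integral_def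
      using integral_abs_bound[of lborel "\<lambda>u. indicator {x..y} u *\<^sub>R \<phi> u"] by (simp add: abs_mult)
    then show ?thesis using int(2)[OF that] HK(2)[OF that] by simp
  qed
  with L1 L2 HK(1)[of 0 1] L4 show ?thesis by (intro that[of \<Lambda> \<phi>]) auto
qed

text \<open>The function \<open>\<phi>\<close> stands for the modulus of the derivative of \<open>h\<close>, and \<open>\<Lambda>\<close> for the length of the graph.\<close>

locale film_profile =
  fixes h :: "real \<Rightarrow> real" and d \<Lambda> :: real and \<phi> :: "real \<Rightarrow> real"
  assumes cont: "continuous_on {0..1} h" and nonneg: "\<And>x. x \<in> {0..1} \<Longrightarrow> h x \<ge> 0"
    and volume: "integral {0..1} h = d" and d: "d > 0" and zero: "h 0 = 0"
    and \<Lambda>1: "\<Lambda> \<ge> 1"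
    and \<phi>: "\<phi> integrable_on {0..1}" "integral {0..1} \<phi> \<le> \<Lambda>" "\<And>u. \<phi> u \<ge> 0"
    and osc: "\<And>x y. 0 \<le> x \<Longrightarrow> x \<le> y \<Longrightarrow> y \<le> 1 \<Longrightarrow> \<bar>h y - h x\<bar> \<le> integral {x..y} \<phi>"
begin

lemma sub_int: "0 \<le> x \<Longrightarrow> y \<le> 1 \<Longrightarrow> \<phi> integrable_on {x..y}"
  by (rule integrable_on_subinterval[OF \<phi>(1)]) auto

lemma h_le: "x \<in> {0..1} \<Longrightarrow> h x \<le> \<Lambda>"
proof -
  assume x: "x \<in> {0..1}"
  have "\<bar>h x - h 0\<bar> \<le> integral {0..x} \<phi>" using x by (intro osc) auto
  also have "\<dots> \<le> integral {0..1} \<phi>" using x \<phi> sub_int by (intro integral_subset_le) auto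
  finally show ?thesis using \<phi>(2) zero by simp
qed

lemma d_le: "d \<le> \<Lambda>"
proof -
  have i: "h integrable_on {0..1}" using cont by (rule integrable_continuous_interval)
  have "integral {0..1} h \<le> integral {0..1} (\<lambda>x::real. \<Lambda>)"
    by (rule integral_le[OF i integrable_const_ivl]) (rule h_le)
  then show ?thesis by (simp add: volume)
qed

text \<open>An interval of the grid that does not carry a square contains a point where \<open>h\<close> is below \<open>1 / n\<close>, so the
  volume above it is at most \<open>1 / n\<close> times \<open>1 / n\<close> plus the variation of \<open>h\<close> there.  These intervals account for at most
  half of the volume, as the total variation is at most \<open>\<Lambda>\<close>; each of the others accounts for at
  most \<open>\<Lambda> / n\<close>.\<close>

lemma many_squares:
  assumes n: "n > 0" and X: "1 / real n \<le> d / (4 * \<Lambda>)"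
  shows "d / (2 * \<Lambda>) \<le> card {i. i < n \<and> (\<forall>x\<in>{real i / n..real (Suc i) / n}. h x \<ge> 1 / n)} * (1 / n)"
proof -
  let ?X = "1 / real n"
  let ?Q = "\<lambda>i. {real i / n..real (Suc i) / n}"
  let ?I = "{i. i < n \<and> (\<forall>x\<in>?Q i. h x \<ge> ?X)}"
  define V where "V i = integral (?Q i) \<phi>" for i
  have X0: "?X > 0" using n by simp
  have sub: "?Q i \<subseteq> {0..1}" if "i < n" for i
  proof -
    have "real (Suc i) / n \<le> 1" using that by simp
    then show ?thesis by (auto intro: order_trans)
  qed
  have hint: "h integrable_on ?Q i" if "i < n" for i
    using continuous_on_subset[OF cont sub[OF that]] by (rule integrable_continuous_interval)
  have const: "integral (?Q i) (\<lambda>x. c) = ?X * c" for i c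
    using n by (simp add: field_simps)
  have V0: "V i \<ge> 0" if "i < n" for i
    unfolding V_def using \<phi>(3) sub[OF that] by (intro integral_nonneg integrable_on_subinterval[OF \<phi>(1)]) auto
  have sumV: "(\<Sum>i<n. V i) \<le> \<Lambda>"
    using integral_split_equal[OF \<phi>(1) n] \<phi>(2) by (simp add: V_def)
  have good: "integral (?Q i) h \<le> ?X * \<Lambda>" if "i < n" for i
  proof -
    have "integral (?Q i) h \<le> integral (?Q i) (\<lambda>x. \<Lambda>)"
      by (rule integral_le[OF hint[OF that] integrable_const_ivl]) (use h_le sub[OF that] in blast)
    then show ?thesis by (simp only: const)
  qed
  have bad: "integral (?Q i) h \<le> ?X * (?X + V i)" if i: "i < n" "i \<notin> ?I" for i
  proof -
    obtain x where x: "x \<in> ?Q i" "h x < ?X" using i by auto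
    have "h y \<le> ?X + V i" if y: "y \<in> ?Q i" for y
    proof -
      define p q where "p = min x y" and "q = max x y"
      have pq: "p \<le> q" "p \<in> ?Q i" "q \<in> ?Q i" using x y by (auto simp: p_def q_def)
      then have pq01: "p \<in> {0..1}" "q \<in> {0..1}" using sub[OF i(1)] by blast+
      have "\<bar>h q - h p\<bar> \<le> integral {p..q} \<phi>" using pq(1) pq01 by (intro osc) auto
      also have "\<dots> \<le> V i"
        unfolding V_def
      proof (rule integral_subset_le)
        show "{p..q} \<subseteq> ?Q i" using pq by auto
        then show "\<phi> integrable_on {p..q}" "\<phi> integrable_on ?Q i"
          using sub[OF i(1)] by (blast intro: integrable_on_subinterval[OF \<phi>(1)])+
      qed (simp add: \<phi>(3))
      finally show ?thesis using x(2) by (auto simp: p_def q_def min_def max_def split: if_splits)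
    qed
    then have "integral (?Q i) h \<le> integral (?Q i) (\<lambda>x. ?X + V i)"
      using hint[OF i(1)] by (intro integral_le) auto
    then show ?thesis by (simp only: const)
  qed
  have "d = (\<Sum>i<n. integral (?Q i) h)"
    using integral_split_equal[OF integrable_continuous_interval[OF cont] n] volume by simp
  also have "\<dots> \<le> (\<Sum>i<n. (if i \<in> ?I then ?X * \<Lambda> else 0) + ?X * (?X + V i))"
  proof (rule sum_mono)
    fix i assume "i \<in> {..<n}"
    then have i: "i < n" by simp
    show "integral (?Q i) h \<le> (if i \<in> ?I then ?X * \<Lambda> else 0) + ?X * (?X + V i)"
    proof (cases "i \<in> ?I")
      case True
      have "0 \<le> ?X * (?X + V i)" using X0 V0[OF i] by simp
      then show ?thesis using good[OF i] True by (simp only: if_True)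
    next
      case False
      then show ?thesis using bad[OF i False] by (simp only: if_False)
    qed
  qed
  also have "\<dots> = (\<Sum>i<n. if i \<in> ?I then ?X * \<Lambda> else 0) + ?X * (\<Sum>i<n. ?X + V i)"
    unfolding sum_distrib_left by (rule sum.distrib)
  also have "(\<Sum>i<n. if i \<in> ?I then ?X * \<Lambda> else 0) = (\<Sum>i\<in>?I. ?X * \<Lambda>)"
    by (rule sum.mono_neutral_cong_right) auto
  also have "\<dots> = card ?I * (?X * \<Lambda>)" by simp
  also have "?X * (\<Sum>i<n. ?X + V i) \<le> ?X * (1 + \<Lambda>)"
    using sumV n by (intro mult_left_mono) (auto simp: sum.distrib)
  also have "?X * (1 + \<Lambda>) \<le> d / (4 * \<Lambda>) * (2 * \<Lambda>)"
    using X \<Lambda>1 d by (intro mult_mono) auto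
  also have "\<dots> = d / 2" using \<Lambda>1 by simp
  finally have "d / 2 \<le> card ?I * (?X * \<Lambda>)" by linarith
  moreover have "(card ?I * ?X) * (2 * \<Lambda>) = 2 * (card ?I * (?X * \<Lambda>))" by (simp only: mult_ac)
  moreover have "d \<le> z" if "d / 2 \<le> y" "z = 2 * y" for y z using that by linarith
  ultimately have "d \<le> (card ?I * ?X) * (2 * \<Lambda>)" by blast
  moreover have "0 < 2 * \<Lambda>" using \<Lambda>1 by simp
  ultimately show ?thesis by (simp only: pos_divide_le_eq)
qed

end

section \<open>The lower bound\<close>

text \<open>The alternatives are the bounds of the two terms of the minimum by a multiple of \<open>E\<close>, with the
  fractional powers removed.\<close>

lemma scaling_le:
  assumes pos: "\<gamma> > 0" "e0 > 0" "b > 0" "d > 0" "E > 0" and C: "C \<ge> 1" and L: "1 + ln (b / (e0 * r0)) \<ge> 0"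
    and surf: "\<gamma> * (1 + d) \<le> 2 * E"
    and alt: "(\<gamma> * e0 * d)\<^sup>2 \<le> C * E ^ 3 \<or> \<gamma> * e0 * b * d * (1 + ln (b / (e0 * r0))) \<le> C * E\<^sup>2"
  shows "scaling \<gamma> e0 b d r0 \<le> (2 + C) * E"
proof -
  have CE: "C powr p * E \<le> C * E" if "p \<le> 1" for p
    using C pos powr_mono[OF that C] by (intro mult_right_mono) auto
  from alt have "min (\<gamma> powr (2/3) * e0 powr (2/3) * d powr (2/3))
           ((\<gamma> * e0 * b * d * (1 + ln (b / (e0 * r0)))) powr (1/2)) \<le> C * E"
  proof
    assume a: "(\<gamma> * e0 * d)\<^sup>2 \<le> C * E ^ 3"
    have "\<gamma> powr (2/3) * e0 powr (2/3) * d powr (2/3) = (\<gamma> * e0 * d) powr (2/3)"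
      using pos by (simp add: powr_mult)
    also have "\<dots> = ((\<gamma> * e0 * d) powr 2) powr (1/3)"
      by (simp only: powr_powr) simp
    also have "\<dots> = ((\<gamma> * e0 * d)\<^sup>2) powr (1/3)" using pos by (simp add: powr_numeral)
    also have "\<dots> \<le> (C * E ^ 3) powr (1/3)" using a by (intro powr_mono2) auto
    also have "\<dots> = C powr (1/3) * (E powr 3) powr (1/3)" using pos C by (simp add: powr_mult powr_numeral)
    also have "\<dots> = C powr (1/3) * E" unfolding powr_powr using pos by simp
    also have "\<dots> \<le> C * E" by (rule CE) simp
    finally show ?thesis by simp
  next
    assume a: "\<gamma> * e0 * b * d * (1 + ln (b / (e0 * r0))) \<le> C * E\<^sup>2"
    have "(\<gamma> * e0 * b * d * (1 + ln (b / (e0 * r0)))) powr (1/2) \<le> (C * E\<^sup>2) powr (1/2)"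
      using a pos L by (intro powr_mono2) auto
    also have "\<dots> = C powr (1/2) * (E powr 2) powr (1/2)" using pos C by (simp add: powr_mult powr_numeral)
    also have "\<dots> = C powr (1/2) * E" unfolding powr_powr using pos by simp
    also have "\<dots> \<le> C * E" by (rule CE) simp
    finally show ?thesis by simp
  qed
  then show ?thesis using surf by (simp add: scaling_def algebra_simps)
qed

lemma sum_size_filter_le:
  assumes I: "finite I" and disj: "\<And>i j p. i \<in> I \<Longrightarrow> j \<in> I \<Longrightarrow> A i p \<Longrightarrow> A j p \<Longrightarrow> i = j"
  shows "(\<Sum>i\<in>I. size (filter_mset (A i) P)) \<le> size P"
proof (induction P)
  case (add p P)
  have "card {i\<in>I. A i p} \<le> Suc 0"
    using I disj by (intro card_le_Suc0_iff_eq[THEN iffD2]) auto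
  moreover have "(\<Sum>i\<in>I. if A i p then 1 else 0) = card {i\<in>I. A i p}"
    using I by (simp add: sum.If_cases Int_def)
  moreover have "(\<Sum>i\<in>I. size (filter_mset (A i) (add_mset p P))) =
      (\<Sum>i\<in>I. if A i p then 1 else 0) + (\<Sum>i\<in>I. size (filter_mset (A i) P))"
    unfolding sum.distrib[symmetric] by (rule sum.cong) auto
  ultimately show ?case using add.IH by simp
qed simp

lemma (in dislocated_square) square_lower_bound_explicit:
  assumes "X \<le> b / e0 * (1 + ln (b / (e0 * r0)))" "b / e0 \<ge> 64 ^ 4 * r0"
  shows "(e0 * X)\<^sup>2 \<le> 10 ^ 10 * bump_const ^ 4 *
    ((LINT z:subgraph h \<inter> {z. a < z$1 \<and> z$1 < a + X \<and> 0 < z$2 \<and> z$2 < X}|lebesgue. (norm (sym_part (H z)))\<^sup>2)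
     + b\<^sup>2 * size (filter_mset (\<lambda>p. dist p (vector [a + X / 2, 0]) \<le> 3 * X / 8) P))"
  using square_lower_bound[OF assms] unfolding en_def sq_def near_def mid_def .

lemma grid_unique:
  fixes w :: real
  assumes w: "w > 0" and ij: "\<bar>x - (real i * w + w / 2)\<bar> < w / 2" "\<bar>x - (real j * w + w / 2)\<bar> < w / 2"
  shows "i = j"
proof (rule ccontr)
  assume "i \<noteq> j"
  then have "real i + 1 \<le> real j \<or> real j + 1 \<le> real i" by linarith
  then have "(real i + 1) * w \<le> real j * w \<or> (real j + 1) * w \<le> real i * w"
    using mult_right_mono[OF _ less_imp_le[OF w]] by blast
  then have "real i * w + w \<le> real j * w \<or> real j * w + w \<le> real i * w" by (simp only: distrib_right mult_1)
  then show False using ij by linarith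
qed

text \<open>The squares of the grid with spacing \<open>X\<close> carry disjoint parts of the strain and of the dislocations, so
  the estimates of \<open>square_lower_bound\<close> add up.  Only when \<open>X < 64 * r0\<close> and dislocations are present do the
  cores not fit; then \<open>X\<close> is so small that the energy \<open>b\<^sup>2\<close> of a single dislocation suffices.\<close>

lemma energy_lower_bound:
  assumes J: "admissible_kernel J" and W: "linear_elastic_density W"
  shows "\<exists>cs::real>0. \<forall>\<gamma> e0 b d r0 :: real.
    \<gamma> > 0 \<and> e0 > 0 \<and> b > 0 \<and> d > 0 \<and> 0 < r0 \<and> b / e0 \<ge> 64 ^ 4 * r0 \<longrightarrow>
      (\<forall>t\<in>admissible J d e0 b r0. ennreal (1 / cs * scaling \<gamma> e0 b d r0) \<le> energy W \<gamma> b t)"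
proof -
  obtain c1 where c1: "c1 > 0" "\<And>A. c1 * (norm (sym_part A))\<^sup>2 \<le> W A"
    using W by (auto simp: linear_elastic_density_def)
  define D where "D = 10 ^ 10 * bump_const ^ 4"
  define c where "c = min c1 1"
  define C where "C = 16 * (D / c)"
  have c: "c > 0" "c \<le> 1" "c \<le> c1" using c1 by (auto simp: c_def)
  have D: "D \<ge> 1"
  proof -
    have "1 * 1 \<le> (10 ^ 10 :: real) * bump_const ^ 4" using bump_const(1) by (intro mult_mono one_le_power) auto
    then show ?thesis by (simp add: D_def)
  qed
  have Dc: "D / c \<ge> 1" using D c by (simp add: pos_le_divide_eq)
  then have C1: "C \<ge> 1" by (simp add: C_def)
  have main: "ennreal (1 / (2 + C) * scaling \<gamma> e0 b d r0) \<le> energy W \<gamma> b t"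
    if par: "\<gamma> > 0" "e0 > 0" "b > 0" "d > 0" "r0 > 0" "b / e0 \<ge> 64 ^ 4 * r0" and t: "t \<in> admissible J d e0 b r0"
    for \<gamma> e0 b d r0 t
  proof -
    obtain h H P where t_eq: "t = (h, H, P)" by (cases t) auto
    obtain Lc where lip: "Lc-lipschitz_on {0..1} h" using t by (auto simp: admissible_def t_eq)
    have adm: "\<And>x. x \<in> {0..1} \<Longrightarrow> h x \<ge> 0" "(LINT x:{0..1}|lebesgue. h x) = d" "h 0 = 0"
      "\<And>p. p \<in># P \<Longrightarrow> ball p r0 \<subseteq> subgraph h" "H \<in> borel_measurable (lebesgue_on (subgraph h))"
      "integrable (lebesgue_on (subgraph h)) (\<lambda>z. (norm (H z))\<^sup>2)"
      "has_bottom_tangential_trace h H (mollified_dislocations J r0 b P) (vector [e0, 0])"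
      using t by (auto simp: admissible_def t_eq)
    have cont: "continuous_on {0..1} h" by (rule lipschitz_on_continuous_on[OF lip])
    have "\<exists>\<Lambda> \<phi>. (\<integral>\<^sup>+x\<in>{0..1}. ennreal (sqrt (1 + (deriv h x)\<^sup>2)) \<partial>lebesgue) = ennreal \<Lambda> \<and> \<Lambda> \<ge> 1 \<and>
      (\<lambda>u. \<bar>\<phi> u\<bar>) integrable_on {0..1} \<and> integral {0..1} (\<lambda>u. \<bar>\<phi> u\<bar>) \<le> \<Lambda> \<and>
      (\<forall>x y. 0 \<le> x \<longrightarrow> x \<le> y \<longrightarrow> y \<le> 1 \<longrightarrow> \<bar>h y - h x\<bar> \<le> integral {x..y} (\<lambda>u. \<bar>\<phi> u\<bar>))"
      by (rule film_length[OF lip]) blast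
    then obtain \<Lambda> \<phi> where \<Lambda>: "(\<integral>\<^sup>+x\<in>{0..1}. ennreal (sqrt (1 + (deriv h x)\<^sup>2)) \<partial>lebesgue) = ennreal \<Lambda>" "\<Lambda> \<ge> 1"
      "(\<lambda>u. \<bar>\<phi> u\<bar>) integrable_on {0..1}" "integral {0..1} (\<lambda>u. \<bar>\<phi> u\<bar>) \<le> \<Lambda>"
      "\<forall>x y. 0 \<le> x \<longrightarrow> x \<le> y \<longrightarrow> y \<le> 1 \<longrightarrow> \<bar>h y - h x\<bar> \<le> integral {x..y} (\<lambda>u. \<bar>\<phi> u\<bar>)"
      by (elim exE conjE)
    have "set_integrable lebesgue {0..1} h" by (rule absolutely_integrable_continuous_real[OF cont])
    from set_lebesgue_integral_eq_integral(2)[OF this] have vol: "integral {0..1} h = d" using adm(2) by simp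
    interpret fp: film_profile h d \<Lambda> "\<lambda>u. \<bar>\<phi> u\<bar>"
      by unfold_locales (use cont adm vol par \<Lambda> in auto)
    interpret sf: strain_field h H "mollified_dislocations J r0 b P" e0
      by unfold_locales (use open_subgraph[OF cont] adm in \<open>auto simp: mollified_dislocations_def\<close>)
    let ?\<Omega> = "subgraph h" and ?q = "\<lambda>z. (norm (sym_part (H z)))\<^sup>2"
    define L where "L = 1 + ln (b / (e0 * r0))"
    define l where "l = b / e0"
    have l: "l > 0" "l \<ge> 64 ^ 4 * r0" using par by (simp_all add: l_def)
    have "1 \<le> l / r0" using l par by (simp add: pos_le_divide_eq)
    then have L1: "L \<ge> 1" by (simp add: L_def l_def ln_ge_zero)
    have lL: "l * L > 0" "l * L \<ge> l" using l L1 by auto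
    \<comment> \<open>the side \<open>X = 1 / n\<close> is the smaller of \<open>d / (4 * \<Lambda>)\<close> and \<open>l * L\<close>, rounded down to the reciprocal of an integer\<close>
    define mx where "mx = max (4 * \<Lambda> / d) (1 / (l * L))"
    define n where "n = nat \<lceil>mx\<rceil>"
    have "4 * \<Lambda> / d \<ge> 4" using fp.d_le par by (simp add: pos_le_divide_eq)
    then have mx: "mx \<ge> 4" by (simp add: mx_def)
    have n: "real n \<ge> mx" "real n \<le> mx + 1" "n > 0" using mx by (auto simp: n_def)
    define X where "X = 1 / real n"
    have X0: "X > 0" using n by (simp add: X_def)
    have grid: "real k / n = real k * X" for k by (simp add: X_def)
    have Xle: "X \<le> d / (4 * \<Lambda>)" "X \<le> l * L"
    proof -
      have "0 < 4 * \<Lambda> / d" using par \<Lambda>(2) by (intro divide_pos_pos) auto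
      then have "0 < real n * (4 * \<Lambda> / d)" using n(3) by (intro mult_pos_pos) auto
      moreover have "4 * \<Lambda> / d \<le> real n" using n(1) by (simp add: mx_def)
      ultimately have "X \<le> 1 / (4 * \<Lambda> / d)" unfolding X_def by (intro divide_left_mono) auto
      then show "X \<le> d / (4 * \<Lambda>)" by simp
      have "X \<le> 1 / (1 / (l * L))" unfolding X_def using n(1,3) lL by (intro divide_left_mono) (auto simp: mx_def)
      then show "X \<le> l * L" by simp
    qed
    have Xge: "X \<ge> d / (8 * \<Lambda>) \<or> X \<ge> l * L / 2"
    proof -
      have "X \<ge> 1 / (2 * mx)" unfolding X_def using n mx by (intro divide_left_mono) auto
      then show ?thesis by (auto simp: mx_def max_def split: if_splits)
    qed
    have qint: "set_integrable lebesgue ?\<Omega> ?q"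
    proof -
      have S: "?\<Omega> \<inter> space lebesgue \<in> sets lebesgue" using sf.\<Omega>_sets by simp
      have "?q \<in> borel_measurable (lebesgue_on ?\<Omega>)"
        unfolding sym_part_norm by (intro borel_measurable_add borel_measurable_power borel_measurable_divide
          borel_measurable_const sf.comp_meas)
      then have "integrable (lebesgue_on ?\<Omega>) ?q"
        by (rule Bochner_Integration.integrable_bound[OF adm(6)]) (auto simp: sym_part_le_norm)
      then show ?thesis by (simp add: set_integrable_def integrable_restrict_space[OF S])
    qed
    define S where "S = (LINT z:?\<Omega>|lebesgue. ?q z)"
    have S0: "S \<ge> 0" unfolding S_def set_lebesgue_integral_def by (intro integral_nonneg_AE) auto
    define E where "E = \<gamma> * \<Lambda> + c1 * S + real (size P) * b\<^sup>2"
    have E: "\<gamma> * \<Lambda> \<le> E" "c * (S + b\<^sup>2 * size P) \<le> E" "E > 0"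
    proof -
      have p: "\<gamma> * \<Lambda> > 0" "c1 * S \<ge> 0" "b\<^sup>2 * size P \<ge> 0" using par \<Lambda>(2) c1 S0 by auto
      then show e: "\<gamma> * \<Lambda> \<le> E" by (simp add: E_def mult.commute)
      show "E > 0" using e p(1) by linarith
      have "c * S \<le> c1 * S" "c * (b\<^sup>2 * size P) \<le> 1 * (b\<^sup>2 * size P)"
        by (rule mult_right_mono[OF c(3) S0], rule mult_right_mono[OF c(2)]) simp
      then show "c * (S + b\<^sup>2 * size P) \<le> E" using p(1) by (simp add: E_def distrib_left mult.commute)
    qed
    have Een: "ennreal E \<le> energy W \<gamma> b t"
    proof -
      have "ennreal (c1 * S) = (\<integral>\<^sup>+z. ennreal (c1 * (indicator ?\<Omega> z *\<^sub>R ?q z)) \<partial>lebesgue)"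
        using nn_integral_eq_integral[OF integrable_mult_right[OF qint[unfolded set_integrable_def], of c1]] c1(1)
        by (simp add: S_def set_lebesgue_integral_def)
      also have "\<dots> \<le> (\<integral>\<^sup>+z\<in>?\<Omega>. ennreal (W (H z)) \<partial>lebesgue)"
        using c1(2) by (intro nn_integral_mono) (auto simp: indicator_def intro: ennreal_leI)
      finally have "ennreal (c1 * S) \<le> (\<integral>\<^sup>+z\<in>?\<Omega>. ennreal (W (H z)) \<partial>lebesgue)" .
      moreover have "ennreal E = ennreal \<gamma> * ennreal \<Lambda> + ennreal (c1 * S) + ennreal (real (size P) * b\<^sup>2)"
      proof -
        have p: "0 \<le> \<gamma> * \<Lambda>" "0 \<le> c1 * S" "0 \<le> real (size P) * b\<^sup>2" using par \<Lambda>(2) c1 S0 by auto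
        have "ennreal \<gamma> * ennreal \<Lambda> = ennreal (\<gamma> * \<Lambda>)" using par \<Lambda>(2) by (intro ennreal_mult[symmetric]) auto
        then show ?thesis unfolding E_def using p by (simp only: ennreal_plus add_nonneg_nonneg)
      qed
      moreover have "energy W \<gamma> b t = ennreal \<gamma> * ennreal \<Lambda> + (\<integral>\<^sup>+z\<in>?\<Omega>. ennreal (W (H z)) \<partial>lebesgue) + ennreal (real (size P) * b\<^sup>2)"
        unfolding energy_def t_eq by (simp only: prod.case \<Lambda>(1))
      ultimately show ?thesis by (simp only:) (intro add_mono order_refl)
    qed
    have alt: "(\<gamma> * e0 * d)\<^sup>2 \<le> C * E ^ 3 \<or> \<gamma> * e0 * b * d * L \<le> C * E\<^sup>2"
    proof (cases "P = {#} \<or> r0 \<le> X / 64")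
      case True
      define I where "I = {i. i < n \<and> (\<forall>x\<in>{real i / n..real (Suc i) / n}. h x \<ge> 1 / n)}"
      define sq where "sq i = {z::real^2. real i / n < z$1 \<and> z$1 < real i / n + X \<and> 0 < z$2 \<and> z$2 < X}" for i
      define A where "A i p \<longleftrightarrow> dist p (vector [real i / n + X / 2, 0]) \<le> 3 * X / 8" for i and p :: "real^2"
      have finI: "finite I" by (simp add: I_def)
      have each: "(e0 * X)\<^sup>2 \<le> D * ((LINT z:?\<Omega> \<inter> sq i|lebesgue. ?q z) + b\<^sup>2 * size (filter_mset (A i) P))" if i: "i \<in> I" for i
      proof -
        have ni1: "real i / n + X = real (Suc i) / n" by (simp add: X_def add_divide_distrib)
        have "real (Suc i) \<le> real n" using i by (simp only: I_def of_nat_le_iff mem_Collect_eq Suc_le_eq)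
        then have ni2: "real (Suc i) / n \<le> 1" using n(3) by (subst divide_le_eq_1_pos) auto
        note ni = ni1 ni2
        have "dislocated_square J h H P b e0 r0 (real i / n) X"
        proof (rule dislocated_square.intro)
          show "strain_field h H (mollified_dislocations J r0 b P) e0" by (rule sf.strain_field_axioms)
          show "real i / n + X \<le> 1" using ni by simp
          show "X \<le> h x" if "x \<in> {real i / n..real i / n + X}" for x
            using that i unfolding ni by (auto simp: I_def X_def)
        qed (use J par X0 adm True in auto)
        then interpret ds: dislocated_square J h H P b e0 r0 "real i / n" X .
        show ?thesis using ds.square_lower_bound_explicit Xle(2) par unfolding D_def sq_def A_def l_def L_def by blast
      qed
      have sumsq: "(\<Sum>i\<in>I. LINT z:?\<Omega> \<inter> sq i|lebesgue. ?q z) \<le> S"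
      proof -
        have sqm: "sq i \<in> sets lebesgue" for i
        proof -
          have "open (sq i)" unfolding sq_def by (intro open_Collect_conj open_Collect_less continuous_intros)
          then show ?thesis by (simp add: borel_open)
        qed
        have int: "integrable lebesgue (\<lambda>z. indicator (?\<Omega> \<inter> sq i) z *\<^sub>R ?q z)" for i
          using set_integrable_subset[OF qint, of "?\<Omega> \<inter> sq i"] sqm sf.\<Omega>_sets by (simp add: set_integrable_def)
        have "(\<Sum>i\<in>I. LINT z:?\<Omega> \<inter> sq i|lebesgue. ?q z) = (LINT z|lebesgue. (\<Sum>i\<in>I. indicator (?\<Omega> \<inter> sq i) z *\<^sub>R ?q z))"
          unfolding set_lebesgue_integral_def by (rule Bochner_Integration.integral_sum[symmetric]) (rule int)
        also have "\<dots> \<le> (LINT z|lebesgue. indicator ?\<Omega> z *\<^sub>R ?q z)"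
        proof (rule integral_mono)
          show "integrable lebesgue (\<lambda>z. \<Sum>i\<in>I. indicator (?\<Omega> \<inter> sq i) z *\<^sub>R ?q z)"
            by (intro Bochner_Integration.integrable_sum int)
          show "integrable lebesgue (\<lambda>z. indicator ?\<Omega> z *\<^sub>R ?q z)" using qint by (simp add: set_integrable_def)
          fix z
          show "(\<Sum>i\<in>I. indicator (?\<Omega> \<inter> sq i) z *\<^sub>R ?q z) \<le> indicator ?\<Omega> z *\<^sub>R ?q z"
          proof (cases "\<exists>i\<in>I. z \<in> ?\<Omega> \<inter> sq i")
            case True
            then obtain i where i: "i \<in> I" "z \<in> ?\<Omega> \<inter> sq i" by blast
            have "z \<notin> sq j" if "j \<noteq> i" for j
            proof
              assume "z \<in> sq j"
              then have "real i * X < z$1" "z$1 < real i * X + X" "real j * X < z$1" "z$1 < real j * X + X"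
                using i(2) by (auto simp: sq_def grid)
              then have "\<bar>z$1 - (real i * X + X / 2)\<bar> < X / 2" "\<bar>z$1 - (real j * X + X / 2)\<bar> < X / 2" by linarith+
              then have "i = j" by (rule grid_unique[OF X0])
              then show False using that by simp
            qed
            then have "(\<Sum>j\<in>I. indicator (?\<Omega> \<inter> sq j) z *\<^sub>R ?q z) = (\<Sum>j\<in>{i}. indicator (?\<Omega> \<inter> sq j) z *\<^sub>R ?q z)"
              using i finI by (intro sum.mono_neutral_right) auto
            also have "\<dots> = indicator (?\<Omega> \<inter> sq i) z *\<^sub>R ?q z"
              by (simp only: sum.insert finite.emptyI empty_iff not_False_eq_True sum.empty add_0_right)
            finally show ?thesis using i by simp
          next
            case False
            then have "(\<Sum>i\<in>I. indicator (?\<Omega> \<inter> sq i) z *\<^sub>R ?q z) = 0" by (intro sum.neutral) auto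
            then show ?thesis by simp
          qed
        qed
        finally show ?thesis by (simp add: S_def set_lebesgue_integral_def)
      qed
      have sumA: "(\<Sum>i\<in>I. size (filter_mset (A i) P)) \<le> size P"
      proof (rule sum_size_filter_le[OF finI])
        fix i j p assume ij: "A i p" "A j p"
        have *: "\<bar>p$1 - (real k * X + X / 2)\<bar> < X / 2" if "A k p" for k
        proof -
          have "\<bar>(p - vector [real k / n + X / 2, 0])$1\<bar> \<le> 3 * X / 8"
            using component_le_norm_cart[of "p - vector [real k / n + X / 2, 0]" 1] that by (simp only: A_def dist_norm)
          then have "\<bar>p$1 - (real k / n + X / 2)\<bar> \<le> 3 * X / 8" by simp
          then show ?thesis using X0 unfolding grid by linarith
        qed
        show "i = j" by (rule grid_unique[OF X0 * *]) (use ij in auto)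
      qed
      have "card I * (e0 * X)\<^sup>2 \<le> (\<Sum>i\<in>I. D * ((LINT z:?\<Omega> \<inter> sq i|lebesgue. ?q z) + b\<^sup>2 * size (filter_mset (A i) P)))"
        using sum_mono[of I "\<lambda>i. (e0 * X)\<^sup>2"] each by simp
      also have "\<dots> = D * ((\<Sum>i\<in>I. LINT z:?\<Omega> \<inter> sq i|lebesgue. ?q z) + b\<^sup>2 * real (\<Sum>i\<in>I. size (filter_mset (A i) P)))"
        by (simp add: sum_distrib_left sum.distrib distrib_left)
      also have "\<dots> \<le> D * (S + b\<^sup>2 * real (size P))"
        using sumsq sumA D by (intro mult_left_mono add_mono) (auto simp del: of_nat_sum)
      also have "\<dots> = D / c * (c * (S + b\<^sup>2 * real (size P)))" using c by simp
      also have "\<dots> \<le> D / c * E" using E(2) Dc by (intro mult_left_mono) auto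
      finally have sumE: "card I * (e0 * X)\<^sup>2 \<le> D / c * E" .
      have "d / (2 * \<Lambda>) \<le> card I * X" using fp.many_squares[OF n(3)] Xle(1) by (simp add: I_def X_def)
      then have "e0\<^sup>2 * X * (d / (2 * \<Lambda>)) \<le> e0\<^sup>2 * X * (card I * X)" using X0 by (intro mult_left_mono) auto
      also have "\<dots> = card I * (e0 * X)\<^sup>2" by (simp add: power2_eq_square)
      finally have "e0\<^sup>2 * X * (d / (2 * \<Lambda>)) \<le> D / c * E" using sumE by linarith
      then have fin: "e0\<^sup>2 * X * d \<le> 2 * (D / c) * E * \<Lambda>" using \<Lambda>(2) by (simp add: field_simps)
      from Xge show ?thesis
      proof
        assume "X \<ge> d / (8 * \<Lambda>)"
        then have "e0\<^sup>2 * (d / (8 * \<Lambda>)) * d \<le> e0\<^sup>2 * X * d" using par by (intro mult_right_mono mult_left_mono) auto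
        then have "e0\<^sup>2 * (d / (8 * \<Lambda>)) * d \<le> 2 * (D / c) * E * \<Lambda>" using fin by linarith
        then have "e0\<^sup>2 * d * d \<le> 16 * (D / c) * E * (\<Lambda> * \<Lambda>)" using \<Lambda>(2) by (simp add: field_simps)
        then have "\<gamma>\<^sup>2 * (e0\<^sup>2 * d * d) \<le> \<gamma>\<^sup>2 * (16 * (D / c) * E * (\<Lambda> * \<Lambda>))" by (intro mult_left_mono) auto
        also have "\<dots> = C * E * (\<gamma> * \<Lambda>)\<^sup>2" by (simp add: C_def power2_eq_square)
        also have "\<dots> \<le> C * E * E\<^sup>2" using E C1 par \<Lambda>(2) by (intro mult_left_mono power_mono) auto
        finally show ?thesis by (simp add: power_mult_distrib power2_eq_square power3_eq_cube mult_ac)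
      next
        assume "X \<ge> l * L / 2"
        then have "e0\<^sup>2 * (l * L / 2) * d \<le> e0\<^sup>2 * X * d" using par by (intro mult_right_mono mult_left_mono) auto
        then have "e0\<^sup>2 * (l * L / 2) * d \<le> 2 * (D / c) * E * \<Lambda>" using fin by linarith
        then have "e0 * b * L * d \<le> 4 * (D / c) * E * \<Lambda>" using par by (simp add: l_def power2_eq_square)
        then have "\<gamma> * (e0 * b * L * d) \<le> \<gamma> * (4 * (D / c) * E * \<Lambda>)" using par by (intro mult_left_mono) auto
        also have "\<dots> = 4 * (D / c) * E * (\<gamma> * \<Lambda>)" by simp
        also have "\<dots> \<le> C * E * E"
        proof (rule mult_mono)
          show "4 * (D / c) * E \<le> C * E" unfolding C_def using Dc E(3) by (intro mult_right_mono) auto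
        qed (use E C1 par \<Lambda>(2) in auto)
        finally show ?thesis by (simp add: power2_eq_square mult_ac)
      qed
    next
      case False
      have "X < 64 * r0" using False by auto
      moreover have "16777216 * r0 \<le> l" using l(2) by simp
      ultimately have "l * L / 2 > X" using lL(2) par by linarith
      then have "d / (8 * \<Lambda>) \<le> X" using Xge by linarith
      then have "d / (8 * \<Lambda>) < 64 * r0" using False by linarith
      then have "d < 512 * r0 * \<Lambda>" using \<Lambda>(2) by (simp add: field_simps)
      then have "\<gamma> * e0 * d \<le> \<gamma> * e0 * (512 * r0 * \<Lambda>)" using par by (intro mult_left_mono) auto
      also have "\<dots> = 512 * r0 * e0 * (\<gamma> * \<Lambda>)" by simp
      also have "\<dots> \<le> b * E"
      proof (rule mult_mono)
        have 1: "64 ^ 4 * (r0 * e0) \<le> b" using par by (simp add: pos_le_divide_eq mult.assoc)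
        have 2: "512 * (r0 * e0) \<le> 64 ^ 4 * (r0 * e0)" using par by (intro mult_right_mono) auto
        show "512 * r0 * e0 \<le> b" unfolding mult.assoc by (rule order_trans[OF 2 1])
      qed (use E par \<Lambda> in auto)
      finally have "(\<gamma> * e0 * d)\<^sup>2 \<le> (b * E)\<^sup>2" using par by (intro power_mono) auto
      also have "\<dots> = b\<^sup>2 * E\<^sup>2" by (simp add: power_mult_distrib)
      also have "\<dots> \<le> E * E\<^sup>2"
      proof (rule mult_right_mono)
        have "size P \<ge> 1" using False by (simp add: Suc_leI nonempty_has_size)
        then have "1 * b\<^sup>2 \<le> real (size P) * b\<^sup>2" by (intro mult_right_mono) auto
        moreover have "0 \<le> \<gamma> * \<Lambda>" "0 \<le> c1 * S" using par \<Lambda>(2) c1 S0 by auto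
        ultimately show "b\<^sup>2 \<le> E" by (simp add: E_def)
      qed simp
      also have "\<dots> = 1 * E ^ 3" by (simp add: power2_eq_square power3_eq_cube)
      also have "\<dots> \<le> C * E ^ 3" using C1 E by (intro mult_right_mono) auto
      finally show ?thesis by simp
    qed
    have "\<gamma> * (1 + d) \<le> 2 * E"
    proof -
      have "\<gamma> * (1 + d) \<le> \<gamma> * (2 * \<Lambda>)" using fp.d_le \<Lambda>(2) par by (intro mult_left_mono) auto
      then show ?thesis using E(1) by simp
    qed
    then have "scaling \<gamma> e0 b d r0 \<le> (2 + C) * E"
      using alt L1 unfolding L_def by (intro scaling_le par E C1) auto
    then have "1 / (2 + C) * scaling \<gamma> e0 b d r0 \<le> E" using C1 by (simp add: field_simps)
    then show ?thesis using Een by (meson ennreal_leI order_trans)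
  qed
  show ?thesis using main C1 by (intro exI[of _ "2 + C"]) auto
qed

section \<open>Fubini's theorem and integration by parts in the half plane\<close>

abbreviation pt :: "real \<Rightarrow> real \<Rightarrow> real^2" where "pt x y \<equiv> vector [x, y]"

lemma continuous_on_pt: "continuous_on S (\<lambda>p. pt (fst p) (snd p))"
  unfolding vector2_eq by (intro continuous_intros)

lemma lborel_pt: "lborel = distr (lborel \<Otimes>\<^sub>M lborel) borel (\<lambda>(x,y). pt x y)"
proof (rule lborel_eqI)
  have m: "(\<lambda>(x,y). pt x y) \<in> borel_measurable (lborel \<Otimes>\<^sub>M lborel)"
    using borel_measurable_continuous_onI[OF continuous_on_pt[of UNIV]] by (simp add: lborel_prod case_prod_unfold)
  fix l u :: "real^2" assume lu: "\<And>b. b \<in> Basis \<Longrightarrow> l \<bullet> b \<le> u \<bullet> b"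
  have B: "(Basis :: (real^2) set) = {axis 1 1, axis 2 1}"
    by (auto simp: Basis_vec_def UNIV_2)
  have le: "l$1 \<le> u$1" "l$2 \<le> u$2" using lu[of "axis 1 1"] lu[of "axis 2 1"] by (simp_all add: B inner_axis)
  have pre: "(\<lambda>(x,y). pt x y) -` box l u \<inter> space (lborel \<Otimes>\<^sub>M lborel) = {l$1<..<u$1} \<times> {l$2<..<u$2}"
    by (auto simp: mem_box_cart forall_2 space_pair_measure)
  have "emeasure (distr (lborel \<Otimes>\<^sub>M lborel) borel (\<lambda>(x,y). pt x y)) (box l u) = emeasure (lborel \<Otimes>\<^sub>M lborel) ({l$1<..<u$1} \<times> {l$2<..<u$2})"
    using m by (subst emeasure_distr) (simp_all add: pre)
  also have "\<dots> = ennreal (u$1 - l$1) * ennreal (u$2 - l$2)"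
    using le by (subst lborel.emeasure_pair_measure_Times) auto
  also have "\<dots> = ennreal (\<Prod>b\<in>Basis. (u - l) \<bullet> b)"
    using le by (simp add: B inner_axis axis_eq_axis ennreal_mult)
  finally show "emeasure (distr (lborel \<Otimes>\<^sub>M lborel) borel (\<lambda>(x,y). pt x y)) (box l u) = ennreal (\<Prod>b\<in>Basis. (u - l) \<bullet> b)" .
qed simp

lemma fubini_pt:
  fixes F :: "real^2 \<Rightarrow> real"
  assumes F: "integrable lborel F"
  shows "(LINT z|lborel. F z) = (LINT x|lborel. (LINT y|lborel. F (pt x y)))"
    and "(LINT z|lborel. F z) = (LINT y|lborel. (LINT x|lborel. F (pt x y)))"
proof -
  have m: "(\<lambda>(x,y). pt x y) \<in> lborel \<Otimes>\<^sub>M lborel \<rightarrow>\<^sub>M borel"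
    using borel_measurable_continuous_onI[OF continuous_on_pt[of UNIV]] by (simp add: lborel_prod case_prod_unfold)
  have Fm: "F \<in> borel_measurable borel" using F by auto
  have i: "integrable (lborel \<Otimes>\<^sub>M lborel) (\<lambda>p. F (case p of (x,y) \<Rightarrow> pt x y))"
    using F integrable_distr_eq[OF m Fm] by (subst (asm) lborel_pt) simp
  have e: "(LINT z|lborel. F z) = (LINT p|(lborel \<Otimes>\<^sub>M lborel). F (case p of (x,y) \<Rightarrow> pt x y))"
    by (subst lborel_pt) (rule integral_distr[OF m Fm])
  show "(LINT z|lborel. F z) = (LINT x|lborel. (LINT y|lborel. F (pt x y)))"
    unfolding e using lborel_pair.integral_fst'[OF i] by simp
  show "(LINT z|lborel. F z) = (LINT y|lborel. (LINT x|lborel. F (pt x y)))"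
    unfolding e using lborel_pair.integral_snd[of "\<lambda>x y. F (pt x y)"] i by (simp add: case_prod_unfold)
qed

lemma pt_out:
  assumes "supp P \<subseteq> cball 0 R" "\<bar>x\<bar> > R \<or> \<bar>y\<bar> > R"
  shows "P (pt x y) = 0"
proof (rule not_supp)
  have "\<bar>x\<bar> \<le> norm (pt x y)" "\<bar>y\<bar> \<le> norm (pt x y)"
    using component_le_norm_cart[of "pt x y" 1] component_le_norm_cart[of "pt x y" 2] by simp_all
  then show "pt x y \<notin> supp P" using assms by (auto simp: dist_norm)
qed

lemma half_plane_indicator_integrable:
  fixes q :: "real^2 \<Rightarrow> real"
  assumes "continuous_on UNIV q" "compact (supp q)"
  shows "integrable lborel (\<lambda>z. indicator {z. z$2 > 0} z * q z)"
proof -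
  have "{z::real^2. z$2 > 0} \<in> sets borel" by (intro borel_open open_Collect_less continuous_intros)
  then show ?thesis
    using integrable_mult_indicator[OF _ continuous_compact_integrable(1)[OF assms], of "{z. z$2 > 0}"] by simp
qed

lemma half_plane_FTC_vertical:
  fixes P q :: "real^2 \<Rightarrow> real"
  assumes q: "continuous_on UNIV q" and R: "supp P \<subseteq> cball 0 R" "supp q \<subseteq> cball 0 R" "R > 0"
    and d: "\<And>x y. ((\<lambda>y. P (pt x y)) has_real_derivative q (pt x y)) (at y)"
  shows "(LINT z|lborel. indicator {z. z$2 > 0} z * q z) = - (LINT x|lborel. P (pt x 0))"
proof -
  have cs: "compact (supp q)" by (rule compact_supp_subset[OF compact_cball R(2)])
  have inner: "(LINT y|lborel. indicator {z. z$2 > 0} (pt x y) * q (pt x y)) = - P (pt x 0)" for x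
  proof -
    have qc: "isCont (\<lambda>y. q (pt x y)) y" for y
    proof -
      have "continuous_on UNIV (\<lambda>y. q (pt x y))"
        unfolding vector2_eq by (rule continuous_on_compose2[OF q]) (auto intro!: continuous_intros)
      then show ?thesis by (simp add: continuous_on_eq_continuous_at)
    qed
    have "(LINT y|lborel. indicator {z. z$2 > 0} (pt x y) * q (pt x y)) = (LINT y|lborel. q (pt x y) * indicator {0..R+1} y)"
    proof (rule integral_cong_AE)
      have cq: "(\<lambda>y. q (pt x y)) \<in> borel_measurable borel"
        using qc by (intro borel_measurable_continuous_onI) (simp add: continuous_on_eq_continuous_at)
      have e: "indicator {z. z$2 > 0} (pt x y) = (indicator {0<..} y :: real)" for y by (auto simp: indicator_def)
      show "(\<lambda>y. indicator {z. z$2 > 0} (pt x y) * q (pt x y)) \<in> borel_measurable lborel"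
        "(\<lambda>y. q (pt x y) * indicator {0..R+1} y) \<in> borel_measurable lborel" using cq unfolding e by simp_all
      from AE_lborel_singleton[of "0::real"]
      show "AE y in lborel. indicator {z. z$2 > 0} (pt x y) * q (pt x y) = q (pt x y) * indicator {0..R+1} y"
      proof eventually_elim
        case (elim y)
        show ?case
        proof (cases "y > R + 1")
          case True
          then have "q (pt x y) = 0" by (intro pt_out[OF R(2)]) auto
          then show ?thesis by simp
        next
          case False
          then show ?thesis using elim by (auto simp: indicator_def)
        qed
      qed
    qed
    also have "\<dots> = P (pt x (R + 1)) - P (pt x 0)"
      by (rule integral_FTC_Icc_real) (use R d qc in auto)
    also have "P (pt x (R + 1)) = 0" by (rule pt_out[OF R(1)]) (use R in auto)
    finally show ?thesis by simp
  qed
  show ?thesis unfolding fubini_pt(1)[OF half_plane_indicator_integrable[OF q cs]] inner by simp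
qed

lemma half_plane_FTC_horizontal:
  fixes P q :: "real^2 \<Rightarrow> real"
  assumes q: "continuous_on UNIV q" and R: "supp P \<subseteq> cball 0 R" "supp q \<subseteq> cball 0 R" "R > 0"
    and d: "\<And>x y. ((\<lambda>x. P (pt x y)) has_real_derivative q (pt x y)) (at x)"
  shows "(LINT z|lborel. indicator {z. z$2 > 0} z * q z) = 0"
proof -
  have cs: "compact (supp q)" by (rule compact_supp_subset[OF compact_cball R(2)])
  have inner: "(LINT x|lborel. indicator {z. z$2 > 0} (pt x y) * q (pt x y)) = 0" for y
  proof -
    have qc: "isCont (\<lambda>x. q (pt x y)) x" for x
    proof -
      have "continuous_on UNIV (\<lambda>x. q (pt x y))"
        unfolding vector2_eq by (rule continuous_on_compose2[OF q]) (auto intro!: continuous_intros)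
      then show ?thesis by (simp add: continuous_on_eq_continuous_at)
    qed
    have "(LINT x|lborel. indicator {z. z$2 > 0} (pt x y) * q (pt x y))
        = (LINT x|lborel. indicator {0<..} y * (q (pt x y) * indicator {-(R+1)..R+1} x))"
    proof (rule Bochner_Integration.integral_cong[OF refl])
      fix x
      show "indicator {z. z$2 > 0} (pt x y) * q (pt x y) = indicator {0<..} y * (q (pt x y) * indicator {-(R+1)..R+1} x)"
      proof (cases "\<bar>x\<bar> > R + 1")
        case True
        then have "q (pt x y) = 0" by (intro pt_out[OF R(2)]) auto
        then show ?thesis by simp
      next
        case False
        then have "x \<in> {-(R+1)..R+1}" by auto
        then show ?thesis by (auto simp: indicator_def)
      qed
    qed
    also have "\<dots> = indicator {0<..} y * (LINT x|lborel. q (pt x y) * indicator {-(R+1)..R+1} x)" by simp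
    also have "(LINT x|lborel. q (pt x y) * indicator {-(R+1)..R+1} x) = P (pt (R + 1) y) - P (pt (-(R + 1)) y)"
      by (rule integral_FTC_Icc_real) (use R d qc in auto)
    also have "\<dots> = 0" using pt_out[OF R(1), of "R + 1" y] pt_out[OF R(1), of "-(R + 1)" y] R by simp
    finally show ?thesis by simp
  qed
  show ?thesis unfolding fubini_pt(2)[OF half_plane_indicator_integrable[OF q cs]] inner by simp
qed

section \<open>Explicit competitors\<close>

text \<open>The prescribed trace and all Burgers vectors are multiples of \<open>(1,0)\<close>, so the second row can be \<open>0\<close>.\<close>

definition row_field :: "(real^2 \<Rightarrow> real) \<Rightarrow> (real^2 \<Rightarrow> real) \<Rightarrow> real^2 \<Rightarrow> real^2^2" where
  "row_field f g z = vector [vector [f z, g z], 0]"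

lemma row_field_simps [simp]:
  "row_field f g z $ 1 $ 1 = f z" "row_field f g z $ 1 $ 2 = g z" "row_field f g z $ 2 = 0"
  by (simp_all add: row_field_def)

lemma norm_row_field: "(norm (row_field f g z))\<^sup>2 = (f z)\<^sup>2 + (g z)\<^sup>2"
proof -
  have "(norm (row_field f g z))\<^sup>2 = (\<Sum>i\<in>UNIV. (norm (row_field f g z $ i))\<^sup>2)"
    by (simp add: norm_vec_def[where 'a="real^2"] L2_set_def sum_nonneg)
  also have "\<dots> = (f z)\<^sup>2 + (g z)\<^sup>2" unfolding sum_2 norm2 by (simp add: power2_eq_square)
  finally show ?thesis .
qed

lemma partial_pt:
  assumes "smooth \<phi>"
  shows "((\<lambda>x. \<phi> (pt x y)) has_real_derivative partial 1 \<phi> (pt x y)) (at x)"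
    and "((\<lambda>y. \<phi> (pt x y)) has_real_derivative partial 2 \<phi> (pt x y)) (at y)"
  using partial_line_derivative[OF smooth_differentiable[OF assms], of "y *\<^sub>R axis 2 1" 1 x]
    partial_line_derivative[OF smooth_differentiable[OF assms], of "x *\<^sub>R axis 1 1" 2 y]
  by (simp_all add: vector2_eq add.commute)

text \<open>Differentiability of \<open>f\<close> in the vertical and of \<open>g\<close> in the horizontal direction is all that the curl of the
  row \<open>(f, g)\<close> involves.\<close>

locale row_competitor =
  fixes h :: "real \<Rightarrow> real" and f g fy gx :: "real^2 \<Rightarrow> real" and e0 :: real
  assumes cont: "continuous_on UNIV f" "continuous_on UNIV g" "continuous_on UNIV fy" "continuous_on UNIV gx"
    and fy: "\<And>x y. ((\<lambda>y. f (pt x y)) has_real_derivative fy (pt x y)) (at y)"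
    and gx: "\<And>x y. ((\<lambda>x. g (pt x y)) has_real_derivative gx (pt x y)) (at x)"
    and bottom: "\<And>x. f (pt x 0) = e0"
begin

text \<open>Both sides only see \<open>\<phi>\<close> on its support, where the subgraph agrees with the upper half plane; the claim is
  integration by parts there.\<close>

lemma trace_identity:
  assumes \<phi>: "\<phi> \<in> test_functions UNIV"
    and s: "supp \<phi> \<inter> {z. z$2 \<ge> 0} \<subseteq> subgraph h \<union> {z. 0 < z$1 \<and> z$1 < 1 \<and> z$2 = 0 \<and> h (z$1) > 0}"
  shows "(LINT z:subgraph h|lebesgue. (gx z - fy z) * \<phi> z) =
    (LINT z:subgraph h|lebesgue. f z * partial 2 \<phi> z - g z * partial 1 \<phi> z)
     + e0 * (LINT x:{0..1}|lebesgue. \<phi> (vector [x, 0]))"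
proof -
  have sm: "smooth \<phi>" and cs: "compact (supp \<phi>)" using \<phi> by (auto simp: test_functions_def)
  obtain R where R: "R > 0" "supp \<phi> \<subseteq> cball 0 R"
    using compact_imp_bounded[OF cs] bounded_pos[of "supp \<phi>"] by (auto simp: dist_norm subset_iff)
  have c\<phi>: "continuous_on UNIV \<phi>" "continuous_on UNIV (partial i \<phi>)" for i
    by (intro smooth_continuous smooth_partial sm)+
  have off: "\<phi> z = 0" "partial i \<phi> z = 0" if "z \<notin> supp \<phi>" for z i
    using that supp_partial[of i \<phi>] not_supp by blast+
  have half: "(LINT z:subgraph h|lebesgue. F z) = (LINT z|lborel. indicator {z. z$2 > 0} z * F z)"
    and int: "integrable lborel (\<lambda>z. indicator {z. z$2 > 0} z * F z)"
    if F: "continuous_on UNIV F" "\<And>z. z \<notin> supp \<phi> \<Longrightarrow> F z = 0" for F :: "real^2 \<Rightarrow> real"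
  proof -
    have "supp F \<subseteq> supp \<phi>" by (rule supp_subset_closed) (use F in \<open>auto simp: supp_def\<close>)
    from compact_supp_subset[OF cs this] show i: "integrable lborel (\<lambda>z. indicator {z. z$2 > 0} z * F z)"
      by (rule half_plane_indicator_integrable[OF F(1)])
    have "(\<lambda>z. indicator (subgraph h) z *\<^sub>R F z) = (\<lambda>z. indicator {z. z$2 > 0} z * F z)"
    proof
      fix z show "indicator (subgraph h) z *\<^sub>R F z = indicator {z. z$2 > 0} z * F z"
      proof (cases "z \<in> supp \<phi> \<and> z$2 > 0")
        case True
        then have "z \<in> subgraph h" using s by force
        then show ?thesis using True by simp
      next
        case False
        then show ?thesis using F(2)[of z] by (auto simp: subgraph_def indicator_def)
      qed
    qed
    then show "(LINT z:subgraph h|lebesgue. F z) = (LINT z|lborel. indicator {z. z$2 > 0} z * F z)"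
      using i by (simp add: set_lebesgue_integral_def integral_completion borel_measurable_integrable)
  qed
  let ?I = "\<lambda>z. indicator {z. z$2 > 0} z :: real"
  have off2: "\<phi> z = 0" "partial i \<phi> z = 0" if "z \<notin> cball 0 R" for z i
    using off that R(2) by blast+
  have sP: "supp (\<lambda>z. a z * \<phi> z) \<subseteq> cball 0 R" for a
    by (rule supp_subset_closed[OF closed_cball]) (simp add: off2 del: mem_cball mem_cball_0)
  have s2: "supp (\<lambda>z. a z * \<phi> z + c z * partial i \<phi> z) \<subseteq> cball 0 R" for a c i
    by (rule supp_subset_closed[OF closed_cball]) (simp add: off2 del: mem_cball mem_cball_0)
  have V: "(LINT z|lborel. ?I z * (fy z * \<phi> z + f z * partial 2 \<phi> z)) = - (LINT x|lborel. f (pt x 0) * \<phi> (pt x 0))"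
  proof (rule half_plane_FTC_vertical[OF _ sP s2 R(1)])
    show "continuous_on UNIV (\<lambda>z. fy z * \<phi> z + f z * partial 2 \<phi> z)" by (intro continuous_intros cont c\<phi>)
    show "((\<lambda>y. f (pt x y) * \<phi> (pt x y)) has_real_derivative fy (pt x y) * \<phi> (pt x y) + f (pt x y) * partial 2 \<phi> (pt x y)) (at y)" for x y
      by (rule DERIV_cong[OF DERIV_mult[OF fy partial_pt(2)[OF sm]]]) simp
  qed
  have Hz: "(LINT z|lborel. ?I z * (gx z * \<phi> z + g z * partial 1 \<phi> z)) = 0"
  proof (rule half_plane_FTC_horizontal[OF _ sP s2 R(1)])
    show "continuous_on UNIV (\<lambda>z. gx z * \<phi> z + g z * partial 1 \<phi> z)" by (intro continuous_intros cont c\<phi>)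
    show "((\<lambda>x. g (pt x y) * \<phi> (pt x y)) has_real_derivative gx (pt x y) * \<phi> (pt x y) + g (pt x y) * partial 1 \<phi> (pt x y)) (at x)" for x y
      by (rule DERIV_cong[OF DERIV_mult[OF gx partial_pt(1)[OF sm]]]) simp
  qed
  have "(LINT z:subgraph h|lebesgue. (gx z - fy z) * \<phi> z) - (LINT z:subgraph h|lebesgue. f z * partial 2 \<phi> z - g z * partial 1 \<phi> z)
     = (LINT z|lborel. ?I z * ((gx z - fy z) * \<phi> z)) - (LINT z|lborel. ?I z * (f z * partial 2 \<phi> z - g z * partial 1 \<phi> z))"
    by (subst (1 2) half) (auto intro!: continuous_intros cont c\<phi> simp: off)
  also have "\<dots> = (LINT z|lborel. ?I z * ((gx z - fy z) * \<phi> z) - ?I z * (f z * partial 2 \<phi> z - g z * partial 1 \<phi> z))"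
    by (rule Bochner_Integration.integral_diff[symmetric]) (auto intro!: int continuous_intros cont c\<phi> simp: off)
  also have "\<dots> = (LINT z|lborel. ?I z * (gx z * \<phi> z + g z * partial 1 \<phi> z) - ?I z * (fy z * \<phi> z + f z * partial 2 \<phi> z))"
    by (rule Bochner_Integration.integral_cong[OF refl]) (simp add: algebra_simps)
  also have "\<dots> = (LINT z|lborel. ?I z * (gx z * \<phi> z + g z * partial 1 \<phi> z)) - (LINT z|lborel. ?I z * (fy z * \<phi> z + f z * partial 2 \<phi> z))"
    by (rule Bochner_Integration.integral_diff) (auto intro!: int continuous_intros cont c\<phi> simp: off)
  also have "\<dots> = (LINT x|lborel. e0 * \<phi> (pt x 0))" unfolding V Hz by (simp add: bottom)
  also have "\<dots> = e0 * (LINT x:{0..1}|lebesgue. \<phi> (pt x 0))"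
  proof -
    have z: "indicator {0..1} x * \<phi> (pt x 0) = \<phi> (pt x 0)" for x
    proof (cases "pt x 0 \<in> supp \<phi>")
      case True
      then have "pt x 0 \<in> subgraph h \<union> {z. 0 < z$1 \<and> z$1 < 1 \<and> z$2 = 0 \<and> h (z$1) > 0}" using s by auto
      then show ?thesis by (auto simp: subgraph_def)
    qed (simp add: off)
    have m: "(\<lambda>x. \<phi> (pt x 0)) \<in> borel_measurable lborel"
      using borel_measurable_continuous_onI[OF continuous_on_slice[OF c\<phi>(1)]] by simp
    show ?thesis using m by (simp add: set_lebesgue_integral_def z integral_completion)
  qed
  finally show ?thesis by simp
qed

text \<open>The curl equation is the special case of the trace condition in which the test function vanishes on the
  bottom.\<close>

lemma admissible_row:
  assumes h: "\<And>x. x \<in> {0..1} \<Longrightarrow> h x \<ge> 0" "C-lipschitz_on {0..1} h" "(LINT x:{0..1}|lebesgue. h x) = d" "h 0 = 0" "h 1 = 0"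
    and balls: "\<And>p. p \<in># P \<Longrightarrow> ball p r0 \<subseteq> subgraph h"
    and curl: "\<And>z. z \<in> subgraph h \<Longrightarrow> gx z - fy z = mollified_dislocations J r0 b P z $ 1"
  shows "(h, row_field f g, P) \<in> admissible J d e0 b r0"
proof -
  let ?\<Omega> = "subgraph h"
  let ?G = "mollified_dislocations J r0 b P"
  have ch: "continuous_on {0..1} h" by (rule lipschitz_on_continuous_on[OF h(2)])
  have op: "open ?\<Omega>" by (rule open_subgraph[OF ch])
  then have \<Omega>: "?\<Omega> \<in> sets lebesgue" "?\<Omega> \<inter> space lebesgue \<in> sets lebesgue" by (auto intro: borel_open)
  have row: "continuous_on UNIV (row_field f g)"
  proof -
    have "row_field f g = (\<lambda>z. \<chi> i j. if i = 1 then (if j = 1 then f z else g z) else 0)"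
      by (auto simp: fun_eq_iff vec_eq_iff forall_2 row_field_def)
    moreover have "continuous_on UNIV (\<lambda>z. if i = 1 then (if j = 1 then f z else g z) else 0)" for i j :: 2
      using cont by (cases "i = 1"; cases "j = 1") auto
    ultimately show ?thesis by (simp only: continuous_on_vec_lambda)
  qed
  then have m: "row_field f g \<in> borel_measurable (lebesgue_on ?\<Omega>)"
    by (intro measurable_restrict_space1 measurable_completion) (simp add: borel_measurable_continuous_onI)
  obtain B where B: "\<And>x. x \<in> {0..1} \<Longrightarrow> h x \<le> B"
    using compact_continuous_image[OF ch compact_Icc] compact_imp_bounded bounded_real by (metis abs_le_D1 imageI)
  have sub: "?\<Omega> \<subseteq> cbox (pt 0 0) (pt 1 B)"
  proof
    fix z assume "z \<in> ?\<Omega>"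
    then have z: "0 < z$1" "z$1 < 1" "0 < z$2" "z$2 < h (z$1)" by (auto simp: subgraph_def)
    moreover have "h (z$1) \<le> B" using z by (intro B) auto
    ultimately show "z \<in> cbox (pt 0 0) (pt 1 B)" by (simp add: mem_box_cart forall_2)
  qed
  have "integrable lborel (\<lambda>z. indicator (cbox (pt 0 0) (pt 1 B)) z *\<^sub>R ((f z)\<^sup>2 + (g z)\<^sup>2))"
    by (rule borel_integrable_compact) (use cont in \<open>auto intro!: continuous_intros intro: continuous_on_subset\<close>)
  then have "integrable lebesgue (\<lambda>z. indicator (cbox (pt 0 0) (pt 1 B)) z * ((f z)\<^sup>2 + (g z)\<^sup>2))"
    by (simp add: integrable_completion)
  from integrable_mult_indicator[OF \<Omega>(1) this]
  have "integrable lebesgue (\<lambda>z. indicator ?\<Omega> z * (indicator (cbox (pt 0 0) (pt 1 B)) z * ((f z)\<^sup>2 + (g z)\<^sup>2)))" by simp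
  moreover have "(\<lambda>z. indicator ?\<Omega> z * (indicator (cbox (pt 0 0) (pt 1 B)) z * ((f z)\<^sup>2 + (g z)\<^sup>2))) =
     (\<lambda>z. indicator ?\<Omega> z * ((f z)\<^sup>2 + (g z)\<^sup>2))" using sub by (auto simp: fun_eq_iff indicator_def)
  ultimately have int: "integrable lebesgue (\<lambda>z. indicator ?\<Omega> z * ((f z)\<^sup>2 + (g z)\<^sup>2))" by simp
  have G2: "?G z $ 2 = 0" for z by (simp add: mollified_dislocations_def)
  have tr: "has_bottom_tangential_trace h (row_field f g) ?G (vector [e0, 0])"
    unfolding has_bottom_tangential_trace_def
  proof (intro ballI impI allI)
    fix \<phi> and i :: 2 assume \<phi>: "\<phi> \<in> test_functions UNIV"
      "supp \<phi> \<inter> {z. z$2 \<ge> 0} \<subseteq> ?\<Omega> \<union> {z. 0 < z$1 \<and> z$1 < 1 \<and> z$2 = 0 \<and> h (z$1) > 0}"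
    have eq: "(LINT z:?\<Omega>|lebesgue. ?G z $ 1 * \<phi> z) = (LINT z:?\<Omega>|lebesgue. (gx z - fy z) * \<phi> z)"
      unfolding set_lebesgue_integral_def
      by (rule Bochner_Integration.integral_cong[OF refl]) (auto simp: indicator_def curl)
    have "i = 1 \<or> i = 2" using exhaust_2 by blast
    then show "(LINT z:?\<Omega>|lebesgue. ?G z $ i * \<phi> z) =
      (LINT z:?\<Omega>|lebesgue. row_field f g z $ i $ 1 * partial 2 \<phi> z - row_field f g z $ i $ 2 * partial 1 \<phi> z)
       + vector [e0, 0] $ i * (LINT x:{0..1}|lebesgue. \<phi> (vector [x, 0]))"
      using trace_identity[OF \<phi>] eq by (auto simp: G2 set_lebesgue_integral_def)
  qed
  have "has_curl (row_field f g) ?G ?\<Omega>"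
    unfolding has_curl_def
  proof (intro ballI allI)
    fix \<phi> and i :: 2 assume \<phi>: "\<phi> \<in> test_functions ?\<Omega>"
    then have sup: "supp \<phi> \<subseteq> ?\<Omega>" and tU: "\<phi> \<in> test_functions UNIV" by (auto simp: test_functions_def)
    have "\<phi> (vector [x, 0]) = 0" for x using sup by (intro not_supp) (auto simp: subgraph_def)
    then have "(LINT x:{0..1}|lebesgue. \<phi> (vector [x, 0])) = 0" by (simp add: set_lebesgue_integral_def)
    moreover have sup2: "supp \<phi> \<inter> {z. z$2 \<ge> 0} \<subseteq> ?\<Omega> \<union> {z. 0 < z$1 \<and> z$1 < 1 \<and> z$2 = 0 \<and> h (z$1) > 0}" using sup by blast
    moreover note tr[unfolded has_bottom_tangential_trace_def, rule_format, OF tU sup2, of i]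
    ultimately show "(LINT z:?\<Omega>|lebesgue. row_field f g z $ i $ 1 * partial 2 \<phi> z - row_field f g z $ i $ 2 * partial 1 \<phi> z)
        = (LINT z:?\<Omega>|lebesgue. ?G z $ i * \<phi> z)" by simp
  qed
  then show "(h, row_field f g, P) \<in> admissible J d e0 b r0"
    using h balls tr m int \<Omega> by (auto simp: admissible_def norm_row_field integrable_restrict_space)
qed

end

section \<open>Averages of the kernel over scales and translations\<close>

text \<open>A common form of all kernels below, namely integrals over a parameter of rescaled and translated copies of
  \<open>f\<close>.\<close>

definition pint :: "real \<Rightarrow> real \<Rightarrow> (real \<Rightarrow> real) \<Rightarrow> (real \<Rightarrow> real^2) \<Rightarrow> (real \<Rightarrow> real) \<Rightarrow> (real^2 \<Rightarrow> real) \<Rightarrow> real^2 \<Rightarrow> real" where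
  "pint a b \<alpha> \<beta> w f z = integral {a..b} (\<lambda>t. f (\<alpha> t *\<^sub>R z + \<beta> t) * w t)"

lemma pint_integrand_continuous:
  fixes a b :: real and \<alpha> w :: "real \<Rightarrow> real" and \<beta> :: "real \<Rightarrow> real^2" and f :: "real^2 \<Rightarrow> real"
  assumes c: "continuous_on {a..b} \<alpha>" "continuous_on {a..b} \<beta>" "continuous_on {a..b} w" and f: "continuous_on UNIV f"
  shows "continuous_on (UNIV \<times> cbox a b) (\<lambda>(z, t). f (\<alpha> t *\<^sub>R z + \<beta> t) * w t)"
proof -
  have "continuous_on (UNIV \<times> cbox a b) (\<lambda>p. f (\<alpha> (snd p) *\<^sub>R fst p + \<beta> (snd p)) * w (snd p))"
    by (intro continuous_on_mult continuous_on_compose2[OF f] continuous_on_add continuous_on_scaleR continuous_on_fst continuous_on_id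
       continuous_on_compose2[OF c(1)] continuous_on_compose2[OF c(2)] continuous_on_compose2[OF c(3)] continuous_on_snd) auto
  then show ?thesis by (simp add: case_prod_unfold)
qed

lemma pint_continuous:
  assumes "continuous_on {a..b} \<alpha>" "continuous_on {a..b} \<beta>" "continuous_on {a..b} w" "continuous_on UNIV f"
  shows "continuous_on UNIV (pint a b \<alpha> \<beta> w f)"
proof -
  have "continuous_on UNIV (\<lambda>z. integral (cbox a b) (\<lambda>t. f (\<alpha> t *\<^sub>R z + \<beta> t) * w t))"
    by (rule integral_continuous_on_param[OF pint_integrand_continuous[OF assms]])
  then show ?thesis by (simp add: pint_def[abs_def])
qed

lemma pint_integrable:
  fixes a b :: real and \<alpha> w :: "real \<Rightarrow> real" and \<beta> :: "real \<Rightarrow> real^2" and f :: "real^2 \<Rightarrow> real"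
  assumes "continuous_on {a..b} \<alpha>" "continuous_on {a..b} \<beta>" "continuous_on {a..b} w" "continuous_on UNIV f"
  shows "(\<lambda>t. f (\<alpha> t *\<^sub>R z + \<beta> t) * w t) integrable_on {a..b}"
  by (intro integrable_continuous_interval continuous_on_mult continuous_on_compose2[OF assms(4)] continuous_intros assms) auto

lemma pint_derivative:
  assumes c: "continuous_on {a..b} \<alpha>" "continuous_on {a..b} \<beta>" "continuous_on {a..b} w" and f: "smooth f"
  shows "((\<lambda>s. pint a b \<alpha> \<beta> w f (z + s *\<^sub>R axis i 1)) has_real_derivative
     pint a b \<alpha> \<beta> (\<lambda>t. \<alpha> t * w t) (partial i f) (z + s *\<^sub>R axis i 1)) (at s)"
proof -
  have "((\<lambda>s. integral (cbox a b) (\<lambda>t. f (\<alpha> t *\<^sub>R (z + s *\<^sub>R axis i 1) + \<beta> t) * w t)) has_real_derivative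
     integral (cbox a b) (\<lambda>t. partial i f (\<alpha> t *\<^sub>R (z + s *\<^sub>R axis i 1) + \<beta> t) * (\<alpha> t * w t))) (at s within UNIV)"
  proof (rule leibniz_rule_field_derivative)
    fix s t :: real
    have "((\<lambda>s. f ((\<alpha> t *\<^sub>R z + \<beta> t) + (\<alpha> t * s) *\<^sub>R axis i 1)) has_real_derivative
        partial i f ((\<alpha> t *\<^sub>R z + \<beta> t) + (\<alpha> t * s) *\<^sub>R axis i 1) * \<alpha> t) (at s)"
      by (rule DERIV_chain2[OF partial_line_derivative[OF smooth_differentiable[OF f]]]) (auto intro!: derivative_eq_intros)
    then have "((\<lambda>s. f (\<alpha> t *\<^sub>R (z + s *\<^sub>R axis i 1) + \<beta> t)) has_real_derivative
        partial i f (\<alpha> t *\<^sub>R (z + s *\<^sub>R axis i 1) + \<beta> t) * \<alpha> t) (at s)"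
      by (simp add: algebra_simps)
    from DERIV_cmult_right[OF this, of "w t"]
    show "((\<lambda>s. f (\<alpha> t *\<^sub>R (z + s *\<^sub>R axis i 1) + \<beta> t) * w t) has_real_derivative
        partial i f (\<alpha> t *\<^sub>R (z + s *\<^sub>R axis i 1) + \<beta> t) * (\<alpha> t * w t)) (at s within UNIV)"
      by (simp add: mult.assoc)
  next
    show "(\<lambda>t. f (\<alpha> t *\<^sub>R (z + s *\<^sub>R axis i 1) + \<beta> t) * w t) integrable_on cbox a b" for s
      using pint_integrable[OF c smooth_continuous[OF f]] by simp
    have cw: "continuous_on {a..b} (\<lambda>t. \<alpha> t * w t)" by (intro continuous_intros c)
    have "continuous_on (UNIV \<times> cbox a b) (\<lambda>p. (z + fst p *\<^sub>R axis i 1, snd p) :: (real^2) \<times> real)"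
      by (intro continuous_intros)
    moreover have "(\<lambda>p. (z + fst p *\<^sub>R axis i 1, snd p)) ` (UNIV \<times> cbox a b) \<subseteq> UNIV \<times> cbox a b" by auto
    note continuous_on_compose2[OF pint_integrand_continuous[OF c(1,2) cw smooth_continuous[OF smooth_partial[OF f, of i]]] _ this]
    ultimately
    show "continuous_on (UNIV \<times> cbox a b) (\<lambda>(s, t). partial i f (\<alpha> t *\<^sub>R (z + s *\<^sub>R axis i 1) + \<beta> t) * (\<alpha> t * w t))"
      by (auto simp: case_prod_unfold)
  qed auto
  then show ?thesis by (simp add: pint_def)
qed

locale kernel =
  fixes J :: "real^2 \<Rightarrow> real" and Jm :: real
  assumes J: "admissible_kernel J" and Jm: "\<And>z. J z \<le> Jm" "Jm > 0"
begin

lemma J_smooth: "smooth J" and J_nonneg: "J z \<ge> 0" and J_outside: "norm z \<ge> 1 \<Longrightarrow> J z = 0"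
proof -
  show "smooth J" "J z \<ge> 0" using J by (auto simp: admissible_kernel_def test_functions_def)
  assume "norm z \<ge> 1"
  then have "z \<notin> supp J" using J by (auto simp: admissible_kernel_def test_functions_def dist_norm)
  then show "J z = 0" by (rule not_supp)
qed

text \<open>The field of a dislocation is \<open>\<kappa>(z) * (- z$2, z$1)\<close> with \<open>\<kappa>(z)\<close> the integral of \<open>J (z / t) / t ^ 3\<close> over the
  scales \<open>t\<close> from \<open>r\<close> to \<open>R\<close>; \<open>kap_d\<close> gives the partial derivatives of \<open>\<kappa>\<close>.\<close>

definition kap :: "real \<Rightarrow> real \<Rightarrow> real^2 \<Rightarrow> real" where
  "kap r R = pint r R (\<lambda>t. 1 / t) (\<lambda>t. 0) (\<lambda>t. 1 / t ^ 3) J"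

definition kap_d :: "2 \<Rightarrow> real \<Rightarrow> real \<Rightarrow> real^2 \<Rightarrow> real" where
  "kap_d i r R = pint r R (\<lambda>t. 1 / t) (\<lambda>t. 0) (\<lambda>t. 1 / t * (1 / t ^ 3)) (partial i J)"

context
  fixes r R :: real
  assumes r: "0 < r" "r \<le> R"
begin

lemma kap_cont_aux: "continuous_on {r..R} (\<lambda>t. 1 / t)" "continuous_on {r..R} (\<lambda>t. 0 :: real^2)"
  "continuous_on {r..R} (\<lambda>t. 1 / t ^ 3)" "continuous_on {r..R} (\<lambda>t. 1 / t * (1 / t ^ 3))"
  using r by (auto intro!: continuous_intros)

lemma kap_continuous: "continuous_on UNIV (kap r R)" "continuous_on UNIV (kap_d i r R)"
  unfolding kap_def kap_d_def
  by (intro pint_continuous kap_cont_aux smooth_continuous J_smooth smooth_partial)+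

lemma kap_derivative:
  "((\<lambda>s. kap r R (z + s *\<^sub>R axis i 1)) has_real_derivative kap_d i r R (z + s *\<^sub>R axis i 1)) (at s)"
  unfolding kap_def kap_d_def by (rule pint_derivative[OF kap_cont_aux(1-3) J_smooth])

text \<open>The divergence of \<open>z \<mapsto> \<kappa>(z) z\<close> is the difference of the kernels at the two scales.\<close>

lemma kap_divergence:
  "2 * kap r R z + z$1 * kap_d 1 r R z + z$2 * kap_d 2 r R z = rescaled J r z - rescaled J R z"
proof -
  let ?d = "\<lambda>t. partial 1 J ((1 / t) *\<^sub>R z) * z$1 + partial 2 J ((1 / t) *\<^sub>R z) * z$2"
  have "((\<lambda>t. 2 * (J ((1 / t) *\<^sub>R z) * (1 / t ^ 3)) + ?d t * (1 / t ^ 4)) has_integral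
      (- (J ((1 / R) *\<^sub>R z) / R\<^sup>2)) - (- (J ((1 / r) *\<^sub>R z) / r\<^sup>2))) {r..R}"
  proof (rule fundamental_theorem_of_calculus[OF r(2)])
    fix t assume "t \<in> {r..R}"
    then have t: "t > 0" using r by auto
    have g: "((\<lambda>t. (1 / t) *\<^sub>R z) has_derivative (\<lambda>s. (s * - (1 / t\<^sup>2)) *\<^sub>R z)) (at t)"
      using t by (auto intro!: derivative_eq_intros simp: power2_eq_square divide_inverse)
    have "((\<lambda>t. J ((1 / t) *\<^sub>R z)) has_derivative (\<lambda>s. s * - (?d t / t\<^sup>2))) (at t)"
      using has_derivative_compose[OF g has_derivative_partial[OF smooth_differentiable[OF J_smooth]]]
      by (rule has_derivative_eq_rhs) (auto simp: fun_eq_iff algebra_simps add_divide_distrib)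
    then have J': "((\<lambda>t. J ((1 / t) *\<^sub>R z)) has_real_derivative - (?d t / t\<^sup>2)) (at t)"
      unfolding has_field_derivative_def by (rule has_derivative_eq_rhs) (simp add: fun_eq_iff)
    have "((\<lambda>t. - (J ((1 / t) *\<^sub>R z) / t\<^sup>2)) has_real_derivative
        2 * (J ((1 / t) *\<^sub>R z) * (1 / t ^ 3)) + ?d t * (1 / t ^ 4)) (at t)"
      using t by (auto intro!: derivative_eq_intros J' simp: power2_eq_square power3_eq_cube power4_eq_xxxx field_simps)
    then show "((\<lambda>t. - (J ((1 / t) *\<^sub>R z) / t\<^sup>2)) has_vector_derivative
        2 * (J ((1 / t) *\<^sub>R z) * (1 / t ^ 3)) + ?d t * (1 / t ^ 4)) (at t within {r..R})"
      by (simp add: has_real_derivative_iff_has_vector_derivative has_vector_derivative_at_within)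
  qed
  then have "integral {r..R} (\<lambda>t. 2 * (J ((1 / t) *\<^sub>R z) * (1 / t ^ 3)) + ?d t * (1 / t ^ 4)) =
      rescaled J r z - rescaled J R z"
    by (simp add: integral_unique rescaled_def inverse_eq_divide)
  moreover have "((\<lambda>t. 2 * (J ((1 / t) *\<^sub>R z) * (1 / t ^ 3)) + ?d t * (1 / t ^ 4)) has_integral
     2 * kap r R z + (z$1 * kap_d 1 r R z + z$2 * kap_d 2 r R z)) {r..R}"
  proof -
    have k: "((\<lambda>t. J ((1 / t) *\<^sub>R z) * (1 / t ^ 3)) has_integral kap r R z) {r..R}"
      unfolding kap_def pint_def
      using pint_integrable[OF kap_cont_aux(1-3) smooth_continuous[OF J_smooth], of z] by (simp add: has_integral_integral)
    have kd: "((\<lambda>t. partial i J ((1 / t) *\<^sub>R z) * (1 / t * (1 / t ^ 3))) has_integral kap_d i r R z) {r..R}" for i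
      unfolding kap_d_def pint_def
      using pint_integrable[OF kap_cont_aux(1,2,4) smooth_continuous[OF smooth_partial[OF J_smooth]], of i z] by (simp add: has_integral_integral)
    have "((\<lambda>t. 2 * (J ((1 / t) *\<^sub>R z) * (1 / t ^ 3)) + (z$1 * (partial 1 J ((1 / t) *\<^sub>R z) * (1 / t * (1 / t ^ 3)))
        + z$2 * (partial 2 J ((1 / t) *\<^sub>R z) * (1 / t * (1 / t ^ 3))))) has_integral
     2 * kap r R z + (z$1 * kap_d 1 r R z + z$2 * kap_d 2 r R z)) {r..R}"
      by (intro has_integral_add has_integral_mult_right k kd)
    then show ?thesis
      by (rule has_integral_eq[rotated]) (simp add: power3_eq_cube power4_eq_xxxx algebra_simps add_divide_distrib)
  qed
  ultimately show ?thesis by (simp add: integral_unique)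
qed

lemma kap_nonneg: "kap r R z \<ge> 0"
  unfolding kap_def pint_def using r
  by (intro integral_nonneg pint_integrable[OF kap_cont_aux(1-3) smooth_continuous[OF J_smooth], of z]) (auto intro!: divide_nonneg_nonneg J_nonneg)

lemma scaled_outside: "t > 0 \<Longrightarrow> norm z \<ge> t \<Longrightarrow> J ((1 / t) *\<^sub>R z) = 0"
  by (rule J_outside) (simp add: pos_le_divide_eq)

lemma kap_outside: "norm z \<ge> R \<Longrightarrow> kap r R z = 0"
proof -
  assume z: "norm z \<ge> R"
  have "kap r R z = integral {r..R} (\<lambda>t. 0)"
    unfolding kap_def pint_def by (rule integral_cong) (use r z scaled_outside in auto)
  then show ?thesis by simp
qed

text \<open>The integrand vanishes for \<open>t \<le> norm z\<close>, and for larger \<open>t\<close> it is at most \<open>Jm\<close> times the derivative of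
  \<open>- 2 / (t\<^sup>2 + (norm z)\<^sup>2)\<close>.\<close>

lemma kap_le: "kap r R z \<le> 2 * Jm / (r\<^sup>2 + (norm z)\<^sup>2)"
proof -
  let ?s = "(norm z)\<^sup>2"
  let ?g = "\<lambda>t. Jm * (4 * t / (t\<^sup>2 + ?s)\<^sup>2)"
  have pos: "t\<^sup>2 + ?s > 0" if "t > 0" for t using that by (simp add: add_pos_nonneg)
  have g: "(?g has_integral (- (2 * Jm / (R\<^sup>2 + ?s))) - (- (2 * Jm / (r\<^sup>2 + ?s)))) {r..R}"
  proof (rule fundamental_theorem_of_calculus[OF r(2)])
    fix t assume "t \<in> {r..R}"
    then have t: "t > 0" using r by auto
    have "((\<lambda>t. - (2 * Jm / (t\<^sup>2 + ?s))) has_real_derivative ?g t) (at t)"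
      using pos[OF t] by (auto intro!: derivative_eq_intros simp: power2_eq_square)
    then show "((\<lambda>t. - (2 * Jm / (t\<^sup>2 + ?s))) has_vector_derivative ?g t) (at t within {r..R})"
      by (simp add: has_real_derivative_iff_has_vector_derivative has_vector_derivative_at_within)
  qed
  have "kap r R z \<le> integral {r..R} ?g"
    unfolding kap_def pint_def
  proof (rule integral_le)
    show "(\<lambda>t. J ((1 / t) *\<^sub>R z + 0) * (1 / t ^ 3)) integrable_on {r..R}"
      by (rule pint_integrable[OF kap_cont_aux(1-3) smooth_continuous[OF J_smooth]])
    show "?g integrable_on {r..R}" using g by blast
    fix t assume "t \<in> {r..R}"
    then have t: "t > 0" using r by auto
    show "J ((1 / t) *\<^sub>R z + 0) * (1 / t ^ 3) \<le> ?g t"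
    proof (cases "norm z \<ge> t")
      case True
      then show ?thesis using scaled_outside[OF t True] t Jm(2) by simp
    next
      case False
      then have "?s \<le> t\<^sup>2" by (intro power_mono) auto
      then have "(t\<^sup>2 + ?s)\<^sup>2 \<le> (2 * t\<^sup>2)\<^sup>2" by (intro power_mono) auto
      also have "\<dots> = 4 * t * t ^ 3" by (simp add: power2_eq_square power3_eq_cube)
      finally have "1 / t ^ 3 \<le> 4 * t / (t\<^sup>2 + ?s)\<^sup>2" using t pos[OF t] by (simp add: field_simps)
      then show ?thesis using Jm J_nonneg t by (intro mult_mono) auto
    qed
  qed
  also have "integral {r..R} ?g \<le> 2 * Jm / (r\<^sup>2 + ?s)"
    using g pos[of R] r Jm(2) by (simp add: integral_unique)
  finally show ?thesis .
qed

end

end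

section \<open>Columns and cores\<close>

text \<open>A sum over dyadic discs, each of which has the same integral up to a constant.\<close>

lemma inverse_square_layers:
  fixes z :: "real^2"
  assumes r: "r > 0" and z: "norm z \<le> 2 ^ N * r"
  shows "1 / (r\<^sup>2 + (norm z)\<^sup>2) \<le> (\<Sum>j\<le>N. 4 / (2 ^ j * r)\<^sup>2 * indicator (cball 0 (2 ^ j * r)) z)"
proof -
  define j where "j = (LEAST j. norm z \<le> 2 ^ j * r)"
  have j: "norm z \<le> 2 ^ j * r" "j \<le> N" unfolding j_def using z by (auto intro: LeastI Least_le)
  have p: "(2 ^ j * r)\<^sup>2 > 0" "r\<^sup>2 + (norm z)\<^sup>2 > 0" using r by (auto intro: add_pos_nonneg)
  have "(2 ^ j * r)\<^sup>2 \<le> 4 * (r\<^sup>2 + (norm z)\<^sup>2)"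
  proof (cases j)
    case (Suc i)
    have "\<not> norm z \<le> 2 ^ i * r" using Suc not_less_Least[of i "\<lambda>j. norm z \<le> 2 ^ j * r"] unfolding j_def by auto
    then have "2 ^ j * r \<le> 2 * norm z" using Suc by simp
    then have "(2 ^ j * r)\<^sup>2 \<le> (2 * norm z)\<^sup>2" using r by (intro power_mono) auto
    also have "(2 * norm z)\<^sup>2 \<le> 4 * (r\<^sup>2 + (norm z)\<^sup>2)" by (simp add: power_mult_distrib)
    finally show ?thesis .
  qed simp
  then have "1 / (r\<^sup>2 + (norm z)\<^sup>2) \<le> 4 / (2 ^ j * r)\<^sup>2" using p by (simp add: divide_le_eq pos_le_divide_eq)
  also have "\<dots> = 4 / (2 ^ j * r)\<^sup>2 * indicator (cball 0 (2 ^ j * r)) z" using j by simp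
  also have "\<dots> \<le> (\<Sum>j\<le>N. 4 / (2 ^ j * r)\<^sup>2 * indicator (cball 0 (2 ^ j * r)) z)"
    by (rule member_le_sum[of j "{..N}" "\<lambda>j. 4 / (2 ^ j * r)\<^sup>2 * indicator (cball 0 (2 ^ j * r)) z"]) (use j in auto)
  finally show ?thesis .
qed

context kernel
begin

text \<open>A column: the kernel at scale \<open>R\<close>, smeared vertically over a length \<open>l\<close> downwards, so that its vertical derivative is the
  difference of the kernels at the two ends (\<open>col_d_eq\<close>).\<close>

definition shift :: "real \<Rightarrow> real \<Rightarrow> real^2" where "shift l t = (t + l / 2) *\<^sub>R axis 2 1"

definition col :: "real \<Rightarrow> real \<Rightarrow> real^2 \<Rightarrow> real" where
  "col l R = pint (- l / 2) (l / 2) (\<lambda>t. 1 / R) (\<lambda>t. (1 / R) *\<^sub>R shift l t) (\<lambda>t. 1 / R\<^sup>2) J"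

definition col_d :: "real \<Rightarrow> real \<Rightarrow> real^2 \<Rightarrow> real" where
  "col_d l R = pint (- l / 2) (l / 2) (\<lambda>t. 1 / R) (\<lambda>t. (1 / R) *\<^sub>R shift l t) (\<lambda>t. 1 / R * (1 / R\<^sup>2)) (partial 2 J)"

context
  fixes l R :: real
  assumes l: "l > 0" and R: "R > 0"
begin

lemma col_cont_aux: "continuous_on S (\<lambda>t. 1 / R)" "continuous_on S (\<lambda>t. (1 / R) *\<^sub>R shift l t)"
  "continuous_on S (\<lambda>t. 1 / R\<^sup>2)" "continuous_on S (\<lambda>t. 1 / R * (1 / R\<^sup>2))"
  unfolding shift_def using R by (auto intro!: continuous_intros)

lemma col_continuous: "continuous_on UNIV (col l R)" "continuous_on UNIV (col_d l R)"
  unfolding col_def col_d_def by (intro pint_continuous col_cont_aux smooth_continuous J_smooth smooth_partial)+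

lemma col_derivative:
  "((\<lambda>s. col l R (z + s *\<^sub>R axis 2 1)) has_real_derivative col_d l R (z + s *\<^sub>R axis 2 1)) (at s)"
  unfolding col_def col_d_def by (rule pint_derivative[OF col_cont_aux(1-3) J_smooth])

lemma col_integrand: "J ((1 / R) *\<^sub>R z + (1 / R) *\<^sub>R shift l t) * (1 / R\<^sup>2) = rescaled J R (z + shift l t)"
  by (simp add: rescaled_def scaleR_add_right inverse_eq_divide)

lemma col_eq: "col l R z = integral {- l / 2..l / 2} (\<lambda>t. rescaled J R (z + shift l t))"
  unfolding col_def pint_def col_integrand ..

lemma col_integrable: "(\<lambda>t. rescaled J R (z + shift l t)) integrable_on {- l / 2..l / 2}"
  using pint_integrable[OF col_cont_aux(1-3) smooth_continuous[OF J_smooth], of z] unfolding col_integrand .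

lemma col_d_eq: "col_d l R z = rescaled J R (z + l *\<^sub>R axis 2 1) - rescaled J R z"
proof -
  have "((\<lambda>t. partial 2 J ((1 / R) *\<^sub>R z + (1 / R) *\<^sub>R shift l t) * (1 / R * (1 / R\<^sup>2))) has_integral
     J ((1 / R) *\<^sub>R z + (1 / R) *\<^sub>R shift l (l / 2)) * (1 / R\<^sup>2) - J ((1 / R) *\<^sub>R z + (1 / R) *\<^sub>R shift l (- l / 2)) * (1 / R\<^sup>2)) {- l / 2..l / 2}"
  proof (rule fundamental_theorem_of_calculus)
    fix t
    have "((\<lambda>t. J (((1 / R) *\<^sub>R z) + ((1 / R) * (t + l / 2)) *\<^sub>R axis 2 1)) has_real_derivative
        partial 2 J (((1 / R) *\<^sub>R z) + ((1 / R) * (t + l / 2)) *\<^sub>R axis 2 1) * (1 / R)) (at t)"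
      by (rule DERIV_chain2[OF partial_line_derivative[OF smooth_differentiable[OF J_smooth]]])
         (use R in \<open>auto intro!: derivative_eq_intros\<close>)
    from DERIV_cmult_right[OF this, of "1 / R\<^sup>2"]
    show "((\<lambda>t. J ((1 / R) *\<^sub>R z + (1 / R) *\<^sub>R shift l t) * (1 / R\<^sup>2)) has_vector_derivative
        partial 2 J ((1 / R) *\<^sub>R z + (1 / R) *\<^sub>R shift l t) * (1 / R * (1 / R\<^sup>2))) (at t within {- l / 2..l / 2})"
      by (simp add: shift_def has_real_derivative_iff_has_vector_derivative[symmetric] has_field_derivative_at_within mult.assoc)
  qed (use l in auto)
  then have "col_d l R z = J ((1 / R) *\<^sub>R z + (1 / R) *\<^sub>R shift l (l / 2)) * (1 / R\<^sup>2) - J ((1 / R) *\<^sub>R z + (1 / R) *\<^sub>R shift l (- l / 2)) * (1 / R\<^sup>2)"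
    unfolding col_d_def pint_def by (rule integral_unique)
  then show ?thesis unfolding col_integrand by (simp add: shift_def)
qed

lemma rescaled_outside: "norm z \<ge> R \<Longrightarrow> rescaled J R z = 0"
  unfolding rescaled_def using J_outside[of "z /\<^sub>R R"] R by (simp add: inverse_eq_divide pos_le_divide_eq)

lemma rescaled_bounds: "0 \<le> rescaled J R z" "rescaled J R z \<le> Jm / R\<^sup>2"
  unfolding rescaled_def using J_nonneg Jm(1) by (auto intro!: divide_right_mono)

lemma col_bounds: "0 \<le> col l R z" "col l R z \<le> l * Jm / R\<^sup>2"
proof -
  show "0 \<le> col l R z" unfolding col_eq by (rule integral_nonneg[OF col_integrable]) (simp add: rescaled_bounds)
  have "col l R z \<le> integral {- l / 2..l / 2} (\<lambda>t. Jm / R\<^sup>2)"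
    unfolding col_eq by (rule integral_le[OF col_integrable integrable_const_ivl]) (rule rescaled_bounds)
  then show "col l R z \<le> l * Jm / R\<^sup>2" using l by simp
qed

lemma col_outside: "\<bar>z$1\<bar> \<ge> R \<or> z$2 \<ge> R \<Longrightarrow> col l R z = 0"
proof -
  assume z: "\<bar>z$1\<bar> \<ge> R \<or> z$2 \<ge> R"
  have "integral {- l / 2..l / 2} (\<lambda>t. rescaled J R (z + shift l t)) = integral {- l / 2..l / 2} (\<lambda>t. 0)"
  proof (rule integral_cong)
    fix t assume t: "t \<in> {- l / 2..l / 2}"
    have "R \<le> norm (z + shift l t)"
      using z t component_le_norm_cart[of "z + shift l t" 1] component_le_norm_cart[of "z + shift l t" 2]
      by (auto simp: shift_def axis_def)
    then show "rescaled J R (z + shift l t) = 0" by (rule rescaled_outside)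
  qed
  then show ?thesis by (simp add: col_eq)
qed

text \<open>The values of the column on the horizontal line at depth \<open>l / 2\<close>; by Fubini's theorem they have mass one
  (\<open>trc_mass\<close>), and \<open>stp\<close> is their primitive.\<close>

definition trc :: "real \<Rightarrow> real" where "trc s = col l R (pt s (- l / 2))"

lemma trc_continuous: "continuous_on UNIV trc"
  unfolding trc_def vector2_eq
  by (rule continuous_on_compose2[OF col_continuous(1)]) (auto intro!: continuous_intros)

lemma trc_outside: "\<bar>s\<bar> \<ge> R \<Longrightarrow> trc s = 0" by (simp add: trc_def col_outside)

lemma trc_nonneg: "trc s \<ge> 0" by (simp add: trc_def col_bounds)

lemma trc_mass:
  assumes "R \<le> l / 2"
  shows "integral {- R..R} trc = 1"
proof -
  let ?f = "rescaled J R"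
  have k: "continuous_on UNIV ?f" "integrable lborel ?f" "(LINT z|lborel. ?f z) = 1"
  proof -
    show c: "continuous_on UNIV ?f" using kernel_props(3)[OF J R, of 0] by simp
    have "compact (supp ?f)" using kernel_props(4)[OF J R, of 0] by simp
    from continuous_compact_integrable(1)[OF c this] show i: "integrable lborel ?f" .
    show "(LINT z|lborel. ?f z) = 1"
      using kernel_props(6)[OF J R, of 0] i by (simp add: integral_completion borel_measurable_integrable)
  qed
  have inner: "(LINT y|lborel. ?f (pt x y)) = trc x" for x
  proof -
    have c: "continuous_on {- l / 2..l / 2} (\<lambda>y. ?f (pt x y))"
      unfolding vector2_eq by (rule continuous_on_compose2[OF k(1)]) (auto intro!: continuous_intros)
    have si: "set_integrable lborel {- l / 2..l / 2} (\<lambda>y. ?f (pt x y))"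
      unfolding set_integrable_def by (rule borel_integrable_compact[OF compact_Icc c])
    have "(LINT y|lborel. ?f (pt x y)) = (LINT y:{- l / 2..l / 2}|lborel. ?f (pt x y))"
      unfolding set_lebesgue_integral_def
    proof (rule Bochner_Integration.integral_cong[OF refl])
      fix y
      show "?f (pt x y) = indicator {- l / 2..l / 2} y *\<^sub>R ?f (pt x y)"
      proof (cases "y \<in> {- l / 2..l / 2}")
        case False
        then have "R \<le> norm (pt x y)" using assms component_le_norm_cart[of "pt x y" 2] by auto
        then show ?thesis using rescaled_outside by simp
      qed simp
    qed
    also have "\<dots> = integral {- l / 2..l / 2} (\<lambda>y. ?f (pt x y))"
      using set_borel_integral_eq_integral(2)[OF si] .
    also have "\<dots> = trc x"
      unfolding trc_def col_eq
      by (intro integral_cong arg_cong[where f="rescaled J R"]) (simp add: vec_eq_iff forall_2 shift_def axis_def)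
    finally show ?thesis .
  qed
  have si: "set_integrable lborel {- R..R} trc"
    unfolding set_integrable_def by (rule borel_integrable_compact[OF compact_Icc]) (rule continuous_on_subset[OF trc_continuous], simp)
  have "1 = (LINT x|lborel. trc x)" using fubini_pt(1)[OF k(2)] unfolding inner k(3) .
  also have "\<dots> = (LINT x:{- R..R}|lborel. trc x)"
    unfolding set_lebesgue_integral_def
  proof (rule Bochner_Integration.integral_cong[OF refl])
    fix x show "trc x = indicator {- R..R} x *\<^sub>R trc x"
      using trc_outside[of x] by (cases "x \<in> {- R..R}") auto
  qed
  also have "\<dots> = integral {- R..R} trc" using set_borel_integral_eq_integral(2)[OF si] .
  finally show ?thesis by simp
qed

definition stp :: "real \<Rightarrow> real" where "stp s = integral {- (\<bar>s\<bar> + R)..s} trc"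

lemma trc_integrable: "trc integrable_on {u..v}"
  by (rule integrable_continuous_interval) (rule continuous_on_subset[OF trc_continuous], simp)

lemma stp_eq: "- Z \<le> s \<Longrightarrow> R \<le> Z \<Longrightarrow> stp s = integral {- Z..s} trc"
proof -
  have *: "integral {- Z'..s} trc = integral {- Z..s} trc" if "Z \<le> Z'" "R \<le> Z" "- Z \<le> s" for Z Z'
  proof -
    have "integral {- Z'..- Z} trc + integral {- Z..s} trc = integral {- Z'..s} trc"
      using that by (intro Henstock_Kurzweil_Integration.integral_combine trc_integrable) auto
    moreover have "integral {- Z'..- Z} trc = integral {- Z'..- Z} (\<lambda>x. 0)"
      by (rule integral_cong) (use that trc_outside in auto)
    ultimately show ?thesis by simp
  qed
  assume "- Z \<le> s" "R \<le> Z"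
  then show ?thesis using *[of "\<bar>s\<bar> + R" Z] *[of Z "\<bar>s\<bar> + R"] R unfolding stp_def by (cases "Z \<le> \<bar>s\<bar> + R") auto
qed

lemma stp_derivative: "(stp has_real_derivative trc s) (at s)"
proof -
  let ?Z = "\<bar>s\<bar> + R + 1"
  have "((\<lambda>u. integral {- ?Z..u} trc) has_real_derivative trc s) (at s within {- ?Z..s + 1})"
    using R by (intro integral_has_real_derivative continuous_on_subset[OF trc_continuous]) auto
  then have "((\<lambda>u. integral {- ?Z..u} trc) has_real_derivative trc s) (at s)"
    using R by (subst (asm) at_within_interior) auto
  then show ?thesis
    by (rule has_field_derivative_transform_within_open[where S="{- ?Z<..}"]) (use R stp_eq[of ?Z] in auto)
qed

lemma stp_bounds:
  assumes "R \<le> l / 2"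
  shows "0 \<le> stp s" "stp s \<le> 1" "s \<le> - R \<Longrightarrow> stp s = 0" "s \<ge> R \<Longrightarrow> stp s = 1"
proof -
  show "0 \<le> stp s" unfolding stp_def by (rule integral_nonneg[OF trc_integrable]) (rule trc_nonneg)
  have full: "integral {- (\<bar>s\<bar> + R)..\<bar>s\<bar> + R} trc = 1"
  proof -
    have z: "integral {- (\<bar>s\<bar> + R)..- R} trc = integral {- (\<bar>s\<bar> + R)..- R} (\<lambda>x. 0)"
      "integral {R..\<bar>s\<bar> + R} trc = integral {R..\<bar>s\<bar> + R} (\<lambda>x. 0)"
      by (rule integral_cong; use trc_outside in auto)+
    have "integral {- (\<bar>s\<bar> + R)..- R} trc + integral {- R..\<bar>s\<bar> + R} trc = integral {- (\<bar>s\<bar> + R)..\<bar>s\<bar> + R} trc"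
      "integral {- R..R} trc + integral {R..\<bar>s\<bar> + R} trc = integral {- R..\<bar>s\<bar> + R} trc"
      using R by (auto intro!: Henstock_Kurzweil_Integration.integral_combine trc_integrable)
    then show ?thesis using z trc_mass[OF assms] by simp
  qed
  have "stp s \<le> integral {- (\<bar>s\<bar> + R)..\<bar>s\<bar> + R} trc"
    unfolding stp_def by (rule integral_subset_le) (use R trc_integrable trc_nonneg in auto)
  then show "stp s \<le> 1" using full by simp
  show "stp s = 0" if "s \<le> - R"
  proof -
    have "stp s = integral {- (\<bar>s\<bar> + R)..s} (\<lambda>x. 0)"
      unfolding stp_def by (rule integral_cong) (use that trc_outside in auto)
    then show ?thesis by simp
  qed
  show "stp s = 1" if "s \<ge> R"
  proof -
    have "integral {- (\<bar>s\<bar> + R)..s} trc + integral {s..\<bar>s\<bar> + R} trc = integral {- (\<bar>s\<bar> + R)..\<bar>s\<bar> + R} trc"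
      using R by (intro Henstock_Kurzweil_Integration.integral_combine trc_integrable) auto
    moreover have "integral {s..\<bar>s\<bar> + R} trc = integral {s..\<bar>s\<bar> + R} (\<lambda>x. 0)"
      by (rule integral_cong) (use that trc_outside in auto)
    ultimately show ?thesis using full by (simp add: stp_def)
  qed
qed

end

text \<open>By \<open>kap_le\<close> the square of the core field is at most of order \<open>1 / (r\<^sup>2 + (norm z)\<^sup>2)\<close>, and of the dyadic
  layers between the scales \<open>r\<close> and \<open>R\<close> each contributes a constant.\<close>

lemma core_energy:
  assumes r: "0 < r" "r \<le> R"
  shows "integrable lborel (\<lambda>z. (norm (z - p))\<^sup>2 * (kap r R (z - p))\<^sup>2)"
    and "(LINT z|lborel. (norm (z - p))\<^sup>2 * (kap r R (z - p))\<^sup>2) \<le> 256 * Jm\<^sup>2 * (1 + ln (R / r))"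
proof -
  define N where "N = nat \<lceil>ln (R / r) / ln 2\<rceil>"
  have "exp (1/2) \<le> (2::real)" using exp_bound[of "1/2"] by (simp add: power2_eq_square)
  then have ln2: "ln 2 \<ge> (1/2::real)" by (subst ln_ge_iff) auto
  have lnR: "ln (R / r) \<ge> 0" using r by (intro ln_ge_zero) (simp add: pos_le_divide_eq)
  have "R / r \<le> 2 ^ N"
  proof -
    have "ln (R / r) / ln 2 \<le> N" unfolding N_def by linarith
    then have "ln (R / r) \<le> N * ln 2" using ln2 by (simp add: pos_divide_le_eq)
    also have "\<dots> = ln (2 ^ N)" by (simp add: ln_realpow)
    finally show ?thesis using r by (subst (asm) ln_le_cancel_iff) auto
  qed
  then have RN: "R \<le> 2 ^ N * r" using r by (simp add: pos_divide_le_eq)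
  have "real N \<le> ln (R / r) / ln 2 + 1" unfolding N_def using lnR ln2 by (simp add: of_nat_nat)
  moreover have "ln (R / r) / ln 2 \<le> ln (R / r) / (1/2)" using lnR ln2 by (intro divide_left_mono) auto
  ultimately have NN: "real N + 1 \<le> 2 * (1 + ln (R / r))" by simp
  let ?k = "\<lambda>z. (norm (z - p))\<^sup>2 * (kap r R (z - p))\<^sup>2"
  let ?B = "\<lambda>z. 4 * Jm\<^sup>2 * (\<Sum>j\<le>N. 4 / (2 ^ j * r)\<^sup>2 * indicator (cball p (2 ^ j * r)) z)"
  have c: "continuous_on UNIV ?k"
    by (intro continuous_intros continuous_on_compose2[OF kap_continuous(1)[OF r]]) auto
  have "supp ?k \<subseteq> cball p R"
    by (rule supp_subset_closed) (use kap_outside[OF r] in \<open>auto simp: dist_norm norm_minus_commute\<close>)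
  from continuous_compact_integrable[OF c compact_supp_subset[OF compact_cball this]]
  have int: "integrable lborel ?k" and intL: "integrable lebesgue ?k" by simp_all
  show "integrable lborel ?k" by (rule int)
  have le: "?k z \<le> ?B z" for z
  proof (cases "norm (z - p) \<ge> R")
    case True
    then have "?k z = 0" using kap_outside[OF r True] by simp
    moreover have "?B z \<ge> 0" by (intro mult_nonneg_nonneg sum_nonneg) auto
    ultimately show ?thesis by linarith
  next
    case False
    let ?s = "r\<^sup>2 + (norm (z - p))\<^sup>2"
    have s: "?s > 0" using r by (intro add_pos_nonneg) auto
    have "(kap r R (z - p))\<^sup>2 \<le> (2 * Jm / ?s)\<^sup>2" by (intro power_mono kap_le[OF r] kap_nonneg[OF r])
    then have "?k z \<le> ?s * (2 * Jm / ?s)\<^sup>2" using r by (intro mult_mono) auto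
    also have "\<dots> = 4 * Jm\<^sup>2 * (1 / ?s)" using s by (simp add: power2_eq_square)
    also have "\<dots> \<le> ?B z"
    proof (rule mult_left_mono)
      have "1 / ?s \<le> (\<Sum>j\<le>N. 4 / (2 ^ j * r)\<^sup>2 * indicator (cball 0 (2 ^ j * r)) (z - p))"
        by (rule inverse_square_layers) (use r False RN in auto)
      also have "\<dots> = (\<Sum>j\<le>N. 4 / (2 ^ j * r)\<^sup>2 * indicator (cball p (2 ^ j * r)) z)"
        by (intro sum.cong refl) (auto simp: indicator_def dist_norm norm_minus_commute)
      finally show "1 / ?s \<le> (\<Sum>j\<le>N. 4 / (2 ^ j * r)\<^sup>2 * indicator (cball p (2 ^ j * r)) z)" .
    qed simp
    finally show ?thesis .
  qed
  have ii: "integrable lebesgue (indicator (cball p (2 ^ j * r)) :: _ \<Rightarrow> real)" for j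
    using r by (intro area_cball(2)) simp
  have "(LINT z|lborel. ?k z) = (LINT z|lebesgue. ?k z)" using int by (simp add: integral_completion borel_measurable_integrable)
  also have "\<dots> \<le> (LINT z|lebesgue. ?B z)"
    by (rule integral_mono[OF intL _ le]) (intro integrable_mult_right Bochner_Integration.integrable_sum ii)
  also have "\<dots> = 4 * Jm\<^sup>2 * (\<Sum>j\<le>N. 4 / (2 ^ j * r)\<^sup>2 * (LINT z|lebesgue. indicator (cball p (2 ^ j * r)) z))"
    by (subst integral_mult_right_zero, subst Bochner_Integration.integral_sum, intro integrable_mult_right ii,
      simp only: integral_mult_right_zero)
  also have "\<dots> \<le> 4 * Jm\<^sup>2 * (\<Sum>j\<le>N. 16)"
  proof (intro mult_left_mono sum_mono)
    fix j
    have "4 / (2 ^ j * r)\<^sup>2 * (LINT z|lebesgue. indicator (cball p (2 ^ j * r)) z) \<le> 4 / (2 ^ j * r)\<^sup>2 * (4 * (2 ^ j * r)\<^sup>2)"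
      using r by (intro mult_left_mono integral_indicator_cball) auto
    also have "\<dots> = 16" using r by simp
    finally show "4 / (2 ^ j * r)\<^sup>2 * (LINT z|lebesgue. indicator (cball p (2 ^ j * r)) z) \<le> 16" .
  qed simp
  also have "\<dots> = 64 * Jm\<^sup>2 * (real N + 1)" by simp
  also have "\<dots> \<le> 64 * Jm\<^sup>2 * (2 * (1 + ln (R / r)))" using NN by (intro mult_left_mono) auto
  also have "\<dots> = 128 * Jm\<^sup>2 * (1 + ln (R / r))" by simp
  also have "\<dots> \<le> 256 * Jm\<^sup>2 * (1 + ln (R / r))" using lnR by (intro mult_right_mono) auto
  finally show "(LINT z|lborel. ?k z) \<le> 256 * Jm\<^sup>2 * (1 + ln (R / r))" .
qed

end

section \<open>A row of dislocations\<close>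

definition ramp :: "real \<Rightarrow> real" where "ramp t = (max 0 (1 - t))\<^sup>2"
definition ramp_d :: "real \<Rightarrow> real" where "ramp_d t = - 2 * max 0 (1 - t)"

lemma ramp_derivative: "(ramp has_real_derivative ramp_d t) (at t)"
proof -
  have pos: "((\<lambda>u::real. (max 0 u)\<^sup>2) has_real_derivative 2 * max 0 u) (at u)" for u
  proof -
    consider "u > 0" | "u < 0" | "u = 0" by linarith
    then show ?thesis
    proof cases
      case 1
      have "((\<lambda>u::real. u\<^sup>2) has_real_derivative 2 * max 0 u) (at u)" using 1 by (auto intro!: derivative_eq_intros)
      then show ?thesis by (rule has_field_derivative_transform_within_open[where S="{0<..}"]) (use 1 in auto)
    next
      case 2
      have "((\<lambda>u::real. 0) has_real_derivative 2 * max 0 u) (at u)" using 2 by simp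
      then show ?thesis by (rule has_field_derivative_transform_within_open[where S="{..<0}"]) (use 2 in auto)
    next
      case 3
      have "((\<lambda>v::real. (max 0 v)\<^sup>2 / v) \<longlongrightarrow> 0) (at 0)"
      proof (rule Lim_null_comparison)
        show "\<forall>\<^sub>F v in at 0. norm ((max 0 v)\<^sup>2 / v :: real) \<le> \<bar>v\<bar>"
          by (auto simp: eventually_at_filter power2_eq_square max_def)
        show "((\<lambda>v::real. \<bar>v\<bar>) \<longlongrightarrow> 0) (at 0)" by (auto intro!: tendsto_eq_intros)
      qed
      then show ?thesis using 3 by (simp add: has_field_derivative_iff)
    qed
  qed
  have "((\<lambda>t. (max 0 (1 - t))\<^sup>2) has_real_derivative 2 * max 0 (1 - t) * (- 1)) (at t)"
    by (rule DERIV_chain2[OF pos]) (auto intro!: derivative_eq_intros)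
  then show ?thesis by (simp add: ramp_def[abs_def] ramp_d_def)
qed

lemma ramp_continuous: "continuous_on S ramp" "continuous_on S ramp_d"
  unfolding ramp_def[abs_def] ramp_d_def[abs_def] by (intro continuous_intros)+

lemma ramp_bounds: "t \<ge> 0 \<Longrightarrow> 0 \<le> ramp t \<and> ramp t \<le> 1" "t \<ge> 0 \<Longrightarrow> \<bar>ramp_d t\<bar> \<le> 2" "t \<ge> 1 \<Longrightarrow> ramp t = 0" "t \<ge> 1 \<Longrightarrow> ramp_d t = 0" "ramp 0 = 1"
  by (auto simp: ramp_def ramp_d_def max_def power_le_one)

lemma ramp_scaled_derivative:
  "w > 0 \<Longrightarrow> ((\<lambda>y. ramp (y / w)) has_real_derivative ramp_d (y / w) / w) (at y)"
proof -
  assume "w > 0"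
  then have "((\<lambda>y. y / w) has_real_derivative 1 / w) (at y)" by (auto intro!: derivative_eq_intros)
  from DERIV_chain2[OF ramp_derivative this] show ?thesis by simp
qed

definition (in kernel) C0 :: real where "C0 = 3 * (1 + 64 * Jm)\<^sup>2 + 12 + 3 * (64 * Jm)\<^sup>2"

text \<open>A row of \<open>N\<close> dislocations at height \<open>l / 2\<close> and mutual distance \<open>l = b / e0\<close>.  Each dislocation has a core field
  that turns its mollified Burgers vector at scale \<open>r0\<close> into one at scale \<open>R\<close> (\<open>kap\<close>), and a column of
  horizontal strain that carries the latter down to the bottom (\<open>col\<close>), where it arrives as the trace
  \<open>trc\<close> of mass one.  What remains on the bottom is the misfit \<open>e0 - M\<close>, whose primitive \<open>U\<close> is bounded
  because \<open>b = e0 * l\<close>; the gradient of \<open>U\<close> times a ramp of height \<open>l\<close> continues it into the film.\<close>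

locale dislocation_row = kernel +
  fixes e0 b r0 l :: real and N :: nat
  assumes pos: "e0 > 0" "r0 > 0" "l > 0" and l: "b = e0 * l" "64 ^ 4 * r0 \<le> l"
begin

definition c :: "nat \<Rightarrow> real" where "c i = (real i + 3 / 2) * l"
definition p :: "nat \<Rightarrow> real^2" where "p i = pt (c i) (l / 2)"

abbreviation "R \<equiv> l / 8"

lemma rR: "0 < r0" "r0 \<le> R" "0 < R" "R \<le> l / 2" "0 < l" and b: "b > 0"
  using pos l by auto

definition P :: "(real^2) multiset" where "P = mset (map p [0..<N])"

definition M :: "real \<Rightarrow> real" where "M x = b * (\<Sum>i<N. trc l R (x - c i))"
definition U :: "real \<Rightarrow> real" where "U x = e0 * (x - l) - b * (\<Sum>i<N. stp l R (x - c i))"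

definition f :: "real^2 \<Rightarrow> real" where
  "f z = (e0 - M (z$1)) * ramp (z$2 / l) + b * (\<Sum>i<N. col l R (z - p i) - (z$2 - l / 2) * kap r0 R (z - p i))"
definition fy :: "real^2 \<Rightarrow> real" where
  "fy z = (e0 - M (z$1)) * (ramp_d (z$2 / l) / l)
     + b * (\<Sum>i<N. col_d l R (z - p i) - (kap r0 R (z - p i) + (z$2 - l / 2) * kap_d 2 r0 R (z - p i)))"
definition g :: "real^2 \<Rightarrow> real" where
  "g z = ramp_d (z$2 / l) / l * U (z$1) + b * (\<Sum>i<N. (z$1 - c i) * kap r0 R (z - p i))"
definition gx :: "real^2 \<Rightarrow> real" where
  "gx z = ramp_d (z$2 / l) / l * (e0 - M (z$1)) + b * (\<Sum>i<N. kap r0 R (z - p i) + (z$1 - c i) * kap_d 1 r0 R (z - p i))"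

lemma U_derivative: "(U has_real_derivative e0 - M x) (at x)"
proof -
  have "((\<lambda>x. stp l R (x - c i)) has_real_derivative trc l R (x - c i)) (at x)" for i
  proof -
    have "((\<lambda>x. x - c i) has_real_derivative 1) (at x)" by (auto intro!: derivative_eq_intros)
    from DERIV_chain2[OF stp_derivative[OF rR(5,3)] this] show ?thesis by simp
  qed
  then show ?thesis unfolding U_def[abs_def] M_def by (auto intro!: derivative_eq_intros)
qed

lemma continuous_parts:
  "continuous_on UNIV (\<lambda>z::real^2. M (z$1))" "continuous_on UNIV (\<lambda>z::real^2. U (z$1))"
  "continuous_on UNIV (\<lambda>z::real^2. ramp (z$2 / l))" "continuous_on UNIV (\<lambda>z::real^2. ramp_d (z$2 / l))"
  "continuous_on UNIV (\<lambda>z. kap r0 R (z - p i))" "continuous_on UNIV (\<lambda>z. kap_d k r0 R (z - p i))"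
  "continuous_on UNIV (\<lambda>z. col l R (z - p i))" "continuous_on UNIV (\<lambda>z. col_d l R (z - p i))"
proof -
  have "continuous_on UNIV U" using U_derivative DERIV_isCont by (metis continuous_at_imp_continuous_on)
  then show "continuous_on UNIV (\<lambda>z::real^2. U (z$1))"
    by (rule continuous_on_compose2) (auto intro!: continuous_intros)
  show "continuous_on UNIV (\<lambda>z::real^2. M (z$1))"
    unfolding M_def by (intro continuous_intros continuous_on_compose2[OF trc_continuous[OF rR(5,3)]]) auto
  show "continuous_on UNIV (\<lambda>z::real^2. ramp (z$2 / l))"
    by (rule continuous_on_compose2[OF ramp_continuous(1)[of UNIV]]) (use pos in \<open>auto intro!: continuous_intros\<close>)
  show "continuous_on UNIV (\<lambda>z::real^2. ramp_d (z$2 / l))"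
    by (rule continuous_on_compose2[OF ramp_continuous(2)[of UNIV]]) (use pos in \<open>auto intro!: continuous_intros\<close>)
  show "continuous_on UNIV (\<lambda>z. kap r0 R (z - p i))"
    by (rule continuous_on_compose2[OF kap_continuous(1)[OF rR(1,2)]]) (auto intro!: continuous_intros)
  show "continuous_on UNIV (\<lambda>z. kap_d k r0 R (z - p i))"
    by (rule continuous_on_compose2[OF kap_continuous(2)[OF rR(1,2)]]) (auto intro!: continuous_intros)
  show "continuous_on UNIV (\<lambda>z. col l R (z - p i))"
    by (rule continuous_on_compose2[OF col_continuous(1)[OF rR(5,3)]]) (auto intro!: continuous_intros)
  show "continuous_on UNIV (\<lambda>z. col_d l R (z - p i))"
    by (rule continuous_on_compose2[OF col_continuous(2)[OF rR(5,3)]]) (auto intro!: continuous_intros)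
qed

lemma pt_shift: "pt x y - p i = (pt x 0 - p i) + y *\<^sub>R axis 2 1" "pt x y - p i = (pt 0 y - p i) + x *\<^sub>R axis 1 1"
  by (simp_all add: vec_eq_iff forall_2 axis_def)

lemma kap_pt:
  "((\<lambda>y. kap r0 R (pt x y - p i)) has_real_derivative kap_d 2 r0 R (pt x y - p i)) (at y)"
  "((\<lambda>x. kap r0 R (pt x y - p i)) has_real_derivative kap_d 1 r0 R (pt x y - p i)) (at x)"
  "((\<lambda>y. col l R (pt x y - p i)) has_real_derivative col_d l R (pt x y - p i)) (at y)"
proof -
  show "((\<lambda>y. kap r0 R (pt x y - p i)) has_real_derivative kap_d 2 r0 R (pt x y - p i)) (at y)"
    using kap_derivative[OF rR(1,2), of "pt x 0 - p i" 2 y] by (simp only: pt_shift(1)[symmetric])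
  show "((\<lambda>x. kap r0 R (pt x y - p i)) has_real_derivative kap_d 1 r0 R (pt x y - p i)) (at x)"
    using kap_derivative[OF rR(1,2), of "pt 0 y - p i" 1 x] by (simp only: pt_shift(2)[symmetric])
  show "((\<lambda>y. col l R (pt x y - p i)) has_real_derivative col_d l R (pt x y - p i)) (at y)"
    using col_derivative[OF rR(5,3), of "pt x 0 - p i" y] by (simp only: pt_shift(1)[symmetric])
qed

sublocale row_competitor h f g fy gx e0 for h
proof
  show "continuous_on UNIV f" "continuous_on UNIV g" "continuous_on UNIV fy" "continuous_on UNIV gx"
    unfolding f_def[abs_def] g_def[abs_def] fy_def[abs_def] gx_def[abs_def]
    using pos by (intro continuous_intros continuous_parts; simp)+
  fix x y
  have "((\<lambda>y. (y - l / 2) * kap r0 R (pt x y - p i)) has_real_derivative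
      (kap r0 R (pt x y - p i) + (y - l / 2) * kap_d 2 r0 R (pt x y - p i))) (at y)" for i
    by (rule DERIV_cong[OF DERIV_mult[OF _ kap_pt(1)]]) (auto intro!: derivative_eq_intros)
  then show "((\<lambda>y. f (pt x y)) has_real_derivative fy (pt x y)) (at y)"
    unfolding f_def fy_def vector_2
    by (intro DERIV_add DERIV_cmult DERIV_sum DERIV_diff kap_pt(3) ramp_scaled_derivative pos)
  have "((\<lambda>x. (x - c i) * kap r0 R (pt x y - p i)) has_real_derivative
      (kap r0 R (pt x y - p i) + (x - c i) * kap_d 1 r0 R (pt x y - p i))) (at x)" for i
    by (rule DERIV_cong[OF DERIV_mult[OF _ kap_pt(2)]]) (auto intro!: derivative_eq_intros)
  then show "((\<lambda>x. g (pt x y)) has_real_derivative gx (pt x y)) (at x)"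
    unfolding g_def gx_def vector_2
    by (intro DERIV_add DERIV_cmult DERIV_sum U_derivative)
  have "kap r0 R (pt x 0 - p i) = 0" for i
    using component_le_norm_cart[of "pt x 0 - p i" 2] pos by (intro kap_outside[OF rR(1,2)]) (simp add: p_def)
  moreover have "col l R (pt x 0 - p i) = trc l R (x - c i)" for i
    unfolding trc_def[OF rR(5,3)] by (intro arg_cong[where f="col l R"]) (simp add: p_def vec_eq_iff forall_2)
  ultimately show "f (pt x 0) = e0" unfolding f_def by (simp add: ramp_bounds M_def)
qed

lemma moll: "mollified_dislocations J r0 b P z $ 1 = b * (\<Sum>i<N. rescaled J r0 (z - p i))"
proof -
  have "(\<Sum>q\<in>#P. rescaled J r0 (z - q)) = (\<Sum>i\<leftarrow>[0..<N]. rescaled J r0 (z - p i))"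
    unfolding P_def by (simp add: sum_mset_sum_list[symmetric] image_mset.compositionality comp_def flip: mset_map)
  also have "\<dots> = (\<Sum>i<N. rescaled J r0 (z - p i))" by (simp add: interv_sum_list_conv_sum_set_nat atLeast0LessThan)
  finally show ?thesis by (simp add: mollified_dislocations_def)
qed

text \<open>The gradient part contributes nothing.  The lower ends of the columns lie \<open>l / 2\<close> below the bottom, so for
  \<open>z$2 \<ge> 0\<close> only the sources at the dislocations are left.\<close>

lemma curl_eq:
  assumes "z$2 \<ge> 0"
  shows "gx z - fy z = mollified_dislocations J r0 b P z $ 1"
proof -
  have "kap r0 R (z - p i) + (z$1 - c i) * kap_d 1 r0 R (z - p i)
      - (col_d l R (z - p i) - (kap r0 R (z - p i) + (z$2 - l / 2) * kap_d 2 r0 R (z - p i))) = rescaled J r0 (z - p i)" for i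
  proof -
    have "R \<le> norm (z - p i + l *\<^sub>R axis 2 1)"
      using component_le_norm_cart[of "z - p i + l *\<^sub>R axis 2 1" 2] assms pos by (simp add: p_def axis_def)
    then have "rescaled J R (z - p i + l *\<^sub>R axis 2 1) = 0" by (rule rescaled_outside[OF rR(5,3)])
    then show ?thesis
      using kap_divergence[OF rR(1,2), of "z - p i"] col_d_eq[OF rR(5,3), of "z - p i"] by (simp add: p_def)
  qed
  note eq = this
  have "gx z - fy z = b * ((\<Sum>i<N. kap r0 R (z - p i) + (z$1 - c i) * kap_d 1 r0 R (z - p i))
     - (\<Sum>i<N. col_d l R (z - p i) - (kap r0 R (z - p i) + (z$2 - l / 2) * kap_d 2 r0 R (z - p i))))"
  proof -
    have "D * A + b * S - (A * D + b * S') = b * (S - S')" for D A S S' :: real by (simp add: algebra_simps)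
    then show ?thesis unfolding gx_def fy_def .
  qed
  then show ?thesis unfolding moll sum_subtractf[symmetric] eq .
qed

text \<open>Up to the factor \<open>b\<close> and a shift by one, \<open>U x\<close> is \<open>x / l\<close> minus the number of dislocations left of \<open>x\<close>,
  the one at \<open>x\<close> being counted in part.\<close>

lemma U_bound:
  assumes x: "0 \<le> x" "x \<le> (real N + 2) * l"
  shows "\<bar>U x\<bar> \<le> b"
proof -
  define X where "X = x / l"
  have X: "0 \<le> X" "X \<le> real N + 2" "x = X * l" using x pos by (auto simp: X_def pos_divide_le_eq)
  note sb = stp_bounds[OF rR(5,3,4)]
  have one: "stp l R (x - c i) = 1" if "real i + 2 \<le> X" for i
  proof (rule sb(4))
    have "(real i + 2) * l \<le> x" using that pos X(3) by (simp add: mult_right_mono)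
    then show "R \<le> x - c i" using pos by (simp add: c_def algebra_simps)
  qed
  have zero: "stp l R (x - c i) = 0" if "X \<le> real i + 1" for i
  proof (rule sb(3))
    have "x \<le> (real i + 1) * l" using that pos X(3) by (simp add: mult_right_mono)
    then show "x - c i \<le> - R" using pos by (simp add: c_def algebra_simps)
  qed
  have count: "min (real n) (X - 2) \<le> (\<Sum>i<n. stp l R (x - c i)) \<and> (\<Sum>i<n. stp l R (x - c i)) \<le> X \<and> (\<Sum>i<n. stp l R (x - c i)) \<le> n" for n
  proof (induction n)
    case 0 then show ?case using X by simp
  next
    case (Suc n)
    let ?s = "stp l R (x - c n)"
    have s: "0 \<le> ?s" "?s \<le> 1" using sb(1,2) by auto
    have lo: "min (real (Suc n)) (X - 2) \<le> (\<Sum>i<n. stp l R (x - c i)) + ?s"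
      using Suc s one[of n] by (cases "real n + 2 \<le> X") auto
    have up: "(\<Sum>i<n. stp l R (x - c i)) + ?s \<le> X"
      using Suc s zero[of n] by (cases "X \<le> real n + 1") auto
    show ?case using lo up Suc s by simp
  qed
  have "U x = b * ((X - 1) - (\<Sum>i<N. stp l R (x - c i)))"
    unfolding U_def X(3) using l(1) by (simp add: algebra_simps)
  moreover have "\<bar>(X - 1) - (\<Sum>i<N. stp l R (x - c i))\<bar> \<le> 1" using count[of N] X by (auto simp: abs_le_iff min_def split: if_splits)
  ultimately show ?thesis using b by (simp add: abs_mult mult_le_cancel_left2)
qed

lemma active_unique: "\<bar>x - c i\<bar> < R \<Longrightarrow> \<bar>x - c j\<bar> < R \<Longrightarrow> i = j"
proof (rule ccontr)
  assume a: "\<bar>x - c i\<bar> < R" "\<bar>x - c j\<bar> < R" "i \<noteq> j"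
  then have "real i + 1 \<le> real j \<or> real j + 1 \<le> real i" by linarith
  then have "(real i + 1) * l \<le> real j * l \<or> (real j + 1) * l \<le> real i * l"
    using mult_right_mono[OF _ less_imp_le[OF pos(3)]] by blast
  then show False using a(1,2) pos(3) unfolding c_def distrib_right abs_less_iff by (elim disjE) linarith+
qed

lemma single_active:
  assumes "\<And>i. \<bar>x - c i\<bar> \<ge> R \<Longrightarrow> s i = (0::real)"
  obtains "(\<Sum>i<N. s i) = 0" "\<And>t. (\<forall>i. \<bar>x - c i\<bar> \<ge> R \<longrightarrow> t i = (0::real)) \<Longrightarrow> (\<Sum>i<N. t i) = 0"
  | i where "i < N" "(\<Sum>i<N. s i) = s i" "\<And>t. (\<forall>i. \<bar>x - c i\<bar> \<ge> R \<longrightarrow> t i = (0::real)) \<Longrightarrow> (\<Sum>i<N. t i) = t i"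
proof (cases "\<exists>i<N. \<bar>x - c i\<bar> < R")
  case True
  then obtain i where i: "i < N" "\<bar>x - c i\<bar> < R" by blast
  have *: "(\<Sum>i<N. t i) = t i" if "\<forall>i. \<bar>x - c i\<bar> \<ge> R \<longrightarrow> t i = (0::real)" for t
  proof -
    have "t j = 0" if "j \<noteq> i" for j using active_unique[OF i(2), of j] that \<open>\<forall>i. _\<close> by (metis not_le)
    then have "(\<Sum>j<N. t j) = (\<Sum>j\<in>{i}. t j)" using i by (intro sum.mono_neutral_right) auto
    then show ?thesis by simp
  qed
  show ?thesis using that(2)[OF i(1) *[of s] *] assms by blast
next
  case False
  have *: "(\<Sum>i<N. t i) = 0" if "\<forall>i. \<bar>x - c i\<bar> \<ge> R \<longrightarrow> t i = (0::real)" for t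
  proof (intro sum.neutral ballI)
    fix i assume "i \<in> {..<N}"
    then have "R \<le> \<bar>x - c i\<bar>" using False by (meson lessThan_iff not_le)
    then show "t i = 0" using that by blast
  qed
  show ?thesis using that(1)[OF *[of s] *] assms by blast
qed

text \<open>The columns and cores of different dislocations have disjoint supports, so at each point at most one of them
  contributes.  All but the core field is of order \<open>e0\<close> and lives below height \<open>l\<close>.\<close>

lemma field_bound:
  assumes z: "0 \<le> z$1" "z$1 \<le> (real N + 2) * l" "0 \<le> z$2"
  shows "(f z)\<^sup>2 + (g z)\<^sup>2 \<le> C0 * e0\<^sup>2 * (if z$2 < l then 1 else 0)
     + 3 * b\<^sup>2 * (\<Sum>i<N. (norm (z - p i))\<^sup>2 * (kap r0 R (z - p i))\<^sup>2)"
proof -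
  let ?\<alpha> = "(e0 - M (z$1)) * ramp (z$2 / l)" and ?\<beta> = "ramp_d (z$2 / l) / l * U (z$1)"
  let ?on = "if z$2 < l then 1 else (0::real)"
  have colb: "0 \<le> col l R w \<and> col l R w \<le> 64 * Jm / l" for w
    using col_bounds[OF rR(5,3), of w] pos by (simp add: power2_eq_square field_simps)
  have off1: "col l R (z - p i) = 0" "kap r0 R (z - p i) = 0" "trc l R (z$1 - c i) = 0" if "\<bar>z$1 - c i\<bar> \<ge> R" for i
  proof -
    have "\<bar>(z - p i)$1\<bar> \<ge> R" using that by (simp add: p_def)
    then show "col l R (z - p i) = 0" "kap r0 R (z - p i) = 0"
      using col_outside[OF rR(5,3), of "z - p i"] kap_outside[OF rR(1,2), of "z - p i"] component_le_norm_cart[of "z - p i" 1] by linarith+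
    show "trc l R (z$1 - c i) = 0" using trc_outside[OF rR(5,3)] that .
  qed
  have trcb: "0 \<le> trc l R s \<and> trc l R s \<le> 64 * Jm / l" for s unfolding trc_def[OF rR(5,3)] by (rule colb)
  have bl: "b * (64 * Jm / l) = 64 * Jm * e0" using l pos by simp
  have M: "0 \<le> M (z$1)" "M (z$1) \<le> 64 * Jm * e0"
  proof -
    have "0 \<le> (\<Sum>i<N. trc l R (z$1 - c i)) \<and> (\<Sum>i<N. trc l R (z$1 - c i)) \<le> 64 * Jm / l"
      by (rule single_active[of "z$1" "\<lambda>i. trc l R (z$1 - c i)"]) (use off1 trcb Jm pos in auto)
    then show "0 \<le> M (z$1)" "M (z$1) \<le> 64 * Jm * e0"
      using b mult_left_mono[of "\<Sum>i<N. trc l R (z$1 - c i)" "64 * Jm / l" b] unfolding M_def bl by simp_all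
  qed
  have al: "?\<alpha>\<^sup>2 \<le> (1 + 64 * Jm)\<^sup>2 * e0\<^sup>2 * ?on"
  proof (cases "z$2 < l")
    case True
    have "\<bar>?\<alpha>\<bar> \<le> (e0 + 64 * Jm * e0) * 1"
      unfolding abs_mult using M pos Jm ramp_bounds(1)[of "z$2 / l"] z by (intro mult_mono) auto
    then have "\<bar>?\<alpha>\<bar>\<^sup>2 \<le> ((1 + 64 * Jm) * e0)\<^sup>2" by (intro power_mono) (auto simp: algebra_simps)
    then show ?thesis using True by (simp add: power_mult_distrib)
  next
    case False
    then have "ramp (z$2 / l) = 0" using pos by (intro ramp_bounds) (simp add: pos_le_divide_eq)
    then show ?thesis using False by simp
  qed
  have be: "?\<beta>\<^sup>2 \<le> 4 * e0\<^sup>2 * ?on"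
  proof (cases "z$2 < l")
    case True
    have "\<bar>?\<beta>\<bar> \<le> (2 / l) * b"
      unfolding abs_mult using ramp_bounds(2)[of "z$2 / l"] U_bound[OF z(1,2)] z pos
      by (intro mult_mono) (auto simp: abs_divide divide_right_mono)
    also have "\<dots> = 2 * e0" using l pos by simp
    finally have "\<bar>?\<beta>\<bar>\<^sup>2 \<le> (2 * e0)\<^sup>2" by (intro power_mono) auto
    also have "\<dots> = 4 * e0\<^sup>2 * ?on" using True by (simp add: power_mult_distrib)
    finally show ?thesis unfolding power2_abs .
  next
    case False
    then have "ramp_d (z$2 / l) = 0" using pos by (intro ramp_bounds) (simp add: pos_le_divide_eq)
    then show ?thesis using False by simp
  qed
  have cw: "(b * col l R (z - p i))\<^sup>2 \<le> (64 * Jm)\<^sup>2 * e0\<^sup>2 * ?on" for i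
  proof (cases "z$2 < l")
    case True
    have "b * col l R (z - p i) \<le> 64 * Jm * e0"
      using colb[of "z - p i"] b mult_left_mono[of "col l R (z - p i)" "64 * Jm / l" b] unfolding bl by simp
    then have "(b * col l R (z - p i))\<^sup>2 \<le> (64 * Jm * e0)\<^sup>2" using b colb[of "z - p i"] by (intro power_mono) auto
    then show ?thesis using True by (simp add: power_mult_distrib)
  next
    case False
    then have "col l R (z - p i) = 0" using pos by (intro col_outside[OF rR(5,3)]) (simp add: p_def)
    then show ?thesis using False by simp
  qed
  have sq3: "(u + v + w)\<^sup>2 \<le> 3 * u\<^sup>2 + 3 * v\<^sup>2 + 3 * w\<^sup>2" for u v w :: real
    using zero_le_power2[of "u - v"] zero_le_power2[of "v - w"] zero_le_power2[of "u - w"]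
    by (simp add: power2_eq_square algebra_simps)
  have on0: "0 \<le> ?on" by simp
  show ?thesis
  proof (rule single_active[of "z$1" "\<lambda>i. kap r0 R (z - p i)"])
    assume t: "\<And>t. (\<forall>i. \<bar>z$1 - c i\<bar> \<ge> R \<longrightarrow> t i = (0::real)) \<Longrightarrow> (\<Sum>i<N. t i) = 0"
    have "f z = ?\<alpha>" "g z = ?\<beta>"
      unfolding f_def g_def by (subst t; simp add: off1)+
    moreover have "(\<Sum>i<N. (norm (z - p i))\<^sup>2 * (kap r0 R (z - p i))\<^sup>2) = 0" by (rule t) (simp add: off1)
    moreover have "?\<alpha>\<^sup>2 + ?\<beta>\<^sup>2 \<le> C0 * e0\<^sup>2 * ?on"
    proof -
      have "?\<alpha>\<^sup>2 + ?\<beta>\<^sup>2 \<le> ((1 + 64 * Jm)\<^sup>2 + 4) * (e0\<^sup>2 * ?on)" using al be by (simp add: algebra_simps)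
      also have "\<dots> \<le> C0 * (e0\<^sup>2 * ?on)" using on0 by (intro mult_right_mono) (auto simp: C0_def)
      finally show ?thesis by (simp add: mult.assoc)
    qed
    ultimately show ?thesis by simp
  next
    fix i assume i: "i < N" and t: "\<And>t. (\<forall>i. \<bar>z$1 - c i\<bar> \<ge> R \<longrightarrow> t i = (0::real)) \<Longrightarrow> (\<Sum>i<N. t i) = t i"
    let ?k = "kap r0 R (z - p i)"
    have fz: "f z = ?\<alpha> + b * col l R (z - p i) + - (b * ((z$2 - l / 2) * ?k))"
      unfolding f_def by (subst t) (simp_all add: off1 algebra_simps)
    have gz: "g z = ?\<beta> + b * ((z$1 - c i) * ?k) + 0" unfolding g_def by (subst t) (simp_all add: off1)
    have kk: "(\<Sum>i<N. (norm (z - p i))\<^sup>2 * (kap r0 R (z - p i))\<^sup>2) = (norm (z - p i))\<^sup>2 * ?k\<^sup>2" by (rule t) (simp add: off1)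
    have nn: "(norm (z - p i))\<^sup>2 = (z$1 - c i)\<^sup>2 + (z$2 - l / 2)\<^sup>2" unfolding norm2 by (simp add: p_def power2_eq_square)
    have "(f z)\<^sup>2 + (g z)\<^sup>2 \<le> 3 * ?\<alpha>\<^sup>2 + 3 * (b * col l R (z - p i))\<^sup>2 + 3 * (b * ((z$2 - l / 2) * ?k))\<^sup>2 + (3 * ?\<beta>\<^sup>2 + 3 * (b * ((z$1 - c i) * ?k))\<^sup>2)"
      using sq3[of ?\<alpha> "b * col l R (z - p i)" "- (b * ((z$2 - l / 2) * ?k))"] sq3[of ?\<beta> "b * ((z$1 - c i) * ?k)" 0]
      unfolding fz gz by simp
    also have "\<dots> \<le> 3 * ((1 + 64 * Jm)\<^sup>2 * e0\<^sup>2 * ?on) + 3 * ((64 * Jm)\<^sup>2 * e0\<^sup>2 * ?on) + 3 * (b * ((z$2 - l / 2) * ?k))\<^sup>2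
       + (3 * (4 * e0\<^sup>2 * ?on) + 3 * (b * ((z$1 - c i) * ?k))\<^sup>2)"
      using al be cw[of i] by linarith
    also have "\<dots> = C0 * e0\<^sup>2 * ?on + 3 * b\<^sup>2 * ((norm (z - p i))\<^sup>2 * ?k\<^sup>2)"
    proof -
      have "3 * ((1 + 64 * Jm)\<^sup>2 * e * k) + 3 * ((64 * Jm)\<^sup>2 * e * k) + 3 * (b * (v * q))\<^sup>2 + (3 * (4 * e * k) + 3 * (b * (u * q))\<^sup>2)
        = C0 * e * k + 3 * b\<^sup>2 * ((u\<^sup>2 + v\<^sup>2) * q\<^sup>2)" for e k u v q :: real
        unfolding C0_def by (simp add: power_mult_distrib algebra_simps)
      then show ?thesis unfolding nn .
    qed
    finally show ?thesis unfolding kk .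
  qed (use off1 in auto)
qed

end

section \<open>Trapezoidal films and their energy\<close>

definition trapezoid :: "real \<Rightarrow> real \<Rightarrow> real \<Rightarrow> real" where
  "trapezoid s w x = max 0 (min 1 (min (x / s) ((w - x) / s)))"

text \<open>A constant bound on a rectangle at the bottom, together with an integrable remainder, covers all
  competitors.\<close>

lemma elastic_energy_le:
  fixes f g q :: "real^2 \<Rightarrow> real"
  assumes W: "\<And>A. W A \<le> c * (norm (sym_part A))\<^sup>2" and pos: "c \<ge> 0" "a \<ge> 0" "w \<ge> 0" "s \<ge> 0"
    and q: "integrable lborel q" "\<And>z. q z \<ge> 0"
    and fg: "\<And>z. z \<in> S \<Longrightarrow> (f z)\<^sup>2 + (g z)\<^sup>2 \<le> a * indicator (cbox (pt 0 0) (pt w s)) z + q z"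
  shows "(\<integral>\<^sup>+z\<in>S. ennreal (W (row_field f g z)) \<partial>lebesgue) \<le> ennreal (c * (a * (w * s) + (LINT z|lborel. q z)))"
proof -
  let ?R = "cbox (pt 0 0) (pt w s)"
  let ?F = "\<lambda>z. c * (a * indicator ?R z + q z)"
  have ne: "?R \<noteq> {}" using pos by (auto simp: interval_ne_empty_cart forall_2)
  have m: "measure lborel ?R = w * s" unfolding content_cbox_cart[OF ne] by (simp add: UNIV_2)
  have iR: "integrable lborel (indicator ?R :: _ \<Rightarrow> real)"
    by (intro integrable_real_indicator emeasure_lborel_cbox_finite) auto
  have iF: "integrable lborel ?F" using iR q(1) by (intro integrable_mult_right Bochner_Integration.integrable_add) auto
  have "(\<integral>\<^sup>+z\<in>S. ennreal (W (row_field f g z)) \<partial>lebesgue) \<le> (\<integral>\<^sup>+z. ennreal (?F z) \<partial>lborel)"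
    unfolding nn_integral_completion
  proof (rule nn_integral_mono)
    fix z
    have "W (row_field f g z) \<le> ?F z" if "z \<in> S"
    proof -
      have "W (row_field f g z) \<le> c * (norm (sym_part (row_field f g z)))\<^sup>2" by (rule W)
      also have "\<dots> \<le> c * ((f z)\<^sup>2 + (g z)\<^sup>2)"
        using sym_part_le_norm[of "row_field f g z"] pos unfolding norm_row_field by (intro mult_left_mono) auto
      also have "\<dots> \<le> ?F z" using fg[OF that] pos by (intro mult_left_mono) auto
      finally show ?thesis .
    qed
    then show "ennreal (W (row_field f g z)) * indicator S z \<le> ennreal (?F z)"
      by (cases "z \<in> S") (auto intro: ennreal_leI)
  qed
  also have "\<dots> = ennreal (LINT z|lborel. ?F z)"
    using iF pos q(2) by (intro nn_integral_eq_integral) auto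
  also have "(LINT z|lborel. ?F z) = c * (a * (w * s) + (LINT z|lborel. q z))"
    using iR q(1) m by (simp add: Bochner_Integration.integral_add)
  finally show ?thesis .
qed

text \<open>The condition \<open>4 * s \<le> w\<close> leaves a plateau of length at least \<open>w / 2\<close>, so that the height is of order
  \<open>d / w\<close>.\<close>

locale trapezoid_film =
  fixes d s w :: real
  assumes d: "d > 0" and s: "s > 0" "4 * s \<le> w" and w: "w \<le> 1"
begin

abbreviation "T \<equiv> trapezoid s w"

lemma T_bounds: "0 \<le> T x" "T x \<le> 1" by (auto simp: trapezoid_def)

lemma T_plateau: "s \<le> x \<Longrightarrow> x \<le> w - s \<Longrightarrow> T x = 1"
  using s by (simp add: trapezoid_def pos_le_divide_eq)

lemma T_outside: "x \<le> 0 \<or> w \<le> x \<Longrightarrow> T x = 0"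
proof -
  assume "x \<le> 0 \<or> w \<le> x"
  then have "x / s \<le> 0 \<or> (w - x) / s \<le> 0" using s by (auto simp: divide_le_0_iff)
  then show ?thesis by (auto simp: trapezoid_def)
qed

lemma T_lipschitz: "\<bar>T x - T y\<bar> \<le> \<bar>x - y\<bar> / s"
proof -
  have cl: "\<bar>max 0 (min 1 (min u v)) - max 0 (min 1 (min u' v'))\<bar> \<le> D" if "\<bar>u - u'\<bar> \<le> D" "\<bar>v - v'\<bar> \<le> D" for u v u' v' D :: real
    using that by (auto simp: max_def min_def)
  show ?thesis unfolding trapezoid_def
    by (rule cl) (use s in \<open>simp_all add: diff_divide_distrib[symmetric] abs_divide abs_minus_commute\<close>)
qed

lemma T_continuous: "continuous_on S T"
  unfolding trapezoid_def[abs_def] using s by (intro continuous_intros) auto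

lemma T_integral: "w / 2 \<le> integral {0..1} T" "integral {0..1} T \<le> w"
proof -
  have i: "T integrable_on {a..b}" for a b by (intro integrable_continuous_real T_continuous)
  have "integral {s..w - s} T = integral {s..w - s} (\<lambda>_. 1)" by (intro integral_cong) (auto simp: T_plateau)
  then have "w / 2 \<le> integral {s..w - s} T" using s by simp
  also have "\<dots> \<le> integral {0..1} T" using s w i by (intro integral_subset_le) (auto simp: T_bounds)
  finally show "w / 2 \<le> integral {0..1} T" .
  have "integral {0..1} T = integral {0..w} T + integral {w..1} T"
    using s w i by (intro Henstock_Kurzweil_Integration.integral_combine[symmetric]) auto
  also have "integral {w..1} T = integral {w..1} (\<lambda>_. 0)" by (intro integral_cong) (auto simp: T_outside)
  also have "integral {0..w} T \<le> integral {0..w} (\<lambda>_. 1)" using i by (intro integral_le) (auto simp: T_bounds)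
  finally show "integral {0..1} T \<le> w" using s by simp
qed

definition height :: real where "height = d / integral {0..1} T"

definition h :: "real \<Rightarrow> real" where "h x = height * T x"

lemma height: "height > 0" "height \<le> 2 * d / w"
proof -
  have w0: "w > 0" using s by linarith
  show "height > 0" unfolding height_def using T_integral(1) w0 d by (intro divide_pos_pos) auto
  have "height \<le> d / (w / 2)" unfolding height_def using T_integral(1) w0 d by (intro divide_left_mono) auto
  then show "height \<le> 2 * d / w" by (simp add: mult.commute)
qed

lemma h_pos: "h x > 0 \<Longrightarrow> 0 < x \<and> x < w"
  using T_outside[of x] by (force simp: h_def)

lemma h_le: "h x \<le> height"
  using height T_bounds[of x] by (simp add: h_def mult_left_le)

lemma subgraph_box: "z \<in> subgraph h \<Longrightarrow> 0 < z$1 \<and> z$1 < w \<and> 0 < z$2 \<and> z$2 < height"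
  using h_pos[of "z$1"] h_le[of "z$1"] by (auto simp: subgraph_def)

lemma h_film:
  "\<And>x. x \<in> {0..1} \<Longrightarrow> h x \<ge> 0" "(height / s)-lipschitz_on {0..1} h"
  "(LINT x:{0..1}|lebesgue. h x) = d" "h 0 = 0" "h 1 = 0"
proof -
  show "h x \<ge> 0" for x using T_bounds height by (simp add: h_def)
  show "h 0 = 0" "h 1 = 0" using w by (simp_all add: h_def T_outside)
  show "(height / s)-lipschitz_on {0..1} h"
  proof (rule lipschitz_onI)
    fix x y
    have "\<bar>h x - h y\<bar> = height * \<bar>T x - T y\<bar>" using height by (simp add: h_def abs_mult flip: right_diff_distrib)
    also have "\<dots> \<le> height * (\<bar>x - y\<bar> / s)" using height T_lipschitz by (intro mult_left_mono) auto
    finally show "dist (h x) (h y) \<le> height / s * dist x y" by (simp add: dist_real_def)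
  qed (use height s in auto)
  have "(LINT x:{0..1}|lebesgue. h x) = integral {0..1} h"
    by (intro set_lebesgue_integral_eq_integral absolutely_integrable_continuous_real)
      (auto simp: h_def[abs_def] intro!: continuous_intros T_continuous)
  also have "\<dots> = height * integral {0..1} T" by (simp add: h_def[abs_def])
  also have "\<dots> = d" using T_integral(1) s by (simp add: height_def)
  finally show "(LINT x:{0..1}|lebesgue. h x) = d" .
qed

lemma deriv_h:
  assumes "x \<notin> {0, s, w - s, w}"
  shows "\<bar>deriv h x\<bar> \<le> height / s * (indicator {0..s} x + indicator {w - s..w} x)"
proof -
  have D: "deriv h x = D" if "(g has_real_derivative D) (at x)" "x \<in> {a<..<b}" "\<And>y. y \<in> {a<..<b} \<Longrightarrow> g y = h y" for g D a b
    by (rule DERIV_imp_deriv, rule has_field_derivative_transform_within_open[OF that(1) _ that(2,3)]) auto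
  let ?B = "height / s * (indicator {0..s} x + indicator {w - s..w} x)"
  have m: "0 \<le> height / s" using height s by simp
  then have B: "0 \<le> ?B" by (intro mult_nonneg_nonneg) auto
  consider "x < 0" | "w < x" | "0 < x" "x < s" | "s < x" "x < w - s" | "w - s < x" "x < w"
    using assms by (auto simp: not_less) linarith
  then show ?thesis
  proof cases
    case 1
    have "deriv h x = 0" by (rule D[of "\<lambda>_. 0" _ "x - 1" 0]) (use 1 in \<open>auto simp: h_def T_outside\<close>)
    then show ?thesis using B by simp
  next
    case 2
    have "deriv h x = 0" by (rule D[of "\<lambda>_. 0" _ w "x + 1"]) (use 2 in \<open>auto simp: h_def T_outside\<close>)
    then show ?thesis using B by simp
  next
    case 3
    have "deriv h x = height / s"
    proof (rule D[of "\<lambda>y. height * (y / s)" _ 0 s])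
      show "height * (y / s) = h y" if "y \<in> {0<..<s}" for y
        using that s by (simp add: h_def trapezoid_def pos_le_divide_eq min_def max_def divide_le_cancel)
    qed (use 3 s in \<open>auto intro!: derivative_eq_intros\<close>)
    moreover have "height / s * 1 \<le> ?B" using 3 by (intro mult_left_mono m) auto
    ultimately show ?thesis using m by simp
  next
    case 4
    have "deriv h x = 0" by (rule D[of "\<lambda>_. height" _ s "w - s"]) (use 4 in \<open>auto simp: h_def T_plateau\<close>)
    then show ?thesis using B by simp
  next
    case 5
    have "deriv h x = - (height / s)"
    proof (rule D[of "\<lambda>y. height * ((w - y) / s)" _ "w - s" w])
      show "height * ((w - y) / s) = h y" if "y \<in> {w - s<..<w}" for y
        using that s by (simp add: h_def trapezoid_def pos_le_divide_eq min_def max_def divide_le_cancel)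
    qed (use 5 s in \<open>auto intro!: derivative_eq_intros\<close>)
    moreover have "height / s * 1 \<le> ?B" using 5 by (intro mult_left_mono m) auto
    ultimately show ?thesis using m by simp
  qed
qed

text \<open>The slope is \<open>height / s\<close> in absolute value on two intervals of length \<open>s\<close> and vanishes elsewhere, and
  \<open>sqrt (1 + x\<^sup>2) \<le> 1 + \<bar>x\<bar>\<close>.\<close>

lemma film_length_le:
  "(\<integral>\<^sup>+x\<in>{0..1}. ennreal (sqrt (1 + (deriv h x)\<^sup>2)) \<partial>lebesgue) \<le> ennreal (1 + 4 * d / w)"
proof -
  have m: "0 \<le> height / s" using height s by simp
  let ?F = "\<lambda>x::real. indicator {0..1} x + height / s * (indicator {0..s} x + indicator {w - s..w} x) :: real"
  have i: "integrable lborel (indicator {a..b} :: real \<Rightarrow> real)" for a b :: real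
    by (intro integrable_real_indicator) (auto simp: emeasure_lborel_Icc_eq)
  have iF: "integrable lborel ?F" by (intro integrable_mult_right Bochner_Integration.integrable_add i)
  have null: "{0, s, w - s, w} \<in> null_sets lebesgue"
    by (intro null_sets_completionI finite_imp_null_set_lborel) auto
  have "(\<integral>\<^sup>+x\<in>{0..1}. ennreal (sqrt (1 + (deriv h x)\<^sup>2)) \<partial>lebesgue) \<le> (\<integral>\<^sup>+x. ennreal (?F x) \<partial>lebesgue)"
  proof (rule nn_integral_mono_AE, rule AE_mp[OF AE_not_in[OF null]], intro AE_I2 impI)
    fix x :: real assume x: "x \<notin> {0, s, w - s, w}"
    have "sqrt (1 + (deriv h x)\<^sup>2) \<le> sqrt 1 + sqrt ((deriv h x)\<^sup>2)" by (rule sqrt_add_le_add_sqrt) auto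
    then have "sqrt (1 + (deriv h x)\<^sup>2) \<le> 1 + height / s * (indicator {0..s} x + indicator {w - s..w} x)"
      using deriv_h[OF x] by simp
    then show "ennreal (sqrt (1 + (deriv h x)\<^sup>2)) * indicator {0..1} x \<le> ennreal (?F x)"
      by (cases "x \<in> {0..1}") (auto intro: ennreal_leI)
  qed
  also have "\<dots> = ennreal (LINT x|lborel. ?F x)"
    unfolding nn_integral_completion
    by (intro nn_integral_eq_integral iF AE_I2 add_nonneg_nonneg mult_nonneg_nonneg m) auto
  also have "(LINT x|lborel. ?F x) = 1 + height / s * (s + s)"
    using s by (subst Bochner_Integration.integral_add | (simp add: i; fail) | simp add: i Bochner_Integration.integral_add)+
  also have "\<dots> = 1 + 2 * height" using s by simp
  finally have "(\<integral>\<^sup>+x\<in>{0..1}. ennreal (sqrt (1 + (deriv h x)\<^sup>2)) \<partial>lebesgue) \<le> ennreal (1 + 2 * height)" .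
  also have "\<dots> \<le> ennreal (1 + 4 * d / w)" using height by (intro ennreal_leI) simp
  finally show ?thesis .
qed

lemma energy_le:
  assumes "\<gamma> > 0" "E \<ge> 0" "(\<integral>\<^sup>+z\<in>subgraph h. ennreal (W (H z)) \<partial>lebesgue) \<le> ennreal E"
  shows "energy W \<gamma> b (h, H, P) \<le> ennreal (\<gamma> * (1 + 4 * d / w) + E + real (size P) * b\<^sup>2)"
proof -
  have w0: "w > 0" using s by linarith
  have "energy W \<gamma> b (h, H, P) \<le> ennreal \<gamma> * ennreal (1 + 4 * d / w) + ennreal E + ennreal (real (size P) * b\<^sup>2)"
    unfolding energy_def prod.case by (intro add_mono mult_left_mono film_length_le assms(3)) auto
  also have "\<dots> = ennreal (\<gamma> * (1 + 4 * d / w) + E + real (size P) * b\<^sup>2)"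
    using assms(1,2) d w0 by (simp add: ennreal_mult[symmetric] ennreal_plus[symmetric] del: ennreal_plus)
  finally show ?thesis .
qed

end

section \<open>The energies of the competitors\<close>

text \<open>The field is the gradient of \<open>e0 * z$1 * ramp (z$2 / w)\<close>, which is of order \<open>e0\<close> in a square of side
  \<open>w\<close>.\<close>

lemma gradient_competitor:
  fixes W :: "real^2^2 \<Rightarrow> real"
  assumes W: "\<And>A. W A \<le> c * (norm (sym_part A))\<^sup>2" "c \<ge> 0" and pos: "\<gamma> > 0" "e0 > 0" "d > 0" and w: "0 < w" "w \<le> 1"
  shows "\<exists>t\<in>admissible J d e0 b r0. energy W \<gamma> b t \<le> ennreal (\<gamma> * (1 + 4 * d / w) + c * (5 * e0\<^sup>2 * w\<^sup>2))"
proof -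
  interpret trapezoid_film d "w / 4" w by unfold_locales (use pos w in auto)
  note w = \<open>0 < w\<close> \<open>w \<le> 1\<close>
  let ?f = "\<lambda>z::real^2. e0 * ramp (z$2 / w)" and ?g = "\<lambda>z::real^2. ramp_d (z$2 / w) / w * (e0 * z$1)"
  let ?fy = "\<lambda>z::real^2. e0 * (ramp_d (z$2 / w) / w)"
  have cr: "continuous_on UNIV (\<lambda>z::real^2. ramp (z$2 / w))" "continuous_on UNIV (\<lambda>z::real^2. ramp_d (z$2 / w))"
  proof -
    show "continuous_on UNIV (\<lambda>z::real^2. ramp (z$2 / w))"
      by (rule continuous_on_compose2[OF ramp_continuous(1)[of UNIV]]) (use w in \<open>auto intro!: continuous_intros\<close>)
    show "continuous_on UNIV (\<lambda>z::real^2. ramp_d (z$2 / w))"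
      by (rule continuous_on_compose2[OF ramp_continuous(2)[of UNIV]]) (use w in \<open>auto intro!: continuous_intros\<close>)
  qed
  interpret row_competitor h ?f ?g ?fy ?fy e0
  proof
    show "continuous_on UNIV ?f" "continuous_on UNIV ?g" "continuous_on UNIV ?fy"
      using w by (intro continuous_intros cr; simp)+
    show "((\<lambda>y. e0 * ramp (pt x y $ 2 / w)) has_real_derivative e0 * (ramp_d (pt x y $ 2 / w) / w)) (at y)" for x y
      unfolding vector_2 by (intro DERIV_cmult ramp_scaled_derivative w)
    show "((\<lambda>x. ramp_d (pt x y $ 2 / w) / w * (e0 * pt x y $ 1)) has_real_derivative e0 * (ramp_d (pt x y $ 2 / w) / w)) (at x)" for x y
      unfolding vector_2 by (use w in \<open>auto intro!: derivative_eq_intros\<close>)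
    show "e0 * ramp (pt x 0 $ 2 / w) = e0" for x by (simp add: ramp_bounds)
  qed
  have "(h, row_field ?f ?g, {#}) \<in> admissible J d e0 b r0"
    by (rule admissible_row[OF h_film]) (auto simp: mollified_dislocations_def)
  moreover have "(\<integral>\<^sup>+z\<in>subgraph h. ennreal (W (row_field ?f ?g z)) \<partial>lebesgue) \<le> ennreal (c * (5 * e0\<^sup>2 * (w * w) + integral\<^sup>L lborel (\<lambda>z::real^2. 0::real)))"
  proof (rule elastic_energy_le[OF W])
    fix z :: "real^2" assume "z \<in> subgraph h"
    then have z: "0 < z$1" "z$1 < w" "0 < z$2" using subgraph_box by auto
    show "(?f z)\<^sup>2 + (?g z)\<^sup>2 \<le> 5 * e0\<^sup>2 * indicator (cbox (pt 0 0) (pt w w)) z + 0"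
    proof (cases "z$2 < w")
      case True
      have t: "0 \<le> z$2 / w" using z w by simp
      have "\<bar>?f z\<bar> \<le> e0 * 1" unfolding abs_mult using ramp_bounds(1)[OF t] pos by (intro mult_mono) auto
      then have "\<bar>?f z\<bar>\<^sup>2 \<le> e0\<^sup>2" by (intro power_mono) auto
      moreover have "\<bar>?g z\<bar> \<le> 2 / w * (e0 * w)"
        unfolding abs_mult using ramp_bounds(2)[OF t] pos w z by (intro mult_mono) (auto simp: abs_divide divide_right_mono)
      then have "\<bar>?g z\<bar>\<^sup>2 \<le> (2 * e0)\<^sup>2" using w by (intro power_mono) auto
      then have "\<bar>?g z\<bar>\<^sup>2 \<le> 4 * e0\<^sup>2" by (simp only: power_mult_distrib) simp
      moreover have "z \<in> cbox (pt 0 0) (pt w w)" using z True by (simp add: mem_box_cart forall_2)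
      ultimately show ?thesis unfolding power2_abs by simp
    next
      case False
      then have "1 \<le> z$2 / w" using w by (simp add: pos_le_divide_eq)
      then show ?thesis by (simp add: ramp_bounds)
    qed
  qed (use w in auto)
  then have "energy W \<gamma> b (h, row_field ?f ?g, {#}) \<le> ennreal (\<gamma> * (1 + 4 * d / w) + c * (5 * e0\<^sup>2 * w\<^sup>2))"
    using energy_le[OF pos(1), of "c * (5 * e0\<^sup>2 * w\<^sup>2)" W "row_field ?f ?g" b "{#}"] W(2) by (simp add: power2_eq_square)
  ultimately show ?thesis by blast
qed

context kernel
begin

text \<open>The elastic and dislocation energies in \<open>dislocation_competitor\<close> add up to at most this multiple of
   \<open>e0 * b * w * (1 + ln (b / (e0 * r0)))\<close>.\<close>

definition K :: "real \<Rightarrow> real" where "K c = c * (C0 + 768 * Jm\<^sup>2 + 20) + 1"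

text \<open>A film at least as high as \<open>l\<close> can hold the row of dislocations under its plateau.\<close>

lemma row_film:
  fixes W :: "real^2^2 \<Rightarrow> real"
  assumes W: "\<And>A. W A \<le> cw * (norm (sym_part A))\<^sup>2" "cw \<ge> 0" and par: "\<gamma> > 0" "e0 > 0" "d > 0" "l > 0" "r0 > 0"
    and l: "64 ^ 4 * r0 \<le> l" and N: "N \<ge> 2" and weq: "w = (real N + 2) * l" "w \<le> 1" and beq: "b = e0 * l"
  shows "\<exists>t\<in>admissible J d e0 b r0. energy W \<gamma> b t \<le>
    ennreal (\<gamma> * (1 + 4 * d / w) + (cw * (C0 + 768 * Jm\<^sup>2 + 20) + 1) * (e0 * b * w * (1 + ln (l / r0))))"
proof -
  have "4 * l \<le> w" unfolding weq using N par by (intro mult_right_mono) auto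
  then interpret trapezoid_film d l w by unfold_locales (use par weq in auto)
  interpret dislocation_row J Jm e0 b r0 l N by unfold_locales (use par l beq in auto)
  note pos = par and w = weq and b = beq
  have w0: "w > 0" using s pos by linarith
  have L: "1 + ln (l / r0) \<ge> 1" using pos l by (simp add: pos_le_divide_eq)
  have C0: "C0 \<ge> 0" by (simp add: C0_def)
  define E where "E = e0 * b * w"
  have E: "E \<ge> 0" using pos w0 b by (simp add: E_def)
  show ?thesis
  proof (cases "height < l")
    \<comment> \<open>the film is lower than one spacing, and a constant strain costs at most \<open>e0 * b * w\<close>\<close>
    case True
    let ?f = "\<lambda>z::real^2. e0" and ?g = "\<lambda>z::real^2. 0 :: real"
    interpret c: row_competitor h ?f ?g ?g ?g e0 by unfold_locales auto
    have adm: "(h, row_field ?f ?g, {#}) \<in> admissible J d e0 b r0"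
      by (rule c.admissible_row[OF h_film]) (auto simp: mollified_dislocations_def)
    have "(\<integral>\<^sup>+z\<in>subgraph h. ennreal (W (row_field ?f ?g z)) \<partial>lebesgue) \<le> ennreal (cw * (e0\<^sup>2 * (w * height) + integral\<^sup>L lborel (\<lambda>z::real^2. 0::real)))"
    proof (rule elastic_energy_le[OF W, where f="?f" and g="?g" and a="e0\<^sup>2" and w=w and s=height and q="\<lambda>_. 0"])
      fix z :: "real^2" assume "z \<in> subgraph h"
      then have "z \<in> cbox (pt 0 0) (pt w height)" using subgraph_box[of z] by (simp add: mem_box_cart forall_2)
      then show "(?f z)\<^sup>2 + (?g z)\<^sup>2 \<le> e0\<^sup>2 * indicator (cbox (pt 0 0) (pt w height)) z + 0" by simp
    qed (use w0 height in auto)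
    then have "energy W \<gamma> b (h, row_field ?f ?g, {#}) \<le> ennreal (\<gamma> * (1 + 4 * d / w) + cw * (e0\<^sup>2 * (w * height)))"
      using energy_le[OF pos(1), of "cw * (e0\<^sup>2 * (w * height))" W "row_field ?f ?g" b "{#}"] W(2) w0 height by simp
    also have "\<dots> \<le> ennreal (\<gamma> * (1 + 4 * d / w) + (cw * (C0 + 768 * Jm\<^sup>2 + 20) + 1) * (e0 * b * w * (1 + ln (l / r0))))"
    proof (intro ennreal_leI add_left_mono)
      have "e0\<^sup>2 * (w * height) \<le> e0\<^sup>2 * (w * l)" using True w0 by (intro mult_left_mono) auto
      also have "\<dots> = E" unfolding E_def b by (simp add: power2_eq_square)
      finally have "cw * (e0\<^sup>2 * (w * height)) \<le> cw * E" using W(2) by (rule mult_left_mono)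
      also have "\<dots> \<le> (cw * (C0 + 768 * Jm\<^sup>2 + 20) + 1) * E"
      proof (rule mult_right_mono[OF _ E])
        have "cw * 1 \<le> cw * (C0 + 768 * Jm\<^sup>2 + 20)" using W(2) C0 by (intro mult_left_mono) auto
        then show "cw \<le> cw * (C0 + 768 * Jm\<^sup>2 + 20) + 1" by simp
      qed
      also have "\<dots> = (cw * (C0 + 768 * Jm\<^sup>2 + 20) + 1) * E * 1" by simp
      also have "\<dots> \<le> (cw * (C0 + 768 * Jm\<^sup>2 + 20) + 1) * E * (1 + ln (l / r0))"
        using L W(2) C0 E by (intro mult_left_mono) auto
      finally show "cw * (e0\<^sup>2 * (w * height)) \<le> (cw * (C0 + 768 * Jm\<^sup>2 + 20) + 1) * (e0 * b * w * (1 + ln (l / r0)))"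
        by (simp add: E_def mult.assoc)
    qed
    finally show ?thesis using adm by blast
  next
    case False
    let ?q = "\<lambda>z. 3 * b\<^sup>2 * (\<Sum>i<N. (norm (z - p i))\<^sup>2 * (kap r0 R (z - p i))\<^sup>2)"
    have adm: "(h, row_field f g, P) \<in> admissible J d e0 b r0"
    proof (rule admissible_row[OF h_film])
      fix q assume "q \<in># P"
      then obtain i where i: "i < N" "q = p i" by (auto simp: P_def)
      have "real i + 1 \<le> real N" using i by linarith
      then have il: "(real i + 1) * l \<le> real N * l" "0 \<le> real i * l" using pos by (auto intro: mult_right_mono)
      show "ball q r0 \<subseteq> subgraph h"
      proof
        fix z assume z: "z \<in> ball q r0"
        then have n: "norm (z - q) < l / 8" using rR by (simp add: dist_norm norm_minus_commute)
        have "\<bar>z$1 - c i\<bar> < l / 8" "\<bar>z$2 - l / 2\<bar> < l / 8"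
          using component_le_norm_cart[of "z - q" 1] component_le_norm_cart[of "z - q" 2] n by (simp_all add: i p_def)
        then have z: "l \<le> z$1" "z$1 \<le> w - l" "0 < z$2" "z$2 < l"
          using il pos(4) unfolding c_def w(1) distrib_right abs_less_iff by linarith+
        then have "h (z$1) = height" by (simp add: h_def T_plateau)
        then show "z \<in> subgraph h" using z w pos False by (simp add: subgraph_def)
      qed
    qed (use curl_eq in \<open>auto simp: subgraph_def\<close>)
    have ci: "integrable lborel (\<lambda>z. (norm (z - p i))\<^sup>2 * (kap r0 R (z - p i))\<^sup>2)"
      and ce: "(LINT z|lborel. (norm (z - p i))\<^sup>2 * (kap r0 R (z - p i))\<^sup>2) \<le> 256 * Jm\<^sup>2 * (1 + ln (R / r0))" for i
      using core_energy[OF rR(1,2)] by auto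
    have el: "(\<integral>\<^sup>+z\<in>subgraph h. ennreal (W (row_field f g z)) \<partial>lebesgue) \<le> ennreal (cw * (C0 * e0\<^sup>2 * (w * l) + (LINT z|lborel. ?q z)))"
    proof (rule elastic_energy_le[OF W])
      show "integrable lborel ?q" by (intro integrable_mult_right Bochner_Integration.integrable_sum ci)
      show "?q z \<ge> 0" for z by (intro mult_nonneg_nonneg sum_nonneg) auto
      fix z assume "z \<in> subgraph h"
      then have z: "0 < z$1" "z$1 < w" "0 < z$2" using subgraph_box by auto
      have "(if z$2 < l then 1 else 0) \<le> (indicator (cbox (pt 0 0) (pt w l)) z :: real)"
        using z by (simp add: mem_box_cart forall_2)
      then have "C0 * e0\<^sup>2 * (if z$2 < l then 1 else 0) \<le> C0 * e0\<^sup>2 * indicator (cbox (pt 0 0) (pt w l)) z"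
        using C0 by (intro mult_left_mono) auto
      then show "(f z)\<^sup>2 + (g z)\<^sup>2 \<le> C0 * e0\<^sup>2 * indicator (cbox (pt 0 0) (pt w l)) z + ?q z"
        using field_bound[of z] z w by linarith
    qed (use w0 pos C0 in auto)
    have Nw: "real N * b\<^sup>2 \<le> E"
    proof -
      have "real N * l \<le> w" unfolding w using pos by (intro mult_right_mono) auto
      then have "e0 * b * (real N * l) \<le> e0 * b * w" using pos b by (intro mult_left_mono) auto
      then show ?thesis unfolding E_def b by (simp add: power2_eq_square mult_ac)
    qed
    have "(LINT z|lborel. ?q z) = 3 * b\<^sup>2 * (\<Sum>i<N. (LINT z|lborel. (norm (z - p i))\<^sup>2 * (kap r0 R (z - p i))\<^sup>2))"
      by (subst integral_mult_right_zero, subst Bochner_Integration.integral_sum, rule ci, rule refl)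
    also have "\<dots> \<le> 3 * b\<^sup>2 * (\<Sum>i<N. 256 * Jm\<^sup>2 * (1 + ln (l / r0)))"
    proof (intro mult_left_mono sum_mono order_trans[OF ce])
      have "R / r0 \<le> l / r0" using rR by (intro divide_right_mono) auto
      moreover have "R / r0 > 0" "l / r0 > 0" using rR by auto
      ultimately have "ln (R / r0) \<le> ln (l / r0)" by (subst ln_le_cancel_iff)
      then show "1 + ln (R / r0) \<le> 1 + ln (l / r0)" by simp
    qed auto
    also have "\<dots> = 768 * Jm\<^sup>2 * (1 + ln (l / r0)) * (real N * b\<^sup>2)" by simp
    also have "\<dots> \<le> 768 * Jm\<^sup>2 * (1 + ln (l / r0)) * E" using L Nw by (intro mult_left_mono) auto
    finally have q: "(LINT z|lborel. ?q z) \<le> 768 * Jm\<^sup>2 * (E * (1 + ln (l / r0)))" by (simp add: mult_ac)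
    have q0: "0 \<le> (LINT z|lborel. ?q z)" by (intro Bochner_Integration.integral_nonneg mult_nonneg_nonneg sum_nonneg) auto
    have EL: "E \<le> E * (1 + ln (l / r0))" using mult_left_mono[OF L E] by simp
    have "energy W \<gamma> b (h, row_field f g, P) \<le> ennreal (\<gamma> * (1 + 4 * d / w) + cw * (C0 * e0\<^sup>2 * (w * l) + (LINT z|lborel. ?q z)) + real (size P) * b\<^sup>2)"
      by (rule energy_le[OF pos(1) _ el]) (use W(2) C0 w0 pos q0 in auto)
    also have "\<dots> \<le> ennreal (\<gamma> * (1 + 4 * d / w) + (cw * (C0 + 768 * Jm\<^sup>2 + 20) + 1) * (e0 * b * w * (1 + ln (l / r0))))"
    proof (rule ennreal_leI)
      have "C0 * e0\<^sup>2 * (w * l) = C0 * E" by (simp add: E_def b power2_eq_square)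
      also have "\<dots> \<le> C0 * (E * (1 + ln (l / r0)))" using EL C0 by (rule mult_left_mono)
      finally have "C0 * e0\<^sup>2 * (w * l) + (LINT z|lborel. ?q z) \<le> C0 * (E * (1 + ln (l / r0))) + 768 * Jm\<^sup>2 * (E * (1 + ln (l / r0)))"
        using q by (rule add_mono)
      also have "\<dots> \<le> (C0 + 768 * Jm\<^sup>2 + 20) * (E * (1 + ln (l / r0)))"
        using EL E by (simp add: distrib_right)
      finally have "cw * (C0 * e0\<^sup>2 * (w * l) + (LINT z|lborel. ?q z)) \<le> cw * ((C0 + 768 * Jm\<^sup>2 + 20) * (E * (1 + ln (l / r0))))"
        using W(2) by (rule mult_left_mono)
      moreover have "real (size P) * b\<^sup>2 \<le> E * (1 + ln (l / r0))" using Nw EL by (simp add: P_def)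
      ultimately show "\<gamma> * (1 + 4 * d / w) + cw * (C0 * e0\<^sup>2 * (w * l) + (LINT z|lborel. ?q z)) + real (size P) * b\<^sup>2
          \<le> \<gamma> * (1 + 4 * d / w) + (cw * (C0 + 768 * Jm\<^sup>2 + 20) + 1) * (e0 * b * w * (1 + ln (l / r0)))"
        unfolding E_def[symmetric] distrib_right[of _ 1] by (simp add: mult.assoc)
    qed
    finally show ?thesis using adm by blast
  qed
qed

text \<open>The width is rounded down to a multiple of the spacing \<open>b / e0\<close>.  When it is below four spacings, the gradient
  field is as good as the row.\<close>

lemma dislocation_competitor:
  fixes W :: "real^2^2 \<Rightarrow> real"
  assumes W: "\<And>A. W A \<le> c * (norm (sym_part A))\<^sup>2" "c \<ge> 0" and pos: "\<gamma> > 0" "e0 > 0" "d > 0" "b > 0" "r0 > 0"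
    and l: "64 ^ 4 * r0 \<le> b / e0" and w: "0 < w" "w \<le> 1"
  shows "\<exists>t\<in>admissible J d e0 b r0. energy W \<gamma> b t \<le>
    ennreal (\<gamma> * (1 + 6 * d / w) + K c * (e0 * b * w * (1 + ln (b / (e0 * r0)))))"
proof -
  define l where "l = b / e0"
  define L where "L = 1 + ln (l / r0)"
  have Leq: "1 + ln (b / (e0 * r0)) = L" by (simp add: L_def l_def)
  have l0: "l > 0" "b = e0 * l" "64 ^ 4 * r0 \<le> l" using pos l by (auto simp: l_def)
  have L: "L \<ge> 1" using pos l0 by (simp add: L_def pos_le_divide_eq)
  have C0: "C0 \<ge> 0" by (simp add: C0_def)
  have K: "K c \<ge> 20 * c" "K c \<ge> 0" using C0 W(2) by (simp_all add: K_def distrib_left)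
  show ?thesis unfolding Leq
  proof (cases "w \<le> 4 * l")
    case True
    obtain t where t: "t \<in> admissible J d e0 b r0" "energy W \<gamma> b t \<le> ennreal (\<gamma> * (1 + 4 * d / w) + c * (5 * e0\<^sup>2 * w\<^sup>2))"
      using gradient_competitor[OF W pos(1-3) w] by blast
    note t(2)
    also have "ennreal (\<gamma> * (1 + 4 * d / w) + c * (5 * e0\<^sup>2 * w\<^sup>2)) \<le> ennreal (\<gamma> * (1 + 6 * d / w) + K c * (e0 * b * w * L))"
    proof (intro ennreal_leI add_mono mult_left_mono)
      show "4 * d / w \<le> 6 * d / w" using pos w by (simp add: divide_right_mono)
      have "5 * e0\<^sup>2 * w\<^sup>2 = 5 * e0\<^sup>2 * w * w" by (simp add: power2_eq_square)
      also have "\<dots> \<le> 5 * e0\<^sup>2 * w * (4 * l)" using True w by (intro mult_left_mono) auto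
      also have "\<dots> = 20 * (e0 * b * w)" unfolding l0(2) by (simp add: power2_eq_square)
      finally have "c * (5 * e0\<^sup>2 * w\<^sup>2) \<le> c * (20 * (e0 * b * w))" using W(2) by (rule mult_left_mono)
      also have "\<dots> = 20 * c * (e0 * b * w)" by simp
      also have "\<dots> \<le> K c * (e0 * b * w * L)"
      proof (rule mult_mono[OF K(1)])
        show "e0 * b * w \<le> e0 * b * w * L" using mult_left_mono[OF L, of "e0 * b * w"] pos w by simp
      qed (use pos w K in auto)
      finally show "c * (5 * e0\<^sup>2 * w\<^sup>2) \<le> K c * (e0 * b * w * L)" .
    qed (use pos in auto)
    finally show "\<exists>t\<in>admissible J d e0 b r0. energy W \<gamma> b t \<le> ennreal (\<gamma> * (1 + 6 * d / w) + K c * (e0 * b * w * L))"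
      using t(1) by blast
  next
    case False
    define n where "n = nat \<lfloor>w / l\<rfloor>"
    define N where "N = n - 2"
    have "4 \<le> w / l" using False l0 by (simp add: pos_le_divide_eq)
    then have "4 \<le> \<lfloor>w / l\<rfloor>" by linarith
    then have n4: "4 \<le> n" and n: "real n \<le> w / l" "w / l < real n + 1" unfolding n_def by linarith+
    have N: "N \<ge> 2" "real N + 2 = real n" using n4 by (auto simp: N_def)
    define w' where "w' = (real N + 2) * l"
    have w': "w' \<le> w" "w < w' + l" unfolding w'_def N(2) using n l0 by (auto simp: pos_le_divide_eq pos_divide_less_eq algebra_simps)
    then have w'': "3 / 4 * w \<le> w'" "w' \<le> 1" "w' > 0" using False w by auto
    obtain t where t: "t \<in> admissible J d e0 b r0"
      "energy W \<gamma> b t \<le> ennreal (\<gamma> * (1 + 4 * d / w') + K c * (e0 * b * w' * L))"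
      using row_film[OF W pos(1-3) l0(1) pos(5) l0(3) N(1) w'_def w''(2) l0(2)] unfolding K_def L_def by blast
    note t(2)
    also have "ennreal (\<gamma> * (1 + 4 * d / w') + K c * (e0 * b * w' * L)) \<le> ennreal (\<gamma> * (1 + 6 * d / w) + K c * (e0 * b * w * L))"
    proof (intro ennreal_leI add_mono mult_left_mono mult_right_mono)
      have "4 * d / w' \<le> 4 * d / (3 / 4 * w)" using w'' w pos by (intro divide_left_mono) auto
      also have "\<dots> \<le> 6 * d / w" using pos w by (simp add: field_simps)
      finally show "4 * d / w' \<le> 6 * d / w" .
    qed (use pos w' L K in auto)
    finally show "\<exists>t\<in>admissible J d e0 b r0. energy W \<gamma> b t \<le> ennreal (\<gamma> * (1 + 6 * d / w) + K c * (e0 * b * w * L))"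
      using t(1) by blast
  qed
qed

end

lemma quotient_min_le:
  fixes x s :: real
  assumes "x > 0" "s > 0"
  shows "6 * x / min 1 s \<le> 6 * x + 6 * x / s"
  using assms by (cases "s \<le> 1") (auto simp: min_def)

text \<open>In either construction \<open>w\<close> is the width at which \<open>\<gamma> * d / w\<close> equals the bulk energy, or \<open>1\<close> if that width is
  larger; at \<open>w = 1\<close> the surface term is of order \<open>\<gamma> * (1 + d)\<close>.\<close>

lemma energy_upper_bound:
  assumes J: "admissible_kernel J" and W: "linear_elastic_density W"
  shows "\<exists>cs::real>0. \<forall>\<gamma> e0 b d r0 :: real.
    \<gamma> > 0 \<and> e0 > 0 \<and> b > 0 \<and> d > 0 \<and> 0 < r0 \<and> b / e0 \<ge> 64 ^ 4 * r0 \<longrightarrow>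
      (\<exists>t\<in>admissible J d e0 b r0. energy W \<gamma> b t \<le> ennreal (cs * scaling \<gamma> e0 b d r0))"
proof -
  obtain c1 where c1: "c1 > 0" "\<And>A. W A \<le> 1 / c1 * (norm (sym_part A))\<^sup>2"
    using W by (auto simp: linear_elastic_density_def)
  define c where "c = 1 / c1"
  have c: "\<And>A. W A \<le> c * (norm (sym_part A))\<^sup>2" "c \<ge> 0" using c1 by (auto simp: c_def)
  have tJ: "J \<in> test_functions (ball 0 1)" using J by (simp add: admissible_kernel_def)
  obtain Jm where "kernel J Jm"
  proof -
    have co: "continuous_on UNIV J" "compact (supp J)"
      using tJ by (auto simp: test_functions_def smooth_def dest: spec[of _ "0::nat"])
    have "bounded (J ` supp J)" by (intro compact_imp_bounded compact_continuous_image continuous_on_subset[OF co(1)] co(2)) auto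
    then obtain B where B: "\<And>z. z \<in> supp J \<Longrightarrow> \<bar>J z\<bar> \<le> B" by (auto simp: bounded_iff)
    have "J z \<le> max B 1" for z
    proof (cases "z \<in> supp J")
      case True then show ?thesis using B[of z] by linarith
    next
      case False
      then have "J z = 0" using closure_subset[of "{x. J x \<noteq> 0}"] by (auto simp: supp_def)
      then show ?thesis by simp
    qed
    then have "kernel J (max B 1)" using J by unfold_locales auto
    then show ?thesis by (rule that)
  qed
  then interpret kernel J Jm .
  have K0: "K c \<ge> 0" using c by (simp add: K_def C0_def)
  show ?thesis
  proof (intro exI[of _ "6 + 5 * c + K c"] conjI allI impI)
    show "6 + 5 * c + K c > 0" using c K0 by simp
    fix \<gamma> e0 b d r0 :: real
    assume "\<gamma> > 0 \<and> e0 > 0 \<and> b > 0 \<and> d > 0 \<and> 0 < r0 \<and> b / e0 \<ge> 64 ^ 4 * r0"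
    then have pos: "\<gamma> > 0" "e0 > 0" "d > 0" "b > 0" "r0 > 0" and l: "64 ^ 4 * r0 \<le> b / e0" by auto
    define L where "L = 1 + ln (b / (e0 * r0))"
    define A where "A = \<gamma> powr (2/3) * e0 powr (2/3) * d powr (2/3)"
    define q where "q = (\<gamma> * e0 * b * d * L) powr (1/2)"
    have L: "L \<ge> 1"
    proof -
      have "1 * r0 \<le> 64 ^ 4 * r0" using pos by (intro mult_right_mono) auto
      then have "1 * r0 \<le> b / e0" using l by (rule order_trans)
      then have "1 \<le> b / e0 / r0" using pos by (simp only: pos_le_divide_eq)
      then show ?thesis by (simp add: L_def)
    qed
    have A0: "A \<ge> 0" and q0: "q > 0" unfolding A_def q_def using pos L by auto
    have g: "\<gamma> + 6 * (\<gamma> * d) + 6 * M + C * M \<le> (6 + 5 * c + K c) * (\<gamma> * (1 + d) + M)" if "M \<ge> 0" "C \<le> 5 * c + K c" for M C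
    proof -
      have "C * M \<le> (5 * c + K c) * M" using that by (intro mult_right_mono) auto
      moreover have "0 \<le> (5 * c + K c) * (\<gamma> * (1 + d))" using c K0 pos by simp
      ultimately show ?thesis using pos by (simp add: algebra_simps)
    qed
    have "\<exists>t\<in>admissible J d e0 b r0. energy W \<gamma> b t \<le> ennreal ((6 + 5 * c + K c) * (\<gamma> * (1 + d) + A))"
    proof -
      define u v k where "u = \<gamma> powr (1/3)" and "v = e0 powr (1/3)" and "k = d powr (1/3)"
      have p3: "x = (x powr (1/3)) ^ 3" "x powr (2/3) = (x powr (1/3))\<^sup>2" if "x > 0" for x :: real
        using that by (simp_all add: powr_power)
      have uvk: "u > 0" "v > 0" "k > 0" using pos by (auto simp: u_def v_def k_def)
      have eq: "\<gamma> = u ^ 3" "e0 = v ^ 3" "d = k ^ 3" "A = u\<^sup>2 * v\<^sup>2 * k\<^sup>2"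
        unfolding A_def u_def v_def k_def using p3[OF pos(1)] p3[OF pos(2)] p3[OF pos(3)] by simp_all
      \<comment> \<open>the solution of \<open>\<gamma> * d / s = e0\<^sup>2 * s\<^sup>2\<close>\<close>
      define s where "s = u * k / v\<^sup>2"
      have s: "s > 0" using uvk by (simp add: s_def)
      have sA: "\<gamma> * d / s = A" "e0\<^sup>2 * s\<^sup>2 = A"
        unfolding s_def eq using uvk by (simp_all add: field_simps power2_eq_square power3_eq_cube)
      define w where "w = min 1 s"
      have w: "0 < w" "w \<le> 1" using s by (auto simp: w_def)
      have "\<gamma> * (1 + 4 * d / w) + c * (5 * e0\<^sup>2 * w\<^sup>2) \<le> \<gamma> + 6 * (\<gamma> * d) + 6 * A + 5 * c * A"
      proof -
        have "\<gamma> * (4 * d / w) \<le> 6 * (\<gamma> * d) / w" using pos w by (simp add: divide_right_mono)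
        also have "\<dots> \<le> 6 * (\<gamma> * d) + 6 * A"
          using quotient_min_le[of "\<gamma> * d" s] pos s sA(1) unfolding w_def by simp
        finally have 1: "\<gamma> * (4 * d / w) \<le> 6 * (\<gamma> * d) + 6 * A" .
        have "e0\<^sup>2 * w\<^sup>2 \<le> A" unfolding sA(2)[symmetric] using w by (intro mult_left_mono power_mono) (auto simp: w_def)
        then have "5 * c * (e0\<^sup>2 * w\<^sup>2) \<le> 5 * c * A" using c by (intro mult_left_mono) auto
        then show ?thesis using 1 by (simp add: distrib_left mult_ac)
      qed
      also have "\<dots> \<le> (6 + 5 * c + K c) * (\<gamma> * (1 + d) + A)" using A0 K0 by (intro g) auto
      finally have "ennreal (\<gamma> * (1 + 4 * d / w) + c * (5 * e0\<^sup>2 * w\<^sup>2)) \<le> ennreal ((6 + 5 * c + K c) * (\<gamma> * (1 + d) + A))" by (rule ennreal_leI)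
      with gradient_competitor[OF c pos(1-3) w] show ?thesis by (meson order_trans)
    qed
    moreover have "\<exists>t\<in>admissible J d e0 b r0. energy W \<gamma> b t \<le> ennreal ((6 + 5 * c + K c) * (\<gamma> * (1 + d) + q))"
    proof -
      have qq: "q * q = \<gamma> * e0 * b * d * L"
        unfolding q_def using pos L by (simp add: powr_half_sqrt)
      \<comment> \<open>the solution of \<open>\<gamma> * d / s = e0 * b * s * L\<close>\<close>
      define s where "s = q / (e0 * b * L)"
      have s: "s > 0" using pos L q0 by (simp add: s_def)
      have sq: "\<gamma> * d / s = q" "e0 * b * s * L = q"
        unfolding s_def using pos L q0 qq by (simp_all add: field_simps)
      define w where "w = min 1 s"
      have w: "0 < w" "w \<le> 1" using s by (auto simp: w_def)
      have "\<gamma> * (1 + 6 * d / w) + K c * (e0 * b * w * L) \<le> \<gamma> + 6 * (\<gamma> * d) + 6 * q + K c * q"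
      proof -
        have 1: "6 * (\<gamma> * d) / w \<le> 6 * (\<gamma> * d) + 6 * q"
          using quotient_min_le[of "\<gamma> * d" s] pos s sq(1) unfolding w_def by simp
        have "e0 * b * w * L \<le> q" unfolding sq(2)[symmetric] using pos L w by (intro mult_left_mono mult_right_mono) (auto simp: w_def)
        then have "K c * (e0 * b * w * L) \<le> K c * q" using K0 by (rule mult_left_mono)
        then show ?thesis using 1 by (simp add: distrib_left mult_ac)
      qed
      also have "\<dots> \<le> (6 + 5 * c + K c) * (\<gamma> * (1 + d) + q)" using q0 c by (intro g) auto
      finally have "ennreal (\<gamma> * (1 + 6 * d / w) + K c * (e0 * b * w * L)) \<le> ennreal ((6 + 5 * c + K c) * (\<gamma> * (1 + d) + q))" by (rule ennreal_leI)
      with dislocation_competitor[OF c pos l w] show ?thesis unfolding L_def[symmetric] by (meson order_trans)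
    qed
    ultimately show "\<exists>t\<in>admissible J d e0 b r0. energy W \<gamma> b t \<le> ennreal ((6 + 5 * c + K c) * scaling \<gamma> e0 b d r0)"
      unfolding scaling_def A_def[symmetric] L_def[symmetric] q_def[symmetric] by (simp add: min_def)
  qed
qed

section \<open>The scaling law\<close>

theorem theorem1p1:
  fixes J :: "real^2 \<Rightarrow> real" and W :: "real^2^2 \<Rightarrow> real"
  assumes "admissible_kernel J" and "linear_elastic_density W"
  shows "\<exists>cs::real>0. \<forall>\<gamma> e0 b d r0 :: real.
    \<gamma> > 0 \<and> e0 > 0 \<and> b > 0 \<and> d > 0 \<and> 0 < r0 \<and> r0 \<le> 1 \<and> b / e0 \<ge> 64 ^ 4 * r0 \<longrightarrow>
      ennreal (1 / cs * scaling \<gamma> e0 b d r0) \<le> (INF t \<in> admissible J d e0 b r0. energy W \<gamma> b t) \<and>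
      (INF t \<in> admissible J d e0 b r0. energy W \<gamma> b t) \<le> ennreal (cs * scaling \<gamma> e0 b d r0)"
proof -
  obtain c1 where c1: "c1 > 0" "\<And>\<gamma> e0 b d r0 t. \<gamma> > 0 \<and> e0 > 0 \<and> b > 0 \<and> d > 0 \<and> 0 < r0 \<and> b / e0 \<ge> 64 ^ 4 * r0 \<Longrightarrow>
      t \<in> admissible J d e0 b r0 \<Longrightarrow> ennreal (1 / c1 * scaling \<gamma> e0 b d r0) \<le> energy W \<gamma> b t"
    using energy_lower_bound[OF assms] by metis
  obtain c2 where c2: "c2 > 0" "\<And>\<gamma> e0 b d r0. \<gamma> > 0 \<and> e0 > 0 \<and> b > 0 \<and> d > 0 \<and> 0 < r0 \<and> b / e0 \<ge> 64 ^ 4 * r0 \<Longrightarrow>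
      \<exists>t\<in>admissible J d e0 b r0. energy W \<gamma> b t \<le> ennreal (c2 * scaling \<gamma> e0 b d r0)"
    using energy_upper_bound[OF assms] by metis
  show ?thesis
  proof (intro exI[of _ "max c1 c2"] conjI allI impI)
    show "max c1 c2 > 0" using c1(1) by simp
    fix \<gamma> e0 b d r0 :: real
    assume "\<gamma> > 0 \<and> e0 > 0 \<and> b > 0 \<and> d > 0 \<and> 0 < r0 \<and> r0 \<le> 1 \<and> b / e0 \<ge> 64 ^ 4 * r0"
    then have hyp: "\<gamma> > 0 \<and> e0 > 0 \<and> b > 0 \<and> d > 0 \<and> 0 < r0 \<and> b / e0 \<ge> 64 ^ 4 * r0" by blast
    have s: "scaling \<gamma> e0 b d r0 \<ge> 0" using hyp by (auto simp: scaling_def intro!: add_nonneg_nonneg)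
    show "ennreal (1 / max c1 c2 * scaling \<gamma> e0 b d r0) \<le> (INF t \<in> admissible J d e0 b r0. energy W \<gamma> b t)"
    proof (rule INF_greatest)
      fix t assume "t \<in> admissible J d e0 b r0"
      from c1(2)[OF hyp this] have "ennreal (1 / c1 * scaling \<gamma> e0 b d r0) \<le> energy W \<gamma> b t" .
      moreover have "1 / max c1 c2 * scaling \<gamma> e0 b d r0 \<le> 1 / c1 * scaling \<gamma> e0 b d r0"
        using c1(1) s by (intro mult_right_mono divide_left_mono) auto
      ultimately show "ennreal (1 / max c1 c2 * scaling \<gamma> e0 b d r0) \<le> energy W \<gamma> b t"
        using ennreal_leI order_trans by blast
    qed
    obtain t where t: "t \<in> admissible J d e0 b r0" "energy W \<gamma> b t \<le> ennreal (c2 * scaling \<gamma> e0 b d r0)"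
      using c2(2)[OF hyp] by blast
    have "c2 * scaling \<gamma> e0 b d r0 \<le> max c1 c2 * scaling \<gamma> e0 b d r0" using s by (intro mult_right_mono) auto
    then have "energy W \<gamma> b t \<le> ennreal (max c1 c2 * scaling \<gamma> e0 b d r0)"
      using t(2) ennreal_leI order_trans by blast
    then show "(INF t \<in> admissible J d e0 b r0. energy W \<gamma> b t) \<le> ennreal (max c1 c2 * scaling \<gamma> e0 b d r0)"
      by (rule INF_lower2[OF t(1)])
  qed
qed

end
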